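(* Let $r\ge 1$, $n\ge 2$, $q\ge n-1$ be integers and write $q=\rho(n-1)+m-1$ with $\rho\in\mathbb N$ and $m\in\{1,\dots,n-1\}$ (Euclidean division of $q$ by $n-1$). Every variety $X\in\mathcal X_{r+1,n}(q)$ spans a projective space of dimension $\pi_{r,n}(q)$, where $$\pi_{r,n}(q)+1=m\binom{r+\rho+1}{r+1}+(n-1-m)\binom{r+\rho}{r+1}.$$
   Context: All varieties are over $\mathbb C$. A property holds for a generic point of an irreducible variety if it holds on a dense Zariski-open subset. A rational normal curve of degree $q$ is a smooth rational curve of degree $q$ spanning a projective space of dimension $q$. Definition of $\mathcal X_{r+1,n}(q)$ ($r\ge1$, $n\ge2$, $q\ge n-1$): it is the class of irreducible algebraic subvarieties $X$, of dimension $r+1$, of a projective space of arbitrary dimension, such that (1) for generic $(x_1,\dots,x_n)\in X^n$ there is a rational normal curve of degree $q$ contained in $X$ and passing through $x_1,\dots,x_n$; (2) the dimension of the projective space spanned by $X$ is the largest possible among all irreducible $(r+1)$-dimensional projective varieties satisfying (1) (for the given $r,n,q$). *)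

theory Defs
  imports
    "HOL-Analysis.Analysis"
    "HOL-Library.Poly_Mapping"
    "HOL-Library.Function_Algebras"
begin

section \<open>Polynomials and forms\<close>

text \<open>Polynomials over the complex numbers in variables indexed by \<open>'v\<close> map
  monomials (finitely supported exponent vectors) to coefficients.\<close>

abbreviation "keys \<equiv> Poly_Mapping.keys"
abbreviation "lookup \<equiv> Poly_Mapping.lookup"

type_synonym 'v cpoly = "('v \<Rightarrow>\<^sub>0 nat) \<Rightarrow>\<^sub>0 complex"

definition monom_eval :: "('v \<Rightarrow>\<^sub>0 nat) \<Rightarrow> ('v \<Rightarrow> complex) \<Rightarrow> complex" where
  "monom_eval m x = (\<Prod>v\<in>keys m. x v ^ lookup m v)"

definition poly_eval :: "'v cpoly \<Rightarrow> ('v \<Rightarrow> complex) \<Rightarrow> complex" where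
  "poly_eval F x = (\<Sum>m\<in>keys F. lookup F m * monom_eval m x)"

text \<open>The zero polynomial is a form of every degree.\<close>

definition form :: "nat \<Rightarrow> nat \<Rightarrow> nat cpoly \<Rightarrow> bool" where
  "form N d F \<longleftrightarrow> (\<forall>m\<in>keys F. keys m \<subseteq> {..N} \<and> (\<Sum>j\<le>N. lookup m j) = d)"

definition multiform :: "nat \<Rightarrow> nat \<Rightarrow> (nat \<Rightarrow> nat) \<Rightarrow> (nat \<times> nat) cpoly \<Rightarrow> bool" where
  "multiform N n d F \<longleftrightarrow>
     (\<forall>m\<in>keys F. keys m \<subseteq> {..<n} \<times> {..N} \<and> (\<forall>i<n. (\<Sum>j\<le>N. lookup m (i, j)) = d i))"

section \<open>Projective space and the Zariski topology\<close>

text \<open>The space \<open>\<complex>\<close>-to-the-\<open>(N+1)\<close> is the space of functions supported on \<open>{..N}\<close>, and the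
  points of projective \<open>N\<close>-space are its one-dimensional linear subspaces.\<close>

definition cscale :: "complex \<Rightarrow> (nat \<Rightarrow> complex) \<Rightarrow> (nat \<Rightarrow> complex)" where
  "cscale c v = (\<lambda>j. c * v j)"

global_interpretation cfun: vector_space cscale
  by unfold_locales (auto simp: cscale_def fun_eq_iff algebra_simps)

definition cvec :: "nat \<Rightarrow> (nat \<Rightarrow> complex) set" where
  "cvec N = {v. \<forall>j>N. v j = 0}"

type_synonym ppoint = "(nat \<Rightarrow> complex) set"

definition line :: "(nat \<Rightarrow> complex) \<Rightarrow> ppoint" where
  "line v = range (\<lambda>c. cscale c v)"

definition proj_space :: "nat \<Rightarrow> ppoint set" where
  "proj_space N = {line v |v. v \<in> cvec N \<and> v \<noteq> 0}"

definition zero_locus :: "nat \<Rightarrow> nat cpoly set \<Rightarrow> ppoint set" where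
  "zero_locus N S = {p \<in> proj_space N. \<forall>F\<in>S. \<forall>v\<in>p. poly_eval F v = 0}"

definition zariski :: "nat \<Rightarrow> ppoint topology" where
  "zariski N = topology (\<lambda>U. \<exists>S \<subseteq> {F. \<exists>d. form N d F}. U = proj_space N - zero_locus N S)"

definition proj_prod :: "nat \<Rightarrow> nat \<Rightarrow> (nat \<Rightarrow> ppoint) set" where
  "proj_prod N n = {..<n} \<rightarrow>\<^sub>E proj_space N"

definition multi_zero_locus :: "nat \<Rightarrow> nat \<Rightarrow> (nat \<times> nat) cpoly set \<Rightarrow> (nat \<Rightarrow> ppoint) set" where
  "multi_zero_locus N n S = {x \<in> proj_prod N n.
     \<forall>F\<in>S. \<forall>v. (\<forall>i<n. v i \<in> x i) \<longrightarrow> poly_eval F (\<lambda>(i, j). v i j) = 0}"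

text \<open>The Zariski topology of the \<open>n\<close>-fold product variety (not the product of the Zariski
  topologies): closed sets are the zero loci of multihomogeneous polynomials.\<close>

definition zariski_prod :: "nat \<Rightarrow> nat \<Rightarrow> (nat \<Rightarrow> ppoint) topology" where
  "zariski_prod N n = topology (\<lambda>U. \<exists>S \<subseteq> {F. \<exists>d. multiform N n d F}.
     U = proj_prod N n - multi_zero_locus N n S)"

subsection \<open>The closed sets are the zero loci\<close>

lemma istopology_zero_loci:
  assumes prod: "\<And>F G. F \<in> A \<Longrightarrow> G \<in> A \<Longrightarrow> \<exists>H\<in>A. \<forall>p\<in>P. Z H p \<longleftrightarrow> Z F p \<or> Z G p"
  shows "istopology (\<lambda>U. \<exists>S\<subseteq>A. U = P - {p\<in>P. \<forall>F\<in>S. Z F p})"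
  unfolding istopology_def
proof (intro conjI allI impI)
  fix U V
  assume "\<exists>S\<subseteq>A. U = P - {p\<in>P. \<forall>F\<in>S. Z F p}" "\<exists>S\<subseteq>A. V = P - {p\<in>P. \<forall>F\<in>S. Z F p}"
  then obtain S T where S: "S \<subseteq> A" "U = P - {p\<in>P. \<forall>F\<in>S. Z F p}"
    and T: "T \<subseteq> A" "V = P - {p\<in>P. \<forall>F\<in>T. Z F p}" by blast
  obtain h where h: "\<And>F G. F \<in> A \<Longrightarrow> G \<in> A \<Longrightarrow> h F G \<in> A"
    "\<And>F G p. F \<in> A \<Longrightarrow> G \<in> A \<Longrightarrow> p \<in> P \<Longrightarrow> Z (h F G) p \<longleftrightarrow> Z F p \<or> Z G p"
    using prod by metis
  let ?R = "{h F G |F G. F \<in> S \<and> G \<in> T}"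
  have "?R \<subseteq> A" using S(1) T(1) h(1) by blast
  moreover have "U \<inter> V = P - {p\<in>P. \<forall>F\<in>?R. Z F p}"
  proof -
    have "(\<forall>F\<in>?R. Z F p) \<longleftrightarrow> (\<forall>F\<in>S. Z F p) \<or> (\<forall>G\<in>T. Z G p)" if "p \<in> P" for p
    proof -
      have "(\<forall>F\<in>?R. Z F p) \<longleftrightarrow> (\<forall>F\<in>S. \<forall>G\<in>T. Z (h F G) p)" by blast
      also have "\<dots> \<longleftrightarrow> (\<forall>F\<in>S. \<forall>G\<in>T. Z F p \<or> Z G p)"
        using h(2) S(1) T(1) that by (meson subsetD)
      finally show ?thesis by blast
    qed
    then show ?thesis using S(2) T(2) by blast
  qed
  ultimately show "\<exists>S\<subseteq>A. U \<inter> V = P - {p\<in>P. \<forall>F\<in>S. Z F p}" by blast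
next
  fix \<K>
  assume "\<forall>U\<in>\<K>. \<exists>S\<subseteq>A. U = P - {p\<in>P. \<forall>F\<in>S. Z F p}"
  then obtain s where s: "\<And>U. U \<in> \<K> \<Longrightarrow> s U \<subseteq> A"
    "\<And>U. U \<in> \<K> \<Longrightarrow> U = P - {p\<in>P. \<forall>F\<in>s U. Z F p}" by metis
  have "\<Union>\<K> = (\<Union>U\<in>\<K>. P - {p\<in>P. \<forall>F\<in>s U. Z F p})" using s(2) by blast
  also have "\<dots> = P - {p\<in>P. \<forall>F\<in>(\<Union>U\<in>\<K>. s U). Z F p}" by blast
  finally have "\<Union>\<K> = P - {p\<in>P. \<forall>F\<in>(\<Union>U\<in>\<K>. s U). Z F p}" .
  moreover have "(\<Union>U\<in>\<K>. s U) \<subseteq> A" using s(1) by blast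
  ultimately show "\<exists>S\<subseteq>A. \<Union>\<K> = P - {p\<in>P. \<forall>F\<in>S. Z F p}" by blast
qed

lemma topspace_zero_loci:
  assumes prod: "\<And>F G. F \<in> A \<Longrightarrow> G \<in> A \<Longrightarrow> \<exists>H\<in>A. \<forall>p\<in>P. Z H p \<longleftrightarrow> Z F p \<or> Z G p"
    and one: "E \<in> A" "\<And>p. p \<in> P \<Longrightarrow> \<not> Z E p"
    and T: "T = topology (\<lambda>U. \<exists>S\<subseteq>A. U = P - {p\<in>P. \<forall>F\<in>S. Z F p})"
  shows "topspace T = P"
    and "closedin T C \<longleftrightarrow> (\<exists>S\<subseteq>A. C = {p\<in>P. \<forall>F\<in>S. Z F p})"
proof -
  have op: "openin T U \<longleftrightarrow> (\<exists>S\<subseteq>A. U = P - {p\<in>P. \<forall>F\<in>S. Z F p})" for U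
    unfolding T using topology_inverse'[OF istopology_zero_loci[OF prod]] by simp
  have "P = P - {p\<in>P. \<forall>F\<in>{E}. Z F p}" using one(2) by blast
  then have "openin T P" unfolding op using one(1) by (intro exI[of _ "{E}"]) simp
  moreover have "U \<subseteq> P" if "openin T U" for U using that op by blast
  ultimately show top: "topspace T = P"
    by (meson openin_subset openin_topspace subset_antisym)
  have "C \<subseteq> P \<and> P - C = P - {p\<in>P. \<forall>F\<in>S. Z F p} \<longleftrightarrow> C = {p\<in>P. \<forall>F\<in>S. Z F p}" for S
    by blast
  then show "closedin T C \<longleftrightarrow> (\<exists>S\<subseteq>A. C = {p\<in>P. \<forall>F\<in>S. Z F p})"
    unfolding closedin_def top op by blast
qed

lemma monom_eval_superset:
  assumes "finite V" "keys m \<subseteq> V"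
  shows "monom_eval m x = (\<Prod>v\<in>V. x v ^ lookup m v)"
  unfolding monom_eval_def using assms
  by (intro prod.mono_neutral_left) (auto simp: in_keys_iff)

lemma monom_eval_add: "monom_eval (m + m') x = monom_eval m x * monom_eval m' x"
proof -
  have "finite (keys m \<union> keys m')" by simp
  then show ?thesis
    using keys_add[of m m']
    by (simp add: monom_eval_superset[of "keys m \<union> keys m'"] lookup_add power_add prod.distrib)
qed

lemma poly_eval_superset:
  assumes "finite M" "keys F \<subseteq> M"
  shows "poly_eval F x = (\<Sum>m\<in>M. lookup F m * monom_eval m x)"
  unfolding poly_eval_def using assms
  by (intro sum.mono_neutral_left) (auto simp: in_keys_iff)

lemma poly_eval_add: "poly_eval (F + G) x = poly_eval F x + poly_eval G x"
proof -
  have "finite (keys F \<union> keys G)" by simp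
  then show ?thesis
    using keys_add[of F G]
    by (simp add: poly_eval_superset[of "keys F \<union> keys G"] lookup_add sum.distrib distrib_right)
qed

lemma poly_eval_0 [simp]: "poly_eval 0 x = 0"
  by (simp add: poly_eval_def)

lemma poly_eval_sum: "poly_eval (\<Sum>i\<in>I. f i) x = (\<Sum>i\<in>I. poly_eval (f i) x)"
  by (induction I rule: infinite_finite_induct) (auto simp: poly_eval_add)

lemma poly_eval_single: "poly_eval (Poly_Mapping.single m c) x = c * monom_eval m x"
  by (cases "c = 0") (auto simp: poly_eval_def)

lemma cpoly_eq_sum_monomials: "F = (\<Sum>m\<in>keys F. Poly_Mapping.single m (lookup F m))"
  by (rule poly_mapping_eqI)
     (auto simp: lookup_sum lookup_single when_def in_keys_iff sum.delta cong: if_cong)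

lemma poly_eval_mult: "poly_eval (F * G) x = poly_eval F x * poly_eval G x"
proof -
  have "F * G = (\<Sum>m\<in>keys F. Poly_Mapping.single m (lookup F m)) *
      (\<Sum>m\<in>keys G. Poly_Mapping.single m (lookup G m))"
    by (rule arg_cong2[where f = "(*)"]) (rule cpoly_eq_sum_monomials)+
  also have "\<dots> = (\<Sum>m\<in>keys F. \<Sum>m'\<in>keys G.
      Poly_Mapping.single (m + m') (lookup F m * lookup G m'))"
    by (simp add: sum_product mult_single)
  finally have "poly_eval (F * G) x = (\<Sum>m\<in>keys F. \<Sum>m'\<in>keys G.
      lookup F m * lookup G m' * (monom_eval m x * monom_eval m' x))"
    by (simp only: poly_eval_sum poly_eval_single monom_eval_add)
  then show ?thesis
    by (simp only: poly_eval_def sum_product mult_ac)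
qed

lemma form_mult:
  assumes "form N d F" "form N e G" shows "form N (d + e) (F * G)"
  unfolding form_def
proof
  fix m assume "m \<in> keys (F * G)"
  then obtain a b where ab: "m = a + b" "a \<in> keys F" "b \<in> keys G"
    using keys_mult[of F G] by blast
  moreover have "keys a \<subseteq> {..N}" "keys b \<subseteq> {..N}"
    "(\<Sum>j\<le>N. lookup a j) = d" "(\<Sum>j\<le>N. lookup b j) = e"
    using assms ab unfolding form_def by auto
  ultimately show "keys m \<subseteq> {..N} \<and> (\<Sum>j\<le>N. lookup m j) = d + e"
    using keys_add[of a b] by (simp add: lookup_add sum.distrib) blast
qed

lemma multiform_mult:
  assumes "multiform N n d F" "multiform N n e G"
  shows "multiform N n (\<lambda>i. d i + e i) (F * G)"
  unfolding multiform_def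
proof
  fix m assume "m \<in> keys (F * G)"
  then obtain a b where ab: "m = a + b" "a \<in> keys F" "b \<in> keys G"
    using keys_mult[of F G] by blast
  moreover have "keys a \<subseteq> {..<n} \<times> {..N}" "keys b \<subseteq> {..<n} \<times> {..N}"
    "\<forall>i<n. (\<Sum>j\<le>N. lookup a (i, j)) = d i" "\<forall>i<n. (\<Sum>j\<le>N. lookup b (i, j)) = e i"
    using assms ab unfolding multiform_def by auto
  ultimately show "keys m \<subseteq> {..<n} \<times> {..N} \<and> (\<forall>i<n. (\<Sum>j\<le>N. lookup m (i, j)) = d i + e i)"
    using keys_add[of a b] by (simp add: lookup_add sum.distrib) blast
qed

lemma poly_eval_form_scale:
  assumes "form N d F" shows "poly_eval F (cscale c v) = c ^ d * poly_eval F v"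
proof -
  have "monom_eval m (cscale c v) = c ^ d * monom_eval m v" if "m \<in> keys F" for m
  proof -
    have m: "keys m \<subseteq> {..N}" "(\<Sum>j\<le>N. lookup m j) = d" using assms that by (auto simp: form_def)
    then show ?thesis
      by (simp add: monom_eval_superset[of "{..N}"] cscale_def power_mult_distrib prod.distrib
          flip: power_sum)
  qed
  then show ?thesis by (simp add: poly_eval_def sum_distrib_left mult_ac)
qed

lemma poly_eval_multiform_scale:
  assumes "multiform N n d F"
  shows "poly_eval F (\<lambda>(i, j). c i * v i j) = (\<Prod>i<n. c i ^ d i) * poly_eval F (\<lambda>(i, j). v i j)"
proof -
  have "monom_eval m (\<lambda>(i, j). c i * v i j) = (\<Prod>i<n. c i ^ d i) * monom_eval m (\<lambda>(i, j). v i j)"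
    if "m \<in> keys F" for m
  proof -
    have m: "keys m \<subseteq> {..<n} \<times> {..N}" "\<forall>i<n. (\<Sum>j\<le>N. lookup m (i, j)) = d i"
      using assms that by (auto simp: multiform_def)
    have "(\<Prod>i<n. \<Prod>j\<le>N. c i ^ lookup m (i, j)) = (\<Prod>i<n. c i ^ d i)"
      using m(2) by (intro prod.cong) (auto simp flip: power_sum)
    then show ?thesis
      using m(1)
      by (simp add: monom_eval_superset[of "{..<n} \<times> {..N}"] power_mult_distrib prod.distrib
          case_prod_beta prod.cartesian_product)
  qed
  then show ?thesis by (simp add: poly_eval_def sum_distrib_left mult_ac)
qed

lemma line_self: "v \<in> line v"
  by (auto simp: line_def cscale_def intro!: image_eqI[of _ _ 1])

lemma vanish_line:
  assumes "form N d F" shows "(\<forall>w\<in>line v. poly_eval F w = 0) \<longleftrightarrow> poly_eval F v = 0"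
  using line_self[of v] poly_eval_form_scale[OF assms] by (auto simp: line_def)

lemma multi_vanish_line:
  assumes F: "multiform N n d F" and x: "\<And>i. i < n \<Longrightarrow> x i = line (u i)"
  shows "(\<forall>v. (\<forall>i<n. v i \<in> x i) \<longrightarrow> poly_eval F (\<lambda>(i, j). v i j) = 0)
    \<longleftrightarrow> poly_eval F (\<lambda>(i, j). u i j) = 0" (is "?L \<longleftrightarrow> ?R")
proof
  assume ?L then show ?R using x line_self by blast
next
  assume R: ?R
  show ?L
  proof (intro allI impI)
    fix v assume "\<forall>i<n. v i \<in> x i"
    then have "\<forall>i<n. \<exists>c. v i = cscale c (u i)" using x by (auto simp: line_def)
    then obtain c where c: "\<And>i. i < n \<Longrightarrow> v i = cscale (c i) (u i)" by metis
    have "monom_eval m (\<lambda>(i, j). v i j) = monom_eval m (\<lambda>(i, j). c i * u i j)"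
      if "m \<in> keys F" for m
    proof -
      have "keys m \<subseteq> {..<n} \<times> {..N}" using F that by (auto simp: multiform_def)
      then show ?thesis unfolding monom_eval_def
        by (intro prod.cong) (auto simp: c cscale_def)
    qed
    then have "poly_eval F (\<lambda>(i, j). v i j) = poly_eval F (\<lambda>(i, j). c i * u i j)"
      by (simp add: poly_eval_def)
    then show "poly_eval F (\<lambda>(i, j). v i j) = 0"
      using R by (simp add: poly_eval_multiform_scale[OF F])
  qed
qed

lemma poly_eval_1: "poly_eval 1 x = 1"
  using poly_eval_single[of 0 1 x] by (simp add: monom_eval_def)

lemma form_1: "form N 0 1" and multiform_1: "multiform N n (\<lambda>_. 0) 1"
  by (auto simp: form_def multiform_def)

lemma
  shows topspace_zariski [simp]: "topspace (zariski N) = proj_space N"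
    and closedin_zariski:
      "closedin (zariski N) C \<longleftrightarrow> (\<exists>S \<subseteq> {F. \<exists>d. form N d F}. C = zero_locus N S)"
proof -
  let ?A = "{F. \<exists>d. form N d F}" and ?Z = "\<lambda>F p. \<forall>v\<in>p. poly_eval F v = 0"
  have prod: "\<exists>H\<in>?A. \<forall>p\<in>proj_space N. ?Z H p \<longleftrightarrow> ?Z F p \<or> ?Z G p"
    if "F \<in> ?A" "G \<in> ?A" for F G
  proof -
    obtain d e where d: "form N d F" and e: "form N e G" using \<open>F \<in> ?A\<close> \<open>G \<in> ?A\<close> by blast
    have "?Z (F * G) p \<longleftrightarrow> ?Z F p \<or> ?Z G p" if "p \<in> proj_space N" for p
    proof -
      obtain v where p: "p = line v" using \<open>p \<in> proj_space N\<close> by (auto simp: proj_space_def)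
      show ?thesis
        unfolding p vanish_line[OF d] vanish_line[OF e] vanish_line[OF form_mult[OF d e]]
        by (simp add: poly_eval_mult)
    qed
    then have "\<forall>p\<in>proj_space N. ?Z (F * G) p \<longleftrightarrow> ?Z F p \<or> ?Z G p" by (rule ballI)
    moreover have "F * G \<in> ?A" using form_mult[OF d e] by (intro CollectI exI)
    ultimately show ?thesis by (rule bexI)
  qed
  have 1: "1 \<in> ?A" "\<not> ?Z 1 p" if "p \<in> proj_space N" for p
    using that form_1 line_self by (auto simp: proj_space_def poly_eval_1)
  have one: "1 \<in> ?A" using form_1 by blast
  note * = topspace_zero_loci[of ?A "proj_space N" ?Z, OF prod one 1(2), of "zariski N"]
  show "topspace (zariski N) = proj_space N"
    by (rule *(1)) (auto simp: zariski_def zero_locus_def)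
  show "closedin (zariski N) C \<longleftrightarrow> (\<exists>S \<subseteq> ?A. C = zero_locus N S)"
    unfolding zero_locus_def by (rule *(2)) (auto simp: zariski_def zero_locus_def)
qed

lemma
  shows topspace_zariski_prod [simp]: "topspace (zariski_prod N n) = proj_prod N n"
    and closedin_zariski_prod:
      "closedin (zariski_prod N n) C \<longleftrightarrow>
        (\<exists>S \<subseteq> {F. \<exists>d. multiform N n d F}. C = multi_zero_locus N n S)"
proof -
  let ?A = "{F. \<exists>d. multiform N n d F}"
    and ?Z = "\<lambda>F x. \<forall>v. (\<forall>i<n. v i \<in> x i) \<longrightarrow> poly_eval F (\<lambda>(i, j). v i j) = 0"
  have rep: "\<exists>u. \<forall>i<n. x i = line (u i)" if "x \<in> proj_prod N n" for x
    using that by (fastforce simp: proj_prod_def proj_space_def PiE_iff intro: choice)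
  have prod: "\<exists>H\<in>?A. \<forall>p\<in>proj_prod N n. ?Z H p \<longleftrightarrow> ?Z F p \<or> ?Z G p"
    if "F \<in> ?A" "G \<in> ?A" for F G
  proof -
    obtain d e where d: "multiform N n d F" and e: "multiform N n e G"
      using \<open>F \<in> ?A\<close> \<open>G \<in> ?A\<close> by blast
    have "?Z (F * G) p \<longleftrightarrow> ?Z F p \<or> ?Z G p" if "p \<in> proj_prod N n" for p
    proof -
      obtain u where u: "\<And>i. i < n \<Longrightarrow> p i = line (u i)" using rep[OF \<open>p \<in> proj_prod N n\<close>] by blast
      show ?thesis
        using multi_vanish_line[OF d u] multi_vanish_line[OF e u]
          multi_vanish_line[OF multiform_mult[OF d e] u]
        by (simp add: poly_eval_mult)
    qed
    then have "\<forall>p\<in>proj_prod N n. ?Z (F * G) p \<longleftrightarrow> ?Z F p \<or> ?Z G p" by (rule ballI)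
    moreover have "F * G \<in> ?A" using multiform_mult[OF d e] by (intro CollectI exI)
    ultimately show ?thesis by (rule bexI)
  qed
  have one: "1 \<in> ?A" using multiform_1 by blast
  have one': "\<not> ?Z 1 p" if "p \<in> proj_prod N n" for p
    using rep[OF that] line_self by (auto simp: poly_eval_1)
  note * = topspace_zero_loci[of ?A "proj_prod N n" ?Z, OF prod one one', of "zariski_prod N n"]
  show "topspace (zariski_prod N n) = proj_prod N n"
    by (rule *(1)) (auto simp: zariski_prod_def multi_zero_locus_def)
  show "closedin (zariski_prod N n) C \<longleftrightarrow> (\<exists>S \<subseteq> ?A. C = multi_zero_locus N n S)"
    unfolding multi_zero_locus_def by (rule *(2)) (auto simp: zariski_prod_def multi_zero_locus_def)
qed

section \<open>Irreducibility, dimension, genericity\<close>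

definition irreducible_set :: "'a topology \<Rightarrow> 'a set \<Rightarrow> bool" where
  "irreducible_set T Z \<longleftrightarrow> Z \<subseteq> topspace T \<and> Z \<noteq> {} \<and>
     (\<forall>A B. closedin T A \<and> closedin T B \<and> Z \<subseteq> A \<union> B \<longrightarrow> Z \<subseteq> A \<or> Z \<subseteq> B)"

definition irreducible_chain :: "'a topology \<Rightarrow> 'a set \<Rightarrow> nat \<Rightarrow> bool" where
  "irreducible_chain T Z d \<longleftrightarrow> (\<exists>c :: nat \<Rightarrow> 'a set.
     (\<forall>i\<le>d. closedin T (c i) \<and> irreducible_set T (c i) \<and> c i \<subseteq> Z) \<and> (\<forall>i<d. c i \<subset> c (Suc i)))"

definition has_dimension :: "'a topology \<Rightarrow> 'a set \<Rightarrow> nat \<Rightarrow> bool" where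
  "has_dimension T Z d \<longleftrightarrow> irreducible_chain T Z d \<and> \<not> irreducible_chain T Z (Suc d)"

definition generically :: "'a topology \<Rightarrow> ('a \<Rightarrow> bool) \<Rightarrow> bool" where
  "generically T P \<longleftrightarrow> (\<exists>U. openin T U \<and> T closure_of U = topspace T \<and> (\<forall>x\<in>U. P x))"

definition proj_variety :: "nat \<Rightarrow> ppoint set \<Rightarrow> bool" where
  "proj_variety N X \<longleftrightarrow> closedin (zariski N) X \<and> irreducible_set (zariski N) X"

text \<open>The span of \<open>X\<close> is the projectivization of the linear span of the union of the
  lines in \<open>X\<close>.\<close>

definition proj_span_dim :: "ppoint set \<Rightarrow> int" where
  "proj_span_dim X = int (cfun.dim (\<Union>X)) - 1"

section \<open>Rational normal curves\<close>

definition regular_map :: "nat \<Rightarrow> ppoint set \<Rightarrow> nat \<Rightarrow> ppoint set \<Rightarrow> (ppoint \<Rightarrow> ppoint) \<Rightarrow> bool" where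
  "regular_map N X M Y f \<longleftrightarrow> f ` X \<subseteq> Y \<and>
     (\<forall>x\<in>X. \<exists>U d F. openin (subtopology (zariski N) X) U \<and> x \<in> U \<and> (\<forall>j\<le>M. form N d (F j)) \<and>
        (\<forall>p\<in>U. \<forall>v\<in>p - {0}.
           (\<exists>j\<le>M. poly_eval (F j) v \<noteq> 0) \<and>
           f p = line (\<lambda>j. if j \<le> M then poly_eval (F j) v else 0)))"

definition birational :: "nat \<Rightarrow> ppoint set \<Rightarrow> nat \<Rightarrow> ppoint set \<Rightarrow> bool" where
  "birational N X M Y \<longleftrightarrow> (\<exists>U V f g.
     openin (subtopology (zariski N) X) U \<and> U \<noteq> {} \<and>
     openin (subtopology (zariski M) Y) V \<and> V \<noteq> {} \<and>
     regular_map N U M V f \<and> regular_map M V N U g \<and>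
     (\<forall>x\<in>U. g (f x) = x) \<and> (\<forall>y\<in>V. f (g y) = y))"

text \<open>The linear subspace whose projectivization is the embedded tangent space of \<open>X\<close> at \<open>p\<close>.\<close>

definition tangent_cone_space :: "nat \<Rightarrow> ppoint set \<Rightarrow> ppoint \<Rightarrow> (nat \<Rightarrow> complex) set" where
  "tangent_cone_space N X p = {w \<in> cvec N. \<forall>F d. form N d F \<and> X \<subseteq> zero_locus N {F} \<longrightarrow>
     (\<forall>v\<in>p - {0}. ((\<lambda>t. poly_eval F (v + cscale t w)) has_field_derivative 0) (at 0))}"

definition smooth_variety :: "nat \<Rightarrow> ppoint set \<Rightarrow> bool" where
  "smooth_variety N X \<longleftrightarrow> proj_variety N X \<and>
     (\<exists>d. has_dimension (zariski N) X d \<and> (\<forall>p\<in>X. cfun.dim (tangent_cone_space N X p) = d + 1))"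

definition hyperplane :: "nat \<Rightarrow> ppoint \<Rightarrow> ppoint set" where
  "hyperplane N a = {p \<in> proj_space N. \<forall>u\<in>a. \<forall>v\<in>p. (\<Sum>j\<le>N. u j * v j) = 0}"

text \<open>The degree of a curve is its number of intersection points with a generic hyperplane;
  hyperplanes are parametrized by the dual projective space.\<close>

definition curve_degree :: "nat \<Rightarrow> ppoint set \<Rightarrow> nat \<Rightarrow> bool" where
  "curve_degree N C q \<longleftrightarrow>
     generically (zariski N) (\<lambda>a. finite (C \<inter> hyperplane N a) \<and> card (C \<inter> hyperplane N a) = q)"

definition rational_normal_curve :: "nat \<Rightarrow> nat \<Rightarrow> ppoint set \<Rightarrow> bool" where
  "rational_normal_curve N q C \<longleftrightarrow>
     proj_variety N C \<and> has_dimension (zariski N) C 1 \<and> smooth_variety N C \<and>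
     birational N C 1 (proj_space 1) \<and> curve_degree N C q \<and> proj_span_dim C = int q"

section \<open>The class of varieties\<close>

definition rnc_through_generic_points :: "nat \<Rightarrow> nat \<Rightarrow> nat \<Rightarrow> ppoint set \<Rightarrow> bool" where
  "rnc_through_generic_points n q N X \<longleftrightarrow>
     generically (subtopology (zariski_prod N n) ({..<n} \<rightarrow>\<^sub>E X))
       (\<lambda>x. \<exists>C. rational_normal_curve N q C \<and> C \<subseteq> X \<and> (\<forall>i<n. x i \<in> C))"

definition rnc_variety :: "nat \<Rightarrow> nat \<Rightarrow> nat \<Rightarrow> nat \<Rightarrow> ppoint set \<Rightarrow> bool" where
  "rnc_variety k n q N X \<longleftrightarrow>
     proj_variety N X \<and> has_dimension (zariski N) X k \<and> rnc_through_generic_points n q N X"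

text \<open>A member of the class is a subvariety together with the dimension of its ambient
  projective space; \<open>k\<close> is the dimension of the variety.\<close>

definition class_X :: "nat \<Rightarrow> nat \<Rightarrow> nat \<Rightarrow> (nat \<times> ppoint set) set" where
  "class_X k n q = {(N, X). rnc_variety k n q N X \<and>
     (\<forall>M Y. rnc_variety k n q M Y \<longrightarrow> proj_span_dim Y \<le> proj_span_dim X)}"

end

theory Submission
  imports Defs "HOL-Computational_Algebra.Fundamental_Theorem_Algebra" "HOL-Library.Landau_Symbols"
begin

text \<open>
  Upper bound: take generic points \<open>x\<^sub>1, \<dots>, x\<^sub>n\<close> of \<open>X\<close> and a hyperplane containing the osculating space of
  \<open>X\<close> of order \<open>\<rho>\<close> at \<open>x\<^sub>1, \<dots>, x\<^sub>m\<close> and of order \<open>\<rho> - 1\<close> at \<open>x\<^sub>m\<^sub>+\<^sub>1, \<dots>, x\<^sub>n\<^sub>-\<^sub>1\<close>. It meets a rational normal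
  curve of degree \<open>q\<close> through the points in at least \<open>m (\<rho> + 1) + (n - 1 - m) \<rho> = q + 1\<close> points counted
  with multiplicity, so it contains the curve and \<open>x\<^sub>n\<close>. Hence these osculating spaces span \<open>X\<close>. At a
  generic point all coordinates are power series in \<open>d = r + 1\<close> of them (Newton iteration), which bounds
  the dimension of the \<open>k\<close>-th osculating space by that of the polynomials of degree at most \<open>k\<close> in \<open>d\<close>
  variables. That at most \<open>d\<close> affine coordinates are algebraically independent is derived from the absence
  of longer chains of subvarieties: \<open>s\<close> independent coordinates yield a chain of \<open>s + 1\<close> prime ideals,
  because the complex field is uncountable while polynomial rings have countable dimension.

  Lower bound: the weighted projective space with one variable \<open>t\<close> of weight 1 and \<open>r\<close> variables \<open>y\<^sub>i\<close> of
  weight \<open>n - 1\<close> is mapped by all monomials of weighted degree at most \<open>q\<close>. By Lagrange interpolation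
  \<open>n\<close> generic points lie on a curve \<open>y\<^sub>i = p\<^sub>i(t)\<close> with \<open>p\<^sub>i\<close> of degree at most \<open>n - 1\<close>, whose image is
  a rational normal curve of degree \<open>q\<close>.
\<close>

section \<open>Polynomials as functions: substitution, degrees, restriction to lines\<close>

section \<open>Polynomials\<close>

text \<open>The two bounds agree because \<open>q + 1 = \<rho> * (n - 1) + m\<close>. Contact of
  order \<open>\<rho> + 1\<close> at \<open>m\<close> points and \<open>\<rho>\<close> at
  \<open>n - 1 - m\<close> points adds up to exactly \<open>q + 1\<close>, one more than a nonzero
  polynomial of degree \<open>q\<close> allows; and dividing the exponent of \<open>t\<close> by
  \<open>n - 1\<close> sorts the weighted monomials into \<open>n - 1\<close> classes with the sizes
  of these osculating spaces. Two features of the definitions shape the proof. Dimension is a length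
  of chains of closed irreducible sets, so it must be compared with algebraic independence in both
  directions: long chains are excluded on parametrized varieties, and produced from independent
  coordinates on an arbitrary member of the class. Rational normal curves are given intrinsically,
  so they are brought into the form \<open>rnc w q\<close>, and each \<open>rnc w q\<close> is in
  turn checked against the intrinsic definition. Finally, the osculating space at a point must be
  fixed before the curve through it is known; hence the local expansions are uniform over all arcs
  through the point.\<close>

definition cX :: "'v \<Rightarrow> 'v cpoly" where
  "cX v = Poly_Mapping.single (Poly_Mapping.single v 1) 1"

definition cC :: "complex \<Rightarrow> 'v cpoly" where
  "cC c = Poly_Mapping.single 0 c"

definition vars_in :: "'v set \<Rightarrow> 'v cpoly \<Rightarrow> bool" where
  "vars_in J F \<longleftrightarrow> (\<forall>m\<in>keys F. keys m \<subseteq> J)"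

definition psubst :: "'v cpoly \<Rightarrow> ('v \<Rightarrow> 'w cpoly) \<Rightarrow> 'w cpoly" where
  "psubst F f = (\<Sum>m\<in>keys F. cC (lookup F m) * (\<Prod>v\<in>keys m. f v ^ lookup m v))"

text \<open>The target is the univariate type \<open>complex poly\<close>, where
  \<open>degree\<close>, \<open>order\<close> and finiteness of the set of roots are
  available.\<close>

definition usubst :: "'v cpoly \<Rightarrow> ('v \<Rightarrow> complex poly) \<Rightarrow> complex poly" where
  "usubst F f = (\<Sum>m\<in>keys F. smult (lookup F m) (\<Prod>v\<in>keys m. f v ^ lookup m v))"

lemma monom_eval_single [simp]: "monom_eval (Poly_Mapping.single v k) x = x v ^ k"
  by (cases "k = 0") (auto simp: monom_eval_def)

lemma monom_eval_0 [simp]: "monom_eval 0 x = 1"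
  by (simp add: monom_eval_def)

lemma poly_eval_cX [simp]: "poly_eval (cX v) x = x v"
  by (simp add: cX_def poly_eval_single)

lemma poly_eval_cC [simp]: "poly_eval (cC c) x = c"
  by (simp add: cC_def poly_eval_single)

lemma poly_eval_diff: "poly_eval (F - G) x = poly_eval F x - poly_eval G x"
  using poly_eval_add[of "F - G" G x] by (simp add: algebra_simps)

lemma poly_eval_power: "poly_eval (F ^ k) x = poly_eval F x ^ k"
  by (induction k) (auto simp: poly_eval_1 poly_eval_mult)

lemma poly_eval_prod: "poly_eval (\<Prod>i\<in>I. f i) x = (\<Prod>i\<in>I. poly_eval (f i) x)"
  by (induction I rule: infinite_finite_induct) (auto simp: poly_eval_1 poly_eval_mult)

lemmas poly_eval_simps =
  poly_eval_add poly_eval_diff poly_eval_mult poly_eval_power poly_eval_prod poly_eval_sum poly_eval_1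

lemma poly_eval_cong:
  assumes "vars_in J F" "\<And>v. v \<in> J \<Longrightarrow> x v = y v"
  shows "poly_eval F x = poly_eval F y"
proof -
  have "monom_eval m x = monom_eval m y" if "m \<in> keys F" for m
    unfolding monom_eval_def using assms that by (intro prod.cong) (auto simp: vars_in_def subset_iff)
  then show ?thesis by (simp add: poly_eval_def)
qed

lemma poly_eval_psubst: "poly_eval (psubst F f) x = poly_eval F (\<lambda>v. poly_eval (f v) x)"
  by (simp add: psubst_def poly_eval_simps) (simp add: poly_eval_def monom_eval_def)

lemma poly_usubst: "poly (usubst F f) c = poly_eval F (\<lambda>v. poly (f v) c)"
  by (simp add: usubst_def poly_sum poly_prod poly_power) (simp add: poly_eval_def monom_eval_def)

lemma degree_monomial_subst_le:
  assumes "\<And>v. v \<in> keys m \<Longrightarrow> degree (f v) \<le> w v"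
  shows "degree (\<Prod>v\<in>keys m. f v ^ lookup m v) \<le> (\<Sum>v\<in>keys m. w v * lookup m v)"
proof -
  have "degree (\<Prod>v\<in>keys m. f v ^ lookup m v) \<le> (\<Sum>v\<in>keys m. degree (f v ^ lookup m v))"
    by (rule order_trans[OF degree_prod_sum_le]) (auto simp: o_def)
  also have "\<dots> \<le> (\<Sum>v\<in>keys m. w v * lookup m v)"
  proof (rule sum_mono)
    fix v assume "v \<in> keys m"
    have "degree (f v ^ lookup m v) \<le> degree (f v) * lookup m v" by (rule degree_power_le)
    also have "\<dots> \<le> w v * lookup m v" using assms[OF \<open>v \<in> keys m\<close>] by simp
    finally show "degree (f v ^ lookup m v) \<le> w v * lookup m v" .
  qed
  finally show ?thesis .
qed

lemma keys_subset_add: "keys a \<subseteq> keys (a + b)" for a b :: "'v \<Rightarrow>\<^sub>0 nat"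
  by (auto simp: in_keys_iff lookup_add)

subsection \<open>Variables of a polynomial\<close>

lemma vars_in_mono: "vars_in I F \<Longrightarrow> I \<subseteq> J \<Longrightarrow> vars_in J F"
  unfolding vars_in_def by blast

lemma vars_in_0 [simp]: "vars_in J 0"
  by (simp add: vars_in_def)

lemma vars_in_1 [simp]: "vars_in J 1"
  by (simp add: vars_in_def)

lemma vars_in_cC [simp]: "vars_in J (cC c)"
  by (simp add: vars_in_def cC_def)

lemma vars_in_cX [simp]: "vars_in J (cX v) \<longleftrightarrow> v \<in> J"
  by (simp add: vars_in_def cX_def)

lemma vars_in_add: "vars_in J F \<Longrightarrow> vars_in J G \<Longrightarrow> vars_in J (F + G)"
  using keys_add[of F G] unfolding vars_in_def by blast

lemma vars_in_uminus: "vars_in J F \<Longrightarrow> vars_in J (- F)"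
  unfolding vars_in_def by (simp add: in_keys_iff)

lemma vars_in_diff: "vars_in J F \<Longrightarrow> vars_in J G \<Longrightarrow> vars_in J (F - G)"
  using vars_in_add[of J F "- G"] vars_in_uminus[of J G] by simp

lemma vars_in_mult:
  assumes "vars_in J F" "vars_in J G" shows "vars_in J (F * G)"
  unfolding vars_in_def
proof
  fix m assume "m \<in> keys (F * G)"
  then obtain a b where "m = a + b" "a \<in> keys F" "b \<in> keys G" using keys_mult[of F G] by blast
  then show "keys m \<subseteq> J" using assms keys_add[of a b] unfolding vars_in_def by blast
qed

lemma vars_in_sum: "(\<And>i. i \<in> I \<Longrightarrow> vars_in J (f i)) \<Longrightarrow> vars_in J (\<Sum>i\<in>I. f i)"
  by (induction I rule: infinite_finite_induct) (auto intro: vars_in_add)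

lemma vars_in_prod: "(\<And>i. i \<in> I \<Longrightarrow> vars_in J (f i)) \<Longrightarrow> vars_in J (\<Prod>i\<in>I. f i)"
  by (induction I rule: infinite_finite_induct) (auto intro: vars_in_mult)

lemma vars_in_power: "vars_in J F \<Longrightarrow> vars_in J (F ^ k)"
  by (induction k) (auto intro: vars_in_mult)

lemma vars_in_psubst:
  assumes "vars_in I F" "\<And>v. v \<in> I \<Longrightarrow> vars_in J (f v)" shows "vars_in J (psubst F f)"
  unfolding psubst_def
proof (intro vars_in_sum vars_in_mult vars_in_prod vars_in_power vars_in_cC)
  show "vars_in J (f v)" if "m \<in> keys F" "v \<in> keys m" for m v
    using assms that by (auto simp: vars_in_def[of I])
qed

lemma vars_in_finite: "\<exists>J. finite J \<and> vars_in J F"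
  by (rule exI[of _ "\<Union>m\<in>keys F. keys m"]) (auto simp: vars_in_def)

subsection \<open>Degrees of forms\<close>

lemma form_0 [simp]: "form N d 0"
  by (simp add: form_def)

lemma form_cC [simp]: "form N 0 (cC c)"
  by (simp add: form_def cC_def)

lemma form_cX: "j \<le> N \<Longrightarrow> form N 1 (cX j)"
  by (auto simp: form_def cX_def lookup_single when_def)

lemma form_add: "form N d F \<Longrightarrow> form N d G \<Longrightarrow> form N d (F + G)"
  using keys_add[of F G] unfolding form_def by blast

lemma form_uminus: "form N d F \<Longrightarrow> form N d (- F)"
  unfolding form_def by (simp add: in_keys_iff)

lemma form_diff: "form N d F \<Longrightarrow> form N d G \<Longrightarrow> form N d (F - G)"
  using form_add[of N d F "- G"] form_uminus[of N d G] by simp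

lemma form_sum: "(\<And>i. i \<in> I \<Longrightarrow> form N d (f i)) \<Longrightarrow> form N d (\<Sum>i\<in>I. f i)"
  by (induction I rule: infinite_finite_induct) (auto intro: form_add)

lemma form_cmult: "form N d F \<Longrightarrow> form N d (cC c * F)"
  using form_mult[OF form_cC] by fastforce

lemma form_prod:
  "(\<And>i. i \<in> I \<Longrightarrow> form N (d i) (f i)) \<Longrightarrow> form N (\<Sum>i\<in>I. d i) (\<Prod>i\<in>I. f i)"
  by (induction I rule: infinite_finite_induct) (auto intro: form_mult form_1)

lemma form_power: "form N d F \<Longrightarrow> form N (k * d) (F ^ k)"
  by (induction k) (auto intro: form_mult form_1)

text \<open>Weighted homogeneity: if \<open>v\<close> has weight \<open>w v\<close>, every monomial
  of \<open>F\<close> has weight \<open>s\<close>. Unequal weights cover substitutions that replace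
  some variables by linear forms and others by constants.\<close>

lemma form_psubst:
  assumes f: "\<And>v. v \<in> I \<Longrightarrow> form N (w v) (f v)" and F: "vars_in I F"
    and s: "\<And>m. m \<in> keys F \<Longrightarrow> (\<Sum>v\<in>keys m. lookup m v * w v) = s"
  shows "form N s (psubst F f)"
  unfolding psubst_def
proof (rule form_sum, rule form_cmult)
  fix m assume m: "m \<in> keys F"
  have "form N (\<Sum>v\<in>keys m. lookup m v * w v) (\<Prod>v\<in>keys m. f v ^ lookup m v)"
    using F m by (intro form_prod form_power f) (auto simp: vars_in_def)
  then show "form N s (\<Prod>v\<in>keys m. f v ^ lookup m v)" by (simp add: s[OF m])
qed

lemma form_vars_in: "form N d F \<Longrightarrow> vars_in {..N} F"
  by (simp add: form_def vars_in_def)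

lemma form_psubst_form:
  assumes P: "form k s P" and f: "\<And>i. i \<le> k \<Longrightarrow> form N e (f i)"
  shows "form N (s * e) (psubst P f)"
proof (rule form_psubst[of "{..k}" N "\<lambda>_. e"])
  fix m assume "m \<in> keys P"
  then have m: "keys m \<subseteq> {..k}" "(\<Sum>j\<le>k. lookup m j) = s" using P by (auto simp: form_def)
  have "(\<Sum>v\<in>keys m. lookup m v) = (\<Sum>j\<le>k. lookup m j)"
    by (rule sum.mono_neutral_left) (use m in \<open>auto simp: in_keys_iff\<close>)
  then show "(\<Sum>v\<in>keys m. lookup m v * e) = s * e" using m by (simp flip: sum_distrib_right)
qed (use f form_vars_in[OF P] in auto)

lemma multiform_diff:
  assumes "multiform N n d F" "multiform N n d G" shows "multiform N n d (F - G)"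
proof -
  have "keys (F - G) \<subseteq> keys F \<union> keys G" by (auto simp: in_keys_iff lookup_minus)
  then show ?thesis using assms unfolding multiform_def by blast
qed

lemma multiform_cX:
  "i < n \<Longrightarrow> j \<le> N \<Longrightarrow> multiform N n (\<lambda>k. if k = i then 1 else 0) (cX (i, j))"
  by (auto simp: multiform_def cX_def lookup_single when_def)

lemma multiform_prod:
  "(\<And>i. i \<in> I \<Longrightarrow> \<exists>d. multiform N n d (f i)) \<Longrightarrow> \<exists>d. multiform N n d (\<Prod>i\<in>I. f i)"
proof (induction I rule: infinite_finite_induct)
  case (insert i I)
  have "\<exists>d. multiform N n d (f i)" "\<exists>e. multiform N n e (\<Prod>i\<in>I. f i)"
    using insert(3,4) by blast+
  then obtain d e where "multiform N n d (f i)" "multiform N n e (\<Prod>i\<in>I. f i)" by blast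
  then have "multiform N n (\<lambda>k. d k + e k) (f i * (\<Prod>i\<in>I. f i))" by (rule multiform_mult)
  then show ?case using insert(1,2) by auto
qed (auto intro: multiform_1)

text \<open>Freezing all blocks of variables except one leaves a form in that block. Through this,
  statements about the product variety are reduced to \<open>X\<close>, one factor at a
  time.\<close>

lemma multiform_partial_eval:
  assumes F: "multiform N n d F" and i: "i < n"
  shows "\<exists>G. form N (d i) G \<and>
    (\<forall>v. poly_eval G v = poly_eval F (\<lambda>(k, j). (z(i := v)) k j))"
proof (intro exI[of _ "psubst F (\<lambda>(k, j). if k = i then cX j else cC (z k j))"] conjI allI)
  let ?f = "\<lambda>(k, j). if k = i then cX j else cC (z k j)"
  show "form N (d i) (psubst F ?f)"
  proof (rule form_psubst[of "{..<n} \<times> {..N}" N "\<lambda>(k, j). if k = i then 1 else 0"])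
    show "vars_in ({..<n} \<times> {..N}) F" using F by (simp add: multiform_def vars_in_def)
    fix m assume "m \<in> keys F"
    then have m: "keys m \<subseteq> {..<n} \<times> {..N}" "(\<Sum>j\<le>N. lookup m (i, j)) = d i"
      using F i by (auto simp: multiform_def)
    have "(\<Sum>v\<in>keys m. lookup m v * (case v of (k, j) \<Rightarrow> if k = i then 1 else 0))
      = (\<Sum>v\<in>{..<n} \<times> {..N}. lookup m v * (case v of (k, j) \<Rightarrow> if k = i then 1 else 0))"
      by (rule sum.mono_neutral_left) (use m in \<open>auto simp: in_keys_iff\<close>)
    also have "\<dots> = (\<Sum>v\<in>{i} \<times> {..N}. lookup m v)"
      by (rule sum.mono_neutral_cong_right) (use i in \<open>auto split: if_splits\<close>)
    also have "\<dots> = (\<Sum>j\<le>N. lookup m (i, j))"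
      using sum.cartesian_product[of "\<lambda>a b. lookup m (a, b)" "{..N}" "{i}"] by simp
    finally show "(\<Sum>v\<in>keys m. lookup m v * (case v of (k, j) \<Rightarrow> if k = i then 1 else 0)) = d i"
      using m by simp
  qed (use form_cX in auto)
  show "poly_eval (psubst F ?f) v = poly_eval F (\<lambda>(k, j). (z(i := v)) k j)" for v
    unfolding poly_eval_psubst
    by (intro arg_cong[where f = "poly_eval F"] ext) (auto simp: fun_upd_def)
qed

subsection \<open>Restriction to lines\<close>

lemma infinite_nonroot:
  fixes p :: "complex poly"
  assumes "p \<noteq> 0" "finite B"
  shows "\<exists>c. c \<notin> B \<and> poly p c \<noteq> 0"
proof -
  have "finite (B \<union> {c. poly p c = 0})" using assms by (simp add: poly_roots_finite)
  then obtain c where "c \<notin> B \<union> {c. poly p c = 0}"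
    using ex_new_if_finite[OF infinite_UNIV_char_0] by blast
  then show ?thesis by blast
qed

lemma poly_eval_line:
  "poly_eval F (\<lambda>v. u v + c * (w v - u v)) = poly (usubst F (\<lambda>v. [:u v, w v - u v:])) c"
  by (simp add: poly_usubst mult.commute)

text \<open>On the line joining \<open>u\<close> and \<open>w\<close> both restrictions are nonzero
  polynomials in one variable, as the parameters 0 and 1 show, so their product has a nonroot. This
  is the irreducibility of affine space.\<close>

lemma two_nonvanishing:
  assumes "poly_eval F u \<noteq> 0" "poly_eval G w \<noteq> 0"
  shows "\<exists>c. poly_eval F (\<lambda>v. u v + c * (w v - u v)) \<noteq> 0 \<and>
    poly_eval G (\<lambda>v. u v + c * (w v - u v)) \<noteq> 0"
proof -
  let ?p = "\<lambda>F. usubst F (\<lambda>v. [:u v, w v - u v:])"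
  have "poly (?p F) 0 \<noteq> 0" "poly (?p G) 1 \<noteq> 0"
    using assms by (simp_all flip: poly_eval_line)
  then have "?p F * ?p G \<noteq> 0" by auto
  then obtain c where "poly (?p F * ?p G) c \<noteq> 0" using infinite_nonroot[of _ "{}"] by blast
  then show ?thesis unfolding poly_eval_line by auto
qed

lemma poly_eval_mult_eq_0:
  assumes "\<And>x. poly_eval F x * poly_eval G x = 0"
  shows "(\<forall>x. poly_eval F x = 0) \<or> (\<forall>x. poly_eval G x = 0)"
  using two_nonvanishing[of F _ G] assms by (metis mult_eq_0_iff)

subsection \<open>Coefficients with respect to one variable\<close>

text \<open>The coefficient stays in the same polynomial type, with \<open>j\<close> no longer
  occurring. The subtraction of exponents is exact because only monomials with exponent
  \<open>i\<close> in \<open>j\<close> are summed.\<close>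

definition cpart :: "'v \<Rightarrow> nat \<Rightarrow> 'v cpoly \<Rightarrow> 'v cpoly" where
  "cpart j i F = (\<Sum>m\<in>{m\<in>keys F. lookup m j = i}.
     Poly_Mapping.single (m - Poly_Mapping.single j i) (lookup F m))"

lemma keys_cpart:
  assumes "m' \<in> keys (cpart j i F)"
  shows "\<exists>m\<in>keys F. lookup m j = i \<and> m = m' + Poly_Mapping.single j i \<and> lookup m' j = 0"
proof -
  obtain m where m: "m \<in> keys F" "lookup m j = i" "m' = m - Poly_Mapping.single j i"
    using assms keys_sum[of "\<lambda>m. Poly_Mapping.single (m - Poly_Mapping.single j i) (lookup F m)"
        "{m\<in>keys F. lookup m j = i}"]
    unfolding cpart_def by (auto split: if_splits)
  then show ?thesis
    by (intro bexI[of _ m] conjI poly_mapping_eqI) (auto simp: lookup_add lookup_minus lookup_single when_def)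
qed

lemma poly_eval_cpart:
  assumes "\<And>m. m \<in> keys F \<Longrightarrow> lookup m j \<le> D"
  shows "poly_eval F x = (\<Sum>i\<le>D. poly_eval (cpart j i F) x * x j ^ i)"
proof -
  have *: "monom_eval m x = monom_eval (m - Poly_Mapping.single j (lookup m j)) x * x j ^ lookup m j" for m
  proof -
    have "m = (m - Poly_Mapping.single j (lookup m j)) + Poly_Mapping.single j (lookup m j)"
      by (rule poly_mapping_eqI) (auto simp: lookup_add lookup_minus lookup_single when_def)
    then show ?thesis by (metis monom_eval_add monom_eval_single)
  qed
  have "(\<Sum>i\<le>D. poly_eval (cpart j i F) x * x j ^ i) =
    (\<Sum>i\<le>D. \<Sum>m | m \<in> keys F \<and> lookup m j = i. lookup F m * monom_eval m x)"
    by (intro sum.cong refl)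
      (auto simp: cpart_def poly_eval_sum poly_eval_single sum_distrib_right mult.assoc *[symmetric]
        intro!: sum.cong)
  also have "\<dots> = (\<Sum>m\<in>keys F. lookup F m * monom_eval m x)"
    by (rule sum.group) (use assms in auto)
  finally show ?thesis by (simp add: poly_eval_def)
qed

lemma exists_exponent_bound: "\<exists>D. \<forall>m\<in>keys (F :: 'v cpoly). lookup m j \<le> D"
  by (rule exI[of _ "Max ((\<lambda>m. lookup m j) ` keys F)"]) auto

lemma vars_in_cpart: "vars_in J F \<Longrightarrow> vars_in (J - {j}) (cpart j i F)"
  unfolding vars_in_def
proof
  fix m' assume F: "\<forall>m\<in>keys F. keys m \<subseteq> J" and m': "m' \<in> keys (cpart j i F)"
  then obtain m where "m \<in> keys F" "m = m' + Poly_Mapping.single j i" "lookup m' j = 0"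
    using keys_cpart[OF m'] by blast
  moreover from this have "keys m' \<subseteq> keys m" using keys_subset_add by metis
  moreover have "j \<notin> keys m'" using \<open>lookup m' j = 0\<close> by (simp add: in_keys_iff)
  ultimately show "keys m' \<subseteq> J - {j}" using F by blast
qed

lemma form_cpart:
  assumes "form (Suc k) s F" shows "form k (s - i) (cpart (Suc k) i F)"
  unfolding form_def
proof
  fix m' assume m': "m' \<in> keys (cpart (Suc k) i F)"
  then obtain m where m: "m \<in> keys F" "lookup m (Suc k) = i"
    "m = m' + Poly_Mapping.single (Suc k) i" "lookup m' (Suc k) = 0"
    using keys_cpart[OF m'] by blast
  have k: "keys m \<subseteq> {..Suc k}" "(\<Sum>j\<le>Suc k. lookup m j) = s" using assms m(1) by (auto simp: form_def)
  have "keys m' \<subseteq> keys m" using m(3) keys_subset_add by metis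
  moreover have "Suc k \<notin> keys m'" using m(4) by (simp add: in_keys_iff)
  ultimately have "keys m' \<subseteq> {..k}" using k(1) by (fastforce simp: le_Suc_eq)
  moreover have "(\<Sum>j\<le>k. lookup m j) = (\<Sum>j\<le>k. lookup m' j)"
    unfolding m(3) by (intro sum.cong) (auto simp: lookup_add lookup_single when_def)
  ultimately show "keys m' \<subseteq> {..k} \<and> (\<Sum>j\<le>k. lookup m' j) = s - i" using k m(2) by simp
qed

text \<open>A monomial is determined by its exponent in \<open>j\<close> together with the remaining
  exponents, so nothing cancels in the sum defining \<open>cpart\<close>.\<close>

lemma cpart_eq_0_imp_eq_0:
  assumes "\<And>i. cpart j i F = 0" shows "F = 0"
proof (rule ccontr)
  assume "F \<noteq> 0"
  then obtain m where m: "m \<in> keys F"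
    by (metis poly_mapping_eqI in_keys_iff lookup_zero)
  let ?i = "lookup m j"
  have inj: "m' = m" if "lookup m' j = ?i"
    "m' - Poly_Mapping.single j ?i = m - Poly_Mapping.single j ?i" for m'
  proof (rule poly_mapping_eqI)
    fix k
    have "lookup (m' - Poly_Mapping.single j ?i) k = lookup (m - Poly_Mapping.single j ?i) k"
      using that by simp
    then show "lookup m' k = lookup m k" using that(1)
      by (cases "k = j") (auto simp: lookup_minus lookup_single)
  qed
  have "lookup (cpart j ?i F) (m - Poly_Mapping.single j ?i)
    = (\<Sum>m'\<in>{m'\<in>keys F. lookup m' j = ?i}. if m' = m then lookup F m else 0)"
    unfolding cpart_def lookup_sum
    by (rule sum.cong) (use inj in \<open>auto simp: lookup_single when_def\<close>)
  also have "\<dots> = lookup F m" using m by (simp add: sum.delta')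
  finally show False using assms[of ?i] m by (simp add: in_keys_iff)
qed

text \<open>Induction over the finitely many variables that occur: with the others fixed,
  \<open>F\<close> is a polynomial in one variable that vanishes everywhere, so all its coefficients
  do. Identities in \<open>cpoly\<close> are later proved by comparing values.\<close>

lemma poly_eval_eq_0_imp_eq_0:
  assumes "\<And>x. poly_eval F x = 0" shows "F = 0"
proof -
  obtain J where J: "finite J" "vars_in J F" using vars_in_finite by blast
  show ?thesis using J assms
  proof (induction J arbitrary: F rule: finite_induct)
    case empty
    have "keys F \<subseteq> {0}" using empty(1) by (auto simp: vars_in_def)
    then have "poly_eval F (\<lambda>_. 0) = lookup F 0"
      by (subst poly_eval_superset[of "{0}"]) auto
    then show ?case using empty(2) \<open>keys F \<subseteq> {0}\<close>
      by (intro poly_mapping_eqI) (metis in_keys_iff insertE empty_iff lookup_zero subset_iff)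
  next
    case (insert j J)
    obtain D where D: "\<And>m. m \<in> keys F \<Longrightarrow> lookup m j \<le> D" using exists_exponent_bound[of F j] by blast
    have vp: "vars_in J (cpart j i F)" for i
      using vars_in_mono[OF vars_in_cpart[OF insert(4), of j i]] insert(2) by blast
    have "poly_eval (cpart j i F) x = 0" for i x
    proof (cases "i \<le> D")
      case True
      define p where "p = (\<Sum>i\<le>D. monom (poly_eval (cpart j i F) x) i)"
      have "poly p y = 0" for y
      proof -
        have "poly p y = (\<Sum>i\<le>D. poly_eval (cpart j i F) (x(j := y)) * (x(j := y)) j ^ i)"
          unfolding p_def poly_sum poly_monom
          by (intro sum.cong refl arg_cong2[where f = "(*)"] poly_eval_cong[OF vp])
            (use insert(2) in auto)
        also have "\<dots> = 0" using poly_eval_cpart[of F j D "x(j := y)", OF D] insert(5)[of "x(j := y)"] by simp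
        finally show ?thesis .
      qed
      then have "p = 0" by (simp add: poly_all_0_iff_0[symmetric])
      moreover have "coeff p i = poly_eval (cpart j i F) x"
        using True by (simp add: p_def coeff_sum sum.delta if_distrib cong: if_cong)
      ultimately show ?thesis by simp
    next
      case False
      have "m' \<notin> keys (cpart j i F)" for m' using keys_cpart[of m' j i F] D False by blast
      then have "keys (cpart j i F) = {}" by blast
      then show ?thesis by (simp add: poly_eval_def)
    qed
    then have "cpart j i F = 0" for i using insert(3)[OF vp, of i] by blast
    then show ?case by (rule cpart_eq_0_imp_eq_0)
  qed
qed

lemma nonzero_cpoly_nonvanishing: "F \<noteq> 0 \<Longrightarrow> \<exists>x. poly_eval F x \<noteq> 0"
  using poly_eval_eq_0_imp_eq_0 by blast

section \<open>Linear dependence by counting, and the relations it yields\<close>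

section \<open>Algebraic relations by counting\<close>

text \<open>Gaussian elimination: a coordinate \<open>b\<close> either imposes no condition or is
  eliminated with a pivot \<open>p\<close>, so each condition uses up at most one element of
  \<open>A\<close>.\<close>

lemma nontrivial_relation:
  fixes M :: "'a \<Rightarrow> 'b \<Rightarrow> complex"
  assumes "finite A" "finite B" "card B < card A"
  shows "\<exists>l. (\<exists>a\<in>A. l a \<noteq> 0) \<and> (\<forall>b\<in>B. (\<Sum>a\<in>A. l a * M a b) = 0)"
  using assms(2,1,3)
proof (induction B arbitrary: A M rule: finite_induct)
  case empty
  then have "A \<noteq> {}" by auto
  then show ?case by (intro exI[of _ "\<lambda>_. 1"]) auto
next
  case (insert b B)
  show ?case
  proof (cases "\<forall>a\<in>A. M a b = 0")
    case True
    have "card B < card A" using insert by simp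
    then obtain l where "\<exists>a\<in>A. l a \<noteq> 0" "\<forall>b\<in>B. (\<Sum>a\<in>A. l a * M a b) = 0"
      using insert(3)[OF insert(4)] by blast
    then show ?thesis using True by (intro exI[of _ l]) auto
  next
    case False
    then obtain p where p: "p \<in> A" "M p b \<noteq> 0" by blast
    let ?A = "A - {p}"
    define M' where "M' a b' = M a b' - M a b / M p b * M p b'" for a b'
    have "finite ?A" "card B < card ?A" using insert p by auto
    from insert(3)[OF this, of M'] obtain l where
      l: "\<exists>a\<in>?A. l a \<noteq> 0" "\<forall>b\<in>B. (\<Sum>a\<in>?A. l a * M' a b) = 0" by blast
    define l' where "l' = l(p := - (\<Sum>a\<in>?A. l a * M a b) / M p b)"
    have *: "(\<Sum>a\<in>A. l' a * M a b') = (\<Sum>a\<in>?A. l a * M' a b')" for b'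
    proof -
      have "(\<Sum>a\<in>A. l' a * M a b') = l' p * M p b' + (\<Sum>a\<in>?A. l' a * M a b')"
        using p insert(4) by (simp add: sum.remove)
      also have "(\<Sum>a\<in>?A. l' a * M a b') = (\<Sum>a\<in>?A. l a * M a b')"
        by (rule sum.cong) (auto simp: l'_def)
      also have "l' p * M p b' = - (\<Sum>a\<in>?A. l a * (M a b / M p b * M p b'))"
        by (simp add: l'_def sum_distrib_right sum_divide_distrib mult.assoc)
      finally show ?thesis by (simp add: M'_def algebra_simps sum_subtractf)
    qed
    have "(\<Sum>a\<in>A. l' a * M a b) = 0" unfolding * M'_def using p by simp
    moreover have "\<exists>a\<in>A. l' a \<noteq> 0" using l(1) by (auto simp: l'_def)
    ultimately show ?thesis using l(2) * by (intro exI[of _ l']) auto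
  qed
qed

text \<open>Bounding each exponent separately, rather than the total degree, makes the admissible
  monomials a box with at most \<open>(E + 1) ^ card J\<close> elements.\<close>

definition max_exp :: "nat \<Rightarrow> 'v cpoly \<Rightarrow> bool" where
  "max_exp E F \<longleftrightarrow> (\<forall>m\<in>keys F. \<forall>v. lookup m v \<le> E)"

lemma max_exp_mult:
  assumes "max_exp D F" "max_exp E G" shows "max_exp (D + E) (F * G)"
  unfolding max_exp_def
proof
  fix m assume "m \<in> keys (F * G)"
  then obtain a b where "m = a + b" "a \<in> keys F" "b \<in> keys G" using keys_mult[of F G] by blast
  then show "\<forall>v. lookup m v \<le> D + E" using assms by (auto simp: max_exp_def lookup_add intro: add_mono)
qed

lemma max_exp_1: "max_exp 0 1"
  by (simp add: max_exp_def)

lemma max_exp_power: "max_exp E F \<Longrightarrow> max_exp (k * E) (F ^ k)"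
  by (induction k) (auto intro: max_exp_1 max_exp_mult)

lemma max_exp_prod:
  "(\<And>i. i \<in> I \<Longrightarrow> max_exp (d i) (f i)) \<Longrightarrow> max_exp (\<Sum>i\<in>I. d i) (\<Prod>i\<in>I. f i)"
  by (induction I rule: infinite_finite_induct) (auto intro: max_exp_1 max_exp_mult)

lemma max_exp_mono: "max_exp D F \<Longrightarrow> D \<le> E \<Longrightarrow> max_exp E F"
  unfolding max_exp_def using order_trans by blast

lemma exists_max_exp: "\<exists>E. max_exp E F"
proof -
  obtain J where J: "finite J" "vars_in J F" using vars_in_finite by blast
  have "lookup m v \<le> Max ((\<lambda>(m, v). lookup m v) ` (keys F \<times> J))" if "m \<in> keys F" for m v
  proof (cases "v \<in> J")
    case True
    then show ?thesis using that J by (intro Max_ge) auto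
  next
    case False
    then have "v \<notin> keys m" using J(2) that by (auto simp: vars_in_def)
    then have "lookup m v = 0" by (simp add: in_keys_iff)
    then show ?thesis by simp
  qed
  then show ?thesis unfolding max_exp_def by blast
qed

lemma box_monomials:
  assumes "finite J"
  shows "finite {m :: 'v \<Rightarrow>\<^sub>0 nat. keys m \<subseteq> J \<and> (\<forall>v. lookup m v \<le> E)}" (is "finite ?B")
    and "card {m :: 'v \<Rightarrow>\<^sub>0 nat. keys m \<subseteq> J \<and> (\<forall>v. lookup m v \<le> E)} \<le> (E + 1) ^ card J"
proof -
  let ?C = "J \<rightarrow>\<^sub>E {..E}"
  have inj: "inj_on (\<lambda>m. restrict (lookup m) J) ?B"
  proof (rule inj_onI, rule poly_mapping_eqI)
    fix m m' v
    assume m: "m \<in> ?B" "m' \<in> ?B" "restrict (lookup m) J = restrict (lookup m') J"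
    show "lookup m v = lookup m' v"
    proof (cases "v \<in> J")
      case True
      then show ?thesis using m(3) by (metis restrict_apply')
    next
      case False
      then have "v \<notin> keys m" "v \<notin> keys m'" using m by auto
      then show ?thesis by (simp add: in_keys_iff)
    qed
  qed
  have sub: "(\<lambda>m. restrict (lookup m) J) ` ?B \<subseteq> ?C" by auto
  have fin: "finite ?C" using assms by (intro finite_PiE) auto
  show "finite ?B" by (rule inj_on_finite[OF inj sub fin])
  show "card ?B \<le> (E + 1) ^ card J"
    using card_inj_on_le[OF inj sub fin] assms by (simp add: card_PiE)
qed

lemma lookup_cC_mult: "lookup (cC c * F) m = c * lookup F m"
proof -
  have "lookup (Poly_Mapping.map ((*) c) F) m = c * lookup F m"
    by (simp add: map.rep_eq when_def)
  then show ?thesis by (simp add: cC_def mult_map_scale_conv_mult)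
qed

lemma monom_eval_sum: "monom_eval (\<Sum>i\<in>I. f i) x = (\<Prod>i\<in>I. monom_eval (f i) x)"
  by (induction I rule: infinite_finite_induct) (auto simp: monom_eval_add)

text \<open>There are more monomials of a large degree in \<open>card J + 2\<close> indeterminates than monomials
  occurring in their values.\<close>

lemma homogeneous_relation:
  fixes g :: "nat \<Rightarrow> 'v cpoly"
  assumes J: "finite J" and g: "\<And>i. i \<le> Suc (card J) \<Longrightarrow> vars_in J (g i)"
  shows "\<exists>s P. form (Suc (card J)) s P \<and> P \<noteq> 0 \<and> (\<forall>u. poly_eval P (\<lambda>i. poly_eval (g i) u) = 0)"
proof -
  define D where "D = Suc (card J)"
  obtain e where e: "\<And>i. max_exp (e i) (g i)"
    using choice[of "\<lambda>i E. max_exp E (g i)"] exists_max_exp by blast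
  define E where "E = Max (e ` {..D})"
  have E: "max_exp E (g i)" if "i \<le> D" for i
    by (rule max_exp_mono[OF e]) (use that in \<open>auto simp: E_def\<close>)
  \<comment> \<open>The values \<open>h \<alpha>\<close> involve at most
    \<open>(s * E + 1) ^ card J\<close> monomials, and \<open>s * E + 1\<close> is at most
    \<open>(a + 1) * (D * E + 1)\<close>. With this \<open>a\<close> the count is at most
    \<open>(a + 1) ^ card J * a\<close>, which is less than
    \<open>card A = (a + 1) ^ D\<close>.\<close>
  define a where "a = (D * E + 1) ^ card J"
  define s where "s = D * a"
  define A where "A = ({1..D} \<rightarrow>\<^sub>E {..a} :: (nat \<Rightarrow> nat) set)"
  define B where "B = {m :: 'v \<Rightarrow>\<^sub>0 nat. keys m \<subseteq> J \<and> (\<forall>v. lookup m v \<le> s * E)}"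
  have finA: "finite A" unfolding A_def by (intro finite_PiE) auto
  have finB: "finite B" unfolding B_def by (rule box_monomials[OF J])
  have "card B \<le> (s * E + 1) ^ card J" unfolding B_def by (rule box_monomials[OF J])
  also have "\<dots> \<le> ((a + 1) * (D * E + 1)) ^ card J"
    by (rule power_mono) (auto simp: s_def algebra_simps)
  also have "\<dots> = (a + 1) ^ card J * a" by (simp only: power_mult_distrib a_def[symmetric])
  also have "\<dots> < (a + 1) ^ D" by (simp add: D_def)
  also have "\<dots> = card A" by (simp add: A_def card_PiE)
  finally have card: "card B < card A" .
  \<comment> \<open>The exponent of \<open>g 0\<close> fills the degree up to \<open>s\<close>,
    which makes the relation homogeneous; since \<open>s = D * a\<close>, the subtraction is never
    truncated on \<open>A\<close>.\<close>
  define r where "r \<alpha> = s - (\<Sum>i=1..D. \<alpha> i)" for \<alpha> :: "nat \<Rightarrow> nat"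
  have r: "(\<Sum>i=1..D. \<alpha> i) + r \<alpha> = s" if "\<alpha> \<in> A" for \<alpha>
  proof -
    have "(\<Sum>i=1..D. \<alpha> i) \<le> (\<Sum>i=1..D. a)"
      by (rule sum_mono) (use that in \<open>auto simp: A_def\<close>)
    then show ?thesis by (simp add: r_def s_def)
  qed
  define h where "h \<alpha> = (\<Prod>i=1..D. g i ^ \<alpha> i) * g 0 ^ r \<alpha>" for \<alpha>
  obtain l where l: "\<exists>\<alpha>\<in>A. l \<alpha> \<noteq> 0" "\<forall>m\<in>B. (\<Sum>\<alpha>\<in>A. l \<alpha> * lookup (h \<alpha>) m) = 0"
    using nontrivial_relation[OF finA finB card, of "\<lambda>\<alpha>. lookup (h \<alpha>)"] by blast
  have hB: "keys (h \<alpha>) \<subseteq> B" if \<alpha>: "\<alpha> \<in> A" for \<alpha>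
  proof -
    have "vars_in J (h \<alpha>)" unfolding h_def
      by (intro vars_in_mult vars_in_prod vars_in_power g) (auto simp: D_def)
    moreover have "max_exp ((\<Sum>i=1..D. \<alpha> i * E) + r \<alpha> * E) (h \<alpha>)" unfolding h_def
      by (intro max_exp_mult max_exp_prod max_exp_power E) auto
    then have "max_exp (s * E) (h \<alpha>)" using r[OF \<alpha>] by (simp flip: sum_distrib_right distrib_right)
    ultimately show ?thesis by (auto simp: B_def vars_in_def max_exp_def)
  qed
  have rel: "(\<Sum>\<alpha>\<in>A. cC (l \<alpha>) * h \<alpha>) = 0"
  proof (rule poly_mapping_eqI)
    fix m
    have "(\<Sum>\<alpha>\<in>A. l \<alpha> * lookup (h \<alpha>) m) = 0"
    proof (cases "m \<in> B")
      case False
      then have "lookup (h \<alpha>) m = 0" if "\<alpha> \<in> A" for \<alpha> using hB[OF that] by (auto simp: in_keys_iff)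
      then show ?thesis by simp
    qed (use l in blast)
    then show "lookup (\<Sum>\<alpha>\<in>A. cC (l \<alpha>) * h \<alpha>) m = lookup 0 m"
      by (simp add: lookup_sum lookup_cC_mult)
  qed
  define mon where "mon \<alpha> = (\<Sum>i=1..D. Poly_Mapping.single i (\<alpha> i)) + Poly_Mapping.single 0 (r \<alpha>)"
    for \<alpha> :: "nat \<Rightarrow> nat"
  have lookup_mon: "lookup (mon \<alpha>) j = (if j = 0 then r \<alpha> else if j \<le> D then \<alpha> j else 0)" for \<alpha> j
    by (auto simp: mon_def lookup_add lookup_sum lookup_single when_def sum.delta)
  have inj: "inj_on mon A"
  proof (rule inj_onI)
    fix \<alpha> \<beta> assume *: "\<alpha> \<in> A" "\<beta> \<in> A" "mon \<alpha> = mon \<beta>"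
    have "\<alpha> j = \<beta> j" if "j \<in> {1..D}" for j
      using arg_cong[OF *(3), of "\<lambda>m. lookup m j"] that by (simp add: lookup_mon)
    then show "\<alpha> = \<beta>" using * unfolding A_def by (intro PiE_ext) auto
  qed
  define P where "P = (\<Sum>\<alpha>\<in>A. Poly_Mapping.single (mon \<alpha>) (l \<alpha>))"
  have "form D s P" unfolding P_def
  proof (rule form_sum)
    fix \<alpha> assume \<alpha>: "\<alpha> \<in> A"
    have "{..D} = insert 0 {1..D}" by auto
    then have "(\<Sum>j\<le>D. lookup (mon \<alpha>) j) = s" using r[OF \<alpha>] by (simp add: lookup_mon)
    moreover have "keys (mon \<alpha>) \<subseteq> {..D}" by (auto simp: in_keys_iff lookup_mon split: if_splits)
    ultimately show "form D s (Poly_Mapping.single (mon \<alpha>) (l \<alpha>))" by (simp add: form_def)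
  qed
  moreover have "P \<noteq> 0"
  proof
    assume "P = 0"
    obtain \<beta> where \<beta>: "\<beta> \<in> A" "l \<beta> \<noteq> 0" using l(1) by blast
    have "lookup P (mon \<beta>) = (\<Sum>\<alpha>\<in>A. if \<alpha> = \<beta> then l \<alpha> else 0)"
      unfolding P_def lookup_sum
      by (rule sum.cong) (use inj \<beta> in \<open>auto simp: lookup_single when_def inj_on_def\<close>)
    then show False using \<beta> \<open>P = 0\<close> finA by simp
  qed
  moreover have "poly_eval P (\<lambda>i. poly_eval (g i) u) = 0" for u
  proof -
    have "poly_eval P (\<lambda>i. poly_eval (g i) u) = poly_eval (\<Sum>\<alpha>\<in>A. cC (l \<alpha>) * h \<alpha>) u"
      unfolding P_def poly_eval_simps
      by (simp add: poly_eval_single mon_def monom_eval_add monom_eval_sum h_def poly_eval_simps)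
    then show ?thesis by (simp add: rel)
  qed
  ultimately show ?thesis unfolding D_def by blast
qed

section \<open>Irreducible closed sets described by forms; bounding the length of chains\<close>

section \<open>Projective varieties as closures\<close>

text \<open>The argument is a set of vectors instead of points, so the range of a parametrization of
  the cone can be inserted directly.\<close>

definition pclosure :: "nat \<Rightarrow> (nat \<Rightarrow> complex) set \<Rightarrow> ppoint set" where
  "pclosure N S = {p \<in> proj_space N.
     \<forall>F d. form N d F \<and> (\<forall>v\<in>S. poly_eval F v = 0) \<longrightarrow> (\<forall>v\<in>p. poly_eval F v = 0)}"

lemma cscale_eq_0_iff: "cscale c v = 0 \<longleftrightarrow> c = 0 \<or> v = 0"
  by (auto simp: cscale_def fun_eq_iff)

lemma line_eq:
  assumes "w \<in> line v" "w \<noteq> 0" shows "line w = line v"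
proof -
  obtain c where w: "w = cscale c v" using assms by (auto simp: line_def)
  have c: "c \<noteq> 0" using assms w cscale_eq_0_iff by blast
  have "cscale b w = cscale (b * c) v" "cscale b v = cscale (b / c) w" for b
    using c by (simp_all add: w cscale_def fun_eq_iff)
  then show ?thesis unfolding line_def by blast
qed

lemma proj_space_line: "p \<in> proj_space N \<Longrightarrow> v \<in> p \<Longrightarrow> v \<noteq> 0 \<Longrightarrow> p = line v"
  by (auto simp: proj_space_def line_eq)

lemma proj_space_cvec:
  assumes "p \<in> proj_space N" "v \<in> p" shows "v \<in> cvec N"
  using assms by (auto simp: proj_space_def line_def cvec_def cscale_def)

lemma line_in_proj_space: "v \<in> cvec N \<Longrightarrow> v \<noteq> 0 \<Longrightarrow> line v \<in> proj_space N"
  by (auto simp: proj_space_def)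

lemma closedin_subset_proj_space: "closedin (zariski N) X \<Longrightarrow> X \<subseteq> proj_space N"
  using closedin_subset by fastforce

lemma closedin_pclosure: "closedin (zariski N) (pclosure N S)"
  unfolding closedin_zariski
  by (rule exI[of _ "{F. (\<exists>d. form N d F) \<and> (\<forall>v\<in>S. poly_eval F v = 0)}"])
    (auto simp: pclosure_def zero_locus_def)

lemma line_in_pclosure: "v \<in> S \<Longrightarrow> v \<in> cvec N \<Longrightarrow> v \<noteq> 0 \<Longrightarrow> line v \<in> pclosure N S"
  by (auto simp: pclosure_def line_in_proj_space vanish_line[THEN iffD2, rule_format])

lemma pclosure_vanish:
  "form N d F \<Longrightarrow> (\<And>v. v \<in> S \<Longrightarrow> poly_eval F v = 0) \<Longrightarrow> p \<in> pclosure N S \<Longrightarrow> v \<in> p \<Longrightarrow> poly_eval F v = 0"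
  unfolding pclosure_def by blast

lemma pclosure_mono: "S \<subseteq> T \<Longrightarrow> pclosure N S \<subseteq> pclosure N T"
  unfolding pclosure_def by blast

lemma closed_separate:
  assumes X: "closedin (zariski N) X" and v: "v \<in> cvec N" "v \<noteq> 0" "line v \<notin> X"
  shows "\<exists>F d. form N d F \<and> (\<forall>w\<in>\<Union>X. poly_eval F w = 0) \<and> poly_eval F v \<noteq> 0"
proof -
  obtain S where S: "S \<subseteq> {F. \<exists>d. form N d F}" "X = zero_locus N S" using X closedin_zariski by blast
  have "line v \<in> proj_space N" using v line_in_proj_space by blast
  then obtain F w where F: "F \<in> S" "w \<in> line v" "poly_eval F w \<noteq> 0"
    using v S by (auto simp: zero_locus_def)
  obtain d where d: "form N d F" using F S by blast
  have "poly_eval F v \<noteq> 0" using F vanish_line[OF d] by blast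
  moreover have "\<forall>w\<in>\<Union>X. poly_eval F w = 0" using S F by (auto simp: zero_locus_def)
  ultimately show ?thesis using d by blast
qed

lemma closedin_zero_locus1: "form N d F \<Longrightarrow> closedin (zariski N) (zero_locus N {F})"
  unfolding closedin_zariski by (intro exI[of _ "{F}"]) auto

lemma pclosure_minimal:
  assumes X: "closedin (zariski N) X" and S: "\<And>v. v \<in> S \<Longrightarrow> line v \<in> X"
  shows "pclosure N S \<subseteq> X"
proof
  fix p assume p: "p \<in> pclosure N S"
  then obtain v where v: "p = line v" "v \<in> cvec N" "v \<noteq> 0"
    by (auto simp: pclosure_def proj_space_def)
  show "p \<in> X"
  proof (rule ccontr)
    assume "p \<notin> X"
    then obtain F d where F: "form N d F" "\<forall>w\<in>\<Union>X. poly_eval F w = 0" "poly_eval F v \<noteq> 0"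
      using closed_separate[OF X] v by blast
    then show False using pclosure_vanish[OF F(1) _ p, of v] v S line_self by blast
  qed
qed

text \<open>If the closure were covered by \<open>A\<close> and \<open>B\<close> but contained in
  neither, forms separating points of \<open>S\<close> from \<open>A\<close> and from
  \<open>B\<close> would have a product vanishing on \<open>S\<close> without either factor doing
  so. Irreducibility thus becomes primeness for forms.\<close>

lemma pclosure_variety:
  assumes S: "S \<noteq> {}" "\<And>v. v \<in> S \<Longrightarrow> v \<in> cvec N \<and> v \<noteq> 0"
    and prod: "\<And>F G d e. form N d F \<Longrightarrow> form N e G \<Longrightarrow> (\<And>v. v \<in> S \<Longrightarrow> poly_eval F v * poly_eval G v = 0) \<Longrightarrow>
      (\<forall>v\<in>S. poly_eval F v = 0) \<or> (\<forall>v\<in>S. poly_eval G v = 0)"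
  shows "proj_variety N (pclosure N S)"
  unfolding proj_variety_def irreducible_set_def
proof (intro conjI allI impI closedin_pclosure)
  show "pclosure N S \<subseteq> topspace (zariski N)" by (auto simp: pclosure_def)
  show "pclosure N S \<noteq> {}" using S line_in_pclosure by blast
  fix A B assume AB: "closedin (zariski N) A \<and> closedin (zariski N) B \<and> pclosure N S \<subseteq> A \<union> B"
  show "pclosure N S \<subseteq> A \<or> pclosure N S \<subseteq> B"
  proof (rule ccontr)
    assume "\<not> ?thesis"
    then obtain v w where v: "v \<in> S" "line v \<notin> A" and w: "w \<in> S" "line w \<notin> B"
      using pclosure_minimal AB by metis
    obtain F d where F: "form N d F" "\<forall>w\<in>\<Union>A. poly_eval F w = 0" "poly_eval F v \<noteq> 0"
      using closed_separate[of N A v] v AB S by blast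
    obtain G e where G: "form N e G" "\<forall>w\<in>\<Union>B. poly_eval G w = 0" "poly_eval G w \<noteq> 0"
      using closed_separate[of N B w] w AB S by blast
    have "poly_eval F x * poly_eval G x = 0" if "x \<in> S" for x
    proof -
      have "line x \<in> A \<union> B" using line_in_pclosure that S AB by blast
      then show ?thesis using F(2) G(2) line_self by (metis UnE UnionI mult_eq_0_iff)
    qed
    then show False using prod[OF F(1) G(1)] F(3) G(3) v w by blast
  qed
qed

text \<open>Irreducibility of \<open>X\<close> applied to the two hypersurfaces given by
  \<open>F\<close> and \<open>G\<close>.\<close>

lemma variety_prod:
  assumes X: "proj_variety N X" and F: "form N d F" and G: "form N e G"
    and 0: "\<And>v. v \<in> \<Union>X \<Longrightarrow> poly_eval F v * poly_eval G v = 0"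
  shows "(\<forall>v\<in>\<Union>X. poly_eval F v = 0) \<or> (\<forall>v\<in>\<Union>X. poly_eval G v = 0)"
proof -
  have XP: "X \<subseteq> proj_space N" using X closedin_subset_proj_space by (auto simp: proj_variety_def)
  have "X \<subseteq> zero_locus N {F} \<union> zero_locus N {G}"
  proof
    fix p assume p: "p \<in> X"
    then obtain v where v: "p = line v" using XP by (auto simp: proj_space_def)
    have "poly_eval F v = 0 \<or> poly_eval G v = 0" using 0[of v] p v line_self[of v] by (metis UnionI mult_eq_0_iff)
    then show "p \<in> zero_locus N {F} \<union> zero_locus N {G}"
      using p XP vanish_line[OF F] vanish_line[OF G] by (auto simp: zero_locus_def v)
  qed
  then have "X \<subseteq> zero_locus N {F} \<or> X \<subseteq> zero_locus N {G}"
    using X closedin_zero_locus1[OF F] closedin_zero_locus1[OF G]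
    by (simp add: proj_variety_def irreducible_set_def)
  then show ?thesis by (auto simp: zero_locus_def)
qed

text \<open>Pulled back along \<open>\<Psi>\<close>, primeness turns into the absence of zero
  divisors among polynomial functions on affine space.\<close>

lemma parametrized_variety:
  assumes \<Psi>: "\<And>u. \<Psi> u \<in> cvec N \<and> \<Psi> u \<noteq> 0" and g: "\<And>u j. \<Psi> u j = poly_eval (g j) u"
  shows "proj_variety N (pclosure N (range \<Psi>))"
proof (rule pclosure_variety)
  fix F G d e assume 0: "\<And>v. v \<in> range \<Psi> \<Longrightarrow> poly_eval F v * poly_eval G v = 0"
  have ev: "poly_eval H (\<Psi> u) = poly_eval (psubst H g) u" for H u
    by (simp add: poly_eval_psubst flip: g)
  have "poly_eval (psubst F g) u * poly_eval (psubst G g) u = 0" for u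
    using 0[of "\<Psi> u"] by (simp add: ev)
  then show "(\<forall>v\<in>range \<Psi>. poly_eval F v = 0) \<or> (\<forall>v\<in>range \<Psi>. poly_eval G v = 0)"
    using poly_eval_mult_eq_0[of "psubst F g" "psubst G g"] by (simp add: ev)
qed (use \<Psi> in auto)

section \<open>Dimension of parametrized varieties\<close>

lemma complex_root_exists:
  fixes x :: complex
  assumes "b \<ge> 1" shows "\<exists>z. z ^ b = x"
proof (cases "x = 0")
  case True
  then show ?thesis using assms by (intro exI[of _ 0]) auto
next
  case False
  have "exp (Ln x / of_nat b) ^ b = exp (of_nat b * (Ln x / of_nat b))"
    by (simp only: exp_of_nat_mult)
  also have "\<dots> = x" using False assms by simp
  finally show ?thesis by blast
qed

text \<open>A form in a single variable is a constant times a power of that variable, so a zero away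
  from the origin forces the constant to vanish. This starts the induction along a chain.\<close>

lemma form_one_variable:
  assumes P: "form 0 s P" and c: "c \<noteq> 0" "poly_eval P (\<lambda>_. c) = 0"
  shows "P = 0"
proof (rule poly_eval_eq_0_imp_eq_0)
  fix x
  have *: "poly_eval P (\<lambda>_. a) = a ^ s * poly_eval P (\<lambda>_. 1)" for a
    using poly_eval_form_scale[OF P, of a "\<lambda>_. 1"] by (simp add: cscale_def)
  have "poly_eval P x = poly_eval P (\<lambda>_. x 0)"
    by (rule poly_eval_cong[OF form_vars_in[OF P]]) auto
  then show "poly_eval P x = 0" using *[of c] *[of "x 0"] c by simp
qed

lemma form_0_const:
  assumes "form N 0 F" shows "poly_eval F v = poly_eval F w"
  using poly_eval_form_scale[OF assms, of 0 v] poly_eval_form_scale[OF assms, of 0 w]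
  by (simp add: cscale_def)

text \<open>If \<open>f\<^sub>0, \<dots>, f\<^sub>k\<close> are algebraically independent on a subvariety and \<open>g\<close> vanishes on it but
  not on the whole variety, then \<open>f\<^sub>0, \<dots>, f\<^sub>k, g\<close> are algebraically independent on the variety.\<close>

lemma chain_independent_forms:
  assumes c: "\<And>i. i \<le> D \<Longrightarrow> proj_variety N (c i)" and strict: "\<And>i. i < D \<Longrightarrow> c i \<subset> c (Suc i)"
  shows "k \<le> D \<Longrightarrow> \<exists>e f. e \<ge> 1 \<and> (\<forall>i\<le>k. form N e (f i)) \<and>
    (\<forall>s P. form k s P \<longrightarrow> (\<forall>v\<in>\<Union>(c k). poly_eval P (\<lambda>i. poly_eval (f i) v) = 0) \<longrightarrow> P = 0)"
proof (induction k)
  case 0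
  have "c 0 \<noteq> {}" "c 0 \<subseteq> proj_space N"
    using c[of 0] closedin_subset_proj_space by (auto simp: proj_variety_def irreducible_set_def)
  then obtain v where v: "line v \<in> c 0" "v \<in> cvec N" "v \<noteq> 0" by (fastforce simp: proj_space_def)
  then obtain j where j: "j \<le> N" "v j \<noteq> 0" by (auto simp: cvec_def fun_eq_iff) (metis not_le)
  have "P = 0" if P: "form 0 s P" "\<forall>w\<in>\<Union>(c 0). poly_eval P (\<lambda>i. poly_eval (cX j) w) = 0" for s P
  proof (rule form_one_variable[OF P(1) j(2)])
    have "v \<in> \<Union>(c 0)" using v(1) line_self by blast
    then show "poly_eval P (\<lambda>_. v j) = 0" using P(2) by auto
  qed
  then show ?case using form_cX[OF j(1)] by (intro exI[of _ 1] exI[of _ "\<lambda>_. cX j"]) auto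
next
  case (Suc k)
  then obtain e f where e: "e \<ge> 1" and f: "\<And>i. i \<le> k \<Longrightarrow> form N e (f i)"
    and ind: "\<And>s P. form k s P \<Longrightarrow> (\<And>v. v \<in> \<Union>(c k) \<Longrightarrow> poly_eval P (\<lambda>i. poly_eval (f i) v) = 0) \<Longrightarrow> P = 0"
    by (metis Suc_leD)
  have ck: "closedin (zariski N) (c k)" and ck1: "c (Suc k) \<subseteq> proj_space N" and sub: "c k \<subset> c (Suc k)"
    using c[of k] c[of "Suc k"] Suc.prems strict[of k] closedin_subset_proj_space
    by (auto simp: proj_variety_def)
  obtain w where w: "line w \<in> c (Suc k)" "line w \<notin> c k" "w \<in> cvec N" "w \<noteq> 0"
    using sub ck1 by (fastforce simp: proj_space_def)
  obtain g b where g: "form N b g" "\<And>v. v \<in> \<Union>(c k) \<Longrightarrow> poly_eval g v = 0" "poly_eval g w \<noteq> 0"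
    using closed_separate[OF ck w(3,4,2)] by blast
  have wU: "w \<in> \<Union>(c (Suc k))" using w(1) line_self by blast
  have b: "b \<ge> 1"
  proof (rule ccontr)
    assume "\<not> b \<ge> 1"
    then have "b = 0" by simp
    then have b0: "form N 0 g" using g(1) by simp
    have "c k \<noteq> {}" "c k \<subseteq> proj_space N"
      using c[of k] Suc.prems closedin_subset_proj_space[OF ck]
      by (auto simp: proj_variety_def irreducible_set_def)
    then obtain v where "line v \<in> c k" by (fastforce simp: proj_space_def)
    then have "poly_eval g v = 0" using g(2) line_self by blast
    then show False using g(3) form_0_const[OF b0, of w v] by simp
  qed
  \<comment> \<open>Powers equalize the degrees: \<open>f i ^ b\<close> and \<open>g ^ e\<close> are
    both of degree \<open>b * e\<close>.\<close>
  define f' where "f' i = (if i \<le> k then f i ^ b else g ^ e)" for i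
  have f': "form N (b * e) (f' i)" for i
    using form_power[OF f, of i b] form_power[OF g(1), of e] by (auto simp: f'_def mult.commute)
  have "P = 0" if P: "form (Suc k) s P"
    and van: "\<And>v. v \<in> \<Union>(c (Suc k)) \<Longrightarrow> poly_eval P (\<lambda>i. poly_eval (f' i) v) = 0" for s P
  proof (rule ccontr)
    assume "P \<noteq> 0"
    define Q where "Q i = cpart (Suc k) i P" for i
    have Q: "form k (s - i) (Q i)" for i unfolding Q_def by (rule form_cpart[OF P])
    have exps: "lookup m (Suc k) \<le> s" if "m \<in> keys P" for m
    proof -
      have "(\<Sum>j\<le>Suc k. lookup m j) = s" using P that by (auto simp: form_def)
      then show ?thesis by simp
    qed
    \<comment> \<open>The relation is sorted by powers of its last variable. Cancelling
      \<open>(g ^ e) ^ a\<close>, which is not identically zero on \<open>c (Suc k)\<close>, leaves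
      the form \<open>R\<close>; on the zeros of \<open>g\<close> only its lowest term, coming from
      \<open>Q a\<close>, survives.\<close>
    define a where "a = (LEAST i. Q i \<noteq> 0)"
    have "\<exists>i. Q i \<noteq> 0" using cpart_eq_0_imp_eq_0[of "Suc k" P] \<open>P \<noteq> 0\<close> by (auto simp: Q_def)
    then have a: "Q a \<noteq> 0" unfolding a_def by (rule LeastI_ex)
    have less_a: "Q i = 0" if "i < a" for i using not_less_Least[of i "\<lambda>i. Q i \<noteq> 0"] that by (auto simp: a_def)
    obtain m where "m \<in> keys (Q a)" using a by (metis poly_mapping_eqI in_keys_iff lookup_zero)
    then obtain m' where "m' \<in> keys P" "lookup m' (Suc k) = a"
      using keys_cpart[of m "Suc k" a P] unfolding Q_def by blast
    then have as: "a \<le> s" using exps by blast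
    define R where "R = (\<Sum>i\<in>{a..s}. psubst (Q i) f' * (g ^ e) ^ (i - a))"
    have R: "form N ((s - a) * (b * e)) R" unfolding R_def
    proof (rule form_sum)
      fix i assume i: "i \<in> {a..s}"
      have "form N ((s - i) * (b * e) + (i - a) * (e * b)) (psubst (Q i) f' * (g ^ e) ^ (i - a))"
        by (intro form_mult form_psubst_form[OF Q] f' form_power g(1))
      moreover have "(s - i) * (b * e) + (i - a) * (e * b) = (s - a) * (b * e)"
      proof -
        have "(s - i) + (i - a) = s - a" using i by auto
        then show ?thesis by (metis add_mult_distrib mult.commute)
      qed
      ultimately show "form N ((s - a) * (b * e)) (psubst (Q i) f' * (g ^ e) ^ (i - a))" by simp
    qed
    have f'_g: "poly_eval (f' (Suc k)) v = poly_eval g v ^ e" for v by (simp add: f'_def poly_eval_power)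
    have split: "poly_eval ((g ^ e) ^ a) v * poly_eval R v = poly_eval P (\<lambda>i. poly_eval (f' i) v)" for v
    proof -
      have "poly_eval P (\<lambda>i. poly_eval (f' i) v)
          = (\<Sum>i\<le>s. poly_eval (psubst (Q i) f') v * (poly_eval g v ^ e) ^ i)"
        using poly_eval_cpart[OF exps] by (simp add: poly_eval_psubst f'_g Q_def)
      also have "\<dots> = (\<Sum>i\<in>{a..s}. poly_eval (psubst (Q i) f') v * (poly_eval g v ^ e) ^ i)"
        by (rule sum.mono_neutral_right) (auto simp: less_a poly_eval_psubst)
      also have "\<dots> = (\<Sum>i\<in>{a..s}. poly_eval ((g ^ e) ^ a) v *
          (poly_eval (psubst (Q i) f') v * (poly_eval g v ^ e) ^ (i - a)))"
        by (rule sum.cong) (auto simp: poly_eval_power mult_ac simp flip: power_add)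
      finally show ?thesis by (simp add: R_def poly_eval_simps sum_distrib_left)
    qed
    have Rv: "poly_eval R v = 0" if "v \<in> \<Union>(c (Suc k))" for v
    proof -
      have "form N (a * (e * b)) ((g ^ e) ^ a)" by (intro form_power g(1))
      moreover have "poly_eval ((g ^ e) ^ a) v * poly_eval R v = 0" if "v \<in> \<Union>(c (Suc k))" for v
        using van[OF that] split[of v] by simp
      ultimately have "(\<forall>v\<in>\<Union>(c (Suc k)). poly_eval ((g ^ e) ^ a) v = 0) \<or> (\<forall>v\<in>\<Union>(c (Suc k)). poly_eval R v = 0)"
        using variety_prod[OF c[OF Suc.prems] _ R] by blast
      moreover have "poly_eval ((g ^ e) ^ a) w \<noteq> 0" using g(3) by (simp add: poly_eval_power)
      ultimately show ?thesis using wU that by blast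
    qed
    \<comment> \<open>On \<open>c k\<close> the surviving term says that \<open>Q a\<close> is a
      relation between the powers \<open>f i ^ b\<close>, which the induction hypothesis reads as a
      relation between the \<open>f i\<close>. Since every complex number is a \<open>b\<close>-th
      power, \<open>Q a\<close> itself must then vanish.\<close>
    have "psubst (Q a) (\<lambda>i. cX i ^ b) = 0"
    proof (rule ind)
      show "form k ((s - a) * (b * 1)) (psubst (Q a) (\<lambda>i. cX i ^ b))"
        by (intro form_psubst_form[OF Q] form_power form_cX)
      fix v assume v: "v \<in> \<Union>(c k)"
      have gv: "poly_eval g v = 0" using g(2) v by blast
      have "v \<in> \<Union>(c (Suc k))"
        using Union_mono[OF psubset_imp_subset[OF sub]] v by (rule subsetD)
      then have "0 = poly_eval R v" using Rv by simp
      also have "\<dots> = (\<Sum>i\<in>{a..s}. if i = a then poly_eval (psubst (Q a) f') v else 0)"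
        unfolding R_def poly_eval_simps
        by (rule sum.cong) (use e in \<open>auto simp: gv power_0_left\<close>)
      also have "\<dots> = poly_eval (psubst (Q a) f') v" using as by simp
      also have "\<dots> = poly_eval (Q a) (\<lambda>i. poly_eval (f i) v ^ b)"
        unfolding poly_eval_psubst
        by (rule poly_eval_cong[OF form_vars_in[OF Q]]) (auto simp: f'_def poly_eval_power)
      finally show "poly_eval (psubst (Q a) (\<lambda>i. cX i ^ b)) (\<lambda>i. poly_eval (f i) v) = 0"
        by (simp add: poly_eval_psubst poly_eval_power)
    qed
    moreover have "poly_eval (Q a) x = 0" if 0: "psubst (Q a) (\<lambda>i. cX i ^ b) = 0" for x
    proof -
      obtain z where z: "\<And>i. z i ^ b = x i"
        using choice[of "\<lambda>i z. z ^ b = x i"] complex_root_exists[OF b] by blast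
      have "poly_eval (psubst (Q a) (\<lambda>i. cX i ^ b)) z = 0" by (simp add: 0)
      then show ?thesis by (simp add: poly_eval_psubst poly_eval_power z)
    qed
    ultimately show False using a poly_eval_eq_0_imp_eq_0 by blast
  qed
  note ind' = this
  show ?case
  proof (intro exI[of _ "b * e"] exI[of _ f'] conjI allI impI)
    show "1 \<le> b * e" using b e mult_le_mono[of 1 b 1 e] by simp
    show "form N (b * e) (f' i)" for i by (rule f')
    fix s P assume P: "form (Suc k) s P" "\<forall>v\<in>\<Union>(c (Suc k)). poly_eval P (\<lambda>i. poly_eval (f' i) v) = 0"
    show "P = 0" by (rule ind'[OF P(1) P(2)[rule_format]])
  qed
qed

text \<open>A chain of that length would carry \<open>card J + 2\<close> algebraically independent
  forms. Composed with the parametrization they are polynomials in \<open>card J\<close> variables,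
  which satisfy a homogeneous relation.\<close>

lemma parametrized_no_long_chain:
  assumes J: "finite J" and g: "\<And>j. j \<le> N \<Longrightarrow> vars_in J (g j)"
    and \<Psi>: "\<And>u j. j \<le> N \<Longrightarrow> \<Psi> u j = poly_eval (g j) u"
    and Z: "Z \<subseteq> pclosure N (range \<Psi>)"
  shows "\<not> irreducible_chain (zariski N) Z (Suc (card J))"
proof
  let ?D = "Suc (card J)"
  assume "irreducible_chain (zariski N) Z ?D"
  then obtain c where c: "\<And>i. i \<le> ?D \<Longrightarrow> proj_variety N (c i)" "\<And>i. i \<le> ?D \<Longrightarrow> c i \<subseteq> Z"
    "\<And>i. i < ?D \<Longrightarrow> c i \<subset> c (Suc i)"
    unfolding irreducible_chain_def proj_variety_def by blast
  obtain e f where f: "\<And>i. i \<le> ?D \<Longrightarrow> form N e (f i)"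
    and ind: "\<And>s P. form ?D s P \<Longrightarrow> (\<And>v. v \<in> \<Union>(c ?D) \<Longrightarrow> poly_eval P (\<lambda>i. poly_eval (f i) v) = 0) \<Longrightarrow> P = 0"
    using chain_independent_forms[where D = ?D and N = N and c = c and k = ?D, OF c(1,3)] by (metis le_refl)
  have "vars_in J (psubst (f i) g)" if "i \<le> ?D" for i
    by (rule vars_in_psubst[OF form_vars_in[OF f[OF that]]]) (use g in auto)
  from homogeneous_relation[where g = "\<lambda>i. psubst (f i) g", OF J this] obtain s P where P: "form ?D s P" "P \<noteq> 0"
    "\<And>u. poly_eval P (\<lambda>i. poly_eval (psubst (f i) g) u) = 0" by blast
  have form: "form N (s * e) (psubst P f)" by (rule form_psubst_form[OF P(1) f])
  have "poly_eval (psubst P f) v = 0" if "v \<in> range \<Psi>" for v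
  proof -
    obtain u where u: "v = \<Psi> u" using \<open>v \<in> range \<Psi>\<close> by blast
    have "poly_eval (f i) v = poly_eval (psubst (f i) g) u" if "i \<le> ?D" for i
      unfolding poly_eval_psubst
      by (rule poly_eval_cong[OF form_vars_in[OF f[OF that]]]) (auto simp: u \<Psi>)
    then have "poly_eval P (\<lambda>i. poly_eval (f i) v) = poly_eval P (\<lambda>i. poly_eval (psubst (f i) g) u)"
      by (intro poly_eval_cong[OF form_vars_in[OF P(1)]]) auto
    then show ?thesis using P(3) by (simp add: poly_eval_psubst)
  qed
  note van = this
  have "poly_eval P (\<lambda>i. poly_eval (f i) v) = 0" if v: "v \<in> \<Union>(c ?D)" for v
  proof -
    obtain p where p: "p \<in> c ?D" "v \<in> p" using v by blast
    have "p \<in> pclosure N (range \<Psi>)" using c(2)[of ?D] Z p(1) by blast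
    from pclosure_vanish[OF form van this p(2)] show ?thesis by (simp add: poly_eval_psubst)
  qed
  then show False using ind[OF P(1)] P(2) by blast
qed

section \<open>From algebraically independent coordinates to chains of subvarieties\<close>

section \<open>Prime ideals of polynomials in countably many variables\<close>

definition pideal :: "nat cpoly set \<Rightarrow> bool" where
  "pideal I \<longleftrightarrow> 0 \<in> I \<and> (\<forall>a\<in>I. \<forall>b\<in>I. a + b \<in> I) \<and> (\<forall>a\<in>I. \<forall>r. r * a \<in> I)"

definition prime_pideal :: "nat cpoly set \<Rightarrow> bool" where
  "prime_pideal I \<longleftrightarrow> pideal I \<and> 1 \<notin> I \<and> (\<forall>a b. a * b \<in> I \<longrightarrow> a \<in> I \<or> b \<in> I)"

definition independent_mod :: "nat cpoly set \<Rightarrow> nat set \<Rightarrow> bool" where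
  "independent_mod I J \<longleftrightarrow> (\<forall>F\<in>I. vars_in J F \<longrightarrow> F = 0)"

text \<open>Ideals live in countably many variables, so a zero is a whole sequence. The ideals of
  affine pieces contain every variable beyond \<open>N\<close>, which forces the zeros that occur
  later into \<open>cvec N\<close>.\<close>

definition variety_of :: "nat cpoly set \<Rightarrow> (nat \<Rightarrow> complex) set" where
  "variety_of I = {v. \<forall>F\<in>I. poly_eval F v = 0}"

lemma pidealD:
  assumes "pideal I"
  shows pideal_0: "0 \<in> I" and pideal_add: "a \<in> I \<Longrightarrow> b \<in> I \<Longrightarrow> a + b \<in> I"
    and pideal_mult: "a \<in> I \<Longrightarrow> r * a \<in> I"
    and pideal_diff: "a \<in> I \<Longrightarrow> b \<in> I \<Longrightarrow> a - b \<in> I"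
proof -
  show "0 \<in> I" "a \<in> I \<Longrightarrow> b \<in> I \<Longrightarrow> a + b \<in> I" "a \<in> I \<Longrightarrow> r * a \<in> I"
    for a b r using assms by (auto simp: pideal_def)
  then show "a - b \<in> I" if "a \<in> I" "b \<in> I" for a b
    using that by (metis add_uminus_conv_diff mult_minus1)
qed

lemma pideal_sum: "pideal I \<Longrightarrow> (\<And>i. i \<in> A \<Longrightarrow> f i \<in> I) \<Longrightarrow> (\<Sum>i\<in>A. f i) \<in> I"
  by (induction A rule: infinite_finite_induct) (auto intro: pideal_0 pideal_add)

lemma pideal_adjoin:
  assumes I: "pideal I" shows "pideal {p + r * x |p r. p \<in> I}" (is "pideal ?I")
    and "I \<subseteq> {p + r * x |p r. p \<in> I}" and "x \<in> {p + r * x |p r. p \<in> I}"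
proof -
  show "I \<subseteq> ?I"
  proof
    fix p assume "p \<in> I"
    moreover have "p = p + 0 * x" by simp
    ultimately show "p \<in> ?I" by blast
  qed
  have "x = 0 + 1 * x" by simp
  then show "x \<in> ?I" using pideal_0[OF I] by blast
  show "pideal ?I" unfolding pideal_def
  proof (intro conjI ballI allI)
    show "0 \<in> ?I" using \<open>I \<subseteq> ?I\<close> pideal_0[OF I] by blast
    fix a assume "a \<in> ?I"
    then obtain p r where a: "a = p + r * x" "p \<in> I" by blast
    {
      fix b assume "b \<in> ?I"
      then obtain p' r' where b: "b = p' + r' * x" "p' \<in> I" by blast
      have "a + b = (p + p') + (r + r') * x" by (simp add: a b algebra_simps)
      then show "a + b \<in> ?I" using a b pideal_add[OF I] by blast
    next
      fix s
      have "s * a = s * p + (s * r) * x" by (simp add: a algebra_simps)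
      then show "s * a \<in> ?I" using a pideal_mult[OF I] by blast
    }
  qed
qed

text \<open>An ideal maximal among those avoiding a multiplicative set is prime. The last clause
  records the maximality: modulo \<open>P\<close>, every element outside \<open>P\<close> divides an
  element of \<open>M\<close>.\<close>

lemma exists_prime_disjoint:
  assumes I: "pideal I" "I \<inter> M = {}" and M: "1 \<in> M" "\<And>a b. a \<in> M \<Longrightarrow> b \<in> M \<Longrightarrow> a * b \<in> M"
  shows "\<exists>P. prime_pideal P \<and> I \<subseteq> P \<and> P \<inter> M = {} \<and> (\<forall>x. x \<notin> P \<longrightarrow> (\<exists>m\<in>M. \<exists>r. m - r * x \<in> P))"
proof -
  let ?A = "{J. pideal J \<and> I \<subseteq> J \<and> J \<inter> M = {}}"
  have "\<exists>P\<in>?A. \<forall>X\<in>?A. P \<subseteq> X \<longrightarrow> X = P"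
  proof (rule subset_Zorn_nonempty)
    show "?A \<noteq> {}" using I by blast
    fix C assume C: "C \<noteq> {}" "subset.chain ?A C"
    then have CA: "C \<subseteq> ?A" and lin: "\<And>X Y. X \<in> C \<Longrightarrow> Y \<in> C \<Longrightarrow> X \<subseteq> Y \<or> Y \<subseteq> X"
      by (auto simp: subset_chain_def)
    have "pideal (\<Union>C)" unfolding pideal_def
    proof (intro conjI ballI allI)
      show "0 \<in> \<Union>C" using C CA pideal_0 by blast
      fix a assume a: "a \<in> \<Union>C"
      {
        fix b assume "b \<in> \<Union>C"
        then obtain X where "X \<in> C" "a \<in> X" "b \<in> X" using a lin by blast
        then show "a + b \<in> \<Union>C" using CA pideal_add by blast
      next
        fix r show "r * a \<in> \<Union>C" using a CA pideal_mult by blast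
      }
    qed
    then show "\<Union>C \<in> ?A" using C CA by blast
  qed
  then obtain P where P: "pideal P" "I \<subseteq> P" "P \<inter> M = {}"
    and max: "\<And>X. pideal X \<Longrightarrow> I \<subseteq> X \<Longrightarrow> X \<inter> M = {} \<Longrightarrow> P \<subseteq> X \<Longrightarrow> X = P" by auto
  have hit: "\<exists>m\<in>M. \<exists>r. m - r * x \<in> P" if x: "x \<notin> P" for x
  proof (rule ccontr)
    assume neg: "\<not> ?thesis"
    let ?I = "{p + r * x |p r. p \<in> P}"
    have "?I \<inter> M = {}"
    proof (rule ccontr)
      assume "?I \<inter> M \<noteq> {}"
      then obtain p r where "p \<in> P" "p + r * x \<in> M" by blast
      moreover from this have "(p + r * x) - r * x \<in> P" by simp
      ultimately show False using neg by blast
    qed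
    then have "?I = P" using max pideal_adjoin[OF P(1), of x] P(2) by blast
    then show False using x pideal_adjoin(3)[OF P(1), of x] by simp
  qed
  have "prime_pideal P" unfolding prime_pideal_def
  proof (intro conjI allI impI)
    show "1 \<notin> P" using P(3) M(1) by blast
    fix a b assume ab: "a * b \<in> P"
    show "a \<in> P \<or> b \<in> P"
    proof (rule ccontr)
      assume "\<not> ?thesis"
      then obtain m r m' r' where m: "m \<in> M" "m - r * a \<in> P" "m' \<in> M" "m' - r' * b \<in> P"
        using hit by (metis (no_types))
      have "m * m' = m' * (m - r * a) + (r * a) * (m' - r' * b) + (r * r') * (a * b)"
        by (simp add: algebra_simps)
      then have "m * m' \<in> P" using m ab by (auto intro!: pideal_add pideal_mult P(1))
      then show False using M(2)[OF m(1,3)] P(3) by blast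
    qed
  qed (rule P(1))
  then show ?thesis using P hit by blast
qed

text \<open>Uncountably many fractions \<open>F\<^sub>c / (x - c)\<close> in a ring of countable dimension are
  linearly dependent; clearing denominators gives an algebraic relation.\<close>

lemma uncountable_relation:
  fixes I :: "nat cpoly set"
  assumes I: "pideal I" and C: "uncountable C" and B: "\<And>c. c \<in> C \<Longrightarrow> F c - B c * (x - cC c) \<in> I"
  shows "\<exists>K l. finite K \<and> K \<subseteq> C \<and> (\<exists>c\<in>K. l c \<noteq> 0) \<and>
    (\<Sum>c\<in>K. cC (l c) * F c * (\<Prod>k\<in>K - {c}. x - cC k)) \<in> I"
proof -
  \<comment> \<open>The countable dimension enters here. Countably many finite boxes exhaust all
    polynomials, so one box contains infinitely many of the \<open>B c\<close>, and a family of
    \<open>card (box n) + 1\<close> of them is linearly dependent.\<close>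
  define box where "box n = {m :: nat \<Rightarrow>\<^sub>0 nat. keys m \<subseteq> {..n} \<and> (\<forall>v. lookup m v \<le> n)}" for n
  have box_mono: "keys G \<subseteq> box n'" if "vars_in {..n} G" "max_exp e G" "n' = max n e" for G n e n'
  proof
    fix m assume "m \<in> keys G"
    then have m: "keys m \<subseteq> {..n}" "\<forall>v. lookup m v \<le> e" using that by (auto simp: vars_in_def max_exp_def)
    have n': "n \<le> n'" "e \<le> n'" unfolding that(3) by auto
    have "keys m \<subseteq> {..n'}" using order_trans[OF m(1)] n'(1) by simp
    moreover have "lookup m v \<le> n'" for v using m(2) n'(2) order_trans by blast
    ultimately show "m \<in> box n'" by (simp add: box_def)
  qed
  have "\<exists>n. keys G \<subseteq> box n" for G :: "nat cpoly"
  proof -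
    obtain J where J: "finite J" "vars_in J G" using vars_in_finite by blast
    then obtain n where "J \<subseteq> {..n}" using finite_nat_iff_bounded_le by blast
    then have "vars_in {..n} G" using J(2) vars_in_mono by blast
    then show ?thesis using exists_max_exp[of G] box_mono by blast
  qed
  then have eq: "C = (\<Union>n. {c\<in>C. keys (B c) \<subseteq> box n})" by blast
  have "\<exists>n. infinite {c\<in>C. keys (B c) \<subseteq> box n}"
  proof (rule ccontr)
    assume "\<not> ?thesis"
    then have "countable (\<Union>n. {c\<in>C. keys (B c) \<subseteq> box n})"
      by (intro countable_UN) (auto intro: countable_finite)
    then show False using C eq by simp
  qed
  then obtain n where n: "infinite {c\<in>C. keys (B c) \<subseteq> box n}" by blast
  have fin: "finite (box n)" unfolding box_def by (rule box_monomials) simp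
  obtain K where K: "finite K" "card K = Suc (card (box n))" "K \<subseteq> {c\<in>C. keys (B c) \<subseteq> box n}"
    using infinite_arbitrarily_large[OF n] by blast
  obtain l where l: "\<exists>c\<in>K. l c \<noteq> 0" "\<forall>m\<in>box n. (\<Sum>c\<in>K. l c * lookup (B c) m) = 0"
    using nontrivial_relation[OF K(1) fin, of "\<lambda>c. lookup (B c)"] K(2) by auto
  have rel: "(\<Sum>c\<in>K. cC (l c) * B c) = 0"
  proof (rule poly_mapping_eqI)
    fix m
    have "(\<Sum>c\<in>K. l c * lookup (B c) m) = 0"
    proof (cases "m \<in> box n")
      case False
      then have "m \<notin> keys (B c)" if "c \<in> K" for c using K(3) that by blast
      then have "\<forall>c\<in>K. lookup (B c) m = 0" by (auto simp: in_keys_iff)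
      then show ?thesis by simp
    qed (use l in blast)
    then show "lookup (\<Sum>c\<in>K. cC (l c) * B c) m = lookup 0 m" by (simp add: lookup_sum lookup_cC_mult)
  qed
  let ?\<Pi> = "\<lambda>c. \<Prod>k\<in>K - {c}. x - cC k"
  have "(\<Sum>c\<in>K. cC (l c) * F c * ?\<Pi> c)
    = (\<Sum>c\<in>K. (cC (l c) * ?\<Pi> c) * (F c - B c * (x - cC c))) + (\<Sum>c\<in>K. cC (l c) * B c * (\<Prod>k\<in>K. x - cC k))"
    unfolding sum.distrib[symmetric]
  proof (rule sum.cong[OF refl])
    fix c assume "c \<in> K"
    then have eq: "(\<Prod>k\<in>K. x - cC k) = (x - cC c) * ?\<Pi> c" using K(1) by (simp add: prod.remove)
    show "cC (l c) * F c * ?\<Pi> c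
      = (cC (l c) * ?\<Pi> c) * (F c - B c * (x - cC c)) + cC (l c) * B c * (\<Prod>k\<in>K. x - cC k)"
      unfolding eq by (simp add: algebra_simps)
  qed
  also have "(\<Sum>c\<in>K. cC (l c) * B c * (\<Prod>k\<in>K. x - cC k)) = 0"
    unfolding sum_distrib_right[symmetric] rel by simp
  finally have "(\<Sum>c\<in>K. cC (l c) * F c * ?\<Pi> c) \<in> I"
    using B K(3) by (auto intro!: pideal_sum[OF I] pideal_mult[OF I])
  then show ?thesis using K l(1) by blast
qed

subsection \<open>The Nullstellensatz for prime ideals\<close>

text \<open>A nonzero complex polynomial in one variable splits, and a prime ideal containing the
  product contains a factor. \<open>G\<close> is the multivariate copy of \<open>p\<close>; the two
  are compared through their values.\<close>

lemma prime_contains_linear: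
  assumes P: "prime_pideal P"
  shows "p \<noteq> 0 \<Longrightarrow> G \<in> P \<Longrightarrow> (\<And>v. poly_eval G v = poly p (v j)) \<Longrightarrow> \<exists>c. cX j - cC c \<in> P"
proof (induction "degree p" arbitrary: p G rule: less_induct)
  case less
  show ?case
  proof (cases "degree p = 0")
    case True
    then obtain a where a: "p = [:a:]" "a \<noteq> 0" using less(2) degree_eq_zeroE by (metis pCons_eq_0_iff)
    have "poly_eval (cC (1 / a) * G - 1) v = 0" for v
      using less(4) a by (simp add: poly_eval_simps)
    then have "cC (1 / a) * G = 1" using poly_eval_eq_0_imp_eq_0[of "cC (1 / a) * G - 1"] by simp
    then have "1 \<in> P" using less(3) P pideal_mult by (metis prime_pideal_def)
    then show ?thesis using P by (simp add: prime_pideal_def)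
  next
    case False
    then obtain c where "poly p c = 0"

      using fundamental_theorem_of_algebra[of p] constant_degree[of p] False by blast
    then obtain q where q: "p = [:- c, 1:] * q"
      unfolding poly_eq_0_iff_dvd by (erule dvdE)
    have q0: "q \<noteq> 0" using q less(2) by auto
    have "degree p = degree [:- c, 1:] + degree q"
      unfolding q using q0 by (intro degree_mult_eq) auto
    then have deg: "degree q < degree p" by simp
    define H :: "nat cpoly" where "H = (\<Sum>i\<le>degree q. cC (coeff q i) * cX j ^ i)"
    have H: "poly_eval H v = poly q (v j)" for v
      by (simp add: H_def poly_eval_simps poly_altdef)
    have "poly_eval (G - (cX j - cC c) * H) v = 0" for v
      using less(4) by (simp add: poly_eval_simps H q algebra_simps)
    then have "G = (cX j - cC c) * H" using poly_eval_eq_0_imp_eq_0[of "G - (cX j - cC c) * H"] by simp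
    then have "cX j - cC c \<in> P \<or> H \<in> P" using less(3) P by (auto simp: prime_pideal_def)
    then show ?thesis using less(1)[OF deg q0 _ H] by blast
  qed
qed

lemma pideal_prod_cong:
  assumes I: "pideal I" and fg: "\<And>i. i \<in> A \<Longrightarrow> f i - g i \<in> I"
  shows "(\<Prod>i\<in>A. f i) - (\<Prod>i\<in>A. g i) \<in> I"
  using fg
proof (induction A rule: infinite_finite_induct)
  case (insert i A)
  have "prod f (insert i A) - prod g (insert i A)
    = prod f A * (f i - g i) + g i * (prod f A - prod g A)"
    using insert(1,2) by (simp add: algebra_simps)
  then show ?case using insert(3,4) by (auto intro!: pideal_add pideal_mult I)
qed (use pideal_0[OF I] in auto)

lemma pideal_psubst_cong:
  assumes I: "pideal I" and fg: "\<And>j. f j - g j \<in> I"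
  shows "psubst F f - psubst F g \<in> I"
proof -
  have "psubst F f - psubst F g = (\<Sum>m\<in>keys F. cC (lookup F m) *
      ((\<Prod>v\<in>keys m. f v ^ lookup m v) - (\<Prod>v\<in>keys m. g v ^ lookup m v)))"
    by (simp add: psubst_def sum_subtractf right_diff_distrib)
  moreover have "f v ^ k - g v ^ k \<in> I" for v k
    using pideal_prod_cong[OF I, of "{..<k}" "\<lambda>_. f v" "\<lambda>_. g v"] fg by simp
  ultimately show ?thesis by (auto intro!: pideal_sum pideal_mult pideal_prod_cong I)
qed

text \<open>Enlarge \<open>P\<close> to a prime \<open>Q\<close> maximal among the ideals avoiding
  the powers of \<open>F\<close>. If no \<open>X_j - c\<close> lay in \<open>Q\<close>, each would
  divide a power of \<open>F\<close> modulo \<open>Q\<close>, with the same exponent for uncountably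
  many \<open>c\<close>; the resulting relation is a nonzero polynomial in \<open>X_j\<close> lying
  in \<open>Q\<close>, which has a linear factor in \<open>Q\<close> after all. So \<open>Q\<close>
  contains \<open>X_j - v_j\<close> for every \<open>j\<close>, and \<open>v\<close> is the desired
  zero.\<close>

theorem nullstellensatz:
  assumes P: "prime_pideal P" and F: "F \<notin> P"
  shows "\<exists>v\<in>variety_of P. poly_eval F v \<noteq> 0"
proof -
  let ?M = "range (\<lambda>k. F ^ k)"
  have powers: "F ^ k \<notin> P" for k
    by (induction k) (use P F in \<open>auto simp: prime_pideal_def\<close>)
  then have "P \<inter> ?M = {}" by auto
  moreover have "1 \<in> ?M" by (rule range_eqI[of _ _ 0]) simp
  moreover have "a * b \<in> ?M" if "a \<in> ?M" "b \<in> ?M" for a b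
    using that by (auto simp flip: power_add)
  ultimately obtain Q where Q: "prime_pideal Q" "P \<subseteq> Q" "Q \<inter> ?M = {}"
    and hit: "\<And>x. x \<notin> Q \<Longrightarrow> \<exists>m\<in>?M. \<exists>r. m - r * x \<in> Q"
    using exists_prime_disjoint[of P ?M] P by (auto simp: prime_pideal_def)
  have QI: "pideal Q" using Q(1) by (simp add: prime_pideal_def)
  have "\<exists>c. cX j - cC c \<in> Q" for j
  proof (rule ccontr)
    assume neg: "\<not> ?thesis"
    then have "\<forall>c. \<exists>k r. F ^ k - r * (cX j - cC c) \<in> Q" using hit by blast
    then obtain k r where kr: "\<And>c. F ^ k c - r c * (cX j - cC c) \<in> Q" by metis
    have "(UNIV :: complex set) = (\<Union>a. {c. k c = a})" by blast
    then have "\<exists>a. uncountable {c. k c = a}"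
      using uncountable_UNIV_complex countable_UN[of "UNIV :: nat set" "\<lambda>a. {c. k c = a}"] by auto
    then obtain a where a: "uncountable {c. k c = a}" by blast
    have "F ^ a - r c * (cX j - cC c) \<in> Q" if "c \<in> {c. k c = a}" for c using kr[of c] that by simp
    from uncountable_relation[OF QI a this] obtain K l where K: "finite K" "\<exists>c\<in>K. l c \<noteq> 0"
      "(\<Sum>c\<in>K. cC (l c) * F ^ a * (\<Prod>k\<in>K - {c}. cX j - cC k)) \<in> Q" by blast
    define G where "G = (\<Sum>c\<in>K. cC (l c) * (\<Prod>k\<in>K - {c}. cX j - cC k))"
    have "F ^ a * G = (\<Sum>c\<in>K. cC (l c) * F ^ a * (\<Prod>k\<in>K - {c}. cX j - cC k))"
      by (simp add: G_def sum_distrib_left mult_ac)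
    then have "F ^ a * G \<in> Q" using K(3) by simp
    moreover have "F ^ a \<notin> Q" using Q(3) by blast
    ultimately have GQ: "G \<in> Q" using Q(1) by (auto simp: prime_pideal_def)
    define p where "p = (\<Sum>c\<in>K. smult (l c) (\<Prod>k\<in>K - {c}. [:- k, 1:]))"
    have Gp: "poly_eval G v = poly p (v j)" for v
      by (simp add: G_def p_def poly_eval_simps poly_sum poly_prod)
    obtain c where c: "c \<in> K" "l c \<noteq> 0" using K by blast
    \<comment> \<open>At the node \<open>c\<close> every other summand has the factor
      \<open>c - c\<close>, so one nonzero coefficient \<open>l c\<close> suffices for
      \<open>p\<close> to be nonzero.\<close>
    have "poly p c = (\<Sum>c'\<in>K. if c' = c then l c * (\<Prod>k\<in>K - {c}. c - k) else 0)"
      unfolding p_def poly_sum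
      by (rule sum.cong) (use c K(1) in \<open>auto simp: poly_prod prod_zero_iff\<close>)
    also have "\<dots> \<noteq> 0" using c K(1) by (simp add: prod_zero_iff)
    finally have "p \<noteq> 0" by auto
    then show False using prime_contains_linear[OF Q(1) _ GQ Gp] neg by blast
  qed
  then obtain v where v: "\<And>j. cX j - cC (v j) \<in> Q" by metis
  have val: "G - cC (poly_eval G v) \<in> Q" for G
  proof -
    have "psubst G cX = G"
      using poly_eval_eq_0_imp_eq_0[of "psubst G cX - G"] by (simp add: poly_eval_simps poly_eval_psubst)
    moreover have "psubst G (\<lambda>j. cC (v j)) = (cC (poly_eval G v) :: nat cpoly)"
      using poly_eval_eq_0_imp_eq_0[of "psubst G (\<lambda>j. cC (v j)) - (cC (poly_eval G v) :: nat cpoly)"]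
      by (simp add: poly_eval_simps poly_eval_psubst)
    ultimately show ?thesis
      using pideal_psubst_cong[where f = cX and g = "\<lambda>j. cC (v j)", OF QI v, of G] by simp
  qed
  have const: "c = 0" if "cC c \<in> Q" for c
  proof (rule ccontr)
    assume "c \<noteq> 0"
    then have "cC (1 / c) * cC c = (1 :: nat cpoly)" by (simp add: cC_def mult_single)
    then show False using pideal_mult[OF QI that, of "cC (1 / c)"] Q(1) by (simp add: prime_pideal_def)
  qed
  have "v \<in> variety_of P" unfolding variety_of_def
  proof (intro CollectI ballI const)
    fix G assume "G \<in> P"
    then have "G - (G - cC (poly_eval G v)) \<in> Q"
      using Q(2) val pideal_diff[OF QI, of G "G - cC (poly_eval G v)"] by blast
    then show "cC (poly_eval G v) \<in> Q" by simp
  qed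
  moreover have "poly_eval F v \<noteq> 0"
  proof
    assume "poly_eval F v = 0"
    then have "F ^ 1 \<in> Q" using val[of F] by (simp add: cC_def)
    then show False using Q(3) by blast
  qed
  ultimately show ?thesis by blast
qed

subsection \<open>Chains of prime ideals\<close>

text \<open>The variable \<open>j\<close> is specialized to a suitable constant \<open>c\<close>
  such that \<open>J\<close> stays independent. If no constant worked, each \<open>c\<close> would
  give a nonzero \<open>F c\<close> in the variables \<open>J\<close> that is divisible by
  \<open>X_j - c\<close> modulo \<open>P\<close>; uncountably many of these yield a nontrivial
  relation in \<open>J\<close> and \<open>j\<close> modulo \<open>P\<close>.\<close>

lemma prime_chain_step:
  assumes P: "prime_pideal P" and j: "j \<notin> J" and ind: "independent_mod P (insert j J)"
  shows "\<exists>Q. prime_pideal Q \<and> P \<subset> Q \<and> independent_mod Q J"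
proof -
  have PI: "pideal P" using P by (simp add: prime_pideal_def)
  define M where "M = {F :: nat cpoly. vars_in J F \<and> F \<noteq> 0}"
  define I where "I c = {p + r * (cX j - cC c) |p r. p \<in> P}" for c
  have "\<exists>c. I c \<inter> M = {}"
  proof (rule ccontr)
    assume "\<not> ?thesis"
    have "\<exists>F r. F \<in> M \<and> F - r * (cX j - cC c) \<in> P" for c
    proof -
      obtain G where G: "G \<in> I c" "G \<in> M" using \<open>\<nexists>c. I c \<inter> M = {}\<close> by blast
      from G(1) obtain p r where "G = p + r * (cX j - cC c)" "p \<in> P"
        unfolding I_def by (elim CollectE exE conjE)
      then have "G - r * (cX j - cC c) \<in> P" by simp
      then show ?thesis using G(2) by (intro exI conjI)
    qed
    then obtain F r where F: "\<And>c. F c \<in> M" "\<And>c. F c - r c * (cX j - cC c) \<in> P" by metis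
    from uncountable_relation[OF PI uncountable_UNIV_complex F(2)] obtain K l where
      K: "finite K" "\<exists>c\<in>K. l c \<noteq> 0" "(\<Sum>c\<in>K. cC (l c) * F c * (\<Prod>k\<in>K - {c}. cX j - cC k)) \<in> P" by blast
    let ?G = "\<Sum>c\<in>K. cC (l c) * F c * (\<Prod>k\<in>K - {c}. cX j - cC k)"
    have "vars_in (insert j J) (F c)" for c
      using F(1)[of c] vars_in_mono[of J "F c" "insert j J"] by (auto simp: M_def)
    then have "vars_in (insert j J) ?G"
      by (intro vars_in_sum vars_in_mult vars_in_prod vars_in_diff) auto
    then have G0: "?G = 0" using ind K(3) by (auto simp: independent_mod_def)
    obtain c where c: "c \<in> K" "l c \<noteq> 0" using K by blast
    obtain u where u: "poly_eval (F c) u \<noteq> 0" using F(1)[of c] nonzero_cpoly_nonvanishing by (auto simp: M_def)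
    have uj: "poly_eval (F c) (u(j := c)) = poly_eval (F c) u"
      by (rule poly_eval_cong[of J]) (use F(1)[of c] j in \<open>auto simp: M_def\<close>)
    have "0 = poly_eval ?G (u(j := c))" by (simp add: G0)
    also have "\<dots> = (\<Sum>c'\<in>K. if c' = c then l c * poly_eval (F c) u * (\<Prod>k\<in>K - {c}. c - k) else 0)"
      unfolding poly_eval_simps
      by (rule sum.cong) (use c K(1) uj in \<open>auto simp: prod_zero_iff\<close>)
    also have "\<dots> \<noteq> 0" using c K(1) u by (simp add: prod_zero_iff)
    finally show False by simp
  qed
  then obtain c where c: "I c \<inter> M = {}" by blast
  obtain Q where Q: "prime_pideal Q" "I c \<subseteq> Q" "Q \<inter> M = {}"
  proof -
    have "pideal (I c)" unfolding I_def by (rule pideal_adjoin(1)[OF PI])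
    moreover have "1 \<in> M" by (simp add: M_def)
    moreover have "a * b \<in> M" if "a \<in> M" "b \<in> M" for a b
      using that vars_in_mult[of J a b] by (simp add: M_def)
    ultimately show ?thesis using exists_prime_disjoint[OF _ c] that by blast
  qed
  have "cX j - cC c \<noteq> (0 :: nat cpoly)"
  proof
    assume "cX j - cC c = (0 :: nat cpoly)"
    then have "poly_eval (cX j - cC c) (\<lambda>_. c + 1) = 0" by simp
    then show False by (simp add: poly_eval_diff)
  qed
  moreover have "vars_in (insert j J) (cX j - cC c)" by (intro vars_in_diff) auto
  ultimately have "cX j - cC c \<notin> P" using ind by (auto simp: independent_mod_def)
  then have "P \<subset> Q"
    using Q(2) pideal_adjoin(2,3)[OF PI, of "cX j - cC c"] unfolding I_def[symmetric] by blast
  moreover have "independent_mod Q J" using Q(3) by (auto simp: independent_mod_def M_def)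
  ultimately show ?thesis using Q(1) by blast
qed

lemma prime_chain:
  assumes "finite J" "prime_pideal P" "independent_mod P J"
  shows "\<exists>c. (\<forall>i\<le>card J. prime_pideal (c i) \<and> P \<subseteq> c i) \<and> (\<forall>i<card J. c (Suc i) \<subset> c i)"
  using assms
proof (induction J arbitrary: P rule: finite_induct)
  case empty
  then show ?case by (intro exI[of _ "\<lambda>_. P"]) auto
next
  case (insert j J)
  obtain Q where Q: "prime_pideal Q" "P \<subset> Q" "independent_mod Q J"
    using prime_chain_step[OF insert(4,2,5)] by blast
  obtain c where c: "\<And>i. i \<le> card J \<Longrightarrow> prime_pideal (c i) \<and> Q \<subseteq> c i" "\<And>i. i < card J \<Longrightarrow> c (Suc i) \<subset> c i"
    using insert(3)[OF Q(1,3)] by blast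
  \<comment> \<open>The smallest ideal \<open>P\<close> receives the largest index: ideals decrease
    along the chain, so their zero sets increase.\<close>
  let ?c = "c(Suc (card J) := P)"
  show ?case
  proof (intro exI[of _ ?c] conjI allI impI)
    fix i assume "i \<le> card (insert j J)"
    then show "prime_pideal (?c i)" "P \<subseteq> ?c i" using c(1)[of i] insert(1,2,4) Q(2)
      by (auto simp: le_Suc_eq)
  next
    fix i assume "i < card (insert j J)"
    then have "i < card J \<or> i = card J" using insert(1,2) by auto
    then show "?c (Suc i) \<subset> ?c i"
    proof
      assume "i = card J"
      then show ?thesis using c(1)[of "card J"] Q(2) by (simp add: psubset_subset_trans)
    qed (use c(2) in auto)
  qed
qed

section \<open>Affine pieces of projective varieties\<close>

text \<open>The chart stays inside the cone, with its coordinate \<open>j\<close> kept equal to 1,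
  so that forms and inhomogeneous polynomials can be evaluated at the same vectors.\<close>

definition affine_piece :: "nat \<Rightarrow> ppoint set \<Rightarrow> (nat \<Rightarrow> complex) set" where
  "affine_piece j X = {v \<in> \<Union>X. v j = 1}"

definition vanishing_ideal :: "(nat \<Rightarrow> complex) set \<Rightarrow> nat cpoly set" where
  "vanishing_ideal S = {F. \<forall>v\<in>S. poly_eval F v = 0}"

text \<open>Each monomial is filled up with a power of the coordinate \<open>j\<close>, which is 1
  on the chart. Monomials with a variable beyond \<open>N\<close> are dropped since they vanish on
  \<open>cvec N\<close>.\<close>

lemma homogenization:
  assumes j: "j \<le> N"
  shows "\<exists>d H. form N d H \<and> (\<forall>v\<in>cvec N. v j = 1 \<longrightarrow> poly_eval H v = poly_eval F v)"
proof -
  define D where "D = Max ((\<lambda>m. \<Sum>i\<in>keys m. lookup m i) ` keys F)"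
  let ?A = "{m\<in>keys F. keys m \<subseteq> {..N}}"
  define H where "H = (\<Sum>m\<in>?A. cC (lookup F m) *
    ((\<Prod>i\<in>keys m. cX i ^ lookup m i) * cX j ^ (D - (\<Sum>i\<in>keys m. lookup m i))))"
  have "form N D H" unfolding H_def
  proof (rule form_sum, rule form_cmult)
    fix m assume m: "m \<in> ?A"
    let ?s = "\<Sum>i\<in>keys m. lookup m i"
    have "?s \<le> D" unfolding D_def using m by (intro Max_ge) auto
    moreover have "form N ((\<Sum>i\<in>keys m. lookup m i * 1) + (D - ?s) * 1) ((\<Prod>i\<in>keys m. cX i ^ lookup m i) * cX j ^ (D - ?s))"
      using m j by (intro form_mult form_prod form_power form_cX) auto
    ultimately show "form N D ((\<Prod>i\<in>keys m. cX i ^ lookup m i) * cX j ^ (D - ?s))" by simp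
  qed
  moreover have "poly_eval H v = poly_eval F v" if v: "v \<in> cvec N" "v j = 1" for v
  proof -
    have "poly_eval H v = (\<Sum>m\<in>?A. lookup F m * monom_eval m v)"
      using v by (simp add: H_def poly_eval_simps monom_eval_def)
    also have "\<dots> = (\<Sum>m\<in>keys F. lookup F m * monom_eval m v)"
    proof (rule sum.mono_neutral_left)
      show "\<forall>m\<in>keys F - ?A. lookup F m * monom_eval m v = 0"
      proof
        fix m assume "m \<in> keys F - ?A"
        then have "\<not> keys m \<subseteq> {..N}" by blast
        then obtain i where "i \<in> keys m" "i > N" by (meson atMost_iff not_le subsetI)
        then have "v i ^ lookup m i = 0" using v(1) by (auto simp: cvec_def in_keys_iff)
        then show "lookup F m * monom_eval m v = 0" using \<open>i \<in> keys m\<close> by (auto simp: monom_eval_def prod_zero_iff)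
      qed
    qed auto
    finally show ?thesis by (simp add: poly_eval_def)
  qed
  ultimately show ?thesis by blast
qed

lemma variety_subset: "proj_variety N X \<Longrightarrow> X \<subseteq> proj_space N"
  using closedin_subset_proj_space by (simp add: proj_variety_def)

lemma variety_cone_scale:
  assumes "proj_variety N X" "v \<in> \<Union>X" shows "cscale c v \<in> \<Union>X"
proof -
  obtain p where p: "p \<in> X" "v \<in> p" using assms(2) by blast
  then obtain w where "p = line w" using variety_subset[OF assms(1)] by (auto simp: proj_space_def)
  then have "cscale c v \<in> p" using p by (auto simp: line_def cscale_def mult.assoc[symmetric])
  then show ?thesis using p(1) by blast
qed

lemma variety_cone_line: "proj_variety N X \<Longrightarrow> v \<in> \<Union>X \<Longrightarrow> v \<noteq> 0 \<Longrightarrow> line v \<in> X"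
  using proj_space_line variety_subset by fastforce

lemma variety_cone_cvec: "proj_variety N X \<Longrightarrow> v \<in> \<Union>X \<Longrightarrow> v \<in> cvec N"
  using variety_subset proj_space_cvec by blast

lemma affine_piece_scale:
  assumes "proj_variety N X" "v \<in> \<Union>X" "v j \<noteq> 0" shows "cscale (1 / v j) v \<in> affine_piece j X"
  using variety_cone_scale[OF assms(1,2), of "1 / v j"] assms(3)
  by (simp add: affine_piece_def cscale_def)

lemma form_vanishes_cone:
  assumes X: "proj_variety N X" and F: "form N d F" and 0: "\<And>v. v \<in> affine_piece j X \<Longrightarrow> poly_eval F v = 0"
    and v: "v \<in> \<Union>X" "v j \<noteq> 0"
  shows "poly_eval F v = 0"
proof -
  have "poly_eval F (cscale (1 / v j) v) = 0" using 0 affine_piece_scale[OF X v] by blast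
  then show ?thesis using v(2) by (simp add: poly_eval_form_scale[OF F])
qed

lemma prime_vanishing_ideal:
  assumes X: "proj_variety N X" and j: "j \<le> N" and ne: "affine_piece j X \<noteq> {}"
  shows "prime_pideal (vanishing_ideal (affine_piece j X))"
  unfolding prime_pideal_def
proof (intro conjI allI impI)
  show "pideal (vanishing_ideal (affine_piece j X))"
    by (auto simp: pideal_def vanishing_ideal_def poly_eval_simps)
  show "1 \<notin> vanishing_ideal (affine_piece j X)" using ne by (auto simp: vanishing_ideal_def poly_eval_simps)
  fix F G assume FG: "F * G \<in> vanishing_ideal (affine_piece j X)"
  obtain d F' where F': "form N d F'" "\<And>v. v \<in> cvec N \<Longrightarrow> v j = 1 \<Longrightarrow> poly_eval F' v = poly_eval F v"
    using homogenization[OF j] by blast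
  obtain e G' where G': "form N e G'" "\<And>v. v \<in> cvec N \<Longrightarrow> v j = 1 \<Longrightarrow> poly_eval G' v = poly_eval G v"
    using homogenization[OF j] by blast
  have piece: "v \<in> cvec N \<and> v j = 1 \<and> v \<in> \<Union>X" if "v \<in> affine_piece j X" for v
    using that variety_cone_cvec[OF X] by (auto simp: affine_piece_def)
  \<comment> \<open>The homogenizations are controlled only on the chart. The factor
    \<open>cX j\<close> makes the product vanish also at the points of \<open>X\<close> with
    coordinate \<open>j\<close> equal to zero.\<close>
  have G1: "form N (e + 1) (G' * cX j)" by (intro form_mult G'(1) form_cX j)
  have "poly_eval F' v * poly_eval (G' * cX j) v = 0" if "v \<in> \<Union>X" for v
  proof (cases "v j = 0")
    case False
    have "poly_eval (F' * G') w = 0" if "w \<in> affine_piece j X" for w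
      using FG that piece[OF that] F'(2) G'(2) by (auto simp: vanishing_ideal_def poly_eval_simps)
    then have "poly_eval (F' * G') v = 0"
      using form_vanishes_cone[OF X form_mult[OF F'(1) G'(1)]] \<open>v \<in> \<Union>X\<close> False by blast
    then show ?thesis by (auto simp: poly_eval_simps)
  qed (simp add: poly_eval_simps)
  then have "(\<forall>v\<in>\<Union>X. poly_eval F' v = 0) \<or> (\<forall>v\<in>\<Union>X. poly_eval (G' * cX j) v = 0)"
    using variety_prod[OF X F'(1) G1] by blast
  then show "F \<in> vanishing_ideal (affine_piece j X) \<or> G \<in> vanishing_ideal (affine_piece j X)"
  proof
    assume 0: "\<forall>v\<in>\<Union>X. poly_eval F' v = 0"
    have "poly_eval F v = 0" if "v \<in> affine_piece j X" for v
      using 0 piece[OF that] F'(2)[of v] by metis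
    then show ?thesis by (simp add: vanishing_ideal_def)
  next
    assume 0: "\<forall>v\<in>\<Union>X. poly_eval (G' * cX j) v = 0"
    have "poly_eval G v = 0" if "v \<in> affine_piece j X" for v
    proof -
      have "poly_eval (G' * cX j) v = 0" "v j = 1" "poly_eval G' v = poly_eval G v"
        using 0 piece[OF that] G'(2)[of v] by blast+
      then show ?thesis by (simp add: poly_eval_simps)
    qed
    then show ?thesis by (simp add: vanishing_ideal_def)
  qed
qed

text \<open>With \<open>d + 1\<close> independent coordinates there is a chain of
  \<open>d + 2\<close> primes above the ideal of the affine piece. The closures of their zero sets
  lie in \<open>X\<close>; they are distinct because the Nullstellensatz provides a zero of the
  smaller prime where a given element of the larger one is nonzero, and homogenization turns that
  element into a form.\<close>

lemma independent_card_le_dimension: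
  assumes X: "proj_variety N X" and dim: "has_dimension (zariski N) X d"
    and j: "j \<le> N" and ne: "affine_piece j X \<noteq> {}"
    and J: "finite J" "independent_mod (vanishing_ideal (affine_piece j X)) J"
  shows "card J \<le> d"
proof (rule ccontr)
  assume "\<not> card J \<le> d"
  then obtain J' where J': "J' \<subseteq> J" "card J' = Suc d" "finite J'"
    using obtain_subset_with_card_n[of "Suc d" J] by (metis not_less_eq_eq)
  let ?I = "vanishing_ideal (affine_piece j X)"
  have "independent_mod ?I J'"
    using J(2) vars_in_mono[OF _ J'(1)] by (auto simp: independent_mod_def)
  from prime_chain[OF J'(3) prime_vanishing_ideal[OF X j ne] this] obtain c where
    c: "\<And>i. i \<le> Suc d \<Longrightarrow> prime_pideal (c i)" "\<And>i. i \<le> Suc d \<Longrightarrow> ?I \<subseteq> c i"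
      "\<And>i. i < Suc d \<Longrightarrow> c (Suc i) \<subset> c i" unfolding J'(2) by blast
  define Z where "Z i = pclosure N (variety_of (c i))" for i
  have pts: "v \<in> cvec N \<and> v j = 1 \<and> v \<noteq> 0 \<and> line v \<in> X" if i: "i \<le> Suc d" and v: "v \<in> variety_of (c i)" for i v
  proof -
    have I: "poly_eval F v = 0" if "F \<in> ?I" for F
      using that c(2)[OF i] v by (auto simp: variety_of_def)
    have "v k = 0" if "k > N" for k
    proof -
      have "cX k \<in> ?I" using that variety_cone_cvec[OF X] by (auto simp: vanishing_ideal_def affine_piece_def cvec_def)
      then show ?thesis using I by fastforce
    qed
    then have cv: "v \<in> cvec N" by (simp add: cvec_def)
    have "cX j - 1 \<in> ?I" by (auto simp: vanishing_ideal_def affine_piece_def poly_eval_simps)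
    then have vj: "v j = 1" using I by (force simp: poly_eval_simps)
    then have v0: "v \<noteq> 0" by auto
    have "line v \<in> X"
    proof (rule ccontr)
      assume "line v \<notin> X"
      then obtain F d where F: "form N d F" "\<forall>w\<in>\<Union>X. poly_eval F w = 0" "poly_eval F v \<noteq> 0"
        using closed_separate[of N X v] X cv v0 by (auto simp: proj_variety_def)
      then have "F \<in> ?I" by (auto simp: vanishing_ideal_def affine_piece_def)
      then show False using I F(3) by blast
    qed
    then show ?thesis using cv vj v0 by blast
  qed
  have notin: "\<exists>v\<in>variety_of (c i). poly_eval F v \<noteq> 0" if "i \<le> Suc d" "F \<notin> c i" for i F
    using nullstellensatz[OF c(1)] that by blast
  have "proj_variety N (Z i)" if i: "i \<le> Suc d" for i
    unfolding Z_def
  proof (rule pclosure_variety)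
    show "variety_of (c i) \<noteq> {}" using notin[OF i, of 1] c(1)[OF i] by (auto simp: prime_pideal_def)
    fix F G d e assume 0: "\<And>v. v \<in> variety_of (c i) \<Longrightarrow> poly_eval F v * poly_eval G v = 0"
    have "F * G \<in> c i" using notin[OF i, of "F * G"] 0 by (auto simp: poly_eval_simps)
    then have "F \<in> c i \<or> G \<in> c i" using c(1)[OF i] by (auto simp: prime_pideal_def)
    then show "(\<forall>v\<in>variety_of (c i). poly_eval F v = 0) \<or> (\<forall>v\<in>variety_of (c i). poly_eval G v = 0)"
      by (auto simp: variety_of_def)
  qed (use pts[OF i] in blast)
  moreover have "Z i \<subseteq> X" if "i \<le> Suc d" for i
    unfolding Z_def using X pts[OF that] by (intro pclosure_minimal) (auto simp: proj_variety_def)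
  moreover have "Z i \<subset> Z (Suc i)" if i: "i < Suc d" for i
  proof (rule psubsetI)
    show "Z i \<subseteq> Z (Suc i)" unfolding Z_def
      by (rule pclosure_mono) (use c(3)[OF i] in \<open>auto simp: variety_of_def\<close>)
    obtain F where F: "F \<in> c i" "F \<notin> c (Suc i)" using c(3)[OF i] by blast
    obtain e H where H: "form N e H" "\<And>v. v \<in> cvec N \<Longrightarrow> v j = 1 \<Longrightarrow> poly_eval H v = poly_eval F v"
      using homogenization[OF j] by blast
    obtain v where v: "v \<in> variety_of (c (Suc i))" "poly_eval F v \<noteq> 0" using notin[OF _ F(2)] i by auto
    have pv: "v \<in> cvec N \<and> v j = 1 \<and> v \<noteq> 0" using pts[OF _ v(1)] i by auto
    have "line v \<in> Z (Suc i)" unfolding Z_def using line_in_pclosure v(1) pv by blast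
    moreover have "line v \<notin> Z i"
    proof
      assume "line v \<in> Z i"
      moreover have "poly_eval H w = 0" if "w \<in> variety_of (c i)" for w
        using that F(1) pts[OF _ that] i H(2) by (auto simp: variety_of_def)
      ultimately have "poly_eval H v = 0" unfolding Z_def using pclosure_vanish[OF H(1)] line_self by blast
      then show False using H(2) pv v(2) by auto
    qed
    ultimately show "Z i \<noteq> Z (Suc i)" by blast
  qed
  ultimately have "irreducible_chain (zariski N) X (Suc d)"
    unfolding irreducible_chain_def proj_variety_def by (intro exI[of _ Z]) auto
  then show False using dim by (simp add: has_dimension_def)
qed

section \<open>Local expansion of a variety at its generic points\<close>

section \<open>Jets of arcs\<close>

definition exps :: "nat \<Rightarrow> nat \<Rightarrow> (nat \<Rightarrow>\<^sub>0 nat) set" where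
  "exps d k = {m. keys m \<subseteq> {..<d} \<and> (\<Sum>i<d. lookup m i) \<le> k}"

text \<open>Stars and bars: the exponents preceded by the slack \<open>k\<close> minus their sum
  form the lists of \<open>d + 1\<close> naturals with sum \<open>k\<close>.\<close>

lemma
  shows finite_exps: "finite (exps d k)" and card_exps: "card (exps d k) = (d + k) choose d"
proof -
  define f where "f m = (k - (\<Sum>i<d. lookup m i)) # map (lookup m) [0..<d]" for m :: "nat \<Rightarrow>\<^sub>0 nat"
  let ?L = "{l::nat list. length l = Suc d \<and> sum_list l = k}"
  have sum: "sum_list (map h [0..<d]) = (\<Sum>i<d. h i)" for h :: "nat \<Rightarrow> nat"
    by (simp add: interv_sum_list_conv_sum_set_nat atLeast0LessThan)
  have "inj_on f (exps d k)"
  proof (rule inj_onI, rule poly_mapping_eqI)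
    fix m m' i assume m: "m \<in> exps d k" "m' \<in> exps d k" "f m = f m'"
    show "lookup m i = lookup m' i"
    proof (cases "i < d")
      case True
      have "map (lookup m) [0..<d] = map (lookup m') [0..<d]" using m(3) by (simp add: f_def)
      then show ?thesis using True by (metis (no_types, lifting) atLeast0LessThan lessThan_iff map_eq_conv set_upt)
    next
      case False
      then have "i \<notin> keys m" "i \<notin> keys m'" using m by (auto simp: exps_def)
      then show ?thesis by (simp add: in_keys_iff)
    qed
  qed
  moreover have "f ` exps d k = ?L"
  proof
    show "f ` exps d k \<subseteq> ?L" by (auto simp: f_def exps_def sum)
    show "?L \<subseteq> f ` exps d k"
    proof
      fix l assume l: "l \<in> ?L"
      then obtain a t where lt: "l = a # t" "length t = d" by (cases l) auto
      define m where "m = (\<Sum>i<d. Poly_Mapping.single i (t ! i))"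
      have lm: "lookup m i = (if i < d then t ! i else 0)" for i
        by (simp add: m_def lookup_sum lookup_single when_def)
      have mt: "map (lookup m) [0..<d] = t" using lt(2) by (intro nth_equalityI) (auto simp: lm)
      have ms: "(\<Sum>i<d. lookup m i) = sum_list t" unfolding sum[symmetric] mt ..
      have k: "a + sum_list t = k" using l lt by simp
      have "f m = l" unfolding f_def mt ms lt(1) using k by simp
      moreover have "m \<in> exps d k" unfolding exps_def mem_Collect_eq ms
        using k by (auto simp: in_keys_iff lm split: if_splits)
      ultimately show "l \<in> f ` exps d k" by blast
    qed
  qed
  ultimately have bij: "bij_betw f (exps d k) ?L" by (simp add: bij_betw_def)
  have "finite ?L"
    by (rule finite_subset[OF _ finite_lists_length_eq[of "{..k}" "Suc d"]]) (use member_le_sum_list in fastforce)+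
  then show "finite (exps d k)" using bij bij_betw_finite by blast
  have "card (exps d k) = (k + Suc d - 1) choose k"
    using bij_betw_same_card[OF bij] card_length_sum_list by simp
  also have "\<dots> = (d + k) choose d" using binomial_symmetric[of k "d + k"] by (simp add: add.commute)
  finally show "card (exps d k) = (d + k) choose d" .
qed

lemma id_bigo_1: "(\<lambda>x::complex. x) \<in> O[at 0](\<lambda>_. 1)"
proof (rule bigoI[of _ 1])
  have "\<forall>\<^sub>F x::complex in at 0. dist x 0 < 1"
    unfolding eventually_at by (intro exI[of _ 1]) auto
  then show "\<forall>\<^sub>F x::complex in at 0. norm x \<le> 1 * norm (1::complex)" by eventually_elim (simp add: dist_norm)
qed

lemma power_bigo: "m \<le> n \<Longrightarrow> (\<lambda>x::complex. x ^ n) \<in> O[at 0](\<lambda>x. x ^ m)"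
proof -
  assume "m \<le> n"
  have "(\<lambda>x::complex. x ^ m * x ^ (n - m)) \<in> O[at 0](\<lambda>x. x ^ m * 1 ^ (n - m))"
    by (intro landau_o.big.mult landau_o.big_power id_bigo_1 landau_o.big_refl)
  then show ?thesis using \<open>m \<le> n\<close> by (simp flip: power_add)
qed

text \<open>Convergence at rate \<open>x\<close> is the regularity of arcs on which the Newton
  iteration rests; polynomial expressions preserve it.\<close>

definition tends_linearly :: "(complex \<Rightarrow> complex) \<Rightarrow> complex \<Rightarrow> bool" where
  "tends_linearly f l \<longleftrightarrow> (\<lambda>x. f x - l) \<in> O[at 0](\<lambda>x. x)"

lemma tends_linearly_const [simp]: "tends_linearly (\<lambda>_. c) c"
  by (simp add: tends_linearly_def)

lemma tends_linearly_add:
  assumes "tends_linearly f l" "tends_linearly g m" shows "tends_linearly (\<lambda>x. f x + g x) (l + m)"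
proof -
  have "(\<lambda>x. (f x - l) + (g x - m)) \<in> O[at 0](\<lambda>x. x)"
    using assms unfolding tends_linearly_def by (rule sum_in_bigo)
  then show ?thesis by (simp add: tends_linearly_def algebra_simps)
qed

lemma tends_linearly_mult:
  assumes f: "tends_linearly f l" and g: "tends_linearly g m"
  shows "tends_linearly (\<lambda>x. f x * g x) (l * m)"
proof -
  have g1: "(\<lambda>x. g x - m) \<in> O[at 0](\<lambda>_. 1)"
    using g landau_o.big_trans id_bigo_1 unfolding tends_linearly_def by blast
  have "(\<lambda>x. (f x - l) * (g x - m)) \<in> O[at 0](\<lambda>x. x * 1)"
    using f g1 unfolding tends_linearly_def by (rule landau_o.big.mult)
  moreover have "(\<lambda>x. l * (g x - m)) \<in> O[at 0](\<lambda>x. x)"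
    using g unfolding tends_linearly_def by (cases "l = 0") auto
  moreover have "(\<lambda>x. m * (f x - l)) \<in> O[at 0](\<lambda>x. x)"
    using f unfolding tends_linearly_def by (cases "m = 0") auto
  ultimately have "(\<lambda>x. (f x - l) * (g x - m) + (l * (g x - m) + m * (f x - l))) \<in> O[at 0](\<lambda>x. x)"
    by (simp add: sum_in_bigo)
  then show ?thesis by (simp add: tends_linearly_def algebra_simps)
qed

lemma tends_linearly_power: "tends_linearly f l \<Longrightarrow> tends_linearly (\<lambda>x. f x ^ k) (l ^ k)"
  by (induction k) (auto intro: tends_linearly_mult)

lemma tends_linearly_sum:
  "(\<And>i. i \<in> I \<Longrightarrow> tends_linearly (f i) (l i)) \<Longrightarrow> tends_linearly (\<lambda>x. \<Sum>i\<in>I. f i x) (\<Sum>i\<in>I. l i)"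
  by (induction I rule: infinite_finite_induct) (auto intro: tends_linearly_add)

lemma tends_linearly_prod:
  "(\<And>i. i \<in> I \<Longrightarrow> tends_linearly (f i) (l i)) \<Longrightarrow> tends_linearly (\<lambda>x. \<Prod>i\<in>I. f i x) (\<Prod>i\<in>I. l i)"
  by (induction I rule: infinite_finite_induct) (auto intro: tends_linearly_mult)

lemma tends_linearly_poly_eval:
  assumes "\<And>i. tends_linearly (\<lambda>x. c x i) (v i)"
  shows "tends_linearly (\<lambda>x. poly_eval F (c x)) (poly_eval F v)"
  unfolding poly_eval_def monom_eval_def
  by (intro tends_linearly_sum tends_linearly_mult tends_linearly_prod tends_linearly_power assms tends_linearly_const)

lemma tends_linearly_deriv:
  assumes "(f has_field_derivative D) (at 0)" shows "tends_linearly f (f 0)"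
  unfolding tends_linearly_def
proof (rule bigoI_tendsto[of _ _ D])
  show "((\<lambda>x. (f x - f 0) / x) \<longlongrightarrow> D) (at 0)"
    using assms by (simp add: has_field_derivative_iff)
  show "\<forall>\<^sub>F x::complex in at 0. x \<noteq> 0" by (simp add: eventually_at_filter)
qed

lemma monom_eval_bigo:
  assumes "\<And>i. (\<lambda>x. h x i) \<in> O[at 0](\<lambda>x. x)"
  shows "(\<lambda>x. monom_eval m (h x)) \<in> O[at 0](\<lambda>x::complex. x ^ (\<Sum>i\<in>keys m. lookup m i))"
proof -
  have "(\<lambda>x. \<Prod>i\<in>A. h x i ^ lookup m i) \<in> O[at 0](\<lambda>x::complex. x ^ (\<Sum>i\<in>A. lookup m i))" for A
  proof (induction A rule: infinite_finite_induct)
    case (insert i A)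
    have "(\<lambda>x. h x i ^ lookup m i * (\<Prod>i\<in>A. h x i ^ lookup m i))
      \<in> O[at 0](\<lambda>x. x ^ lookup m i * x ^ (\<Sum>i\<in>A. lookup m i))"
      by (intro landau_o.big.mult landau_o.big_power assms insert)
    then show ?case using insert by (simp add: power_add)
  qed auto
  then show ?thesis unfolding monom_eval_def .
qed

text \<open>Membership in \<open>S\<close> is asked only near 0: a projective curve moved into a
  chart by division leaves it where the denominator vanishes.\<close>

definition arc :: "(nat \<Rightarrow> complex) set \<Rightarrow> (nat \<Rightarrow> complex) \<Rightarrow> (complex \<Rightarrow> nat \<Rightarrow> complex) \<Rightarrow> bool" where
  "arc S v c \<longleftrightarrow> (\<forall>i. tends_linearly (\<lambda>x. c x i) (v i)) \<and> (\<forall>\<^sub>F x in at 0. c x \<in> S)"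

text \<open>Newton iteration, uniformly in the arc.\<close>

lemma coordinate_jet:
  assumes A: "\<And>i. vars_in J (A i)" and S: "\<And>w. w \<in> S \<Longrightarrow> (\<Sum>i\<le>D. poly_eval (A i) w * w j ^ i) = 0"
    and \<delta>: "(\<Sum>i\<le>D. of_nat i * poly_eval (A i) v * v j ^ (i - 1)) \<noteq> 0"
  shows "\<exists>T. vars_in J T \<and> (\<forall>c. arc S v c \<longrightarrow> (\<lambda>x. c x j - poly_eval T (c x)) \<in> O[at 0](\<lambda>x. x ^ Suc k))"
proof (induction k)
  case 0
  show ?case by (rule exI[of _ "cC (v j)"]) (auto simp: arc_def tends_linearly_def)
next
  case (Suc k)
  define \<delta> where "\<delta> = (\<Sum>i\<le>D. of_nat i * poly_eval (A i) v * v j ^ (i - 1))"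
  have \<delta>0: "\<delta> \<noteq> 0" using assms(3) by (simp add: \<delta>_def)
  obtain T where T: "vars_in J T"
    "\<And>c. arc S v c \<Longrightarrow> (\<lambda>x. c x j - poly_eval T (c x)) \<in> O[at 0](\<lambda>x. x ^ Suc k)" using Suc by blast
  \<comment> \<open>A Newton step with the derivative frozen at its value \<open>\<delta>\<close> at
    \<open>v\<close>, so that \<open>T'\<close> is again a polynomial in the variables
    \<open>J\<close>.\<close>
  define T' where "T' = T - cC (1 / \<delta>) * (\<Sum>i\<le>D. A i * T ^ i)"
  have "vars_in J T'" unfolding T'_def
    by (intro vars_in_diff vars_in_mult vars_in_sum vars_in_power T A vars_in_cC)
  moreover have "(\<lambda>x. c x j - poly_eval T' (c x)) \<in> O[at 0](\<lambda>x. x ^ Suc (Suc k))" if c: "arc S v c" for c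
  proof -
    define y where "y x = c x j" for x
    define t where "t x = poly_eval T (c x)" for x
    \<comment> \<open>\<open>Q\<close> is the divided difference of the relation between
      \<open>t\<close> and \<open>y\<close>. Both tend to \<open>v j\<close> along the arc, so
      \<open>Q\<close> tends to the derivative \<open>\<delta>\<close>.\<close>
    define Q where "Q x = (\<Sum>i\<le>D. poly_eval (A i) (c x) * (\<Sum>p<i. t x ^ (i - Suc p) * y x ^ p))" for x
    have cv: "tends_linearly (\<lambda>x. c x i) (v i)" for i using c by (simp add: arc_def)
    have d: "(\<lambda>x. y x - t x) \<in> O[at 0](\<lambda>x. x ^ Suc k)" using T(2)[OF c] by (simp add: y_def t_def)
    have "(\<lambda>x. x ^ Suc k) \<in> O[at 0](\<lambda>x::complex. x)" using power_bigo[of 1 "Suc k"] by simp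
    then have "tends_linearly (\<lambda>x. y x - t x) 0"
      using landau_o.big_trans[OF d] by (simp add: tends_linearly_def)
    then have "tends_linearly (\<lambda>x. y x + (- 1) * (y x - t x)) (v j + (- 1) * 0)"
      unfolding y_def by (intro tends_linearly_add tends_linearly_mult cv tends_linearly_const)
    then have t: "tends_linearly t (v j)" by (simp add: algebra_simps cong: if_cong)
    have "tends_linearly Q (\<Sum>i\<le>D. poly_eval (A i) v * (\<Sum>p<i. v j ^ (i - Suc p) * v j ^ p))"
      unfolding Q_def y_def
      by (intro tends_linearly_sum tends_linearly_mult tends_linearly_power tends_linearly_poly_eval cv t)
    also have "(\<Sum>i\<le>D. poly_eval (A i) v * (\<Sum>p<i. v j ^ (i - Suc p) * v j ^ p)) = \<delta>"
      unfolding \<delta>_def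
    proof (rule sum.cong[OF refl])
      fix i
      have "(\<Sum>p<i. v j ^ (i - Suc p) * v j ^ p) = (\<Sum>p<i. v j ^ (i - 1))"
        by (rule sum.cong) (auto simp flip: power_add)
      then show "poly_eval (A i) v * (\<Sum>p<i. v j ^ (i - Suc p) * v j ^ p)
        = of_nat i * poly_eval (A i) v * v j ^ (i - 1)" by simp
    qed
    finally have "(\<lambda>x. Q x - \<delta>) \<in> O[at 0](\<lambda>x. x)" by (simp add: tends_linearly_def)
    from landau_o.big.mult[OF d this]
    have prod: "(\<lambda>x. (y x - t x) * (Q x - \<delta>)) \<in> O[at 0](\<lambda>x. x ^ Suc (Suc k))" by (simp add: mult_ac)
    \<comment> \<open>The new error is a constant times \<open>(y - t) * (Q - \<delta>)\<close>: the
      old error of order \<open>k + 1\<close> gains a factor of order 1.\<close>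
    have ev: "\<forall>\<^sub>F x in at 0. c x j - poly_eval T' (c x) = - 1 / \<delta> * ((y x - t x) * (Q x - \<delta>))"
    proof -
      have "\<forall>\<^sub>F x in at 0. c x \<in> S" using c by (simp add: arc_def)
      then show ?thesis
      proof eventually_elim
        case (elim x)
        have "(y x - t x) * Q x = (\<Sum>i\<le>D. poly_eval (A i) (c x) * (y x ^ i - t x ^ i))"
          unfolding Q_def sum_distrib_left power_diff_sumr2
          by (rule sum.cong) (auto simp: mult_ac)
        also have "\<dots> = (\<Sum>i\<le>D. poly_eval (A i) (c x) * y x ^ i) - (\<Sum>i\<le>D. poly_eval (A i) (c x) * t x ^ i)"
          by (simp add: algebra_simps sum_subtractf)
        also have "(\<Sum>i\<le>D. poly_eval (A i) (c x) * y x ^ i) = 0" using S[OF elim] by (simp add: y_def)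
        finally have "poly_eval T' (c x) = t x + (y x - t x) * Q x / \<delta>"
          by (simp add: T'_def poly_eval_simps t_def)
        then show ?case using \<delta>0 by (simp add: y_def field_simps)
      qed
    qed
    show ?thesis
      using landau_o.big.in_cong[OF ev] prod \<delta>0 by simp
  qed
  ultimately show ?case by blast
qed

text \<open>Taylor expansion at \<open>v\<close>, with the coordinates in \<open>J\<close>
  renumbered from 0 by \<open>\<iota>\<close>. The coefficients \<open>t\<close> are those of the
  shifted polynomial; they are found before \<open>S\<close> and \<open>c\<close> are given and so
  serve all arcs through \<open>v\<close>.\<close>

lemma truncated_expansion:
  assumes J: "finite J" "card J \<le> d"
  shows "\<exists>\<iota> :: nat \<Rightarrow> nat. \<forall>T. vars_in J T \<longrightarrow> (\<exists>t. \<forall>S c. arc S v c \<longrightarrow>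
    (\<lambda>x. poly_eval T (c x) - (\<Sum>m\<in>exps d k. t m * monom_eval m (\<lambda>i. c x (\<iota> i) - v (\<iota> i))))
      \<in> O[at 0](\<lambda>x. x ^ Suc k))"
proof -
  obtain \<iota> where \<iota>: "bij_betw \<iota> {0..<card J} J" using ex_bij_betw_nat_finite[OF J(1)] by blast
  define pos where "pos = inv_into {0..<card J} \<iota>"
  have pos: "\<iota> (pos j) = j" "pos j < d" if "j \<in> J" for j
  proof -
    show "\<iota> (pos j) = j" unfolding pos_def by (rule bij_betw_inv_into_right[OF \<iota> that])
    have "pos j \<in> {0..<card J}"
      unfolding pos_def using bij_betwE[OF bij_betw_inv_into[OF \<iota>]] that by blast
    then show "pos j < d" using J(2) by simp
  qed
  show ?thesis
  proof (intro exI[of _ \<iota>] allI impI)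
    fix T assume T: "vars_in J T"
    define T' where "T' = psubst T (\<lambda>j. cC (v j) + cX (pos j))"
    have T'_vars: "vars_in {..<d} T'" unfolding T'_def
      by (rule vars_in_psubst[OF T]) (use pos in \<open>auto intro!: vars_in_add\<close>)
    have T'_eval: "poly_eval T' (\<lambda>i. w (\<iota> i) - v (\<iota> i)) = poly_eval T w" for w
      unfolding T'_def poly_eval_psubst
      by (rule poly_eval_cong[OF T]) (use pos in \<open>auto simp: poly_eval_simps\<close>)
    show "\<exists>t. \<forall>S c. arc S v c \<longrightarrow>
      (\<lambda>x. poly_eval T (c x) - (\<Sum>m\<in>exps d k. t m * monom_eval m (\<lambda>i. c x (\<iota> i) - v (\<iota> i))))
      \<in> O[at 0](\<lambda>x. x ^ Suc k)"
    proof (intro exI[of _ "lookup T'"] allI impI)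
      fix S c assume c: "arc S v c"
      define h where "h x i = c x (\<iota> i) - v (\<iota> i)" for x i
      have h: "(\<lambda>x. h x i) \<in> O[at 0](\<lambda>x. x)" for i using c by (simp add: arc_def tends_linearly_def h_def)
      have fin: "finite (keys T' \<union> exps d k)" using finite_exps by simp
      have "poly_eval T (c x) = (\<Sum>m\<in>keys T' \<union> exps d k. lookup T' m * monom_eval m (h x))" for x
        using T'_eval[of "c x"] poly_eval_superset[OF fin, of T'] by (simp add: h_def[abs_def])
      also have "(\<Sum>m\<in>keys T' \<union> exps d k. lookup T' m * monom_eval m (h x))
        = (\<Sum>m\<in>exps d k. lookup T' m * monom_eval m (h x)) + (\<Sum>m\<in>keys T' - exps d k. lookup T' m * monom_eval m (h x))" for x
        using sum.union_disjoint[of "exps d k" "keys T' - exps d k" "\<lambda>m. lookup T' m * monom_eval m (h x)"] finite_exps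
        by (simp add: Un_commute)
      finally have eq: "poly_eval T (c x) - (\<Sum>m\<in>exps d k. lookup T' m * monom_eval m (h x))
        = (\<Sum>m\<in>keys T' - exps d k. lookup T' m * monom_eval m (h x))" for x by simp
      have "(\<lambda>x. \<Sum>m\<in>keys T' - exps d k. lookup T' m * monom_eval m (h x)) \<in> O[at 0](\<lambda>x. x ^ Suc k)"
      proof (rule big_sum_in_bigo)
        fix m assume m: "m \<in> keys T' - exps d k"
        have "keys m \<subseteq> {..<d}" using m T'_vars by (auto simp: vars_in_def)
        moreover from this have "(\<Sum>i\<in>keys m. lookup m i) = (\<Sum>i<d. lookup m i)"
          by (intro sum.mono_neutral_left) (auto simp: in_keys_iff)
        ultimately have "Suc k \<le> (\<Sum>i\<in>keys m. lookup m i)" using m by (auto simp: exps_def)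
        then have "(\<lambda>x. monom_eval m (h x)) \<in> O[at 0](\<lambda>x. x ^ Suc k)"
          using landau_o.big_trans[OF monom_eval_bigo[of h m, OF h] power_bigo] by blast
        then show "(\<lambda>x. lookup T' m * monom_eval m (h x)) \<in> O[at 0](\<lambda>x. x ^ Suc k)"
          by (cases "lookup T' m = 0") auto
      qed
      then show "(\<lambda>x. poly_eval T (c x) - (\<Sum>m\<in>exps d k. lookup T' m * monom_eval m (\<lambda>i. c x (\<iota> i) - v (\<iota> i))))
        \<in> O[at 0](\<lambda>x. x ^ Suc k)" unfolding h_def[symmetric] eq .
    qed
  qed
qed

text \<open>One factor is split off at a time: after division by the \<open>K\<close>-th power the
  quotient is still bounded by a multiple of \<open>x\<close>, so it vanishes at
  \<open>\<sigma>\<close>.\<close>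

lemma poly_bigo_dvd:
  "(\<lambda>x. poly p (\<sigma> + x)) \<in> O[at 0](\<lambda>x. x ^ K) \<Longrightarrow> [:- \<sigma>, 1:] ^ K dvd (p :: complex poly)"
proof (induction K)
  case (Suc K)
  have "(\<lambda>x. poly p (\<sigma> + x)) \<in> O[at 0](\<lambda>x. x ^ K)"
    by (rule landau_o.big_trans[OF Suc.prems power_bigo]) simp
  then obtain q where q: "p = [:- \<sigma>, 1:] ^ K * q" using Suc.IH by (auto elim: dvdE)
  obtain C where C: "\<forall>\<^sub>F x in at 0. norm (poly p (\<sigma> + x)) \<le> C * norm (x ^ Suc K)"
    using Suc.prems by (auto elim: landau_o.bigE)
  have "\<forall>\<^sub>F x::complex in at 0. x \<noteq> 0" by (simp add: eventually_at_filter)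
  with C have bound: "\<forall>\<^sub>F x in at 0. norm (poly q (\<sigma> + x)) \<le> C * norm x"
  proof eventually_elim
    case (elim x)
    have "norm (poly p (\<sigma> + x)) = norm x ^ K * norm (poly q (\<sigma> + x))"
      by (simp add: q poly_power norm_mult norm_power)
    then have "norm x ^ K * norm (poly q (\<sigma> + x)) \<le> norm x ^ K * (C * norm x)"
      using elim by (simp add: norm_mult norm_power mult_ac)
    then show ?case using elim(2) by simp
  qed
  have "((\<lambda>x::complex. C * norm x) \<longlongrightarrow> C * norm (0::complex)) (at 0)"
    by (intro tendsto_intros)
  then have "((\<lambda>x::complex. C * norm x) \<longlongrightarrow> 0) (at 0)" by simp
  note lim0 = Lim_null_comparison[OF bound this]
  have "((\<lambda>x. poly q (\<sigma> + x)) \<longlongrightarrow> poly q (\<sigma> + 0)) (at 0)" by (intro tendsto_intros)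
  then have "((\<lambda>x. poly q (\<sigma> + x)) \<longlongrightarrow> poly q \<sigma>) (at 0)" by simp
  from tendsto_unique[OF _ this lim0] have "poly q \<sigma> = 0" by simp
  then have "[:- \<sigma>, 1:] dvd q" by (simp add: poly_eq_0_iff_dvd)
  then have "[:- \<sigma>, 1:] ^ K * [:- \<sigma>, 1:] dvd p" unfolding q by (rule mult_dvd_mono[OF dvd_refl])
  then show ?case by (simp only: power_Suc2)
qed simp

section \<open>Osculating spaces\<close>

text \<open>Take a relation for the coordinate \<open>j\<close> of least degree over the polynomials
  in \<open>J\<close>. Its derivative has smaller degree and, in characteristic zero, a nonzero
  leading coefficient, so by minimality it cannot vanish on all of \<open>S\<close>.\<close>

lemma separating_relation:
  assumes I: "prime_pideal (vanishing_ideal S)" and ind: "independent_mod (vanishing_ideal S) J"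
    and dep: "\<not> independent_mod (vanishing_ideal S) (insert j J)" and j: "j \<notin> J"
  shows "\<exists>D A. (\<forall>i. vars_in J (A i)) \<and> (\<forall>w\<in>S. (\<Sum>i\<le>D. poly_eval (A i) w * w j ^ i) = 0) \<and>
    (\<exists>w\<in>S. (\<Sum>i\<le>D. of_nat i * poly_eval (A i) w * w j ^ (i - 1)) \<noteq> 0)"
proof -
  define rel where "rel D A \<longleftrightarrow> (\<forall>i. vars_in J (A i)) \<and> A D \<noteq> 0 \<and>
    (\<forall>w\<in>S. (\<Sum>i\<le>D. poly_eval (A i) w * w j ^ i) = 0)" for D and A :: "nat \<Rightarrow> nat cpoly"
  obtain F where F: "F \<in> vanishing_ideal S" "vars_in (insert j J) F" "F \<noteq> 0"
    using dep by (auto simp: independent_mod_def)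
  obtain E where E: "\<And>m. m \<in> keys F \<Longrightarrow> lookup m j \<le> E" using exists_exponent_bound[of F j] by blast
  obtain i0 where i0: "cpart j i0 F \<noteq> 0" using cpart_eq_0_imp_eq_0[of j F] F(3) by blast
  have bd: "i \<le> E" if "cpart j i F \<noteq> 0" for i
  proof -
    obtain m where "m \<in> keys (cpart j i F)" using \<open>cpart j i F \<noteq> 0\<close> by (metis poly_mapping_eqI in_keys_iff lookup_zero)
    then show ?thesis using keys_cpart[of m j i F] E by blast
  qed
  define D0 where "D0 = (GREATEST i. cpart j i F \<noteq> 0)"
  have D0: "cpart j D0 F \<noteq> 0" unfolding D0_def by (rule GreatestI_nat[where P = "\<lambda>i. cpart j i F \<noteq> 0", OF i0 bd])
  have D0_max: "i \<le> D0" if "cpart j i F \<noteq> 0" for i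
    unfolding D0_def by (rule Greatest_le_nat[where P = "\<lambda>i. cpart j i F \<noteq> 0", OF that bd])
  have "rel D0 (\<lambda>i. cpart j i F)" unfolding rel_def
  proof (intro conjI allI ballI)
    show "vars_in J (cpart j i F)" for i using vars_in_cpart[OF F(2), of j i] j by simp
    fix w assume "w \<in> S"
    then have "0 = (\<Sum>i\<le>E. poly_eval (cpart j i F) w * w j ^ i)"
      using F(1) poly_eval_cpart[of F j E w, OF E] by (simp add: vanishing_ideal_def)
    also have "\<dots> = (\<Sum>i\<le>D0. poly_eval (cpart j i F) w * w j ^ i)"
      by (rule sum.mono_neutral_right) (use bd[OF D0] D0_max in force)+
    finally show "(\<Sum>i\<le>D0. poly_eval (cpart j i F) w * w j ^ i) = 0" by simp
  qed (rule D0)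
  then have ex: "\<exists>D A. rel D A" by blast
  define D where "D = (LEAST D. \<exists>A. rel D A)"
  have "\<exists>A. rel D A" unfolding D_def by (rule LeastI_ex[OF ex])
  then obtain A where A: "rel D A" by blast
  have "D \<noteq> 0"
  proof
    assume "D = 0"
    then have "A 0 \<in> vanishing_ideal S" "vars_in J (A 0)" "A 0 \<noteq> 0"
      using A by (auto simp: rel_def vanishing_ideal_def)
    then show False using ind by (auto simp: independent_mod_def)
  qed
  then obtain D' where D': "D = Suc D'" using not0_implies_Suc by blast
  define B where "B i = cC (of_nat (Suc i)) * A (Suc i)" for i
  have "\<not> rel D' B" using not_less_Least[of D' "\<lambda>D. \<exists>A. rel D A"] D' by (auto simp: D_def)
  moreover have "B D' \<noteq> 0"
  proof
    assume "B D' = 0"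
    then have "lookup (B D') m = 0" for m by simp
    then have "lookup (A D) m = 0" for m using D' by (simp add: B_def lookup_cC_mult del: of_nat_Suc)
    then show False using A by (auto simp: rel_def intro: poly_mapping_eqI)
  qed
  moreover have "vars_in J (B i)" for i using A by (auto simp: B_def rel_def intro: vars_in_mult)
  ultimately obtain w where w: "w \<in> S" "(\<Sum>i\<le>D'. poly_eval (B i) w * w j ^ i) \<noteq> 0"
    by (auto simp: rel_def)
  have "(\<Sum>i\<le>D. of_nat i * poly_eval (A i) w * w j ^ (i - 1)) = (\<Sum>i\<le>D'. poly_eval (B i) w * w j ^ i)"
    unfolding D' by (simp add: sum.atMost_Suc_shift B_def poly_eval_simps del: sum.atMost_Suc of_nat_Suc)
  then have "(\<Sum>i\<le>D. of_nat i * poly_eval (A i) w * w j ^ (i - 1)) \<noteq> 0" using w(2) by simp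
  then show ?thesis using A w(1) unfolding rel_def by blast
qed

text \<open>\<open>L\<close> consists of the Taylor coefficient vectors of the coordinates as
  functions of those in \<open>J\<close>, one vector for each monomial of degree at most
  \<open>k\<close>. A functional vanishing on them kills the \<open>k\<close>-jet of every curve in
  \<open>X\<close> through \<open>v\<close>, which is the stated divisibility.\<close>

lemma osculation_at:
  assumes J: "finite J" "card J \<le> d" and j0: "j0 \<le> N" and X: "proj_variety N X"
    and v: "v \<in> \<Union>X" "v j0 \<noteq> 0"
    and jet: "\<And>j. j \<le> N \<Longrightarrow> \<exists>T. vars_in J T \<and> (\<forall>c. arc (affine_piece j0 X) (cscale (1 / v j0) v) c \<longrightarrow>
      (\<lambda>x. c x j - poly_eval T (c x)) \<in> O[at 0](\<lambda>x. x ^ Suc k))"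
  shows "\<exists>L. finite L \<and> card L \<le> (d + k) choose d \<and>
    (\<forall>l G \<sigma>. (\<forall>w\<in>L. (\<Sum>i\<le>N. l i * w i) = 0) \<longrightarrow> (\<forall>x. (\<lambda>i. poly (G i) x) \<in> \<Union>X) \<longrightarrow>
      (\<lambda>i. poly (G i) \<sigma>) = v \<longrightarrow> [:- \<sigma>, 1:] ^ Suc k dvd (\<Sum>i\<le>N. smult (l i) (G i)))"
proof -
  define v1 where "v1 = cscale (1 / v j0) v"
  let ?S = "affine_piece j0 X"
  have "\<forall>j. \<exists>T. j \<le> N \<longrightarrow> vars_in J T \<and> (\<forall>c. arc ?S v1 c \<longrightarrow>
      (\<lambda>x. c x j - poly_eval T (c x)) \<in> O[at 0](\<lambda>x. x ^ Suc k))"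
    using jet unfolding v1_def by blast
  from choice[OF this] obtain T where T: "\<And>j. j \<le> N \<Longrightarrow> vars_in J (T j)"
    "\<And>j c. j \<le> N \<Longrightarrow> arc ?S v1 c \<Longrightarrow> (\<lambda>x. c x j - poly_eval (T j) (c x)) \<in> O[at 0](\<lambda>x. x ^ Suc k)" by blast
  obtain \<iota> where \<iota>: "\<And>T. vars_in J T \<Longrightarrow> \<exists>t. \<forall>S c. arc S v1 c \<longrightarrow>
    (\<lambda>x. poly_eval T (c x) - (\<Sum>m\<in>exps d k. t m * monom_eval m (\<lambda>i. c x (\<iota> i) - v1 (\<iota> i))))
      \<in> O[at 0](\<lambda>x. x ^ Suc k)" using truncated_expansion[OF J] by blast
  have "\<forall>j. \<exists>t. j \<le> N \<longrightarrow> (\<forall>S c. arc S v1 c \<longrightarrow>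
    (\<lambda>x. poly_eval (T j) (c x) - (\<Sum>m\<in>exps d k. t m * monom_eval m (\<lambda>i. c x (\<iota> i) - v1 (\<iota> i))))
      \<in> O[at 0](\<lambda>x. x ^ Suc k))" using \<iota> T(1) by blast
  from choice[OF this] obtain t where t: "\<And>j S c. j \<le> N \<Longrightarrow> arc S v1 c \<Longrightarrow>
    (\<lambda>x. poly_eval (T j) (c x) - (\<Sum>m\<in>exps d k. t j m * monom_eval m (\<lambda>i. c x (\<iota> i) - v1 (\<iota> i))))
      \<in> O[at 0](\<lambda>x. x ^ Suc k)" by blast
  define L where "L = (\<lambda>m j. t j m) ` exps d k"
  have "finite L" unfolding L_def using finite_exps by blast
  moreover have "card L \<le> (d + k) choose d"
    unfolding L_def card_exps[symmetric] by (rule card_image_le[OF finite_exps])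
  moreover have "[:- \<sigma>, 1:] ^ Suc k dvd (\<Sum>i\<le>N. smult (l i) (G i))"
    if l: "\<forall>w\<in>L. (\<Sum>i\<le>N. l i * w i) = 0" and GX: "\<forall>x. (\<lambda>i. poly (G i) x) \<in> \<Union>X"
      and G\<sigma>: "(\<lambda>i. poly (G i) \<sigma>) = v" for l G \<sigma>
  proof (rule poly_bigo_dvd)
    have Gi: "poly (G i) \<sigma> = v i" for i using fun_cong[OF G\<sigma>, of i] .
    \<comment> \<open>Division by the coordinate \<open>j0\<close> moves the curve into the chart;
      multiplication by the bounded function \<open>poly (G j0) (\<sigma> + x)\<close> undoes it at
      the end.\<close>
    define c where "c x = cscale (1 / poly (G j0) (\<sigma> + x)) (\<lambda>i. poly (G i) (\<sigma> + x))" for x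
    have lim: "((\<lambda>x. poly (G j0) (\<sigma> + x)) \<longlongrightarrow> poly (G j0) (\<sigma> + 0)) (at 0)" by (intro tendsto_intros)
    then have nz: "\<forall>\<^sub>F x in at 0. poly (G j0) (\<sigma> + x) \<noteq> 0"
      using v(2) Gi[of j0] by (intro tendsto_imp_eventually_ne) auto
    have "tends_linearly (\<lambda>x. c x i) (c 0 i)" for i
    proof -
      have "((\<lambda>x. 1 / poly (G j0) (\<sigma> + x) * poly (G i) (\<sigma> + x)) has_field_derivative
         (poly (pderiv (G i)) \<sigma> * poly (G j0) \<sigma> - poly (G i) \<sigma> * poly (pderiv (G j0)) \<sigma>) / (poly (G j0) \<sigma>)\<^sup>2) (at 0)"
        using v(2) Gi[of j0]
        by (auto intro!: derivative_eq_intros poly_DERIV[THEN DERIV_chain2] simp: field_simps power2_eq_square)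
      from tends_linearly_deriv[OF this] show ?thesis by (simp add: c_def cscale_def)
    qed
    moreover have "c 0 = v1" by (simp add: c_def v1_def cscale_def Gi)
    moreover have "\<forall>\<^sub>F x in at 0. c x \<in> ?S" using nz
    proof eventually_elim
      case (elim x)
      then show ?case unfolding c_def using affine_piece_scale[OF X GX[rule_format, of "\<sigma> + x"], of j0] by simp
    qed
    ultimately have c: "arc ?S v1 c" by (auto simp: arc_def)
    define h where "h m x = monom_eval m (\<lambda>i. c x (\<iota> i) - v1 (\<iota> i))" for m x
    have ci: "(\<lambda>x. c x i - (\<Sum>m\<in>exps d k. t i m * h m x)) \<in> O[at 0](\<lambda>x. x ^ Suc k)" if "i \<le> N" for i
      using sum_in_bigo(1)[OF T(2)[OF that c] t[OF that c]] by (simp add: h_def)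
    have "(\<lambda>x. \<Sum>i\<le>N. l i * (c x i - (\<Sum>m\<in>exps d k. t i m * h m x))) \<in> O[at 0](\<lambda>x. x ^ Suc k)"
    proof (rule big_sum_in_bigo)
      fix i assume "i \<in> {..N}"
      then show "(\<lambda>x. l i * (c x i - (\<Sum>m\<in>exps d k. t i m * h m x))) \<in> O[at 0](\<lambda>x. x ^ Suc k)"
        using ci[of i] by (cases "l i = 0") auto
    qed
    also have "(\<lambda>x. \<Sum>i\<le>N. l i * (c x i - (\<Sum>m\<in>exps d k. t i m * h m x))) = (\<lambda>x. \<Sum>i\<le>N. l i * c x i)"
    proof
      fix x
      have "(\<Sum>i\<le>N. l i * (\<Sum>m\<in>exps d k. t i m * h m x)) = (\<Sum>m\<in>exps d k. (\<Sum>i\<le>N. l i * t i m) * h m x)"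
        by (simp add: sum_distrib_left sum_distrib_right mult.assoc) (rule sum.swap)
      also have "\<dots> = 0" using l by (intro sum.neutral) (auto simp: L_def)
      finally show "(\<Sum>i\<le>N. l i * (c x i - (\<Sum>m\<in>exps d k. t i m * h m x))) = (\<Sum>i\<le>N. l i * c x i)"
        by (simp add: right_diff_distrib sum_subtractf)
    qed
    finally have lc: "(\<lambda>x. \<Sum>i\<le>N. l i * c x i) \<in> O[at 0](\<lambda>x. x ^ Suc k)" .
    have ev: "\<forall>\<^sub>F x in at 0. poly (\<Sum>i\<le>N. smult (l i) (G i)) (\<sigma> + x)
      = poly (G j0) (\<sigma> + x) * (\<Sum>i\<le>N. l i * c x i)" using nz
      by eventually_elim (simp add: poly_sum c_def cscale_def sum_distrib_left)
    have "(\<lambda>x. poly (G j0) (\<sigma> + x)) \<in> O[at 0](\<lambda>_. 1)"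
      by (rule bigoI_tendsto[of _ _ "poly (G j0) (\<sigma> + 0)"]) (use lim in simp_all)
    from landau_o.big.mult[OF this lc]
    show "(\<lambda>x. poly (\<Sum>i\<le>N. smult (l i) (G i)) (\<sigma> + x)) \<in> O[at 0](\<lambda>x. x ^ Suc k)"
      using landau_o.big.in_cong[OF ev] by simp
  qed
  ultimately show ?thesis by blast
qed

text \<open>A maximal independent set \<open>J\<close> of coordinates on a chart has at most
  \<open>d\<close> elements. Every other coordinate satisfies a relation over \<open>J\<close> with
  derivative not identically zero, and Newton iteration applies wherever none of these derivatives
  vanishes. By primeness of the vanishing ideal such points exist, and one form \<open>F\<close>
  describes them.\<close>

theorem generic_osculation:
  assumes X: "proj_variety N X" and dim: "has_dimension (zariski N) X d"
  shows "\<exists>e F. form N e F \<and> (\<exists>v\<in>\<Union>X. poly_eval F v \<noteq> 0) \<and>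
    (\<forall>v\<in>\<Union>X. poly_eval F v \<noteq> 0 \<longrightarrow> (\<forall>k. \<exists>L. finite L \<and> card L \<le> (d + k) choose d \<and>
      (\<forall>l G \<sigma>. (\<forall>w\<in>L. (\<Sum>i\<le>N. l i * w i) = 0) \<longrightarrow> (\<forall>x. (\<lambda>i. poly (G i) x) \<in> \<Union>X) \<longrightarrow>
        (\<lambda>i. poly (G i) \<sigma>) = v \<longrightarrow> [:- \<sigma>, 1:] ^ Suc k dvd (\<Sum>i\<le>N. smult (l i) (G i)))))"
proof -
  have "X \<noteq> {}" using X by (simp add: proj_variety_def irreducible_set_def)
  then obtain v where v: "line v \<in> X" "v \<in> cvec N" "v \<noteq> 0"
    using variety_subset[OF X] by (fastforce simp: proj_space_def)
  then obtain j0 where j0: "j0 \<le> N" "v j0 \<noteq> 0" by (auto simp: cvec_def fun_eq_iff) (metis not_le)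
  let ?S = "affine_piece j0 X"
  let ?I = "vanishing_ideal ?S"
  have ne: "?S \<noteq> {}" using affine_piece_scale[OF X, of v j0] v(1) j0(2) line_self[of v] by blast
  have I: "prime_pideal ?I" by (rule prime_vanishing_ideal[OF X j0(1) ne])
  have "independent_mod ?I {}" unfolding independent_mod_def
  proof (intro ballI impI)
    fix F assume F: "F \<in> ?I" "vars_in {} F"
    obtain w where "w \<in> ?S" using ne by blast
    then have "poly_eval F x = 0" for x
      using F poly_eval_cong[OF F(2), of x w] by (simp add: vanishing_ideal_def)
    then show "F = 0" by (rule poly_eval_eq_0_imp_eq_0)
  qed
  then have "{} \<in> {J. J \<subseteq> {..N} \<and> independent_mod ?I J}" by simp
  moreover have "finite {J. J \<subseteq> {..N} \<and> independent_mod ?I J}" by simp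
  ultimately obtain J where J: "J \<subseteq> {..N}" "independent_mod ?I J"
    and J_max: "\<And>J'. J \<subseteq> J' \<Longrightarrow> J' \<subseteq> {..N} \<Longrightarrow> independent_mod ?I J' \<Longrightarrow> J' = J"
    using finite_has_maximal[of "{J. J \<subseteq> {..N} \<and> independent_mod ?I J}"] by (metis (mono_tags, lifting) empty_iff mem_Collect_eq)
  have finJ: "finite J" using J(1) finite_subset by blast
  have cardJ: "card J \<le> d" by (rule independent_card_le_dimension[OF X dim j0(1) ne finJ J(2)])
  have "\<forall>j. \<exists>D A. j \<in> {..N} - J \<longrightarrow> (\<forall>i. vars_in J (A i)) \<and>
    (\<forall>w\<in>?S. (\<Sum>i\<le>D. poly_eval (A i) w * w j ^ i) = 0) \<and>
    (\<exists>w\<in>?S. (\<Sum>i\<le>D. of_nat i * poly_eval (A i) w * w j ^ (i - 1)) \<noteq> 0)"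
  proof (intro allI)
    fix j
    show "\<exists>D A. j \<in> {..N} - J \<longrightarrow> (\<forall>i. vars_in J (A i)) \<and>
      (\<forall>w\<in>?S. (\<Sum>i\<le>D. poly_eval (A i) w * w j ^ i) = 0) \<and>
      (\<exists>w\<in>?S. (\<Sum>i\<le>D. of_nat i * poly_eval (A i) w * w j ^ (i - 1)) \<noteq> 0)"
    proof (cases "j \<in> {..N} - J")
      case True
      then have "\<not> independent_mod ?I (insert j J)" using J_max[of "insert j J"] J(1) by blast
      from separating_relation[OF I J(2) this] True show ?thesis by blast
    qed blast
  qed
  from choice[OF this] obtain D where "\<forall>j. \<exists>A. j \<in> {..N} - J \<longrightarrow> (\<forall>i. vars_in J (A i)) \<and>
    (\<forall>w\<in>?S. (\<Sum>i\<le>D j. poly_eval (A i) w * w j ^ i) = 0) \<and>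
    (\<exists>w\<in>?S. (\<Sum>i\<le>D j. of_nat i * poly_eval (A i) w * w j ^ (i - 1)) \<noteq> 0)" by (rule exE)
  from choice[OF this] obtain A where A: "\<And>i j. j \<in> {..N} - J \<Longrightarrow> vars_in J (A j i)"
    "\<And>j w. j \<in> {..N} - J \<Longrightarrow> w \<in> ?S \<Longrightarrow> (\<Sum>i\<le>D j. poly_eval (A j i) w * w j ^ i) = 0"
    "\<And>j. j \<in> {..N} - J \<Longrightarrow> \<exists>w\<in>?S. (\<Sum>i\<le>D j. of_nat i * poly_eval (A j i) w * w j ^ (i - 1)) \<noteq> 0"
    by blast
  define R where "R j = (\<Sum>i\<le>D j. cC (of_nat i) * A j i * cX j ^ (i - 1))" for j
  have R: "poly_eval (R j) w = (\<Sum>i\<le>D j. of_nat i * poly_eval (A j i) w * w j ^ (i - 1))" for j w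
    by (simp add: R_def poly_eval_simps)
  have "R j \<notin> ?I" if "j \<in> {..N} - J" for j using A(3)[OF that] by (auto simp: vanishing_ideal_def R)
  moreover have "(\<Prod>j\<in>K. R j) \<notin> ?I" if "finite K" "\<And>j. j \<in> K \<Longrightarrow> R j \<notin> ?I" for K
    using that I by (induction K rule: finite_induct) (auto simp: prime_pideal_def)
  ultimately have "(\<Prod>j\<in>{..N} - J. R j) \<notin> ?I" by blast
  then obtain w where w: "w \<in> ?S" "\<And>j. j \<in> {..N} - J \<Longrightarrow> poly_eval (R j) w \<noteq> 0"
    by (auto simp: vanishing_ideal_def poly_eval_simps prod_zero_iff)
  have "\<forall>j. \<exists>e H. form N e H \<and> (\<forall>v\<in>cvec N. v j0 = 1 \<longrightarrow> poly_eval H v = poly_eval (R j) v)"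
    using homogenization[OF j0(1)] by blast
  from choice[OF this] obtain e where "\<forall>j. \<exists>H. form N (e j) H \<and>
    (\<forall>v\<in>cvec N. v j0 = 1 \<longrightarrow> poly_eval H v = poly_eval (R j) v)" by (rule exE)
  from choice[OF this] obtain H where H: "\<And>j. form N (e j) (H j)"
    "\<And>j v. v \<in> cvec N \<Longrightarrow> v j0 = 1 \<Longrightarrow> poly_eval (H j) v = poly_eval (R j) v" by blast
  \<comment> \<open>The factor \<open>cX j0\<close> excludes points outside the chart; the factors
    \<open>H j\<close> exclude those where the derivative of a relation vanishes.\<close>
  define F where "F = cX j0 * (\<Prod>j\<in>{..N} - J. H j)"
  have formF: "form N (1 + (\<Sum>j\<in>{..N} - J. e j)) F"
    unfolding F_def by (intro form_mult form_prod H(1) form_cX j0(1))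
  have piece: "u \<in> cvec N \<and> u j0 = 1 \<and> u \<in> \<Union>X" if "u \<in> ?S" for u
    using that variety_cone_cvec[OF X] by (auto simp: affine_piece_def)
  have "poly_eval F w \<noteq> 0"
    using w piece[OF w(1)] H(2) by (auto simp: F_def poly_eval_simps prod_zero_iff)
  then have nonvan: "\<exists>w\<in>\<Union>X. poly_eval F w \<noteq> 0" using piece[OF w(1)] by blast
  have osc: "\<exists>L. finite L \<and> card L \<le> (d + k) choose d \<and>
      (\<forall>l G \<sigma>. (\<forall>w\<in>L. (\<Sum>i\<le>N. l i * w i) = 0) \<longrightarrow> (\<forall>x. (\<lambda>i. poly (G i) x) \<in> \<Union>X) \<longrightarrow>
        (\<lambda>i. poly (G i) \<sigma>) = v \<longrightarrow> [:- \<sigma>, 1:] ^ Suc k dvd (\<Sum>i\<le>N. smult (l i) (G i)))"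
    if v: "v \<in> \<Union>X" "poly_eval F v \<noteq> 0" for v k
  proof (rule osculation_at[OF finJ cardJ j0(1) X v(1)])
    show vj: "v j0 \<noteq> 0" using v(2) by (auto simp: F_def poly_eval_simps)
    let ?v = "cscale (1 / v j0) v"
    have v1: "?v \<in> ?S" by (rule affine_piece_scale[OF X v(1) vj])
    fix j assume j: "j \<le> N"
    show "\<exists>T. vars_in J T \<and> (\<forall>c. arc ?S ?v c \<longrightarrow> (\<lambda>x. c x j - poly_eval T (c x)) \<in> O[at 0](\<lambda>x. x ^ Suc k))"
    proof (cases "j \<in> J")
      case True
      then show ?thesis by (intro exI[of _ "cX j"]) auto
    next
      case False
      then have j': "j \<in> {..N} - J" using j by simp
      have "poly_eval (H j) v \<noteq> 0" using v(2) j' by (auto simp: F_def poly_eval_simps prod_zero_iff)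
      then have "poly_eval (H j) ?v \<noteq> 0" using vj by (simp add: poly_eval_form_scale[OF H(1)])
      then have "poly_eval (R j) ?v \<noteq> 0" using H(2)[of ?v j] piece[OF v1] by simp
      then have "(\<Sum>i\<le>D j. of_nat i * poly_eval (A j i) ?v * ?v j ^ (i - 1)) \<noteq> 0" by (simp only: R not_False_eq_True)
      from coordinate_jet[where A = "A j", OF A(1)[OF j'] A(2)[OF j'] this] show ?thesis by blast
    qed
  qed
  show ?thesis
    by (intro exI[of _ "1 + (\<Sum>j\<in>{..N} - J. e j)"] exI[of _ F] conjI ballI impI allI)
      (rule formF nonvan osc; assumption?)+
qed

section \<open>Duality, and reduction of intrinsic rational normal curves to a normal form\<close>

section \<open>Linear functionals\<close>

lemma sum_fun_apply: "(\<Sum>i\<in>I. f i) x = (\<Sum>i\<in>I. f i x)"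
  for f :: "'a \<Rightarrow> 'b \<Rightarrow> complex"
  by (induction I rule: infinite_finite_induct) auto

lemma linear_functional_extension:
  assumes B: "cfun.independent B" "B \<subseteq> cvec N"
  shows "\<exists>l. \<forall>v\<in>B. (\<Sum>j\<le>N. l j * v j) = f v"
proof -
  interpret c: vector_space "(*) :: complex \<Rightarrow> complex \<Rightarrow> complex"
    by unfold_locales (auto simp: algebra_simps)
  interpret vp: vector_space_pair cscale "(*) :: complex \<Rightarrow> complex \<Rightarrow> complex" ..
  obtain g where g: "Vector_Spaces.linear cscale (*) g" "\<forall>v\<in>B. g v = f v"
    using vp.linear_independent_extend[OF B(1)] by blast
  interpret g: Vector_Spaces.linear cscale "(*)" g by (rule g(1))
  define e where "e j = (\<lambda>i. if i = j then 1 else 0 :: complex)" for j :: nat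
  have "(\<Sum>j\<le>N. g (e j) * v j) = f v" if v: "v \<in> B" for v
  proof -
    have "v = (\<Sum>j\<le>N. cscale (v j) (e j))"
    proof
      fix i
      have "(\<Sum>j\<le>N. cscale (v j) (e j)) i = (\<Sum>j\<le>N. v j * (if i = j then 1 else 0))"
        by (simp only: sum_fun_apply cscale_def e_def)
      also have "\<dots> = (\<Sum>j\<le>N. if j = i then v i else 0)" by (rule sum.cong) auto
      finally have "(\<Sum>j\<le>N. cscale (v j) (e j)) i = (\<Sum>j\<le>N. if j = i then v i else 0)" .
      then show "v i = (\<Sum>j\<le>N. cscale (v j) (e j)) i" using B(2) v by (auto simp: cvec_def)
    qed
    then have "g v = (\<Sum>j\<le>N. v j * g (e j))" by (metis (no_types, lifting) g.sum g.scale sum.cong)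
    then show ?thesis using g(2) v by (simp add: mult.commute)
  qed
  then show ?thesis by (intro exI[of _ "\<lambda>j. g (e j)"]) blast
qed

lemma linear_functional_separation:
  assumes S: "S \<subseteq> cvec N" and v: "v \<in> cvec N" "v \<notin> cfun.span S"
  shows "\<exists>l. (\<forall>w\<in>S. (\<Sum>j\<le>N. l j * w j) = 0) \<and> (\<Sum>j\<le>N. l j * v j) = 1"
proof -
  obtain B where B: "B \<subseteq> S" "cfun.independent B" "S \<subseteq> cfun.span B"
    using cfun.maximal_independent_subset[of S] by blast
  have vB: "v \<notin> cfun.span B" using v(2) B(1) cfun.span_mono by blast
  have "cfun.independent (insert v B)" using cfun.independent_insertI[OF vB B(2)] .
  moreover have "insert v B \<subseteq> cvec N" using B S v by blast
  ultimately obtain l where l: "\<forall>w\<in>insert v B. (\<Sum>j\<le>N. l j * w j) = (if w = v then 1 else 0)"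
    using linear_functional_extension[of "insert v B" N "\<lambda>w. if w = v then 1 else 0"] by blast
  let ?T = "{w. (\<Sum>j\<le>N. l j * w j) = 0}"
  have "v \<notin> B" using vB cfun.span_base by blast
  then have "B \<subseteq> ?T" using l by auto
  moreover have "cfun.subspace ?T"
    by (rule cfun.subspaceI)
      (auto simp: cscale_def distrib_left sum.distrib mult.left_commute simp flip: sum_distrib_left)
  ultimately have "cfun.span B \<subseteq> ?T" by (rule cfun.span_minimal)
  then show ?thesis using B(3) l by (intro exI[of _ l]) auto
qed

definition linear_form :: "nat \<Rightarrow> (nat \<Rightarrow> complex) \<Rightarrow> nat cpoly" where
  "linear_form N l = (\<Sum>j\<le>N. cC (l j) * cX j)"

lemma form_linear_form: "form N 1 (linear_form N l)"
  unfolding linear_form_def by (intro form_sum form_cmult form_cX) auto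

lemma poly_eval_linear_form [simp]: "poly_eval (linear_form N l) v = (\<Sum>j\<le>N. l j * v j)"
  by (simp add: linear_form_def poly_eval_simps)

text \<open>Inclusion in a span is tested by duality, because all bounds on spans here come from
  hyperplanes containing a given set.\<close>

lemma cone_subset_span:
  assumes S: "S \<subseteq> cvec N" "T \<subseteq> cvec N"
    and van: "\<And>l. (\<And>w. w \<in> S \<Longrightarrow> (\<Sum>j\<le>N. l j * w j) = 0) \<Longrightarrow> \<forall>v\<in>T. (\<Sum>j\<le>N. l j * v j) = 0"
  shows "T \<subseteq> cfun.span S"
proof (rule subsetI, rule ccontr)
  fix v assume v: "v \<in> T" "v \<notin> cfun.span S"
  then obtain l where l: "\<forall>w\<in>S. (\<Sum>j\<le>N. l j * w j) = 0" "(\<Sum>j\<le>N. l j * v j) = 1"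
    using linear_functional_separation[OF S(1), of v] S(2) by blast
  have "\<forall>v\<in>T. (\<Sum>j\<le>N. l j * v j) = 0" by (rule van) (use l in blast)
  then show False using v(1) l(2) by auto
qed

section \<open>Normal form of rational normal curves\<close>

definition vcurve :: "(nat \<Rightarrow> nat \<Rightarrow> complex) \<Rightarrow> nat \<Rightarrow> complex \<Rightarrow> complex \<Rightarrow> nat \<Rightarrow> complex" where
  "vcurve w q s t = (\<lambda>j. \<Sum>k\<le>q. s ^ (q - k) * t ^ k * w k j)"

definition rnc :: "(nat \<Rightarrow> nat \<Rightarrow> complex) \<Rightarrow> nat \<Rightarrow> ppoint set" where
  "rnc w q = {line (vcurve w q s t) |s t. s \<noteq> 0 \<or> t \<noteq> 0}"

text \<open>Linear independence of \<open>w 0, ..., w q\<close> is witnessed by explicit functionals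
  \<open>b l\<close>, which read off the monomials \<open>s ^ (q - l) * t ^ l\<close> at a point of
  the curve.\<close>

definition dual_family :: "nat \<Rightarrow> nat \<Rightarrow> (nat \<Rightarrow> nat \<Rightarrow> complex) \<Rightarrow> (nat \<Rightarrow> nat \<Rightarrow> complex) \<Rightarrow> bool" where
  "dual_family N q w b \<longleftrightarrow> (\<forall>k\<le>q. w k \<in> cvec N) \<and>
     (\<forall>k\<le>q. \<forall>l\<le>q. (\<Sum>j\<le>N. b l j * w k j) = (if k = l then 1 else 0))"

lemma vcurve_scale: "vcurve w q (c * s) (c * t) = cscale (c ^ q) (vcurve w q s t)"
proof
  fix j
  have "(c * s) ^ (q - k) * (c * t) ^ k * w k j = c ^ q * (s ^ (q - k) * t ^ k * w k j)" if "k \<le> q" for k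
  proof -
    have "c ^ q = c ^ (q - k) * c ^ k" using that by (simp flip: power_add)
    then show ?thesis by (simp add: power_mult_distrib)
  qed
  then show "vcurve w q (c * s) (c * t) j = cscale (c ^ q) (vcurve w q s t) j"
    unfolding vcurve_def cscale_def sum_distrib_left by (intro sum.cong) auto
qed

lemma line_cscale: "c \<noteq> 0 \<Longrightarrow> line (cscale c v) = line v"
proof (cases "v = 0")
  case False
  assume "c \<noteq> 0"
  then have "cscale c v \<in> line v" "cscale c v \<noteq> 0" using False by (auto simp: line_def cscale_eq_0_iff)
  then show ?thesis by (rule line_eq)
qed (simp add: cscale_eq_0_iff)

lemma line_vcurve_scale: "c \<noteq> 0 \<Longrightarrow> line (vcurve w q (c * s) (c * t)) = line (vcurve w q s t)"
  by (simp add: vcurve_scale line_cscale)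

lemma vcurve_cvec: "dual_family N q w b \<Longrightarrow> vcurve w q s t \<in> cvec N"
  by (auto simp: dual_family_def cvec_def vcurve_def)

lemma dual_vcurve:
  assumes "dual_family N q w b" "l \<le> q"
  shows "(\<Sum>j\<le>N. b l j * vcurve w q s t j) = s ^ (q - l) * t ^ l"
proof -
  have "(\<Sum>j\<le>N. b l j * vcurve w q s t j) = (\<Sum>k\<le>q. s ^ (q - k) * t ^ k * (\<Sum>j\<le>N. b l j * w k j))"
    unfolding vcurve_def sum_distrib_left
    by (subst sum.swap) (simp add: mult_ac)
  also have "\<dots> = (\<Sum>k\<le>q. if k = l then s ^ (q - l) * t ^ l else 0)"
    using assms by (intro sum.cong) (auto simp: dual_family_def)
  finally show ?thesis using assms(2) by simp
qed

lemma vcurve_nonzero: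
  assumes "dual_family N q w b" "s \<noteq> 0 \<or> t \<noteq> 0" shows "vcurve w q s t \<noteq> 0"
proof
  assume 0: "vcurve w q s t = 0"
  have "s ^ (q - l) * t ^ l = 0" if "l \<le> q" for l
    using dual_vcurve[OF assms(1) that, of s t] by (simp add: 0)
  from this[of 0] this[of q] show False using assms(2) by auto
qed

text \<open>The minors belong to the matrix with rows \<open>\<beta> 0, ..., \<beta> (q - 1)\<close>
  and \<open>\<beta> 1, ..., \<beta> q\<close>. If \<open>\<beta> 0\<close> is nonzero, they make
  \<open>\<beta>\<close> a geometric progression; otherwise the squares of the intermediate terms
  vanish successively and only \<open>\<beta> q\<close> remains.\<close>

lemma proportional_minors:
  fixes \<beta> :: "nat \<Rightarrow> complex"
  assumes q: "q \<ge> 1" and minors: "\<And>i j. i < q \<Longrightarrow> j < q \<Longrightarrow> \<beta> i * \<beta> (Suc j) = \<beta> (Suc i) * \<beta> j"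
    and ne: "\<exists>k\<le>q. \<beta> k \<noteq> 0"
  shows "\<exists>a s t. a \<noteq> 0 \<and> (s \<noteq> 0 \<or> t \<noteq> 0) \<and> (\<forall>k\<le>q. \<beta> k = a * (s ^ (q - k) * t ^ k))"
proof (cases "\<beta> 0 = 0")
  case False
  have *: "\<beta> k = \<beta> 0 * (\<beta> 1 / \<beta> 0) ^ k" if "k \<le> q" for k
    using that
  proof (induction k)
    case (Suc k)
    then have "\<beta> 0 * \<beta> (Suc k) = \<beta> 1 * \<beta> k" using minors[of 0 k] q by simp
    then have "\<beta> (Suc k) = \<beta> 1 / \<beta> 0 * \<beta> k" using False by (simp add: field_simps)
    also have "\<dots> = \<beta> 0 * (\<beta> 1 / \<beta> 0) ^ Suc k" using Suc by simp
    finally show ?case .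
  qed simp
  have "\<forall>k\<le>q. \<beta> k = \<beta> 0 * (1 ^ (q - k) * (\<beta> 1 / \<beta> 0) ^ k)"
    unfolding power_one mult_1 using * by blast
  moreover have "(1 :: complex) \<noteq> 0 \<or> \<beta> 1 / \<beta> 0 \<noteq> 0" by simp
  ultimately show ?thesis using False by blast
next
  case True
  have z: "\<beta> k = 0" if "k < q" for k
    using that
  proof (induction k)
    case (Suc k)
    then have "\<beta> (Suc k) * \<beta> (Suc k) = \<beta> k * \<beta> (Suc (Suc k))" using minors[of k "Suc k"] by simp
    then show ?case using Suc by simp
  qed (use True in simp)
  then have "\<beta> q \<noteq> 0" using ne by (metis le_neq_implies_less)
  moreover have "\<forall>k\<le>q. \<beta> k = \<beta> q * (0 ^ (q - k) * 1 ^ k)"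
  proof (intro allI impI)
    fix k assume "k \<le> q"
    show "\<beta> k = \<beta> q * (0 ^ (q - k) * 1 ^ k)"
    proof (cases "k = q")
      case False
      then have "k < q" using \<open>k \<le> q\<close> by simp
      then show ?thesis using z[of k] by (simp add: power_0_left)
    qed simp
  qed
  moreover have "(0 :: complex) \<noteq> 0 \<or> (1 :: complex) \<noteq> 0" by simp
  ultimately show ?thesis by blast
qed

text \<open>The equations are the classical determinantal ones: the linear forms \<open>E j\<close>
  cut out the span of the \<open>w k\<close>, and the minors \<open>M i j\<close> express that the
  dual coordinates of the point are proportional to \<open>s ^ (q - k) * t ^ k\<close>.\<close>

lemma closedin_rnc:
  assumes wb: "dual_family N q w b" and q: "q \<ge> 1"
  shows "closedin (zariski N) (rnc w q)"
proof -
  define B where "B l = linear_form N (b l)" for l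
  define E where "E j = cX j - (\<Sum>l\<le>q. cC (w l j) * B l)" for j
  define M where "M i j = B i * B (Suc j) - B (Suc i) * B j" for i j
  let ?S = "E ` {..N} \<union> (\<lambda>(i, j). M i j) ` ({..<q} \<times> {..<q})"
  have B: "form N 1 (B l)" for l unfolding B_def by (rule form_linear_form)
  have E: "form N 1 (E j)" if "j \<le> N" for j
    unfolding E_def by (intro form_diff form_sum form_cmult form_cX B that)
  have M: "form N (1 + 1) (M i j)" for i j unfolding M_def by (intro form_diff form_mult B)
  have "rnc w q = zero_locus N ?S"
  proof
    show "rnc w q \<subseteq> zero_locus N ?S"
    proof
      fix p assume "p \<in> rnc w q"
      then obtain s t where p: "p = line (vcurve w q s t)" "s \<noteq> 0 \<or> t \<noteq> 0" by (auto simp: rnc_def)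
      let ?v = "vcurve w q s t"
      have Bv: "poly_eval (B l) ?v = s ^ (q - l) * t ^ l" if "l \<le> q" for l
        using dual_vcurve[OF wb that] by (simp add: B_def)
      have E0: "poly_eval (E j) ?v = 0" for j
      proof -
        have "(\<Sum>l\<le>q. w l j * poly_eval (B l) ?v) = ?v j"
          unfolding vcurve_def[of w q s t] by (rule sum.cong) (use Bv in \<open>auto simp: vcurve_def\<close>)
        then show ?thesis by (simp add: E_def poly_eval_simps)
      qed
      have M0: "poly_eval (M i j) ?v = 0" if "i < q" "j < q" for i j
      proof -
        have "s ^ (q - i) = s ^ (q - Suc i) * s" "s ^ (q - j) = s ^ (q - Suc j) * s"
          using that by (simp_all flip: power_Suc2 add: Suc_diff_Suc)
        then show ?thesis using that by (simp add: M_def poly_eval_simps Bv)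
      qed
      have "\<forall>w\<in>line ?v. poly_eval F w = 0" if "F \<in> ?S" for F
      proof -
        consider j where "j \<le> N" "F = E j" | i j where "i < q" "j < q" "F = M i j" using \<open>F \<in> ?S\<close> by auto
        then show ?thesis
        proof cases
          case 1
          then show ?thesis using vanish_line[OF E[OF 1(1)], of ?v] E0[of j] by simp
        next
          case 2
          then show ?thesis using vanish_line[OF M, of ?v] M0[OF 2(1,2)] by simp
        qed
      qed
      moreover have "p \<in> proj_space N"
        using p vcurve_cvec[OF wb] vcurve_nonzero[OF wb] line_in_proj_space by blast
      ultimately show "p \<in> zero_locus N ?S" unfolding zero_locus_def p(1) by blast
    qed
    show "zero_locus N ?S \<subseteq> rnc w q"
    proof
      fix p assume p: "p \<in> zero_locus N ?S"
      then obtain v where v: "p = line v" "v \<in> cvec N" "v \<noteq> 0" by (auto simp: zero_locus_def proj_space_def)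
      define \<beta> where "\<beta> l = poly_eval (B l) v" for l
      have vp: "v \<in> p" using v(1) line_self by simp
      have "poly_eval (E j) v = 0" if "j \<le> N" for j using p that vp by (auto simp: zero_locus_def)
      then have vj: "v j = (\<Sum>l\<le>q. w l j * \<beta> l)" if "j \<le> N" for j
        using that by (simp add: E_def poly_eval_simps \<beta>_def)
      have "poly_eval (M i j) v = 0" if "i < q" "j < q" for i j using p that vp by (auto simp: zero_locus_def)
      then have minors: "\<beta> i * \<beta> (Suc j) = \<beta> (Suc i) * \<beta> j" if "i < q" "j < q" for i j
        using that by (simp add: M_def poly_eval_simps \<beta>_def)
      have "\<exists>k\<le>q. \<beta> k \<noteq> 0"
      proof (rule ccontr)
        assume "\<not> ?thesis"
        then have "v j = 0" for j using vj v(2) by (cases "j \<le> N") (auto simp: cvec_def)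
        then show False using v(3) by (auto simp: fun_eq_iff)
      qed
      from proportional_minors[OF q minors this] obtain a s t where
        ast: "a \<noteq> 0" "s \<noteq> 0 \<or> t \<noteq> 0" "\<And>k. k \<le> q \<Longrightarrow> \<beta> k = a * (s ^ (q - k) * t ^ k)" by blast
      have "v = cscale a (vcurve w q s t)"
      proof
        fix j
        show "v j = cscale a (vcurve w q s t) j"
        proof (cases "j \<le> N")
          case True
          show ?thesis unfolding vj[OF True] cscale_def vcurve_def sum_distrib_left
            by (rule sum.cong) (auto simp: ast(3))
        next
          case False
          then show ?thesis using v(2) vcurve_cvec[OF wb, of s t] by (simp add: cvec_def cscale_def)
        qed
      qed
      then show "p \<in> rnc w q" using v(1) ast(1,2) by (auto simp: line_cscale rnc_def)
    qed
  qed
  moreover have "\<exists>d. form N d (E j)" if "j \<le> N" for j using E[OF that] by (rule exI)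
  then have "?S \<subseteq> {F. \<exists>d. form N d F}" using exI[of "\<lambda>d. form N d (M _ _)", OF M] by auto
  ultimately show ?thesis unfolding closedin_zariski by blast
qed

lemma point_variety:
  assumes v: "v \<in> cvec N" "v \<noteq> 0" shows "proj_variety N {line v}"
proof -
  have "pclosure N {v} \<subseteq> {line v}"
  proof
    fix p assume p: "p \<in> pclosure N {v}"
    then obtain u where u: "p = line u" "u \<in> cvec N" "u \<noteq> 0" by (auto simp: pclosure_def proj_space_def)
    have up: "u \<in> p" using u(1) line_self by simp
    obtain i where i: "i \<le> N" "v i \<noteq> 0" using v by (auto simp: cvec_def fun_eq_iff) (metis not_le)
    have "v i * u j = v j * u i" for j
    proof (cases "j \<le> N")
      case True
      have "form N 1 (cC (v i) * cX j - cC (v j) * cX i)"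
        using True i by (intro form_diff form_cmult form_cX)
      from pclosure_vanish[OF this _ p up] show ?thesis by (simp add: poly_eval_simps mult.commute)
    next
      case False
      then show ?thesis using u(2) v(1) by (simp add: cvec_def)
    qed
    then have "u = cscale (u i / v i) v" using i(2) by (auto simp: cscale_def fun_eq_iff field_simps)
    then have "u \<in> line v" by (auto simp: line_def)
    then show "p \<in> {line v}" using u(1,3) line_eq by blast
  qed
  moreover have "line v \<in> pclosure N {v}" using v line_in_pclosure by blast
  ultimately have "pclosure N {v} = {line v}" by blast
  moreover have "proj_variety N (pclosure N {v})" by (rule pclosure_variety) (use v in auto)
  ultimately show ?thesis by simp
qed

subsection \<open>Sections by generic hyperplanes\<close>

lemma rsquarefree_card_roots:
  fixes p :: "complex poly"
  assumes "rsquarefree p" shows "card {z. poly p z = 0} = degree p"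
proof -
  have p0: "p \<noteq> 0" using assms by (simp add: rsquarefree_def)
  have "degree p = degree (smult (lead_coeff p) (\<Prod>z|poly p z = 0. [:-z, 1:]))"
    by (simp add: complex_poly_decompose_rsquarefree[OF assms])
  also have "\<dots> = (\<Sum>z|poly p z = 0. degree [:-z, 1:])"
    using p0 by (simp add: degree_prod_eq_sum_degree)
  finally show ?thesis by simp
qed

lemma cpoly_common_nonvanishing:
  fixes F :: "'a \<Rightarrow> nat cpoly"
  assumes "finite K" "\<And>k. k \<in> K \<Longrightarrow> F k \<noteq> 0"
  shows "\<exists>x. \<forall>k\<in>K. poly_eval (F k) x \<noteq> 0"
proof -
  have "(\<Prod>k\<in>K. F k) \<noteq> 0" using assms by simp
  then obtain x where "poly_eval (\<Prod>k\<in>K. F k) x \<noteq> 0" using nonzero_cpoly_nonvanishing by blast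
  then show ?thesis using assms(1) by (intro exI[of _ x]) (simp add: poly_eval_simps)
qed

lemma linear_form_nonzero: "j \<le> N \<Longrightarrow> l j \<noteq> 0 \<Longrightarrow> linear_form N l \<noteq> 0"
proof
  assume j: "j \<le> N" "l j \<noteq> 0" "linear_form N l = 0"
  have "0 = poly_eval (linear_form N l) (\<lambda>i. if i = j then 1 else 0)" by (simp add: j(3) del: poly_eval_linear_form)
  also have "\<dots> = l j" using j(1) by (simp add: sum.delta' if_distrib cong: if_cong)
  finally show False using j(2) by simp
qed

text \<open>The complement of a nonempty open set is closed, so some form vanishes on it but not at
  a chosen point outside it. Genericity is from then on the nonvanishing of a single form.\<close>

lemma generic_point_form:
  assumes "generically (zariski N) P"
  shows "\<exists>F e. form N e F \<and> F \<noteq> 0 \<and> (\<forall>v\<in>cvec N. poly_eval F v \<noteq> 0 \<longrightarrow> v \<noteq> 0 \<longrightarrow> P (line v))"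
proof -
  obtain U where U: "openin (zariski N) U" "zariski N closure_of U = proj_space N" "\<And>x. x \<in> U \<Longrightarrow> P x"
    using assms by (auto simp: generically_def)
  have "(\<lambda>i. if i = 0 then 1 else 0 :: complex) \<in> cvec N" "(\<lambda>i. if i = 0 then 1 else 0 :: complex) \<noteq> (0 :: nat \<Rightarrow> complex)"
    by (auto simp: cvec_def fun_eq_iff intro!: exI[of _ 0])
  then have "proj_space N \<noteq> {}" using line_in_proj_space by blast
  then have "U \<noteq> {}" using U(2) by auto
  then obtain \<alpha> where \<alpha>: "line \<alpha> \<in> U" "\<alpha> \<in> cvec N" "\<alpha> \<noteq> 0"
    using openin_subset[OF U(1)] by (fastforce simp: proj_space_def)
  have "closedin (zariski N) (proj_space N - U)" using U(1) by (metis openin_closedin_eq topspace_zariski)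
  then obtain F e where F: "form N e F" "\<forall>w\<in>\<Union>(proj_space N - U). poly_eval F w = 0" "poly_eval F \<alpha> \<noteq> 0"
    using closed_separate[of N "proj_space N - U" \<alpha>] \<alpha> by blast
  have "P (line v)" if "v \<in> cvec N" "poly_eval F v \<noteq> 0" "v \<noteq> 0" for v
  proof -
    have "line v \<in> proj_space N" using that line_in_proj_space by blast
    moreover have "line v \<notin> proj_space N - U" using F(2) that(2) line_self by blast
    ultimately show ?thesis using U(3) by blast
  qed
  moreover have "F \<noteq> 0" using F(3) by auto
  ultimately show ?thesis using F(1) by blast
qed

text \<open>In a pencil spanned by coprime polynomials only finitely many members have multiple roots,
  or roots in a given finite set.\<close>

lemma generic_hyperplane_degree:
  fixes g :: "nat \<Rightarrow> complex poly"
  assumes base: "\<And>\<tau>. \<exists>j\<le>N. poly (g j) \<tau> \<noteq> 0"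
    and deg: "\<And>j. j \<le> N \<Longrightarrow> degree (g j) \<le> e" and lead: "\<exists>j\<le>N. coeff (g j) e \<noteq> 0"
    and gv: "\<And>\<tau>. gv \<tau> = (\<lambda>j. if j \<le> N then poly (g j) \<tau> else 0)"
    and B: "finite B" "inj_on (\<lambda>\<tau>. line (gv \<tau>)) (- B)" "\<And>\<tau>. \<tau> \<notin> B \<Longrightarrow> line (gv \<tau>) \<in> C"
    and C: "curve_degree N C q"
  shows "e \<le> q"
proof (cases "e = 0")
  case False
  obtain F d where F: "form N d F" "F \<noteq> 0"
    "\<And>v. v \<in> cvec N \<Longrightarrow> poly_eval F v \<noteq> 0 \<Longrightarrow> v \<noteq> 0 \<Longrightarrow>
      finite (C \<inter> hyperplane N (line v)) \<and> card (C \<inter> hyperplane N (line v)) = q"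
    using generic_point_form[OF C[unfolded curve_degree_def]] by blast
  define h where "h a = (\<Sum>j\<le>N. smult (a j) (g j))" for a
  have h_eval: "poly (h a) \<tau> = (\<Sum>j\<le>N. a j * poly (g j) \<tau>)" for a \<tau> by (simp add: h_def poly_sum)
  have h_coeff: "coeff (h a) e = (\<Sum>j\<le>N. a j * coeff (g j) e)" for a by (simp add: h_def coeff_sum)
  have h_deg: "degree (h a) \<le> e" for a unfolding h_def
    by (intro degree_sum_le) (auto simp: deg)
  have h_line: "h (\<lambda>j. a j + c * b j) = h a + smult c (h b)" for a b c
    by (rule poly_eqI) (simp add: h_def coeff_sum sum.distrib algebra_simps sum_distrib_left)
  obtain j where "j \<le> N" "coeff (g j) e \<noteq> 0" using lead by blast
  then have "F * linear_form N (\<lambda>j. coeff (g j) e) \<noteq> 0"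
    using F(2) linear_form_nonzero[of j N "\<lambda>j. coeff (g j) e"] by simp
  then obtain x where x: "poly_eval F x \<noteq> 0" "(\<Sum>j\<le>N. coeff (g j) e * x j) \<noteq> 0"
    using nonzero_cpoly_nonvanishing[of "F * linear_form N (\<lambda>j. coeff (g j) e)"] by (auto simp: poly_eval_mult)
  define a where "a j = (if j \<le> N then x j else 0)" for j
  have Fa: "poly_eval F a \<noteq> 0"
    using x(1) poly_eval_cong[OF form_vars_in[OF F(1)], of a x] by (simp add: a_def)
  have la: "coeff (h a) e \<noteq> 0" using x(2) by (simp add: h_coeff a_def mult.commute)
  then have ha: "h a \<noteq> 0" "degree (h a) = e" using h_deg[of a] le_degree[of "h a" e] by auto
  have finR: "finite {\<tau>. poly (h a) \<tau> = 0}" using ha(1) by (simp add: poly_roots_finite)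
  \<comment> \<open>The second generator of the pencil is chosen nonzero at every root of
    \<open>h a\<close>, so that the two generators have no common root.\<close>
  have "\<exists>y. \<forall>\<tau>\<in>{\<tau>. poly (h a) \<tau> = 0}. poly_eval (linear_form N (\<lambda>j. poly (g j) \<tau>)) y \<noteq> 0"
  proof (rule cpoly_common_nonvanishing[OF finR])
    fix \<tau>
    obtain j where "j \<le> N" "poly (g j) \<tau> \<noteq> 0" using base by blast
    then show "linear_form N (\<lambda>j. poly (g j) \<tau>) \<noteq> 0"
      using linear_form_nonzero[of j N "\<lambda>j. poly (g j) \<tau>"] by simp
  qed
  then obtain y where y: "\<And>\<tau>. poly (h a) \<tau> = 0 \<Longrightarrow> (\<Sum>j\<le>N. poly (g j) \<tau> * y j) \<noteq> 0" by auto
  define b where "b j = (if j \<le> N then y j else 0)" for j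
  have hb: "poly (h b) \<tau> \<noteq> 0" if "poly (h a) \<tau> = 0" for \<tau>
    using y[OF that] by (simp add: h_eval b_def mult.commute)
  \<comment> \<open>The Wronskian of the pencil: every double root of a member
    \<open>h a + c * h b\<close> is a root of \<open>W\<close>, and \<open>W\<close> is independent
    of \<open>c\<close>.\<close>
  define W where "W = pderiv (h a) * h b - h a * pderiv (h b)"
  \<comment> \<open>At a root of \<open>h a\<close>, where \<open>h b\<close> is nonzero,
    differentiation lowers the order of \<open>h a\<close> by exactly one, so the two products in
    \<open>W\<close> have different orders there.\<close>
  have "W \<noteq> 0"
  proof
    assume "W = 0"
    then have W: "pderiv (h a) * h b = h a * pderiv (h b)" by (simp add: W_def)
    obtain z where z: "poly (h a) z = 0"
      using fundamental_theorem_of_algebra[of "h a"] constant_degree[of "h a"] ha(2) False by auto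
    have hb0: "h b \<noteq> 0" using hb[OF z] by auto
    have d0: "pderiv (h a) \<noteq> 0" using ha(2) False by (simp add: pderiv_eq_0_iff)
    have "order z (h a) \<noteq> 0" using z ha(1) by (simp add: order_root)
    then have o: "order z (h a) = Suc (order z (pderiv (h a)))" using order_pderiv[OF ha(1) z] by simp
    have p0: "pderiv (h a) * h b \<noteq> 0" using d0 hb0 by simp
    have "order z (h b) = 0" using hb[OF z] by (simp add: order_0I)
    then have "order z (pderiv (h a) * h b) = order z (pderiv (h a))" using order_mult[OF p0] by simp
    moreover have "order z (h a * pderiv (h b)) \<ge> order z (h a)" using order_mult[of "h a" "pderiv (h b)" z] W p0 by simp
    ultimately show False using o W by simp
  qed
  define Z where "Z = {z. poly W z = 0} \<union> B"
  have finZ: "finite Z" using \<open>W \<noteq> 0\<close> B(1) by (simp add: Z_def poly_roots_finite)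
  \<comment> \<open>The roots of \<open>p\<close> are the parameters for which the hyperplane fails
    the genericity condition \<open>F\<close> or the leading coefficient drops.\<close>
  define p where "p = usubst F (\<lambda>j. [:a j, b j:]) * [:coeff (h a) e, coeff (h b) e:]"
  have "poly p 0 \<noteq> 0" using Fa la by (simp add: p_def poly_usubst)
  then have "p \<noteq> 0" by auto
  \<comment> \<open>A point \<open>z\<close> of \<open>Z\<close> is a root of at most one member of
    the pencil, the one with parameter \<open>- poly (h a) z / poly (h b) z\<close>; these finitely
    many parameters are avoided.\<close>
  then obtain c where c: "c \<notin> (\<lambda>z. - poly (h a) z / poly (h b) z) ` Z" "poly p c \<noteq> 0"
    using infinite_nonroot[of p "(\<lambda>z. - poly (h a) z / poly (h b) z) ` Z"] finZ by blast
  define \<alpha> where "\<alpha> j = a j + c * b j" for j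
  define H where "H = h a + smult c (h b)"
  have H: "H = h \<alpha>" unfolding H_def \<alpha>_def[abs_def] by (rule h_line[symmetric])
  have "poly_eval F (\<lambda>j. poly [:a j, b j:] c) \<noteq> 0"
    using c(2) unfolding p_def poly_mult poly_usubst by (metis mult_zero_left)
  then have F\<alpha>: "poly_eval F \<alpha> \<noteq> 0" by (simp add: \<alpha>_def[abs_def])
  have "coeff H e \<noteq> 0" using c(2) unfolding p_def poly_mult by (auto simp: H_def)
  then have degH: "degree H = e" "H \<noteq> 0" using h_deg[of \<alpha>] le_degree[of H e] H by auto
  have Z: "z \<notin> Z" if z: "poly H z = 0" for z
  proof
    assume "z \<in> Z"
    have eq: "poly (h a) z = - c * poly (h b) z" using z by (simp add: H_def eq_neg_iff_add_eq_0)
    then have "poly (h b) z \<noteq> 0" using hb[of z] by auto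
    then have "c = - poly (h a) z / poly (h b) z" using eq by simp
    then show False using c(1) \<open>z \<in> Z\<close> by blast
  qed
  have "rsquarefree H" unfolding rsquarefree_roots
  proof (intro allI notI)
    fix z assume z: "poly H z = 0 \<and> poly (pderiv H) z = 0"
    then have "poly (h a) z = - c * poly (h b) z" "poly (pderiv (h a)) z = - c * poly (pderiv (h b)) z"
      by (simp_all add: H_def pderiv_add pderiv_smult eq_neg_iff_add_eq_0)
    then have "poly W z = 0" by (simp add: W_def algebra_simps)
    then show False using Z[of z] z by (simp add: Z_def)
  qed
  then have cardH: "card {z. poly H z = 0} = e" using rsquarefree_card_roots degH by blast
  have \<alpha>v: "\<alpha> \<in> cvec N" by (simp add: \<alpha>_def a_def b_def cvec_def)
  have "\<alpha> \<noteq> 0"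
  proof
    assume "\<alpha> = 0"
    then have "H = 0" unfolding H h_def by simp
    then show False using degH by simp
  qed
  from F(3)[OF \<alpha>v F\<alpha> this] have fin: "finite (C \<inter> hyperplane N (line \<alpha>))" "card (C \<inter> hyperplane N (line \<alpha>)) = q"
    by blast+
  have "(\<lambda>\<tau>. line (gv \<tau>)) ` {z. poly H z = 0} \<subseteq> C \<inter> hyperplane N (line \<alpha>)"
  proof
    fix p assume "p \<in> (\<lambda>\<tau>. line (gv \<tau>)) ` {z. poly H z = 0}"
    then obtain z where z: "poly H z = 0" "p = line (gv z)" by blast
    have "gv z \<in> cvec N" "gv z \<noteq> 0" using base[of z] by (auto simp: gv cvec_def fun_eq_iff)
    then have "p \<in> proj_space N" unfolding z(2) by (rule line_in_proj_space)
    moreover have "(\<Sum>j\<le>N. u j * v j) = 0" if uv: "u \<in> line \<alpha>" "v \<in> line (gv z)" for u v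
    proof -
      obtain r r' where "u = cscale r \<alpha>" "v = cscale r' (gv z)" using uv by (auto simp: line_def)
      then have "(\<Sum>j\<le>N. u j * v j) = r * r' * (\<Sum>j\<le>N. \<alpha> j * poly (g j) z)"
        by (simp add: cscale_def gv sum_distrib_left mult_ac)
      also have "\<dots> = 0" using z(1) by (simp add: H h_eval)
      finally show ?thesis .
    qed
    moreover have "p \<in> C" using B(3)[of z] Z[OF z(1)] z(2) by (simp add: Z_def)
    ultimately show "p \<in> C \<inter> hyperplane N (line \<alpha>)" unfolding hyperplane_def z(2) by blast
  qed
  moreover have "inj_on (\<lambda>\<tau>. line (gv \<tau>)) {z. poly H z = 0}"
    by (rule inj_on_subset[OF B(2)]) (use Z in \<open>auto simp: Z_def\<close>)
  ultimately have "card {z. poly H z = 0} \<le> q" using card_inj_on_le fin by metis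
  then show ?thesis using cardH by simp
qed simp

lemma poly_sum_coeffs:
  fixes p :: "complex poly"
  assumes "degree p \<le> q" shows "poly p x = (\<Sum>k\<le>q. coeff p k * x ^ k)"
  unfolding poly_altdef by (rule sum.mono_neutral_left) (use assms in \<open>auto intro: coeff_eq_0\<close>)

definition affine_point :: "complex \<Rightarrow> nat \<Rightarrow> complex" where
  "affine_point \<tau> = (\<lambda>j. if j = 0 then 1 else if j = 1 then \<tau> else 0)"

lemma affine_point_cvec: "affine_point \<tau> \<in> cvec 1" and affine_point_nonzero: "affine_point \<tau> \<noteq> 0"
  by (auto simp: affine_point_def cvec_def fun_eq_iff)

lemma poly_eval_affine_point:
  "poly_eval F (affine_point \<tau>) = poly (usubst F (\<lambda>j. if j = 0 then 1 else if j = 1 then [:0, 1:] else 0)) \<tau>"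
  unfolding poly_usubst by (rule arg_cong[where f = "poly_eval F"]) (auto simp: affine_point_def)

lemma open_projective_line_cofinite:
  assumes U: "openin (zariski 1) U" "U \<noteq> {}"
  shows "finite {\<tau>. line (affine_point \<tau>) \<notin> U}"
proof -
  obtain v where v: "line v \<in> U" "v \<in> cvec 1" "v \<noteq> 0"
    using U openin_subset[OF U(1)] by (fastforce simp: proj_space_def)
  have "closedin (zariski 1) (proj_space 1 - U)" using U(1) by (metis openin_closedin_eq topspace_zariski)
  then obtain H e where H: "form 1 e H" "\<forall>w\<in>\<Union>(proj_space 1 - U). poly_eval H w = 0" "poly_eval H v \<noteq> 0"
    using closed_separate[of 1 "proj_space 1 - U" v] v by blast
  \<comment> \<open>The point \<open>v\<close> of \<open>U\<close> may be the point at infinity, so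
    its coordinate 0 is first varied to a nonzero value at which \<open>H\<close> still does not
    vanish.\<close>
  define r where "r = usubst H (\<lambda>j. if j = 0 then [:0, 1:] else [:v j:])"
  have r: "poly r c = poly_eval H (v(0 := c))" for c
    unfolding r_def poly_usubst by (rule arg_cong[where f = "poly_eval H"]) auto
  have "poly r (v 0) \<noteq> 0" using H(3) by (simp add: r)
  then have "r \<noteq> 0" by auto
  then obtain c where c: "c \<noteq> 0" "poly r c \<noteq> 0" using infinite_nonroot[of r "{0}"] by auto
  have "v(0 := c) = cscale c (affine_point (v 1 / c))"
    using v(2) c(1) by (auto simp: cscale_def affine_point_def fun_eq_iff cvec_def)
  then have "poly_eval H (affine_point (v 1 / c)) \<noteq> 0"
    using c by (auto simp: r poly_eval_form_scale[OF H(1)])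
  then have nz: "usubst H (\<lambda>j. if j = 0 then 1 else if j = 1 then [:0, 1:] else 0) \<noteq> 0"
    by (auto simp: poly_eval_affine_point)
  have "{\<tau>. line (affine_point \<tau>) \<notin> U} \<subseteq> {\<tau>. poly (usubst H (\<lambda>j. if j = 0 then 1 else if j = 1 then [:0, 1:] else 0)) \<tau> = 0}"
  proof
    fix \<tau> assume "\<tau> \<in> {\<tau>. line (affine_point \<tau>) \<notin> U}"
    then have "line (affine_point \<tau>) \<in> proj_space 1 - U"
      using line_in_proj_space affine_point_cvec affine_point_nonzero by blast
    then have "poly_eval H (affine_point \<tau>) = 0" using H(2) line_self by blast
    then show "\<tau> \<in> {\<tau>. poly (usubst H (\<lambda>j. if j = 0 then 1 else if j = 1 then [:0, 1:] else 0)) \<tau> = 0}"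
      by (simp add: poly_eval_affine_point)
  qed
  then show ?thesis by (rule finite_subset) (simp add: poly_roots_finite nz)
qed

text \<open>A common divisor of maximal degree is divided out: a remaining common root would enlarge
  it by a linear factor.\<close>

lemma remove_common_roots:
  fixes f :: "nat \<Rightarrow> complex poly"
  assumes ne: "j0 \<le> N" "f j0 \<noteq> 0"
  shows "\<exists>h g. h \<noteq> 0 \<and> (\<forall>j\<le>N. f j = h * g j) \<and> (\<forall>\<tau>. \<exists>j\<le>N. poly (g j) \<tau> \<noteq> 0)"
proof -
  let ?P = "\<lambda>n. \<exists>h. h \<noteq> 0 \<and> degree h = n \<and> (\<forall>j\<le>N. h dvd f j)"
  have P0: "?P 0" by (rule exI[of _ 1]) auto
  have bd: "n \<le> degree (f j0)" if "?P n" for n using that ne dvd_imp_degree_le by blast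
  define n where "n = Greatest ?P"
  have "?P n" unfolding n_def by (rule GreatestI_nat[where P = ?P, OF P0 bd])
  then obtain h where h: "h \<noteq> 0" "degree h = n" "\<And>j. j \<le> N \<Longrightarrow> h dvd f j" by blast
  then have "\<forall>j. \<exists>k. j \<le> N \<longrightarrow> f j = h * k" by (blast elim: dvdE)
  from choice[OF this] obtain g where g: "\<And>j. j \<le> N \<Longrightarrow> f j = h * g j" by blast
  have "\<exists>j\<le>N. poly (g j) \<tau> \<noteq> 0" for \<tau>
  proof (rule ccontr)
    assume 0: "\<not> ?thesis"
    have "h * [:- \<tau>, 1:] dvd f j" if "j \<le> N" for j
    proof -
      have "poly (g j) \<tau> = 0" using 0 that by blast
      then show ?thesis unfolding g[OF that] poly_eq_0_iff_dvd by (intro mult_dvd_mono) auto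
    qed
    moreover have "degree (h * [:- \<tau>, 1:]) = Suc n" using h(1,2) by (subst degree_mult_eq) auto
    moreover have "h * [:- \<tau>, 1:] \<noteq> 0" using h(1) by (metis mult_eq_0_iff pCons_eq_0_iff one_neq_zero)
    ultimately have "?P (Suc n)" by blast
    then have "Suc n \<le> n" unfolding n_def by (rule Greatest_le_nat[where P = ?P, OF _ bd])
    then show False by simp
  qed
  then show ?thesis using h(1) g by blast
qed

text \<open>The inverse map from the line to \<open>C\<close> is given by forms near one point. On
  the affine line these become polynomials valid at all but finitely many parameters, because
  nonempty open sets of the projective line are cofinite. Common roots are divided out, so the
  quotients define a point at every parameter; injectivity comes from the left inverse
  \<open>f\<close>.\<close>

lemma birational_parametrization:
  assumes "birational N C 1 (proj_space 1)"
  shows "\<exists>g B. (\<forall>\<tau>. \<exists>j\<le>N. poly (g j) \<tau> \<noteq> 0) \<and> finite B \<and>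
    inj_on (\<lambda>\<tau>. line (\<lambda>j. if j \<le> N then poly (g j) \<tau> else 0)) (- B) \<and>
    (\<forall>\<tau>. \<tau> \<notin> B \<longrightarrow> line (\<lambda>j. if j \<le> N then poly (g j) \<tau> else 0) \<in> C)"
proof -
  obtain U V f \<phi> where U: "openin (subtopology (zariski N) C) U"
    and V: "openin (subtopology (zariski 1) (proj_space 1)) V" "V \<noteq> {}"
    and reg: "regular_map 1 V N U \<phi>" and inv: "\<forall>y\<in>V. f (\<phi> y) = y"
    using assms unfolding birational_def by (elim exE conjE) (rule that; assumption)
  have UC: "U \<subseteq> C" using openin_subset[OF U] by simp
  obtain y where y: "y \<in> V" using V(2) by blast
  from reg have "\<forall>x\<in>V. \<exists>U d F. openin (subtopology (zariski 1) V) U \<and> x \<in> U \<and> (\<forall>j\<le>N. form 1 d (F j)) \<and>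
      (\<forall>p\<in>U. \<forall>v\<in>p - {0}. (\<exists>j\<le>N. poly_eval (F j) v \<noteq> 0) \<and>
        \<phi> p = line (\<lambda>j. if j \<le> N then poly_eval (F j) v else 0))"
    unfolding regular_map_def by (rule conjunct2)
  from bspec[OF this y] obtain U' d F where U': "openin (subtopology (zariski 1) V) U'" "y \<in> U'"
    and F: "\<forall>j\<le>N. form 1 d (F j)"
    and val: "\<forall>p\<in>U'. \<forall>v\<in>p - {0}. (\<exists>j\<le>N. poly_eval (F j) v \<noteq> 0) \<and>
        \<phi> p = line (\<lambda>j. if j \<le> N then poly_eval (F j) v else 0)"
    by (elim exE conjE) (rule that; assumption)
  have \<phi>V: "\<phi> ` V \<subseteq> U" using reg by (simp add: regular_map_def)
  have "subtopology (zariski 1) (proj_space 1) = zariski 1"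
    using subtopology_topspace[of "zariski 1"] by simp
  then have "openin (zariski 1) V" using V(1) by simp
  then have U'o: "openin (zariski 1) U'" using U'(1) openin_trans_full by blast
  have U'V: "U' \<subseteq> V" using openin_subset[OF U'(1)] by simp
  define B0 where "B0 = {\<tau>. line (affine_point \<tau>) \<notin> U'}"
  have B0: "finite B0" unfolding B0_def by (rule open_projective_line_cofinite[OF U'o]) (use U'(2) in blast)
  define p where "p j = usubst (F j) (\<lambda>j. if j = 0 then 1 else if j = 1 then [:0, 1:] else 0)" for j
  have p: "poly (p j) \<tau> = poly_eval (F j) (affine_point \<tau>)" for j \<tau> by (simp add: p_def poly_eval_affine_point)
  have \<phi>: "(\<exists>j\<le>N. poly (p j) \<tau> \<noteq> 0) \<and> \<phi> (line (affine_point \<tau>)) = line (\<lambda>j. if j \<le> N then poly (p j) \<tau> else 0)"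
    if "\<tau> \<notin> B0" for \<tau>
  proof -
    have "line (affine_point \<tau>) \<in> U'" using that by (simp add: B0_def)
    moreover have "affine_point \<tau> \<in> line (affine_point \<tau>) - {0}"
      using line_self affine_point_nonzero by blast
    ultimately show ?thesis unfolding p by (rule val[THEN bspec, THEN bspec])
  qed
  obtain \<tau>0 where "\<tau>0 \<notin> B0" using ex_new_if_finite[OF infinite_UNIV_char_0 B0] by blast
  then obtain j0 where "j0 \<le> N" "p j0 \<noteq> 0" using \<phi> by force
  from remove_common_roots[of j0 N p, OF this] obtain h g where
    hg: "h \<noteq> 0" "\<And>j. j \<le> N \<Longrightarrow> p j = h * g j" "\<And>\<tau>. \<exists>j\<le>N. poly (g j) \<tau> \<noteq> 0" by blast
  define B where "B = B0 \<union> {\<tau>. poly h \<tau> = 0}"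
  have finB: "finite B" using B0 hg(1) by (simp add: B_def poly_roots_finite)
  let ?gv = "\<lambda>\<tau> j. if j \<le> N then poly (g j) \<tau> else 0"
  have eq: "\<phi> (line (affine_point \<tau>)) = line (?gv \<tau>)" if "\<tau> \<notin> B" for \<tau>
  proof -
    have "(\<lambda>j. if j \<le> N then poly (p j) \<tau> else 0) = cscale (poly h \<tau>) (?gv \<tau>)"
      by (auto simp: cscale_def hg(2))
    then show ?thesis using \<phi>[of \<tau>] that by (simp add: B_def line_cscale)
  qed
  have inV: "line (affine_point \<tau>) \<in> V" if "\<tau> \<notin> B" for \<tau> using that U'V by (auto simp: B_def B0_def)
  have "inj_on (\<lambda>\<tau>. line (?gv \<tau>)) (- B)"
  proof (rule inj_onI)
    fix \<sigma> \<tau> assume *: "\<sigma> \<in> - B" "\<tau> \<in> - B" "line (?gv \<sigma>) = line (?gv \<tau>)"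
    then have "\<phi> (line (affine_point \<sigma>)) = \<phi> (line (affine_point \<tau>))" using eq by simp
    then have "line (affine_point \<sigma>) = line (affine_point \<tau>)" using inv inV * by (metis ComplD)
    then obtain c where c: "affine_point \<sigma> = cscale c (affine_point \<tau>)"
      using line_self[of "affine_point \<sigma>"] by (auto simp: line_def)
    show "\<sigma> = \<tau>" using fun_cong[OF c, of 0] fun_cong[OF c, of 1] by (simp add: affine_point_def cscale_def)
  qed
  moreover have "line (?gv \<tau>) \<in> C" if "\<tau> \<notin> B" for \<tau>
    using inV[OF that] \<phi>V UC eq[OF that] by (metis image_subset_iff subsetD)
  ultimately show ?thesis using hg(3) finB by blast
qed

text \<open>A form vanishing on \<open>X\<close> pulls back to a polynomial in the parameter that
  vanishes off a finite set, hence everywhere. Exceptional parameters are filled in this way without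
  taking limits.\<close>

lemma poly_family_cofinite:
  assumes X: "closedin (zariski N) X" and B: "finite B"
    and gv: "\<And>\<tau>. gv \<tau> = (\<lambda>j. poly (g j) \<tau>)" "\<And>\<tau>. gv \<tau> \<in> cvec N" "\<And>\<tau>. \<tau> \<notin> B \<Longrightarrow> line (gv \<tau>) \<in> X"
    and nz: "gv \<sigma> \<noteq> 0"
  shows "line (gv \<sigma>) \<in> X"
proof (rule ccontr)
  assume "line (gv \<sigma>) \<notin> X"
  then obtain F d where F: "form N d F" "\<forall>w\<in>\<Union>X. poly_eval F w = 0" "poly_eval F (gv \<sigma>) \<noteq> 0"
    using closed_separate[OF X gv(2) nz] by blast
  have ev: "poly_eval F (gv \<tau>) = poly (usubst F g) \<tau>" for \<tau> by (simp add: poly_usubst gv(1))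
  have "usubst F g \<noteq> 0" using F(3) ev[of \<sigma>] by auto
  then obtain \<tau> where "\<tau> \<notin> B" "poly (usubst F g) \<tau> \<noteq> 0" using infinite_nonroot[OF _ B] by blast
  then show False using F(2) gv(3)[of \<tau>] line_self ev by (metis UnionI)
qed

lemma rnc_subset_closed:
  assumes X: "closedin (zariski N) X" and wb: "dual_family N q w b"
    and on_X: "\<And>\<tau>. line (vcurve w q 1 \<tau>) \<in> X"
  shows "rnc w q \<subseteq> X"
proof
  fix p assume "p \<in> rnc w q"
  then obtain s t where p: "p = line (vcurve w q s t)" "s \<noteq> 0 \<or> t \<noteq> 0" by (auto simp: rnc_def)
  \<comment> \<open>The point with \<open>s = 0\<close> is included by fixing \<open>t\<close> and
    varying the first parameter: for \<open>\<sigma> \<noteq> 0\<close> the point is that of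
    \<open>vcurve w q 1 (t / \<sigma>)\<close>.\<close>
  define h where "h j = (\<Sum>k\<le>q. [:0, 1:] ^ (q - k) * [:t ^ k * w k j:])" for j
  have h: "vcurve w q \<sigma> t = (\<lambda>j. poly (h j) \<sigma>)" for \<sigma>
    by (simp add: vcurve_def h_def poly_sum poly_power mult_ac)
  show "p \<in> X" unfolding p(1)
  proof (rule poly_family_cofinite[OF X, where B = "{0}" and g = h and gv = "\<lambda>\<sigma>. vcurve w q \<sigma> t"])
    fix \<sigma> :: complex assume "\<sigma> \<notin> {0}"
    then have "line (vcurve w q \<sigma> t) = line (vcurve w q 1 (t / \<sigma>))"
      using line_vcurve_scale[of \<sigma> w q 1 "t / \<sigma>"] by simp
    then show "line (vcurve w q \<sigma> t) \<in> X" using on_X by simp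
  qed (rule finite.intros h vcurve_cvec[OF wb] vcurve_nonzero[OF wb p(2)])+
qed

text \<open>Birationality gives a polynomial parametrization, and counting intersections with a
  generic hyperplane bounds its degree by \<open>q\<close>. Its closure is all of \<open>C\<close>
  by dimension, so the coefficient vectors span \<open>C\<close>, and the dimension of the span
  makes all \<open>q + 1\<close> of them independent.\<close>

theorem rational_normal_curve_normal_form:
  assumes C: "rational_normal_curve N q C" and q: "q \<ge> 1"
  shows "\<exists>w b. dual_family N q w b \<and> C = rnc w q"
proof -
  have Cv: "proj_variety N C" and dim: "has_dimension (zariski N) C 1" and deg: "curve_degree N C q"
    and span: "proj_span_dim C = int q" and bir: "birational N C 1 (proj_space 1)"
    using C by (auto simp: rational_normal_curve_def)
  have Cc: "closedin (zariski N) C" using Cv by (simp add: proj_variety_def)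
  obtain g' B where g': "\<And>\<tau>. \<exists>j\<le>N. poly (g' j) \<tau> \<noteq> 0" and B: "finite B"
    "inj_on (\<lambda>\<tau>. line (\<lambda>j. if j \<le> N then poly (g' j) \<tau> else 0)) (- B)"
    "\<And>\<tau>. \<tau> \<notin> B \<Longrightarrow> line (\<lambda>j. if j \<le> N then poly (g' j) \<tau> else 0) \<in> C"
    using birational_parametrization[OF bir] by blast
  define g where "g j = (if j \<le> N then g' j else 0)" for j
  define gv where "gv \<tau> = (\<lambda>j. poly (g j) \<tau>)" for \<tau>
  have gv': "gv \<tau> = (\<lambda>j. if j \<le> N then poly (g' j) \<tau> else 0)" for \<tau> by (auto simp: gv_def g_def)
  have gv_nz: "gv \<tau> \<noteq> 0" for \<tau> using g'[of \<tau>] by (auto simp: gv' fun_eq_iff)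
  have gv_cvec: "gv \<tau> \<in> cvec N" for \<tau> by (simp add: gv' cvec_def)
  define e where "e = Max (degree ` g' ` {..N})"
  have deg_g: "degree (g' j) \<le> e" if "j \<le> N" for j using that by (auto simp: e_def)
  have "e \<in> degree ` g' ` {..N}" unfolding e_def by (rule Max_in) auto
  then obtain j1 where j1: "j1 \<le> N" "degree (g' j1) = e" by auto
  have "e \<le> q"
  proof (cases "e = 0")
    case False
    then have "coeff (g' j1) e \<noteq> 0" using j1 by auto
    then show ?thesis
      using generic_hyperplane_degree[OF g' deg_g _ gv' B(1) _ _ deg] j1(1) B(2,3) unfolding gv' by blast
  qed simp
  have on_C: "line (gv \<tau>) \<in> C" for \<tau>
    by (rule poly_family_cofinite[OF Cc B(1) gv_def gv_cvec _ gv_nz]) (use B(3) in \<open>simp add: gv'\<close>)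
  define \<Psi> where "\<Psi> u = gv (u 0)" for u :: "nat \<Rightarrow> complex"
  have "\<exists>G. \<forall>u. \<Psi> u j = poly_eval G u" for j
  proof (intro exI allI)
    show "\<Psi> u j = poly_eval (\<Sum>i\<le>degree (g j). cC (coeff (g j) i) * cX 0 ^ i) u" for u
      by (simp add: \<Psi>_def gv_def poly_eval_simps poly_altdef)
  qed
  then obtain G where G: "\<And>u j. \<Psi> u j = poly_eval (G j) u" by metis
  define Z where "Z = pclosure N (range \<Psi>)"
  have Zv: "proj_variety N Z" unfolding Z_def
    by (rule parametrized_variety[OF _ G]) (use gv_nz gv_cvec in \<open>auto simp: \<Psi>_def\<close>)
  have ZC: "Z \<subseteq> C" unfolding Z_def by (rule pclosure_minimal[OF Cc]) (use on_C in \<open>auto simp: \<Psi>_def\<close>)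
  have in_Z: "line (gv \<tau>) \<in> Z" for \<tau>
  proof -
    have "gv \<tau> = \<Psi> (\<lambda>_. \<tau>)" by (simp add: \<Psi>_def)
    then show ?thesis unfolding Z_def using line_in_pclosure gv_nz gv_cvec by (metis rangeI)
  qed
  have ZC_eq: "Z = C"
  proof (rule ccontr)
    assume "Z \<noteq> C"
    obtain \<sigma> where \<sigma>: "\<sigma> \<notin> B" using ex_new_if_finite[OF infinite_UNIV_char_0 B(1)] by blast
    obtain \<tau> where \<tau>: "\<tau> \<notin> insert \<sigma> B" using ex_new_if_finite[of "insert \<sigma> B"] infinite_UNIV_char_0 B(1) by blast
    have "line (gv \<sigma>) \<noteq> line (gv \<tau>)" using inj_onD[OF B(2), of \<sigma> \<tau>] \<sigma> \<tau> by (auto simp: gv')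
    then have "{line (gv \<sigma>)} \<subset> Z" using in_Z[of \<sigma>] in_Z[of \<tau>] by auto
    moreover have "Z \<subset> C" using ZC \<open>Z \<noteq> C\<close> by blast
    \<comment> \<open>A point, the closure of the parametrized part and \<open>C\<close> would be a
      chain of length 2 in a set of dimension 1.\<close>
    ultimately have "irreducible_chain (zariski N) C 2"
      using point_variety[OF gv_cvec gv_nz, of \<sigma>] Zv Cv
      unfolding irreducible_chain_def proj_variety_def
      by (intro exI[of _ "\<lambda>i::nat. if i = 0 then {line (gv \<sigma>)} else if i = 1 then Z else C"])
        (auto simp: less_2_cases_iff)
    then show False using dim by (simp add: has_dimension_def numeral_2_eq_2)
  qed
  define w where "w k = (\<lambda>j. coeff (g j) k)" for k
  have w_cvec: "w k \<in> cvec N" for k by (simp add: w_def cvec_def g_def)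
  have deg_g': "degree (g j) \<le> q" for j using deg_g[of j] \<open>e \<le> q\<close> by (auto simp: g_def)
  have gv_w: "gv \<tau> = vcurve w q 1 \<tau>" for \<tau>
    using poly_sum_coeffs[OF deg_g'] by (simp add: gv_def vcurve_def w_def mult.commute)
  have C_span: "\<Union>C \<subseteq> cfun.span (w ` {..q})"
  proof (rule cone_subset_span)
    show "w ` {..q} \<subseteq> cvec N" using w_cvec by blast
    show "\<Union>C \<subseteq> cvec N" using variety_cone_cvec[OF Cv] by blast
    fix l assume l: "\<And>x. x \<in> w ` {..q} \<Longrightarrow> (\<Sum>j\<le>N. l j * x j) = 0"
    have "poly_eval (linear_form N l) x = 0" if x: "x \<in> range \<Psi>" for x
    proof -
      obtain u where "x = gv (u 0)" using x by (auto simp: \<Psi>_def)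
      then have "(\<Sum>j\<le>N. l j * x j) = (\<Sum>j\<le>N. \<Sum>k\<le>q. u 0 ^ k * (l j * w k j))"
        by (simp add: gv_w vcurve_def sum_distrib_left mult_ac)
      also have "\<dots> = (\<Sum>k\<le>q. u 0 ^ k * (\<Sum>j\<le>N. l j * w k j))"
        by (subst sum.swap) (simp add: sum_distrib_left)
      also have "\<dots> = 0" using l by simp
      finally show ?thesis by simp
    qed
    then show "\<forall>v\<in>\<Union>C. (\<Sum>j\<le>N. l j * v j) = 0"
      using pclosure_vanish[OF form_linear_form] ZC_eq unfolding Z_def by fastforce
  qed
  have dimC: "cfun.dim (\<Union>C) = Suc q" using span by (simp add: proj_span_dim_def)
  \<comment> \<open>The cone over \<open>C\<close> spans a space of dimension \<open>q + 1\<close>,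
    and only \<open>q + 1\<close> coefficient vectors are available, so they are distinct and
    independent.\<close>
  have "Suc q \<le> card (w ` {..q})" using cfun.dim_le_card[OF C_span] dimC by simp
  moreover have "card (w ` {..q}) \<le> Suc q" using card_image_le[of "{..q}" w] by simp
  ultimately have cardw: "card (w ` {..q}) = Suc q" by simp
  then have inj: "inj_on w {..q}" by (intro eq_card_imp_inj_on) auto
  have indep: "cfun.independent (w ` {..q})"
  proof (rule ccontr)
    assume "\<not> ?thesis"
    then obtain a where a: "a \<in> w ` {..q}" "a \<in> cfun.span (w ` {..q} - {a})" using cfun.dependent_def by blast
    have "w ` {..q} \<subseteq> cfun.span (w ` {..q} - {a})"
      using a(2) cfun.span_superset[of "w ` {..q} - {a}"] by blast
    then have "cfun.span (w ` {..q}) \<subseteq> cfun.span (w ` {..q} - {a})"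
      by (rule cfun.span_minimal) (rule cfun.subspace_span)
    then have "\<Union>C \<subseteq> cfun.span (w ` {..q} - {a})" using C_span by blast
    then have "Suc q \<le> card (w ` {..q} - {a})" using cfun.dim_le_card dimC by (metis finite_Diff finite_atMost finite_imageI)
    then show False using a(1) cardw by simp
  qed
  have "\<forall>l. \<exists>b. \<forall>v\<in>w ` {..q}. (\<Sum>j\<le>N. b j * v j) = (if v = w l then 1 else 0)"
    using linear_functional_extension[where f = "\<lambda>v. if v = w _ then 1 else 0", OF indep] w_cvec by blast
  then obtain b where b: "\<And>l v. v \<in> w ` {..q} \<Longrightarrow> (\<Sum>j\<le>N. b l j * v j) = (if v = w l then 1 else 0)"
    by metis
  have wb: "dual_family N q w b" unfolding dual_family_def
  proof (intro conjI allI impI)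
    fix k l assume "k \<le> q" "l \<le> q"
    then show "(\<Sum>j\<le>N. b l j * w k j) = (if k = l then 1 else 0)"
      using b[of "w k" l] inj_onD[OF inj, of k l] by auto
  qed (rule w_cvec)
  have "C \<subseteq> rnc w q" unfolding ZC_eq[symmetric] Z_def
  proof (rule pclosure_minimal[OF closedin_rnc[OF wb q]])
    fix v assume "v \<in> range \<Psi>"
    then obtain u where u: "v = vcurve w q 1 (u 0)" by (auto simp: \<Psi>_def gv_w)
    have "(1 :: complex) \<noteq> 0 \<or> u 0 \<noteq> 0" by simp
    then show "line v \<in> rnc w q" unfolding u rnc_def by blast
  qed
  moreover have "rnc w q \<subseteq> C"
    by (rule rnc_subset_closed[OF Cc wb]) (use on_C in \<open>simp add: gv_w\<close>)
  ultimately show ?thesis using wb by blast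
qed

theorem rational_normal_curve_parametrization:
  assumes C: "rational_normal_curve N q C" and q: "q \<ge> 1" and P: "finite P" "P \<subseteq> C"
  shows "\<exists>G. (\<forall>i. degree (G i) \<le> q) \<and> (\<forall>x. (\<lambda>i. poly (G i) x) \<in> \<Union>C) \<and>
    (\<forall>p\<in>P. \<exists>\<sigma>. p = line (\<lambda>i. poly (G i) \<sigma>))"
proof -
  obtain w b where wb: "dual_family N q w b" and Cw: "C = rnc w q"
    using rational_normal_curve_normal_form[OF C q] by blast
  have "\<forall>p\<in>P. \<exists>st. p = line (vcurve w q (fst st) (snd st)) \<and> (fst st \<noteq> 0 \<or> snd st \<noteq> 0)"
    using P(2) unfolding Cw rnc_def by force
  then obtain st where st: "\<And>p. p \<in> P \<Longrightarrow> p = line (vcurve w q (fst (st p)) (snd (st p)))"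
    "\<And>p. p \<in> P \<Longrightarrow> fst (st p) \<noteq> 0 \<or> snd (st p) \<noteq> 0" by metis
  define B where "B = (\<lambda>p. snd (st p) / fst (st p)) ` P"
  \<comment> \<open>The substitution \<open>s = x\<close>, \<open>t = 1 + x * \<beta>\<close> misses
    only the parameter point \<open>(1 : \<beta>)\<close>. Choosing \<open>\<beta>\<close> away from
    the slopes of the given points puts all of them at finite parameters of a single polynomial
    curve.\<close>
  obtain \<beta> where \<beta>: "\<beta> \<notin> B" using ex_new_if_finite[of B] infinite_UNIV_char_0 P(1) by (auto simp: B_def)
  define G where "G j = (\<Sum>k\<le>q. [:0, 1:] ^ (q - k) * [:1, \<beta>:] ^ k * [:w k j:])" for j
  have G: "(\<lambda>j. poly (G j) x) = vcurve w q x (1 + x * \<beta>)" for x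
    by (simp add: G_def vcurve_def poly_sum poly_power mult_ac)
  have "degree (G j) \<le> q" for j unfolding G_def
  proof (rule degree_sum_le)
    fix k assume "k \<in> {..q}"
    have "degree ([:0, 1:] ^ (q - k) * [:1, \<beta>:] ^ k * [:w k j:])
      \<le> degree ([:0, 1 :: complex:] ^ (q - k)) + degree ([:1, \<beta>:] ^ k) + degree [:w k j:]"
      using degree_mult_le[of "[:0, 1:] ^ (q - k) * [:1, \<beta>:] ^ k" "[:w k j:]"] degree_mult_le[of "[:0, 1:] ^ (q - k)" "[:1, \<beta>:] ^ k"]
      by linarith
    also have "\<dots> \<le> (q - k) + k + 0"
      using degree_power_le[of "[:0, 1 :: complex:]" "q - k"] degree_power_le[of "[:1, \<beta>:]" k]
      by (intro add_mono) (auto intro: order_trans)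
    finally show "degree ([:0, 1:] ^ (q - k) * [:1, \<beta>:] ^ k * [:w k j:]) \<le> q" using \<open>k \<in> {..q}\<close> by simp
  qed simp
  moreover have "(\<lambda>j. poly (G j) x) \<in> \<Union>C" for x
  proof -
    have "x \<noteq> 0 \<or> 1 + x * \<beta> \<noteq> 0" by auto
    then have "line (vcurve w q x (1 + x * \<beta>)) \<in> C" unfolding Cw rnc_def by blast
    then show ?thesis unfolding G using line_self by blast
  qed
  moreover have "\<exists>\<sigma>. p = line (\<lambda>i. poly (G i) \<sigma>)" if p: "p \<in> P" for p
  proof -
    let ?s = "fst (st p)" and ?t = "snd (st p)"
    define c where "c = ?t - \<beta> * ?s"
    have c: "c \<noteq> 0"
    proof
      assume "c = 0"
      then have "?t = \<beta> * ?s" by (simp add: c_def)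
      then have "?s \<noteq> 0" using st(2)[OF p] by auto
      then have "\<beta> = ?t / ?s" using \<open>?t = \<beta> * ?s\<close> by simp
      then show False using \<beta> p by (auto simp: B_def)
    qed
    have "c * (?s / c) = ?s" "c * (1 + ?s / c * \<beta>) = ?t"
      using c by (simp_all add: distrib_left) (simp add: c_def mult.commute)
    then have "line (vcurve w q ?s ?t) = line (vcurve w q (?s / c) (1 + ?s / c * \<beta>))"
      using line_vcurve_scale[OF c, of w q "?s / c" "1 + ?s / c * \<beta>"] by simp
    then show ?thesis using st(1)[OF p] G by metis
  qed
  ultimately show ?thesis by blast
qed

section \<open>Hyperplanes osculating at generic points\<close>

section \<open>The upper bound\<close>

lemma sum_order_le_degree:
  fixes p :: "complex poly"
  assumes "p \<noteq> 0" "finite A" shows "(\<Sum>z\<in>A. order z p) \<le> degree p"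
proof -
  let ?R = "{z. poly p z = 0}"
  have fin: "finite ?R" using assms(1) by (simp add: poly_roots_finite)
  have "(\<Sum>z\<in>A. order z p) = (\<Sum>z\<in>A \<inter> ?R. order z p)"
    by (rule sum.mono_neutral_right) (use assms in \<open>auto simp: order_0I\<close>)
  also have "\<dots> \<le> (\<Sum>z\<in>?R. order z p)" by (rule sum_mono2) (use fin in auto)
  also have "\<dots> = (\<Sum>z\<in>?R. degree ([:- z, 1:] ^ order z p))" by (simp add: degree_power_eq)
  also have "\<dots> = degree (smult (lead_coeff p) (\<Prod>z\<in>?R. [:- z, 1:] ^ order z p))"
    using assms(1) by (simp add: degree_prod_eq_sum_degree)
  also have "\<dots> = degree p" by (simp add: complex_poly_decompose)
  finally show ?thesis .
qed

text \<open>By irreducibility a product of forms not identically zero on \<open>X\<close> is again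
  not identically zero, so finitely many open conditions can be met at once.\<close>

lemma variety_common_nonvanishing:
  assumes X: "proj_variety N X" and K: "finite K"
    and F: "\<And>F. F \<in> K \<Longrightarrow> (\<exists>d. form N d F) \<and> (\<exists>v\<in>\<Union>X. poly_eval F v \<noteq> 0)"
  shows "\<exists>v\<in>\<Union>X. \<forall>F\<in>K. poly_eval F v \<noteq> 0"
proof -
  have "(\<exists>d. form N d (\<Prod>F\<in>K. F)) \<and> (\<exists>v\<in>\<Union>X. poly_eval (\<Prod>F\<in>K. F) v \<noteq> 0)"
    using K F
  proof (induction K rule: finite_induct)
    case empty
    have "X \<noteq> {}" "X \<subseteq> proj_space N"
      using X variety_subset[OF X] by (auto simp: proj_variety_def irreducible_set_def)
    then obtain v where "line v \<in> X" by (fastforce simp: proj_space_def)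
    then have "v \<in> \<Union>X" using line_self by blast
    then have "\<exists>v\<in>\<Union>X. poly_eval 1 v \<noteq> 0" by (intro bexI[of _ v]) (simp_all add: poly_eval_1)
    then show ?case using form_1 by auto
  next
    case (insert F K)
    have "(\<exists>d. form N d (\<Prod>F\<in>K. F)) \<and> (\<exists>v\<in>\<Union>X. poly_eval (\<Prod>F\<in>K. F) v \<noteq> 0)"
      by (rule insert(3)) (use insert(4) in blast)
    then obtain d where d: "form N d (\<Prod>F\<in>K. F)" "\<exists>v\<in>\<Union>X. poly_eval (\<Prod>F\<in>K. F) v \<noteq> 0" by blast
    obtain e where e: "form N e F" "\<exists>v\<in>\<Union>X. poly_eval F v \<noteq> 0" using insert(4)[of F] by blast
    have "\<exists>v\<in>\<Union>X. poly_eval F v * poly_eval (\<Prod>F\<in>K. F) v \<noteq> 0"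
      using variety_prod[OF X e(1) d(1)] d(2) e(2) by blast
    then show ?case using form_mult[OF e(1) d(1)] insert(1,2) by (auto simp: poly_eval_mult)
  qed
  then obtain v where "v \<in> \<Union>X" "poly_eval (\<Prod>F\<in>K. F) v \<noteq> 0" by blast
  then show ?thesis using K by (intro bexI[of _ v]) (auto simp: poly_eval_prod)
qed

text \<open>Positive dimension provides a strict inclusion of nonempty closed subsets of
  \<open>X\<close>, so \<open>X\<close> is not a single point, and another point of \<open>X\<close>
  is separated from the closed set formed by the given one. Such forms keep successively chosen
  points distinct.\<close>

lemma form_avoiding_point:
  assumes X: "proj_variety N X" and dim: "has_dimension (zariski N) X d" "d \<ge> 1"
    and v: "v \<in> cvec N" "v \<noteq> 0"
  shows "\<exists>L. (\<exists>d. form N d L) \<and> (\<exists>x\<in>\<Union>X. poly_eval L x \<noteq> 0) \<and> (\<forall>x\<in>line v. poly_eval L x = 0)"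
proof -
  have "irreducible_chain (zariski N) X d" using dim(1) by (simp add: has_dimension_def)
  then obtain c where c: "\<forall>i\<le>d. closedin (zariski N) (c i) \<and> irreducible_set (zariski N) (c i) \<and> c i \<subseteq> X"
    "\<forall>i<d. c i \<subset> c (Suc i)"
    unfolding irreducible_chain_def by (elim exE conjE) (rule that; assumption)
  have "c 0 \<noteq> {}" "c 0 \<subset> c 1" "c 1 \<subseteq> X" using c(1)[rule_format, of 0] c(1)[rule_format, of 1] c(2)[rule_format, of 0] dim(2)
    by (auto simp: irreducible_set_def)
  then have "\<not> X \<subseteq> {line v}" by blast
  then obtain p where p: "p \<in> X" "p \<noteq> line v" by blast
  then obtain x where x: "p = line x" "x \<in> cvec N" "x \<noteq> 0"
    using variety_subset[OF X] by (auto simp: proj_space_def)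
  have "closedin (zariski N) {line v}" using point_variety[OF v] by (simp add: proj_variety_def)
  then obtain L e where L: "form N e L" "\<forall>w\<in>\<Union>{line v}. poly_eval L w = 0" "poly_eval L x \<noteq> 0"
    using closed_separate[of N "{line v}" x] x p by auto
  moreover have "x \<in> \<Union>X" using p x line_self by blast
  ultimately show ?thesis by auto
qed

text \<open>A nonempty open subset of the product contains the locus where one multihomogeneous
  polynomial does not vanish. Genericity of tuples thereby becomes a condition that can be
  specialized factor by factor and combined with other forms.\<close>

lemma generic_tuple_form:
  assumes X: "proj_variety N X"
    and gen: "generically (subtopology (zariski_prod N n) ({..<n} \<rightarrow>\<^sub>E X)) P"
  shows "\<exists>G d. multiform N n d G \<and>
    (\<exists>v. (\<forall>i<n. v i \<in> \<Union>X \<and> v i \<noteq> 0) \<and> poly_eval G (\<lambda>(i, j). v i j) \<noteq> 0) \<and>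
    (\<forall>v. (\<forall>i<n. v i \<in> \<Union>X \<and> v i \<noteq> 0) \<longrightarrow> poly_eval G (\<lambda>(i, j). v i j) \<noteq> 0 \<longrightarrow>
      P (\<lambda>i\<in>{..<n}. line (v i)))"
proof -
  let ?Y = "{..<n} \<rightarrow>\<^sub>E X"
  have XP: "X \<subseteq> proj_space N" by (rule variety_subset[OF X])
  have YP: "?Y \<subseteq> proj_prod N n" using XP unfolding proj_prod_def by (intro PiE_mono) auto
  have "X \<noteq> {}" using X by (simp add: proj_variety_def irreducible_set_def)
  then have "?Y \<noteq> {}" by (simp add: PiE_eq_empty_iff)
  obtain U where U: "openin (subtopology (zariski_prod N n) ?Y) U"
    "subtopology (zariski_prod N n) ?Y closure_of U = topspace (subtopology (zariski_prod N n) ?Y)"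
    "\<And>x. x \<in> U \<Longrightarrow> P x" using gen by (auto simp: generically_def)
  have "topspace (subtopology (zariski_prod N n) ?Y) = ?Y" using YP by auto
  then have "U \<noteq> {}" using U(2) \<open>?Y \<noteq> {}\<close> by auto
  then obtain z where z: "z \<in> U" by blast
  obtain W where W: "openin (zariski_prod N n) W" "U = W \<inter> ?Y" using U(1) by (auto simp: openin_subtopology)
  have WP: "W \<subseteq> proj_prod N n" using openin_subset[OF W(1)] by simp
  have "closedin (zariski_prod N n) (proj_prod N n - W)"
    using W(1) by (metis openin_closedin_eq topspace_zariski_prod)
  then obtain S where S: "S \<subseteq> {F. \<exists>d. multiform N n d F}" "proj_prod N n - W = multi_zero_locus N n S"
    using closedin_zariski_prod by blast
  have zY: "z \<in> ?Y" "z \<in> W" using z W(2) by blast+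
  have "\<forall>i. \<exists>v. i < n \<longrightarrow> z i = line v \<and> v \<in> cvec N \<and> v \<noteq> 0"
    using zY(1) XP by (force simp: proj_space_def PiE_iff)
  from choice[OF this] obtain v where v: "\<And>i. i < n \<Longrightarrow> z i = line (v i) \<and> v i \<in> cvec N \<and> v i \<noteq> 0" by blast
  have "z \<notin> multi_zero_locus N n S" using zY(2) S(2) by blast
  then obtain G where G: "G \<in> S" "\<not> (\<forall>v. (\<forall>i<n. v i \<in> z i) \<longrightarrow> poly_eval G (\<lambda>(i, j). v i j) = 0)"
    using zY(1) YP unfolding multi_zero_locus_def by blast
  obtain d where d: "multiform N n d G" using G(1) S(1) by blast
  have "poly_eval G (\<lambda>(i, j). v i j) \<noteq> 0"
    using G(2) multi_vanish_line[OF d, of z v] v by blast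
  moreover have "v i \<in> \<Union>X \<and> v i \<noteq> 0" if "i < n" for i
    using v[OF that] zY(1) that line_self[of "v i"] by (auto simp: PiE_iff)
  moreover have "P (\<lambda>i\<in>{..<n}. line (v i))"
    if v: "\<forall>i<n. v i \<in> \<Union>X \<and> v i \<noteq> 0" and Gv: "poly_eval G (\<lambda>(i, j). v i j) \<noteq> 0" for v
  proof -
    let ?x = "\<lambda>i\<in>{..<n}. line (v i)"
    have x: "?x \<in> ?Y" using v variety_cone_line[OF X] by auto
    have "?x \<notin> multi_zero_locus N n S"
    proof
      assume "?x \<in> multi_zero_locus N n S"
      then have "\<forall>v'. (\<forall>i<n. v' i \<in> ?x i) \<longrightarrow> poly_eval G (\<lambda>(i, j). v' i j) = 0"
        using G(1) by (simp add: multi_zero_locus_def)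
      then show False using Gv line_self by auto
    qed
    then have "?x \<in> W" using x YP S(2) by blast
    then show ?thesis using U(3) W(2) x by blast
  qed
  ultimately show ?thesis using d by (intro exI[of _ G] exI[of _ d] conjI exI[of _ v]) auto
qed

text \<open>A hyperplane containing the osculating spaces of orders \<open>\<rho>\<close> or \<open>\<rho> - 1\<close> at \<open>n - 1\<close> generic
  points meets a rational normal curve of degree \<open>q\<close> through them in at least \<open>q + 1\<close> points counted
  with multiplicity, hence contains it.\<close>

theorem span_upper_bound:
  assumes d: "d \<ge> 1" and n: "n \<ge> 2" and m: "1 \<le> m" "m \<le> n - 1" and \<rho>: "\<rho> \<ge> 1"
    and q: "q + 1 = \<rho> * (n - 1) + m" and X: "rnc_variety d n q N X"
  shows "cfun.dim (\<Union>X) \<le> m * ((d + \<rho>) choose d) + (n - 1 - m) * ((d + \<rho> - 1) choose d)"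
proof -
  have Xv: "proj_variety N X" and dim: "has_dimension (zariski N) X d"
    and gen: "rnc_through_generic_points n q N X" using X by (auto simp: rnc_variety_def)
  have q1: "q \<ge> 1"
  proof -
    have "1 * 1 \<le> \<rho> * (n - 1)" by (rule mult_le_mono) (use \<rho> n in auto)
    then show ?thesis using q m by linarith
  qed
  obtain e F where F: "form N e F" "\<exists>v\<in>\<Union>X. poly_eval F v \<noteq> 0"
    and osc: "\<forall>v\<in>\<Union>X. poly_eval F v \<noteq> 0 \<longrightarrow> (\<forall>k. \<exists>L. finite L \<and> card L \<le> (d + k) choose d \<and>
      (\<forall>l G \<sigma>. (\<forall>w\<in>L. (\<Sum>i\<le>N. l i * w i) = 0) \<longrightarrow> (\<forall>x. (\<lambda>i. poly (G i) x) \<in> \<Union>X) \<longrightarrow>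
        (\<lambda>i. poly (G i) \<sigma>) = v \<longrightarrow> [:- \<sigma>, 1:] ^ Suc k dvd (\<Sum>i\<le>N. smult (l i) (G i))))"
    using generic_osculation[OF Xv dim] by (elim exE conjE) (rule that; assumption)
  obtain G dG where G: "multiform N n dG G"
    and G0: "\<exists>v. (\<forall>i<n. v i \<in> \<Union>X \<and> v i \<noteq> 0) \<and> poly_eval G (\<lambda>(i, j). v i j) \<noteq> 0"
    and GP: "\<forall>v. (\<forall>i<n. v i \<in> \<Union>X \<and> v i \<noteq> 0) \<longrightarrow> poly_eval G (\<lambda>(i, j). v i j) \<noteq> 0 \<longrightarrow>
      (\<exists>C. rational_normal_curve N q C \<and> C \<subseteq> X \<and> (\<forall>i<n. (\<lambda>i\<in>{..<n}. line (v i)) i \<in> C))"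
    using generic_tuple_form[OF Xv gen[unfolded rnc_through_generic_points_def]]
    by (elim exE conjE) (rule that; blast)
  \<comment> \<open>The first \<open>n - 1\<close> points are replaced one after another, with
    \<open>G\<close> kept nonzero at the tuple, until they are distinct and admit osculating spaces.
    The last point remains free to be moved off a hyperplane.\<close>
  have "\<exists>v. (\<forall>i<n. v i \<in> \<Union>X \<and> v i \<noteq> 0) \<and> poly_eval G (\<lambda>(i, j). v i j) \<noteq> 0 \<and>
      (\<forall>i<k. poly_eval F (v i) \<noteq> 0) \<and> (\<forall>i<k. \<forall>i'<i. v i \<notin> line (v i'))" if "k \<le> n - 1" for k
    using that
  proof (induction k)
    case (Suc k)
    have "k \<le> n - 1" using Suc.prems by simp
    from Suc.IH[OF this] obtain v where v': "\<forall>i<n. v i \<in> \<Union>X \<and> v i \<noteq> 0" "poly_eval G (\<lambda>(i, j). v i j) \<noteq> 0"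
      "\<forall>i<k. poly_eval F (v i) \<noteq> 0" "\<forall>i<k. \<forall>i'<i. v i \<notin> line (v i')"
      by (elim exE conjE) (rule that; assumption)
    note v = v'(1)[rule_format] v'(2) v'(3)[rule_format] v'(4)[rule_format]
    have kn: "k < n" using Suc.prems by simp
    obtain H where H: "form N (dG k) H" "\<And>x. poly_eval H x = poly_eval G (\<lambda>(i, j). (v(k := x)) i j)"
      using multiform_partial_eval[OF G kn, of v] by blast
    have "\<forall>i. \<exists>L. i < k \<longrightarrow> (\<exists>d. form N d L) \<and> (\<exists>x\<in>\<Union>X. poly_eval L x \<noteq> 0) \<and> (\<forall>x\<in>line (v i). poly_eval L x = 0)"
    proof
      fix i
      show "\<exists>L. i < k \<longrightarrow> (\<exists>d. form N d L) \<and> (\<exists>x\<in>\<Union>X. poly_eval L x \<noteq> 0) \<and> (\<forall>x\<in>line (v i). poly_eval L x = 0)"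
      proof (cases "i < k")
        case True
        then have "v i \<in> cvec N" "v i \<noteq> 0" using v(1)[of i] kn variety_cone_cvec[OF Xv] by auto
        then show ?thesis using form_avoiding_point[OF Xv dim d] by blast
      qed simp
    qed
    from choice[OF this] obtain L where L: "\<And>i. i < k \<Longrightarrow> (\<exists>d. form N d (L i)) \<and>
      (\<exists>x\<in>\<Union>X. poly_eval (L i) x \<noteq> 0) \<and> (\<forall>x\<in>line (v i). poly_eval (L i) x = 0)" by blast
    \<comment> \<open>The form \<open>cX j\<close> keeps the new vector nonzero; it does not vanish
      identically on \<open>X\<close> because the old vector has a nonzero coordinate
      \<open>j\<close>.\<close>
    obtain j where j: "j \<le> N" "v k j \<noteq> 0"
      using v(1)[OF kn] variety_cone_cvec[OF Xv] by (auto simp: cvec_def fun_eq_iff) (metis not_le)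
    have "\<exists>x\<in>\<Union>X. \<forall>K\<in>{cX j, H, F} \<union> L ` {..<k}. poly_eval K x \<noteq> 0"
    proof (rule variety_common_nonvanishing[OF Xv])
      have "poly_eval H (v k) \<noteq> 0" using v(2) by (simp add: H(2))
      then have H0: "\<exists>x\<in>\<Union>X. poly_eval H x \<noteq> 0" using v(1)[OF kn] by blast
      have "poly_eval (cX j) (v k) \<noteq> 0" using j(2) by simp
      then have j0: "\<exists>x\<in>\<Union>X. poly_eval (cX j) x \<noteq> 0" using v(1)[OF kn] by blast
      show "(\<exists>d. form N d K) \<and> (\<exists>x\<in>\<Union>X. poly_eval K x \<noteq> 0)" if K: "K \<in> {cX j, H, F} \<union> L ` {..<k}" for K
      proof -
        consider "K = cX j" | "K = H" | "K = F" | i where "i < k" "K = L i" using K by auto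
        then show ?thesis
        proof cases
          case 1
          then show ?thesis using form_cX[OF j(1)] j0 by blast
        next
          case 2
          then show ?thesis using H(1) H0 by blast
        next
          case 3
          then show ?thesis using F by blast
        next
          case 4
          then show ?thesis using L[OF 4(1)] by blast
        qed
      qed
    qed simp
    then obtain x where x: "x \<in> \<Union>X" "x j \<noteq> 0" "poly_eval H x \<noteq> 0" "poly_eval F x \<noteq> 0"
      "\<And>i. i < k \<Longrightarrow> poly_eval (L i) x \<noteq> 0" by auto
    have x0: "x \<noteq> 0" using x(2) by auto
    have xL: "x \<notin> line (v i)" if "i < k" for i using L[OF that] x(5)[OF that] by blast
    show ?case
    proof (intro exI[of _ "v(k := x)"] conjI allI impI)
      show "poly_eval G (\<lambda>(i, j). (v(k := x)) i j) \<noteq> 0" using x(3) H(2) by simp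
      show "(v(k := x)) i \<in> \<Union>X" "(v(k := x)) i \<noteq> 0" if "i < n" for i using v(1)[OF that] x(1) x0 by auto
      show "poly_eval F ((v(k := x)) i) \<noteq> 0" if "i < Suc k" for i using that v(3)[of i] x(4) by (auto simp: less_Suc_eq)
      show "(v(k := x)) i \<notin> line ((v(k := x)) i')" if "i < Suc k" "i' < i" for i i'
        using that v(4)[of i i'] xL[of i'] by (auto simp: less_Suc_eq)
    qed
  qed (use G0 in auto)
  from this[OF le_refl] obtain v where v': "\<forall>i<n. v i \<in> \<Union>X \<and> v i \<noteq> 0" "poly_eval G (\<lambda>(i, j). v i j) \<noteq> 0"
      "\<forall>i<n - 1. poly_eval F (v i) \<noteq> 0" "\<forall>i<n - 1. \<forall>i'<i. v i \<notin> line (v i')"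
    by (elim exE conjE) (rule that; assumption)
  note v = v'(1)[rule_format] v'(2) v'(3)[rule_format] v'(4)[rule_format]
  \<comment> \<open>The order of the osculating space at the \<open>i\<close>-th point. Contact has
    multiplicity \<open>Suc (k i)\<close>, and these multiplicities sum to
    \<open>q + 1\<close>.\<close>
  define k where "k i = (if i < m then \<rho> else \<rho> - 1)" for i :: nat
  have "\<forall>i. \<exists>L. i < n - 1 \<longrightarrow> finite L \<and> card L \<le> (d + k i) choose d \<and>
      (\<forall>l G \<sigma>. (\<forall>w\<in>L. (\<Sum>i\<le>N. l i * w i) = 0) \<longrightarrow> (\<forall>x. (\<lambda>i. poly (G i) x) \<in> \<Union>X) \<longrightarrow>
        (\<lambda>i. poly (G i) \<sigma>) = v i \<longrightarrow> [:- \<sigma>, 1:] ^ Suc (k i) dvd (\<Sum>i\<le>N. smult (l i) (G i)))"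
    (is "\<forall>i. \<exists>L. i < n - 1 \<longrightarrow> ?Q i L")
  proof
    fix i
    have *: "\<exists>L. ?Q i L" if "i < n - 1"
      by (rule osc[THEN bspec, THEN mp, THEN spec]) (use v(1)[of i] v(3)[OF that] that in auto)
    show "\<exists>L. i < n - 1 \<longrightarrow> ?Q i L"
    proof (cases "i < n - 1")
      case True
      from *[OF True] obtain L where "?Q i L" by (rule exE)
      then show ?thesis by (intro exI impI)
    next
      case False
      then show ?thesis by (intro exI impI) (erule notE)
    qed
  qed
  from choice[OF this] obtain L where LQ: "\<forall>i. i < n - 1 \<longrightarrow> ?Q i (L i)" by (rule exE)
  note LQ = LQ[THEN spec, THEN mp]
  note L = LQ[THEN conjunct1] LQ[THEN conjunct2, THEN conjunct1]
    LQ[THEN conjunct2, THEN conjunct2, THEN spec, THEN spec, THEN spec, THEN mp, THEN mp, THEN mp]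
  \<comment> \<open>Vectors in \<open>L i\<close> may have coordinates beyond \<open>N\<close>.
    Truncation brings them into \<open>cvec N\<close> without changing their pairing with
    \<open>l\<close>.\<close>
  define trunc where "trunc w = (\<lambda>j. if j \<le> N then w j else 0)" for w :: "nat \<Rightarrow> complex"
  define M where "M = trunc ` (\<Union>i<n - 1. L i)"
  have finM: "finite M" unfolding M_def using L(1) by auto
  have "card M \<le> card (\<Union>i<n - 1. L i)" unfolding M_def by (rule card_image_le) (use L(1) in auto)
  also have "\<dots> \<le> (\<Sum>i<n - 1. card (L i))" by (rule card_UN_le) simp
  also have "\<dots> \<le> (\<Sum>i<n - 1. (d + k i) choose d)" by (rule sum_mono) (use L(2) in auto)
  also have "\<dots> = m * ((d + \<rho>) choose d) + (n - 1 - m) * ((d + \<rho> - 1) choose d)"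
  proof -
    have "{..<n - 1} = {..<m} \<union> {m..<n - 1}" using m by auto
    then have "(\<Sum>i<n - 1. (d + k i) choose d) = (\<Sum>i<m. (d + k i) choose d) + (\<Sum>i\<in>{m..<n - 1}. (d + k i) choose d)"
      by (simp add: sum.union_disjoint ivl_disj_int)
    then show ?thesis using \<rho> by (simp add: k_def)
  qed
  finally have cardM: "card M \<le> m * ((d + \<rho>) choose d) + (n - 1 - m) * ((d + \<rho> - 1) choose d)" .
  have total: "(\<Sum>i<n - 1. Suc (k i)) = q + 1"
  proof -
    have "{..<n - 1} = {..<m} \<union> {m..<n - 1}" using m by auto
    then have "(\<Sum>i<n - 1. Suc (k i)) = (\<Sum>i<m. Suc (k i)) + (\<Sum>i\<in>{m..<n - 1}. Suc (k i))"
      by (simp add: sum.union_disjoint ivl_disj_int)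
    also have "\<dots> = m * Suc \<rho> + (n - 1 - m) * \<rho>" using \<rho> by (simp add: k_def)
    also have "\<dots> = \<rho> * (m + (n - 1 - m)) + m" by (simp add: algebra_simps)
    finally show ?thesis using m q by simp
  qed
  have n1: "n - 1 < n" using n by simp
  have "\<Union>X \<subseteq> cfun.span M"
  proof (rule cone_subset_span)
    show "M \<subseteq> cvec N" by (auto simp: M_def trunc_def cvec_def)
    show "\<Union>X \<subseteq> cvec N" using variety_cone_cvec[OF Xv] by blast
    fix l assume lM: "\<And>w. w \<in> M \<Longrightarrow> (\<Sum>j\<le>N. l j * w j) = 0"
    have lL: "\<forall>w\<in>L i. (\<Sum>j\<le>N. l j * w j) = 0" if "i < n - 1" for i
    proof
      fix w assume "w \<in> L i"
      then have "trunc w \<in> M" using that by (auto simp: M_def)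
      from lM[OF this] show "(\<Sum>j\<le>N. l j * w j) = 0" by (simp add: trunc_def)
    qed
    show "\<forall>v\<in>\<Union>X. (\<Sum>j\<le>N. l j * v j) = 0"
    proof (rule ccontr)
      assume "\<not> ?thesis"
      then have l0: "\<exists>x\<in>\<Union>X. poly_eval (linear_form N l) x \<noteq> 0" by simp
      obtain H where H: "form N (dG (n - 1)) H" "\<And>x. poly_eval H x = poly_eval G (\<lambda>(i, j). (v(n - 1 := x)) i j)"
        using multiform_partial_eval[OF G n1, of v] by blast
      have "poly_eval H (v (n - 1)) \<noteq> 0" using v(2) by (simp add: H(2))
      then have H0: "\<exists>x\<in>\<Union>X. poly_eval H x \<noteq> 0" using v(1)[OF n1] by blast
      \<comment> \<open>If the hyperplane did not contain \<open>X\<close>, the last point could be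
        moved off it while the tuple stays generic. The curve through this new tuple gives the
        contradiction.\<close>
      have "\<exists>x\<in>\<Union>X. \<forall>K\<in>{linear_form N l, H}. poly_eval K x \<noteq> 0"
      proof (rule variety_common_nonvanishing[OF Xv])
        fix K assume "K \<in> {linear_form N l, H}"
        then show "(\<exists>d. form N d K) \<and> (\<exists>x\<in>\<Union>X. poly_eval K x \<noteq> 0)"
          using l0 H0 H(1) form_linear_form[of N l] by (elim insertE emptyE) blast+
      qed simp
      then obtain x where x: "x \<in> \<Union>X" "(\<Sum>j\<le>N. l j * x j) \<noteq> 0" "poly_eval H x \<noteq> 0" by auto
      have "x \<noteq> 0" using x(2) by auto
      define v' where "v' = v(n - 1 := x)"
      have v': "\<And>i. i < n \<Longrightarrow> v' i \<in> \<Union>X \<and> v' i \<noteq> 0" "\<And>i. i < n - 1 \<Longrightarrow> v' i = v i" "v' (n - 1) = x"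
        using v(1) x(1) \<open>x \<noteq> 0\<close> by (auto simp: v'_def)
      have "poly_eval G (\<lambda>(i, j). v' i j) \<noteq> 0" using x(3) H(2) by (simp add: v'_def)
      then obtain C where C: "rational_normal_curve N q C" "C \<subseteq> X" "\<And>i. i < n \<Longrightarrow> line (v' i) \<in> C"
        using GP[rule_format, of v'] v'(1) by auto
      have "(\<lambda>i. line (v' i)) ` {..<n} \<subseteq> C" using C(3) by blast
      from rational_normal_curve_parametrization[OF C(1) q1 finite_imageI[OF finite_lessThan] this]
      obtain g where g': "\<forall>i. degree (g i) \<le> q" "\<forall>x. (\<lambda>i. poly (g i) x) \<in> \<Union>C"
          "\<forall>p\<in>(\<lambda>i. line (v' i)) ` {..<n}. \<exists>\<sigma>. p = line (\<lambda>j. poly (g j) \<sigma>)"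
        by (elim exE conjE) (rule that; assumption)
      note g = g'(1)[rule_format] g'(2)[rule_format] bspec[OF g'(3) imageI, OF lessThan_iff[THEN iffD2]]
      have gX: "(\<lambda>i. poly (g i) x) \<in> \<Union>X" for x using g(2)[of x] C(2) by blast
      have "\<forall>i. \<exists>\<sigma>. i < n \<longrightarrow> line (v' i) = line (\<lambda>j. poly (g j) \<sigma>)" using g(3) by blast
      from choice[OF this] obtain \<sigma> where \<sigma>: "\<And>i. i < n \<Longrightarrow> line (v' i) = line (\<lambda>j. poly (g j) (\<sigma> i))" by blast
      have scale: "\<exists>a. a \<noteq> 0 \<and> v' i = cscale a (\<lambda>j. poly (g j) (\<sigma> i))" if "i < n" for i
      proof -
        have "v' i \<in> line (\<lambda>j. poly (g j) (\<sigma> i))" using \<sigma>[OF that] line_self by blast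
        then obtain a where a: "v' i = cscale a (\<lambda>j. poly (g j) (\<sigma> i))" by (auto simp: line_def)
        moreover have "a \<noteq> 0" using a v'(1)[OF that] by (auto simp: cscale_eq_0_iff)
        ultimately show ?thesis by blast
      qed
      define b where "b = (\<Sum>i\<le>N. smult (l i) (g i))"
      have dvd: "[:- \<sigma> i, 1:] ^ Suc (k i) dvd b" if i: "i < n - 1" for i
      proof -
        have "i < n" using i by simp
        from scale[OF this] obtain a where a: "a \<noteq> 0" "v' i = cscale a (\<lambda>j. poly (g j) (\<sigma> i))" by blast
        \<comment> \<open>The osculation property is stated for curves hitting the vector
          \<open>v i\<close> itself, so the parametrization is rescaled by \<open>a\<close>.\<close>
        have "[:- \<sigma> i, 1:] ^ Suc (k i) dvd (\<Sum>j\<le>N. smult (l j) (smult a (g j)))"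
        proof (rule L(3)[OF i lL[OF i]])
          show "\<forall>x. (\<lambda>j. poly (smult a (g j)) x) \<in> \<Union>X"
            using variety_cone_scale[OF Xv gX, of a] by (simp add: cscale_def)
          show "(\<lambda>j. poly (smult a (g j)) (\<sigma> i)) = v i"
            using a(2) v'(2)[OF i] by (simp add: cscale_def)
        qed
        also have "(\<Sum>j\<le>N. smult (l j) (smult a (g j))) = smult a b"
          by (rule poly_eqI) (simp add: b_def coeff_sum sum_distrib_left mult_ac)
        finally show ?thesis using a(1) by (simp add: dvd_smult_iff del: power_Suc)
      qed
      have inj: "inj_on \<sigma> {..<n - 1}"
      proof -
        have "\<sigma> i \<noteq> \<sigma> i'" if "i < n - 1" "i' < i" for i i'
        proof
          assume "\<sigma> i = \<sigma> i'"
          then have "line (v' i) = line (v' i')" using \<sigma>[of i] \<sigma>[of i'] that by simp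
          then show False using v(4)[OF that] v'(2)[of i] v'(2)[of i'] that line_self[of "v i"] by auto
        qed
        then show ?thesis by (intro linorder_inj_onI') (metis lessThan_iff)
      qed
      have "b = 0"
      proof (rule ccontr)
        assume b0: "b \<noteq> 0"
        have "q + 1 = (\<Sum>i<n - 1. Suc (k i))" using total by simp
        also have "\<dots> \<le> (\<Sum>i<n - 1. order (\<sigma> i) b)"
          by (rule sum_mono) (use dvd b0 order_divides in blast)
        also have "\<dots> = (\<Sum>z\<in>\<sigma> ` {..<n - 1}. order z b)" using inj by (simp add: sum.reindex)
        also have "\<dots> \<le> degree b" by (rule sum_order_le_degree[OF b0]) simp
        also have "\<dots> \<le> q" unfolding b_def
          by (rule degree_sum_le) (use g(1) order_trans[OF degree_smult_le] in auto)
        finally show False by simp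
      qed
      obtain a where a: "v' (n - 1) = cscale a (\<lambda>j. poly (g j) (\<sigma> (n - 1)))" using scale[OF n1] by blast
      have xj: "x j = a * poly (g j) (\<sigma> (n - 1))" for j
        using fun_cong[OF a, of j] unfolding v'(3) cscale_def .
      have "(\<Sum>j\<le>N. l j * x j) = a * poly b (\<sigma> (n - 1))"
        unfolding xj by (simp add: b_def poly_sum sum_distrib_left mult_ac)
      then show False using x(2) \<open>b = 0\<close> by simp
    qed
  qed
  from cfun.dim_le_card[OF this finM] have "cfun.dim (\<Union>X) \<le> card M" .
  then show ?thesis using cardM by simp
qed

section \<open>The curves in normal form satisfy the intrinsic definition\<close>

section \<open>Standard rational normal curves\<close>

lemma dual_family_independent:
  assumes wb: "dual_family N q w b"
  shows "cfun.independent (w ` {..q})" and "card (w ` {..q}) = Suc q"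
proof -
  have w: "w ` {..q} \<subseteq> cvec N" using wb by (auto simp: dual_family_def)
  have bw: "(\<Sum>j\<le>N. b l j * w k j) = (if k = l then 1 else 0)" if "k \<le> q" "l \<le> q" for k l
    using wb that by (simp add: dual_family_def)
  have "inj_on w {..q}"
  proof (rule inj_onI)
    fix k l assume "k \<in> {..q}" "l \<in> {..q}" "w k = w l"
    then show "k = l" using bw[of k l] bw[of l l] by (auto split: if_splits)
  qed
  then show "card (w ` {..q}) = Suc q" by (simp add: card_image)
  show "cfun.independent (w ` {..q})"
  proof
    assume "cfun.dependent (w ` {..q})"
    then obtain k where k: "k \<le> q" "w k \<in> cfun.span (w ` {..q} - {w k})"
      unfolding cfun.dependent_def by auto
    let ?T = "{v. (\<Sum>j\<le>N. b k j * v j) = 0}"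
    have "w ` {..q} - {w k} \<subseteq> ?T" using bw k(1) by auto
    moreover have "cfun.subspace ?T"
      by (rule cfun.subspaceI)
        (auto simp: cscale_def distrib_left sum.distrib mult.left_commute simp flip: sum_distrib_left)
    ultimately have "w k \<in> ?T" using k(2) cfun.span_minimal by blast
    then show False using bw[OF k(1) k(1)] by simp
  qed
qed

lemma dim_dual_family:
  assumes wb: "dual_family N q w b" and S: "S \<subseteq> cfun.span (w ` {..q})" "w ` {..q} \<subseteq> cfun.span S"
  shows "cfun.dim S = Suc q"
proof -
  have "cfun.span S = cfun.span (w ` {..q})"
    using cfun.span_minimal[OF S(1) cfun.subspace_span] cfun.span_minimal[OF S(2) cfun.subspace_span] by blast
  then show ?thesis
    using cfun.dim_span[of S] cfun.dim_span_eq_card_independent[OF dual_family_independent(1)[OF wb]]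
      dual_family_independent(2)[OF wb] by simp
qed

context
  fixes N q w b
  assumes wb: "dual_family N q w b" and q1: "q \<ge> 1"
begin

lemma vcurve_polynomial: "vcurve w q 1 (u 0) j = poly_eval (\<Sum>k\<le>q. cC (w k j) * cX 0 ^ k) u"
  by (simp add: vcurve_def poly_eval_simps mult.commute)

text \<open>As the closure of its affine part the curve is parametrized by one variable;
  irreducibility and the upper bound on its dimension follow from this.\<close>

lemma rnc_eq_pclosure: "rnc w q = pclosure N (range (\<lambda>u :: nat \<Rightarrow> complex. vcurve w q 1 (u 0)))"
proof
  show "rnc w q \<subseteq> pclosure N (range (\<lambda>u :: nat \<Rightarrow> complex. vcurve w q 1 (u 0)))"
  proof (rule rnc_subset_closed[OF closedin_pclosure wb])
    fix \<tau>
    have "vcurve w q 1 \<tau> \<in> range (\<lambda>u :: nat \<Rightarrow> complex. vcurve w q 1 (u 0))"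
      by (rule range_eqI[where x = "\<lambda>_. \<tau>"]) simp
    then show "line (vcurve w q 1 \<tau>) \<in> pclosure N (range (\<lambda>u :: nat \<Rightarrow> complex. vcurve w q 1 (u 0)))"
      using line_in_pclosure vcurve_cvec[OF wb] vcurve_nonzero[OF wb, of 1 \<tau>] by simp
  qed
  show "pclosure N (range (\<lambda>u :: nat \<Rightarrow> complex. vcurve w q 1 (u 0))) \<subseteq> rnc w q"
  proof (rule pclosure_minimal[OF closedin_rnc[OF wb q1]])
    fix v assume "v \<in> range (\<lambda>u :: nat \<Rightarrow> complex. vcurve w q 1 (u 0))"
    then obtain u :: "nat \<Rightarrow> complex" where u: "v = vcurve w q 1 (u 0)" by blast
    have "(1 :: complex) \<noteq> 0 \<or> u 0 \<noteq> 0" by simp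
    then show "line v \<in> rnc w q" unfolding u rnc_def by blast
  qed
qed

lemma rnc_variety_structure: "proj_variety N (rnc w q)"
  unfolding rnc_eq_pclosure
  by (rule parametrized_variety[OF _ vcurve_polynomial])
    (use vcurve_cvec[OF wb] vcurve_nonzero[OF wb] in auto)

lemma rnc_affine_points_distinct:
  assumes "line (vcurve w q 1 t) = line (vcurve w q 1 t')" shows "t = t'"
proof -
  have "vcurve w q 1 t \<in> line (vcurve w q 1 t')" using assms line_self by blast
  then obtain c where c: "vcurve w q 1 t = cscale c (vcurve w q 1 t')" by (auto simp: line_def)
  have "(1::complex) ^ (q - l) * t ^ l = c * (1 ^ (q - l) * t' ^ l)" if "l \<le> q" for l
  proof -
    have "(1::complex) ^ (q - l) * t ^ l = (\<Sum>j\<le>N. b l j * cscale c (vcurve w q 1 t') j)"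
      using dual_vcurve[OF wb that, of 1 t] by (simp add: c)
    also have "\<dots> = c * (\<Sum>j\<le>N. b l j * vcurve w q 1 t' j)" by (simp add: cscale_def sum_distrib_left mult_ac)
    finally show ?thesis using dual_vcurve[OF wb that, of 1 t'] by simp
  qed
  from this[of 0] this[of 1] q1 show ?thesis by simp
qed

lemma rnc_dimension: "has_dimension (zariski N) (rnc w q) 1"
  unfolding has_dimension_def
proof
  have p: "line (vcurve w q 1 t) \<in> rnc w q" for t
  proof -
    have "(1 :: complex) \<noteq> 0 \<or> t \<noteq> 0" by simp
    then show ?thesis unfolding rnc_def by blast
  qed
  have "line (vcurve w q 1 0) \<noteq> line (vcurve w q 1 1)" using rnc_affine_points_distinct[of 0 1] by auto
  then have "{line (vcurve w q 1 0)} \<subset> rnc w q" using p[of 0] p[of 1] by auto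
  moreover have "proj_variety N {line (vcurve w q 1 0)}"
    by (rule point_variety) (use vcurve_cvec[OF wb] vcurve_nonzero[OF wb] in auto)
  ultimately show "irreducible_chain (zariski N) (rnc w q) 1"
    using rnc_variety_structure unfolding irreducible_chain_def proj_variety_def
    by (intro exI[of _ "\<lambda>i::nat. if i = 0 then {line (vcurve w q 1 0)} else rnc w q"]) auto
  have "\<not> irreducible_chain (zariski N) (rnc w q) (Suc (card {0 :: nat}))"
  proof (rule parametrized_no_long_chain[where g = "\<lambda>j. \<Sum>k\<le>q. cC (w k j) * cX 0 ^ k"
        and \<Psi> = "\<lambda>u. vcurve w q 1 (u 0)"])
    show "vars_in {0} (\<Sum>k\<le>q. cC (w k j) * cX 0 ^ k)" for j
      by (intro vars_in_sum vars_in_mult vars_in_power) auto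
  qed (rule finite.intros vcurve_polynomial equalityD1[OF rnc_eq_pclosure])+
  then show "\<not> irreducible_chain (zariski N) (rnc w q) (Suc 1)" by simp
qed

lemma rnc_span: "proj_span_dim (rnc w q) = int q"
proof -
  let ?S = "\<Union>(rnc w q)"
  have SN: "?S \<subseteq> cvec N" using variety_cone_cvec[OF rnc_variety_structure] by blast
  have wN: "w ` {..q} \<subseteq> cvec N" using wb by (auto simp: dual_family_def)
  have "?S \<subseteq> cfun.span (w ` {..q})"
  proof (rule cone_subset_span[OF wN SN], rule ballI)
    fix l v assume l: "\<And>x. x \<in> w ` {..q} \<Longrightarrow> (\<Sum>j\<le>N. l j * x j) = 0" and "v \<in> ?S"
    then obtain s t c where v: "v = cscale c (vcurve w q s t)" by (auto simp: rnc_def line_def)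
    have "(\<Sum>j\<le>N. l j * v j) = (\<Sum>j\<le>N. \<Sum>k\<le>q. c * s ^ (q - k) * t ^ k * (l j * w k j))"
      by (simp add: v cscale_def vcurve_def sum_distrib_left mult_ac)
    also have "\<dots> = (\<Sum>k\<le>q. c * s ^ (q - k) * t ^ k * (\<Sum>j\<le>N. l j * w k j))"
      by (subst sum.swap) (simp add: sum_distrib_left)
    also have "\<dots> = 0" using l by simp
    finally show "(\<Sum>j\<le>N. l j * v j) = 0" .
  qed
  moreover have "w ` {..q} \<subseteq> cfun.span ?S"
  proof (rule cone_subset_span[OF SN wN], rule ballI)
    fix l v assume l: "\<And>x. x \<in> ?S \<Longrightarrow> (\<Sum>j\<le>N. l j * x j) = 0" and v: "v \<in> w ` {..q}"
    \<comment> \<open>The coefficients of \<open>p\<close> are the values of \<open>l\<close> on the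
      \<open>w k\<close>. A hyperplane containing the curve makes \<open>p\<close> vanish at every
      parameter, so it contains each \<open>w k\<close>.\<close>
    define p where "p = (\<Sum>k\<le>q. monom (\<Sum>j\<le>N. l j * w k j) k)"
    have "poly p \<tau> = 0" for \<tau>
    proof -
      have "(1 :: complex) \<noteq> 0 \<or> \<tau> \<noteq> 0" by simp
      then have "line (vcurve w q 1 \<tau>) \<in> rnc w q" unfolding rnc_def by blast
      then have "vcurve w q 1 \<tau> \<in> ?S" using line_self by blast
      then have "0 = (\<Sum>j\<le>N. l j * vcurve w q 1 \<tau> j)" using l by simp
      also have "\<dots> = (\<Sum>j\<le>N. \<Sum>k\<le>q. \<tau> ^ k * (l j * w k j))"
        by (simp add: vcurve_def sum_distrib_left mult_ac)
      also have "\<dots> = poly p \<tau>"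
        by (subst sum.swap) (simp add: p_def poly_sum poly_monom sum_distrib_left sum_distrib_right mult_ac)
      finally show ?thesis by simp
    qed
    then have "p = 0" by (simp add: poly_all_0_iff_0[symmetric])
    moreover obtain k where "k \<le> q" "v = w k" using v by blast
    moreover from this have "coeff p k = (\<Sum>j\<le>N. l j * v j)" by (simp add: p_def coeff_sum)
    ultimately show "(\<Sum>j\<le>N. l j * v j) = 0" by simp
  qed
  ultimately have "cfun.dim ?S = Suc q" by (rule dim_dual_family[OF wb])
  then show ?thesis by (simp add: proj_span_dim_def)
qed

subsection \<open>Birationality\<close>

text \<open>Away from \<open>s = 0\<close> the first two dual coordinates are proportional to
  \<open>(1 : t)\<close>; the inverse is the parametrization written with forms of degree
  \<open>q\<close>.\<close>

lemma rnc_birational: "birational N (rnc w q) 1 (proj_space 1)"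
proof -
  \<comment> \<open>Points are lines, so the maps are defined through a chosen nonzero
    representative; \<open>fB\<close> and \<open>gG\<close> show that the choice does not affect the
    value.\<close>
  define rep where "rep p = (SOME v. v \<in> p \<and> v \<noteq> (0 :: nat \<Rightarrow> complex))" for p
  define B where "B l = linear_form N (b l)" for l
  define G :: "nat \<Rightarrow> nat cpoly" where "G j = (\<Sum>k\<le>q. cC (w k j) * (cX 0 ^ (q - k) * cX 1 ^ k))" for j
  define f where "f p = line (\<lambda>j. if j \<le> 1 then poly_eval (B j) (rep p) else 0)" for p
  define g where "g p = line (\<lambda>j. if j \<le> N then poly_eval (G j) (rep p) else 0)" for p
  define U where "U = {line (vcurve w q 1 t) |t. True}"
  define V where "V = {line (affine_point t) |t. True}"
  have rep: "rep (line u) \<in> line u - {0}" if "u \<noteq> 0" for u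
    using someI[of "\<lambda>v. v \<in> line u \<and> v \<noteq> 0" u] that line_self[of u] by (simp add: rep_def)
  have vc0: "vcurve w q 1 t \<noteq> 0" for t using vcurve_nonzero[OF wb, of 1 t] by simp
  have fB: "(\<exists>j\<le>1. poly_eval (B j) v \<noteq> 0) \<and>
      line (\<lambda>j. if j \<le> 1 then poly_eval (B j) v else 0) = line (affine_point t)"
    if v: "v \<in> line (vcurve w q 1 t) - {0}" for v t
  proof -
    obtain c where c: "v = cscale c (vcurve w q 1 t)" "c \<noteq> 0" using v by (auto simp: line_def cscale_eq_0_iff)
    have Bl: "poly_eval (B l) v = c * t ^ l" if "l \<le> q" for l
    proof -
      have "poly_eval (B l) v = c * (\<Sum>j\<le>N. b l j * vcurve w q 1 t j)"
        by (simp add: B_def c(1) cscale_def sum_distrib_left mult_ac)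
      then show ?thesis using dual_vcurve[OF wb that, of 1 t] by simp
    qed
    have "(\<lambda>j. if j \<le> 1 then poly_eval (B j) v else 0) = cscale c (affine_point t)"
      using Bl[of 0] Bl[of 1] q1 by (auto simp: cscale_def affine_point_def fun_eq_iff le_Suc_eq)
    then show ?thesis using c(2) Bl[of 0] by (auto simp: line_cscale intro: exI[of _ 0])
  qed
  have gG: "(\<exists>j\<le>N. poly_eval (G j) v \<noteq> 0) \<and>
      line (\<lambda>j. if j \<le> N then poly_eval (G j) v else 0) = line (vcurve w q 1 t)"
    if v: "v \<in> line (affine_point t) - {0}" for v t
  proof -
    obtain c where c: "v = cscale c (affine_point t)" "c \<noteq> 0" using v by (auto simp: line_def cscale_eq_0_iff)
    have v01: "v 0 = c * 1" "v 1 = c * t" by (auto simp: c cscale_def affine_point_def)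
    have Gj: "poly_eval (G j) v = vcurve w q (c * 1) (c * t) j" for j
      by (simp add: G_def poly_eval_simps vcurve_def v01 v01[unfolded One_nat_def] mult_ac)
    have "(\<lambda>j. if j \<le> N then poly_eval (G j) v else 0) = vcurve w q (c * 1) (c * t)"
      using vcurve_cvec[OF wb, of "c * 1" "c * t"] by (auto simp: Gj cvec_def fun_eq_iff)
    moreover have "vcurve w q (c * 1) (c * t) \<noteq> 0" using vcurve_nonzero[OF wb, of "c * 1" "c * t"] c(2) by simp
    then obtain j where "vcurve w q (c * 1) (c * t) j \<noteq> 0" by (auto simp: fun_eq_iff)
    moreover from this have "j \<le> N" using vcurve_cvec[OF wb, of "c * 1" "c * t"] by (auto simp: cvec_def not_le[symmetric])
    ultimately show ?thesis using line_vcurve_scale[OF c(2)] Gj by metis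
  qed
  have fU: "f (line (vcurve w q 1 t)) = line (affine_point t)" for t
    unfolding f_def using fB[OF rep[OF vc0]] by blast
  have gV: "g (line (affine_point t)) = line (vcurve w q 1 t)" for t
    unfolding g_def using gG[OF rep[OF affine_point_nonzero]] by blast
  have UN: "U \<subseteq> proj_space N" using line_in_proj_space[OF vcurve_cvec[OF wb] vc0] by (auto simp: U_def)
  have V1: "V \<subseteq> proj_space 1"
    using line_in_proj_space[OF affine_point_cvec affine_point_nonzero] by (auto simp: V_def)
  have U_eq: "U = (proj_space N - zero_locus N {B 0}) \<inter> rnc w q"
  proof
    show "U \<subseteq> (proj_space N - zero_locus N {B 0}) \<inter> rnc w q"
    proof
      fix p assume "p \<in> U"
      then obtain t where p: "p = line (vcurve w q 1 t)" by (auto simp: U_def)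
      have "(1 :: complex) \<noteq> 0 \<or> t \<noteq> 0" by simp
      then have "p \<in> rnc w q" unfolding p rnc_def by blast
      moreover have "poly_eval (B 0) (vcurve w q 1 t) = 1" using dual_vcurve[OF wb, of 0 1 t] by (simp add: B_def)
      then have "p \<notin> zero_locus N {B 0}" using line_self[of "vcurve w q 1 t"] unfolding p zero_locus_def by force
      ultimately show "p \<in> (proj_space N - zero_locus N {B 0}) \<inter> rnc w q" using \<open>p \<in> U\<close> UN by blast
    qed
    show "(proj_space N - zero_locus N {B 0}) \<inter> rnc w q \<subseteq> U"
    proof
      fix p assume p: "p \<in> (proj_space N - zero_locus N {B 0}) \<inter> rnc w q"
      then obtain s t where st: "p = line (vcurve w q s t)" by (auto simp: rnc_def)
      have "s \<noteq> 0"
      proof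
        assume "s = 0"
        then have "poly_eval (B 0) (vcurve w q s t) = 0" using dual_vcurve[OF wb, of 0 s t] q1 by (simp add: B_def)
        then have "\<forall>v\<in>p. poly_eval (B 0) v = 0"
          unfolding st B_def vanish_line[OF form_linear_form] .
        then show False using p by (auto simp: zero_locus_def)
      qed
      then have "p = line (vcurve w q 1 (t / s))" using line_vcurve_scale[of s w q 1 "t / s"] by (simp add: st)
      then show "p \<in> U" by (auto simp: U_def)
    qed
  qed
  have V_eq: "V = proj_space 1 - zero_locus 1 {cX 0}"
  proof
    show "V \<subseteq> proj_space 1 - zero_locus 1 {cX 0}"
    proof
      fix p assume "p \<in> V"
      then obtain t where p: "p = line (affine_point t)" by (auto simp: V_def)
      have "affine_point t \<in> p" "poly_eval (cX 0) (affine_point t) \<noteq> 0"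
        unfolding p using line_self by (auto simp: affine_point_def)
      then show "p \<in> proj_space 1 - zero_locus 1 {cX 0}" using \<open>p \<in> V\<close> V1 by (auto simp: zero_locus_def)
    qed
    show "proj_space 1 - zero_locus 1 {cX 0} \<subseteq> V"
    proof
      fix p assume p: "p \<in> proj_space 1 - zero_locus 1 {cX 0}"
      then obtain v where v: "p = line v" "v \<in> cvec 1" by (auto simp: proj_space_def)
      have "v 0 \<noteq> 0"
      proof
        assume "v 0 = 0"
        then have "\<forall>x\<in>p. poly_eval (cX 0) x = 0" unfolding v(1) by (auto simp: line_def cscale_def)
        then show False using p by (auto simp: zero_locus_def)
      qed
      moreover from this have "v = cscale (v 0) (affine_point (v 1 / v 0))"
        using v(2) by (auto simp: cscale_def affine_point_def cvec_def fun_eq_iff)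
      ultimately have "p = line (affine_point (v 1 / v 0))" using v(1) line_cscale by metis
      then show "p \<in> V" by (auto simp: V_def)
    qed
  qed
  have "openin (zariski N) (proj_space N - zero_locus N {B 0})"
    using closedin_zero_locus1[OF form_linear_form[of N "b 0"]] unfolding B_def by (metis openin_diff openin_topspace topspace_zariski)
  then have Uo: "openin (subtopology (zariski N) (rnc w q)) U" unfolding U_eq by (rule openin_subtopology_Int)
  have "openin (zariski 1) V" unfolding V_eq
    using closedin_zero_locus1[OF form_cX[of 0 1]] by (metis openin_diff openin_topspace topspace_zariski zero_le)
  then have Vo: "openin (subtopology (zariski 1) (proj_space 1)) V"
    using subtopology_topspace[of "zariski 1"] by simp
  have "regular_map N U 1 V f" unfolding regular_map_def
  proof (intro conjI ballI)
    show "f ` U \<subseteq> V" using fU by (auto simp: U_def V_def)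
    fix x assume x: "x \<in> U"
    show "\<exists>U' d F. openin (subtopology (zariski N) U) U' \<and> x \<in> U' \<and> (\<forall>j\<le>1. form N d (F j)) \<and>
      (\<forall>p\<in>U'. \<forall>v\<in>p - {0}. (\<exists>j\<le>1. poly_eval (F j) v \<noteq> 0) \<and>
        f p = line (\<lambda>j. if j \<le> 1 then poly_eval (F j) v else 0))"
    proof (rule exI[of _ U], rule exI[of _ 1], rule exI[of _ B], intro conjI ballI allI impI x)
      show "openin (subtopology (zariski N) U) U" by (rule openin_subtopology_refl[THEN iffD2]) (use UN in simp)
      show "form N 1 (B j)" for j unfolding B_def by (rule form_linear_form)
      fix p v assume "p \<in> U" "v \<in> p - {0}"
      then obtain t where p: "p = line (vcurve w q 1 t)" and v: "v \<in> line (vcurve w q 1 t) - {0}" by (auto simp: U_def)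
      show "\<exists>j\<le>1. poly_eval (B j) v \<noteq> 0" "f p = line (\<lambda>j. if j \<le> 1 then poly_eval (B j) v else 0)"
        using fB[OF v] fU[of t] p by auto
    qed
  qed
  moreover have "regular_map 1 V N U g" unfolding regular_map_def
  proof (intro conjI ballI)
    show "g ` V \<subseteq> U" using gV by (auto simp: U_def V_def)
    fix x assume x: "x \<in> V"
    show "\<exists>U' d F. openin (subtopology (zariski 1) V) U' \<and> x \<in> U' \<and> (\<forall>j\<le>N. form 1 d (F j)) \<and>
      (\<forall>p\<in>U'. \<forall>v\<in>p - {0}. (\<exists>j\<le>N. poly_eval (F j) v \<noteq> 0) \<and>
        g p = line (\<lambda>j. if j \<le> N then poly_eval (F j) v else 0))"
    proof (rule exI[of _ V], rule exI[of _ q], rule exI[of _ G], intro conjI ballI allI impI x)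
      show "openin (subtopology (zariski 1) V) V" by (rule openin_subtopology_refl[THEN iffD2]) (use V1 in simp)
      show "form 1 q (G j)" for j unfolding G_def
      proof (rule form_sum, rule form_cmult)
        fix k assume "k \<in> {..q}"
        have "form 1 ((q - k) * 1 + k * 1) (cX 0 ^ (q - k) * cX 1 ^ k)"
          by (intro form_mult form_power form_cX) auto
        then show "form 1 q (cX 0 ^ (q - k) * cX 1 ^ k)" using \<open>k \<in> {..q}\<close> by simp
      qed
      fix p v assume "p \<in> V" "v \<in> p - {0}"
      then obtain t where p: "p = line (affine_point t)" and v: "v \<in> line (affine_point t) - {0}" by (auto simp: V_def)
      show "\<exists>j\<le>N. poly_eval (G j) v \<noteq> 0" "g p = line (\<lambda>j. if j \<le> N then poly_eval (G j) v else 0)"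
        using gG[OF v] gV[of t] p by auto
    qed
  qed
  moreover have "\<forall>x\<in>U. g (f x) = x" "\<forall>y\<in>V. f (g y) = y" using fU gV by (auto simp: U_def V_def)
  moreover have "U \<noteq> {}" "V \<noteq> {}" by (auto simp: U_def V_def)
  ultimately show ?thesis unfolding birational_def using Uo Vo by blast
qed

end

lemma cX_neq_0: "cX v \<noteq> 0"
proof
  assume "cX v = 0"
  then have "poly_eval (cX v) (\<lambda>_. 1) = 0" by simp
  then show False by simp
qed

subsection \<open>Smoothness\<close>

text \<open>The chain rule along coordinatewise differentiable paths together with linearity in the
  direction. Vectors are sequences here, so this replaces a total derivative on a normed
  space.\<close>

definition differential :: "((nat \<Rightarrow> complex) \<Rightarrow> complex) \<Rightarrow> ((nat \<Rightarrow> complex) \<Rightarrow> (nat \<Rightarrow> complex) \<Rightarrow> complex) \<Rightarrow> bool" where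
  "differential f E \<longleftrightarrow>
     (\<forall>x w. (\<forall>j. ((\<lambda>t. x t j) has_field_derivative w j) (at 0)) \<longrightarrow>
       ((\<lambda>t. f (x t)) has_field_derivative E (x 0) w) (at 0)) \<and>
     (\<forall>v w w' a b. E v (\<lambda>j. a * w j + b * w' j) = a * E v w + b * E v w')"

lemma differential_const: "differential (\<lambda>_. c) (\<lambda>_ _. 0)"
  by (simp add: differential_def)

lemma differential_coordinate: "differential (\<lambda>v. v j) (\<lambda>_ w. w j)"
  by (simp add: differential_def)

lemma differential_add:
  "differential f D \<Longrightarrow> differential g E \<Longrightarrow> differential (\<lambda>v. f v + g v) (\<lambda>v w. D v w + E v w)"
  unfolding differential_def by (auto intro: DERIV_add simp: algebra_simps)

lemma differential_mult:
  assumes "differential f D" "differential g E"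
  shows "differential (\<lambda>v. f v * g v) (\<lambda>v w. D v w * g v + E v w * f v)"
  unfolding differential_def
proof (intro conjI allI impI)
  fix x :: "complex \<Rightarrow> nat \<Rightarrow> complex" and w
  assume "\<forall>j. ((\<lambda>t. x t j) has_field_derivative w j) (at 0)"
  then show "((\<lambda>t. f (x t) * g (x t)) has_field_derivative D (x 0) w * g (x 0) + E (x 0) w * f (x 0)) (at 0)"
    using assms unfolding differential_def by (intro DERIV_mult) auto
qed (use assms in \<open>auto simp: differential_def algebra_simps\<close>)

lemma differential_prod_power: "finite K \<Longrightarrow> \<exists>E. differential (\<lambda>v. \<Prod>i\<in>K. v i ^ m i) E"
proof (induction K rule: finite_induct)
  case (insert i K)
  have "\<exists>E. differential (\<lambda>v. v i ^ k) E" for k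
  proof (induction k)
    case (Suc k)
    then obtain E where "differential (\<lambda>v. v i ^ k) E" by blast
    from differential_mult[OF differential_coordinate this] show ?case by (simp only: power_Suc) (rule exI)
  qed (auto intro: differential_const)
  then show ?case using insert differential_mult by fastforce
qed (auto intro: differential_const)

lemma differential_poly_eval: "\<exists>E. differential (poly_eval F) E"
proof -
  have "\<exists>E. differential (\<lambda>v. \<Sum>m\<in>M. lookup F m * monom_eval m v) E" if "finite M" for M
    using that
  proof (induction M rule: finite_induct)
    case (insert m M)
    obtain D where "differential (monom_eval m) D"
      using differential_prod_power[of "keys m" "lookup m"] unfolding monom_eval_def[abs_def] by auto
    then have "\<exists>D. differential (\<lambda>v. lookup F m * monom_eval m v) D"
      using differential_mult[OF differential_const] by blast
    then show ?case using insert differential_add by fastforce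
  qed (auto intro: differential_const)
  from this[of "keys F"] show ?thesis unfolding poly_eval_def[abs_def] by simp
qed

lemma differential_line:
  assumes "differential f E" shows "((\<lambda>t. f (v + cscale t w)) has_field_derivative E v w) (at 0)"
proof -
  have "((\<lambda>t. (v + cscale t w) j) has_field_derivative w j) (at 0)" for j
    by (auto intro!: derivative_eq_intros simp: cscale_def)
  moreover have "v + cscale 0 w = v" by (simp add: cscale_def fun_eq_iff)
  ultimately show ?thesis using assms unfolding differential_def by metis
qed

text \<open>The recursion is the system of linearized minors at the point with dual coordinates
  \<open>t ^ k\<close>. Its solutions form the plane spanned by \<open>t ^ k\<close> and the
  derivative \<open>k * t ^ (k - 1)\<close>.\<close>

lemma minors_tangent:
  fixes \<omega> :: "nat \<Rightarrow> complex"
  assumes "\<And>j. j < q \<Longrightarrow> \<omega> (Suc j) + \<omega> 0 * t ^ Suc j = t * \<omega> j + \<omega> 1 * t ^ j"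
  shows "k \<le> q \<Longrightarrow> \<omega> k = \<omega> 0 * t ^ k + (\<omega> 1 - t * \<omega> 0) * (of_nat k * t ^ (k - 1))"
proof (induction k)
  case (Suc k)
  have "\<omega> (Suc k) = t * \<omega> k + \<omega> 1 * t ^ k - \<omega> 0 * t ^ Suc k"
    using assms[of k] Suc.prems by (simp add: algebra_simps)
  also have "\<dots> = t * (\<omega> 0 * t ^ k + (\<omega> 1 - t * \<omega> 0) * (of_nat k * t ^ (k - 1))) + \<omega> 1 * t ^ k - \<omega> 0 * t ^ Suc k"
    using Suc by simp
  also have "\<dots> = \<omega> 0 * t ^ Suc k + (\<omega> 1 - t * \<omega> 0) * (of_nat (Suc k) * t ^ (Suc k - 1))"
    by (cases k) (simp_all add: algebra_simps)
  finally show ?case .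
qed simp

text \<open>The point and the derivative \<open>d\<close> of the parametrization are tangent,
  because along the corresponding paths on the cone every equation of the curve stays zero.
  Conversely, the linearized equations of the span and of the minors leave only the plane spanned by
  these two vectors.\<close>

lemma rnc_tangent_dim:
  assumes wb: "dual_family N q w b" and q1: "q \<ge> 1"
  shows "cfun.dim (tangent_cone_space N (rnc w q) (line (vcurve w q 1 t))) = 2"
proof -
  let ?v = "vcurve w q 1 t"
  let ?T = "tangent_cone_space N (rnc w q) (line ?v)"
  define d where "d j = (\<Sum>k\<le>q. of_nat k * t ^ (k - 1) * w k j)" for j
  define B where "B l = linear_form N (b l)" for l
  have t10: "(1 :: complex) \<noteq> 0 \<or> t \<noteq> 0" by simp
  have v0: "?v \<noteq> 0" by (rule vcurve_nonzero[OF wb t10])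
  have dN: "d \<in> cvec N" using wb by (auto simp: d_def cvec_def dual_family_def)
  have Bw: "poly_eval (B l) (w k) = (if k = l then 1 else 0)" if "k \<le> q" "l \<le> q" for k l
    using wb that by (simp add: B_def dual_family_def)
  have Bv: "poly_eval (B l) ?v = t ^ l" if "l \<le> q" for l
    using dual_vcurve[OF wb that, of 1 t] by (simp add: B_def)
  have Bd: "poly_eval (B l) d = of_nat l * t ^ (l - 1)" if "l \<le> q" for l
  proof -
    have "poly_eval (B l) d = (\<Sum>k\<le>q. of_nat k * t ^ (k - 1) * poly_eval (B l) (w k))"
      unfolding B_def poly_eval_linear_form d_def sum_distrib_left by (subst sum.swap) (simp add: mult_ac)
    also have "\<dots> = (\<Sum>k\<le>q. if k = l then of_nat l * t ^ (l - 1) else 0)"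
      by (rule sum.cong) (use Bw that in auto)
    finally show ?thesis using that by simp
  qed
  have van: "poly_eval F (vcurve w q s u) = 0"
    if F: "form N e F" "rnc w q \<subseteq> zero_locus N {F}" and su: "s \<noteq> 0 \<or> u \<noteq> 0" for F e s u
  proof -
    have "line (vcurve w q s u) \<in> zero_locus N {F}" using F(2) su unfolding rnc_def by blast
    then show ?thesis using line_self by (auto simp: zero_locus_def)
  qed
  have in_T: "x \<in> ?T" if xN: "x \<in> cvec N"
    and curve: "\<And>F e E c. form N e F \<Longrightarrow> rnc w q \<subseteq> zero_locus N {F} \<Longrightarrow> differential (poly_eval F) E \<Longrightarrow> E (cscale c ?v) x = 0 \<or> c = 0" for x
    unfolding tangent_cone_space_def
  proof (intro CollectI conjI allI impI ballI xN, elim conjE)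
    fix F e u assume F: "form N e F" "rnc w q \<subseteq> zero_locus N {F}" and u: "u \<in> line ?v - {0}"
    obtain E where E: "differential (poly_eval F) E" using differential_poly_eval by blast
    obtain c where c: "u = cscale c ?v" using u by (auto simp: line_def)
    have "c \<noteq> 0" using u c by (auto simp: cscale_eq_0_iff)
    then have "E u x = 0" using curve[OF F E, of c] c by simp
    then show "((\<lambda>t. poly_eval F (u + cscale t x)) has_field_derivative 0) (at 0)"
      using differential_line[OF E, of u x] by simp
  qed
  have vT: "?v \<in> ?T"
  proof (rule in_T[OF vcurve_cvec[OF wb]])
    fix F e E c assume F: "form N e F" "rnc w q \<subseteq> zero_locus N {F}" and E: "differential (poly_eval F) E"
    have "poly_eval F (cscale c ?v + cscale \<tau> ?v) = 0" for \<tau>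
    proof -
      have "cscale c ?v + cscale \<tau> ?v = cscale (c + \<tau>) ?v" by (simp add: cscale_def fun_eq_iff algebra_simps)
      then show ?thesis using van[OF F t10] by (simp add: poly_eval_form_scale[OF F(1)])
    qed
    then have "((\<lambda>t. 0) has_field_derivative E (cscale c ?v) ?v) (at (0 :: complex))"
      using differential_line[OF E, of "cscale c ?v" ?v] by simp
    then show "E (cscale c ?v) ?v = 0 \<or> c = 0" using DERIV_unique DERIV_const by blast
  qed
  have dT: "d \<in> ?T"
  proof (rule in_T[OF dN])
    fix F e E c assume F: "form N e F" "rnc w q \<subseteq> zero_locus N {F}" and E: "differential (poly_eval F) E"
    have der: "((\<lambda>\<tau>. cscale c (vcurve w q 1 (t + \<tau>)) j) has_field_derivative c * d j) (at 0)" for j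
    proof -
      have "((\<lambda>\<tau>. c * (\<Sum>k\<le>q. (t + \<tau>) ^ k * w k j)) has_field_derivative
          c * (\<Sum>k\<le>q. of_nat k * (t + 0) ^ (k - 1) * w k j)) (at 0)"
        by (rule DERIV_cmult, rule DERIV_sum) (auto intro!: derivative_eq_intros)
      then show ?thesis by (simp add: cscale_def vcurve_def d_def)
    qed
    have "((\<lambda>\<tau>. poly_eval F (cscale c (vcurve w q 1 (t + \<tau>)))) has_field_derivative
        E (cscale c (vcurve w q 1 (t + 0))) (\<lambda>j. c * d j)) (at 0)"
      by (rule E[unfolded differential_def, THEN conjunct1, THEN spec, THEN spec, THEN mp,
            of "\<lambda>\<tau>. cscale c (vcurve w q 1 (t + \<tau>))" "\<lambda>j. c * d j"]) (use der in blast)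
    moreover have "poly_eval F (cscale c (vcurve w q 1 (t + \<tau>))) = 0" for \<tau>
      using van[OF F, of 1 "t + \<tau>"] by (simp add: poly_eval_form_scale[OF F(1)])
    ultimately have "((\<lambda>t. 0) has_field_derivative E (cscale c ?v) (\<lambda>j. c * d j)) (at (0 :: complex))" by simp
    then have "E (cscale c ?v) (\<lambda>j. c * d j) = 0" using DERIV_unique DERIV_const by blast
    moreover have "E (cscale c ?v) (\<lambda>j. c * d j + 0 * d j) = c * E (cscale c ?v) d + 0 * E (cscale c ?v) d"
      using E unfolding differential_def by blast
    ultimately show "E (cscale c ?v) d = 0 \<or> c = 0" by auto
  qed
  have T_sub: "?T \<subseteq> cfun.span {?v, d}"
  proof
    fix x assume x: "x \<in> ?T"
    have xN: "x \<in> cvec N" using x by (simp add: tangent_cone_space_def)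
    have der: "((\<lambda>\<tau>. poly_eval F (?v + cscale \<tau> x)) has_field_derivative 0) (at 0)"
      if "form N e F" "rnc w q \<subseteq> zero_locus N {F}" for F e
      using x that line_self[of ?v] v0 unfolding tangent_cone_space_def by blast
    have vanish: "rnc w q \<subseteq> zero_locus N {F}"
      if F: "form N e F" "\<And>s u. s \<noteq> 0 \<or> u \<noteq> 0 \<Longrightarrow> poly_eval F (vcurve w q s u) = 0" for F e
    proof
      fix p assume "p \<in> rnc w q"
      then obtain s u where p: "p = line (vcurve w q s u)" "s \<noteq> 0 \<or> u \<noteq> 0" by (auto simp: rnc_def)
      have "p \<in> proj_space N"
        unfolding p(1) by (rule line_in_proj_space[OF vcurve_cvec[OF wb] vcurve_nonzero[OF wb p(2)]])
      then show "p \<in> zero_locus N {F}" using vanish_line[OF F(1), of "vcurve w q s u"] F(2)[OF p(2)] p(1)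
        by (simp add: zero_locus_def)
    qed
    define \<omega> where "\<omega> l = poly_eval (B l) x" for l
    have Blin: "poly_eval (B l) (?v + cscale \<tau> x) = poly_eval (B l) ?v + \<tau> * \<omega> l" for l \<tau>
      by (simp add: B_def \<omega>_def cscale_def distrib_left sum.distrib sum_distrib_left mult_ac)
    \<comment> \<open>The equations of the span are linear, hence their own linearization, so a
      tangent vector is determined by its dual coordinates \<open>\<omega>\<close>.\<close>
    have x_eq: "x j = (\<Sum>l\<le>q. \<omega> l * w l j)" if j: "j \<le> N" for j
    proof -
      define E where "E = cX j - (\<Sum>l\<le>q. cC (w l j) * B l)"
      have E: "form N 1 E"
        unfolding E_def B_def by (intro form_diff form_sum form_cmult form_cX form_linear_form j)
      have "rnc w q \<subseteq> zero_locus N {E}"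
      proof (rule vanish[OF E])
        fix s u :: complex
        have "(\<Sum>l\<le>q. w l j * poly_eval (B l) (vcurve w q s u)) = vcurve w q s u j"
          unfolding vcurve_def[of w q s u, THEN fun_cong]
          by (rule sum.cong) (use dual_vcurve[OF wb, of _ s u] in \<open>auto simp: B_def vcurve_def\<close>)
        then show "poly_eval E (vcurve w q s u) = 0" by (simp add: E_def poly_eval_simps)
      qed
      from der[OF E this] have der0: "((\<lambda>\<tau>. poly_eval E (?v + cscale \<tau> x)) has_field_derivative 0) (at 0)" .
      have eq: "poly_eval E (?v + cscale \<tau> x) = poly_eval E ?v + \<tau> * (x j - (\<Sum>l\<le>q. \<omega> l * w l j))" for \<tau>
        unfolding E_def poly_eval_simps poly_eval_cX poly_eval_cC Blin
        by (simp add: cscale_def algebra_simps sum.distrib sum_distrib_left)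
      have "((\<lambda>\<tau>. poly_eval E ?v + \<tau> * (x j - (\<Sum>l\<le>q. \<omega> l * w l j))) has_field_derivative
          (x j - (\<Sum>l\<le>q. \<omega> l * w l j))) (at 0)" by (auto intro!: derivative_eq_intros)
      from DERIV_unique[OF this der0[unfolded eq]] have "x j - (\<Sum>l\<le>q. \<omega> l * w l j) = 0" .
      then show ?thesis by simp
    qed
    \<comment> \<open>The linearized minor on the columns 0 and \<open>j\<close>; these minors
      already determine all \<open>\<omega> k\<close> from the first two.\<close>
    have rec: "\<omega> (Suc j) + \<omega> 0 * t ^ Suc j = t * \<omega> j + \<omega> 1 * t ^ j" if j: "j < q" for j
    proof -
      define M where "M = B 0 * B (Suc j) - B 1 * B j"
      have M: "form N (1 + 1) M" unfolding M_def B_def by (intro form_diff form_mult form_linear_form)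
      have "rnc w q \<subseteq> zero_locus N {M}"
      proof (rule vanish[OF M])
        fix s u :: complex
        have "s ^ q = s ^ (q - 1) * s" using q1 by (cases q) auto
        moreover have "s ^ (q - j) = s ^ (q - Suc j) * s" using j by (simp flip: power_Suc2 add: Suc_diff_Suc)
        ultimately show "poly_eval M (vcurve w q s u) = 0"
          using j q1 dual_vcurve[OF wb, of _ s u] by (simp add: M_def B_def poly_eval_simps)
      qed
      from der[OF M this] have der0: "((\<lambda>\<tau>. poly_eval M (?v + cscale \<tau> x)) has_field_derivative 0) (at 0)" .
      have eq: "poly_eval M (?v + cscale \<tau> x) =
          (1 + \<tau> * \<omega> 0) * (t ^ Suc j + \<tau> * \<omega> (Suc j)) - (t + \<tau> * \<omega> 1) * (t ^ j + \<tau> * \<omega> j)" for \<tau>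
        using j q1 Bv[of 0] Bv[of 1] Bv[of j] Bv[of "Suc j"] by (simp add: M_def poly_eval_simps Blin)
      have "((\<lambda>\<tau>. (1 + \<tau> * \<omega> 0) * (t ^ Suc j + \<tau> * \<omega> (Suc j)) - (t + \<tau> * \<omega> 1) * (t ^ j + \<tau> * \<omega> j))
          has_field_derivative (\<omega> 0 * t ^ Suc j + \<omega> (Suc j) - (\<omega> 1 * t ^ j + t * \<omega> j))) (at 0)"
        by (auto intro!: derivative_eq_intros)
      from DERIV_unique[OF this der0[unfolded eq]]
      have "\<omega> 0 * t ^ Suc j + \<omega> (Suc j) - (\<omega> 1 * t ^ j + t * \<omega> j) = 0" .
      then show ?thesis by (simp add: algebra_simps)
    qed
    have "x = cscale (\<omega> 0) ?v + cscale (\<omega> 1 - t * \<omega> 0) d"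
    proof
      fix j
      show "x j = (cscale (\<omega> 0) ?v + cscale (\<omega> 1 - t * \<omega> 0) d) j"
      proof (cases "j \<le> N")
        case True
        have "x j = (\<Sum>l\<le>q. (\<omega> 0 * t ^ l + (\<omega> 1 - t * \<omega> 0) * (of_nat l * t ^ (l - 1))) * w l j)"
          unfolding x_eq[OF True]
        proof (rule sum.cong[OF refl])
          fix l assume "l \<in> {..q}"
          then have "\<omega> l = \<omega> 0 * t ^ l + (\<omega> 1 - t * \<omega> 0) * (of_nat l * t ^ (l - 1))"
            using minors_tangent[where \<omega> = \<omega> and k = l, OF rec] by blast
          then show "\<omega> l * w l j = (\<omega> 0 * t ^ l + (\<omega> 1 - t * \<omega> 0) * (of_nat l * t ^ (l - 1))) * w l j"
            by (rule arg_cong[where f = "\<lambda>z. z * w l j"])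
        qed
        then show ?thesis
          by (simp add: cscale_def vcurve_def d_def sum_distrib_left algebra_simps sum.distrib sum_subtractf)
      next
        case False
        then show ?thesis using xN dN vcurve_cvec[OF wb, of 1 t] by (simp add: cvec_def cscale_def)
      qed
    qed
    then show "x \<in> cfun.span {?v, d}"
      using cfun.span_add[OF cfun.span_scale[OF cfun.span_base] cfun.span_scale[OF cfun.span_base], of ?v "{?v, d}" d]
      by simp
  qed
  \<comment> \<open>The point and \<open>d\<close> are certified independent by functionals:
    \<open>b 0\<close> takes the values 1 and 0 on them, and \<open>b 1 - t * b 0\<close> the values
    0 and 1.\<close>
  define w' where "w' k = (if k = 0 then ?v else d)" for k :: nat
  define b' where "b' l = (if l = 0 then b 0 else (\<lambda>j. b 1 j - t * b 0 j))" for l :: nat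
  have "dual_family N 1 w' b'" unfolding dual_family_def
  proof (intro conjI allI impI)
    show "w' k \<in> cvec N" for k using vcurve_cvec[OF wb] dN by (simp add: w'_def)
    fix k l :: nat assume kl: "k \<le> 1" "l \<le> 1"
    have "(\<Sum>j\<le>N. b 0 j * ?v j) = 1" "(\<Sum>j\<le>N. b 1 j * ?v j) = t"
      "(\<Sum>j\<le>N. b 0 j * d j) = 0" "(\<Sum>j\<le>N. b 1 j * d j) = 1"
      using Bv[of 0] Bv[of 1] Bd[of 0] Bd[of 1] q1 by (simp_all add: B_def)
    then show "(\<Sum>j\<le>N. b' l j * w' k j) = (if k = l then 1 else 0)" using kl
      by (auto simp: b'_def w'_def le_Suc_eq left_diff_distrib sum_subtractf mult.assoc simp flip: sum_distrib_left)
  qed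
  moreover have "w' ` {..1} = {?v, d}" by (auto simp: w'_def atMost_Suc)
  ultimately have "cfun.dim ?T = Suc 1"
    using T_sub vT dT cfun.span_superset[of ?T] by (intro dim_dual_family[of N 1 w' b']) auto
  then show ?thesis by simp
qed

text \<open>Exchanging the two parameters moves the point at infinity into the affine part, so the
  tangent computation at affine points covers the whole curve.\<close>

lemma vcurve_reverse: "vcurve (\<lambda>k. w (q - k)) q s t = vcurve w q t s"
proof
  fix j
  have "(\<Sum>k\<le>q. s ^ (q - k) * t ^ k * w (q - k) j) = (\<Sum>k\<le>q. t ^ (q - k) * s ^ k * w k j)"
    by (rule sum.reindex_bij_witness[of _ "\<lambda>k. q - k" "\<lambda>k. q - k"]) auto
  then show "vcurve (\<lambda>k. w (q - k)) q s t j = vcurve w q t s j" by (simp add: vcurve_def)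
qed

lemma rnc_reverse: "rnc (\<lambda>k. w (q - k)) q = rnc w q"
  unfolding rnc_def vcurve_reverse by blast

lemma dual_family_reverse: "dual_family N q w b \<Longrightarrow> dual_family N q (\<lambda>k. w (q - k)) (\<lambda>l. b (q - l))"
  unfolding dual_family_def by auto

lemma rnc_smooth:
  assumes wb: "dual_family N q w b" and q1: "q \<ge> 1"
  shows "smooth_variety N (rnc w q)"
  unfolding smooth_variety_def
proof (intro conjI exI[of _ 1] ballI)
  show "proj_variety N (rnc w q)" by (rule rnc_variety_structure[OF wb q1])
  show "has_dimension (zariski N) (rnc w q) 1" by (rule rnc_dimension[OF wb q1])
  fix p assume "p \<in> rnc w q"
  then obtain s t where p: "p = line (vcurve w q s t)" "s \<noteq> 0 \<or> t \<noteq> 0" by (auto simp: rnc_def)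
  show "cfun.dim (tangent_cone_space N (rnc w q) p) = 1 + 1"
  proof (cases "s = 0")
    case False
    then have "p = line (vcurve w q 1 (t / s))" using line_vcurve_scale[of s w q 1 "t / s"] p(1) by simp
    then show ?thesis using rnc_tangent_dim[OF wb q1, of "t / s"] by simp
  next
    case True
    then have "t \<noteq> 0" using p(2) by simp
    then have "p = line (vcurve (\<lambda>k. w (q - k)) q 1 (s / t))"
      using line_vcurve_scale[of t w q "s / t" 1] p(1) by (simp add: vcurve_reverse)
    then show ?thesis using rnc_tangent_dim[OF dual_family_reverse[OF wb] q1, of "s / t"] by (simp add: rnc_reverse)
  qed
qed

subsection \<open>Degree\<close>

text \<open>Monic polynomials of degree \<open>q\<close> with a double root form a \<open>(q - 1)\<close>-parameter family, so their
  \<open>q + 1\<close> coefficients satisfy a homogeneous relation.\<close>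

lemma discriminant_form:
  assumes q1: "q \<ge> 1"
  shows "\<exists>s P. form q s P \<and> P \<noteq> 0 \<and>
    (\<forall>h :: complex poly. degree h = q \<longrightarrow> \<not> rsquarefree h \<longrightarrow> poly_eval P (coeff h) = 0)"
proof -
  have dbl: "\<exists>z k. h = [:- z, 1:]\<^sup>2 * k" if h: "degree h = q" "\<not> rsquarefree h" for h :: "complex poly"
  proof -
    have "h \<noteq> 0" using h(1) q1 by auto
    then obtain z where "order z h \<noteq> 0" "order z h \<noteq> 1" using h(2) by (auto simp: rsquarefree_def)
    then have "[:- z, 1:]\<^sup>2 dvd h" using order_divides[of z 2 h] by simp
    then show ?thesis unfolding dvd_def by blast
  qed
  show ?thesis
  proof (cases "q = 1")
    case True
    \<comment> \<open>A polynomial of degree 1 has no double root, so the constant form 1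
      serves.\<close>
    have "rsquarefree h" if dh: "degree h = q" for h :: "complex poly"
    proof (rule ccontr)
      assume "\<not> rsquarefree h"
      then obtain z k where hk: "h = [:- z, 1:]\<^sup>2 * k" using dbl[OF dh] by blast
      then have "k \<noteq> 0" using dh q1 by auto
      then have "degree h = 2 + degree k" unfolding hk by (simp add: degree_mult_eq degree_power_eq)
      then show False using dh True by simp
    qed
    then show ?thesis using form_1 by (intro exI[of _ 0] exI[of _ 1]) auto
  next
    case False
    then have q2: "q \<ge> 2" using q1 by simp
    \<comment> \<open>\<open>c\<close> lists the coefficients of a monic polynomial of degree
      \<open>q - 2\<close> with the unknowns \<open>u 1, ..., u (q - 2)\<close> as lower
      coefficients, and \<open>g\<close> those of its product with the square of
      \<open>X - u 0\<close>.\<close>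
    define c :: "nat \<Rightarrow> nat cpoly" where "c l = (if l < q - 2 then cX (Suc l) else if l = q - 2 then 1 else 0)" for l
    define g where "g i = (if i \<ge> 2 then c (i - 2) else 0) - cC 2 * cX 0 * (if i \<ge> 1 then c (i - 1) else 0) + cX 0 ^ 2 * c i" for i
    have "vars_in {..<q - 1} (c l)" for l using q2 by (auto simp: c_def)
    then have "vars_in {..<q - 1} (g i)" for i
      unfolding g_def using q2 by (intro vars_in_add vars_in_diff vars_in_mult vars_in_power) auto
    then obtain s P where P: "form q s P" "P \<noteq> 0" "\<And>u. poly_eval P (\<lambda>i. poly_eval (g i) u) = 0"
      using homogeneous_relation[of "{..<q - 1}" g] q2 by auto
    have "poly_eval P (coeff h) = 0" if h: "degree h = q" "\<not> rsquarefree h" for h :: "complex poly"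
    proof -
      obtain z k where hk: "h = [:- z, 1:]\<^sup>2 * k" using dbl[OF h] by blast
      have k0: "k \<noteq> 0" using hk h(1) q1 by auto
      then have "degree h = 2 + degree k" unfolding hk by (simp add: degree_mult_eq degree_power_eq)
      then have dk: "degree k = q - 2" using h(1) by simp
      \<comment> \<open>Only monic cofactors are parametrized; a general leading coefficient is
        absorbed by the homogeneity of \<open>P\<close>.\<close>
      define a where "a = lead_coeff k"
      have a0: "a \<noteq> 0" using k0 by (simp add: a_def)
      define u where "u i = (if i = 0 then z else coeff k (i - 1) / a)" for i
      have cu: "a * poly_eval (c l) u = coeff k l" for l
        using a0 dk by (auto simp: c_def u_def poly_eval_1 a_def coeff_eq_0)
      have hk': "h = smult (z\<^sup>2) k + pCons 0 (smult (- 2 * z) k + pCons 0 k)"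
        unfolding hk by (simp add: power2_eq_square algebra_simps)
      have "coeff h i = a * poly_eval (g i) u" for i
      proof -
        have u0: "u 0 = z" by (simp add: u_def)
        consider "i = 0" | "i = 1" | j where "i = Suc (Suc j)" by (metis One_nat_def not0_implies_Suc)
        then show ?thesis
        proof cases
          case 1
          then show ?thesis using cu[of 0] by (simp add: hk' g_def poly_eval_simps u0 algebra_simps)
        next
          case 2
          then show ?thesis using cu[of 0] cu[of 1] by (simp add: hk' g_def poly_eval_simps u0 algebra_simps flip: cu)
        next
          case 3
          have "a * poly_eval (g i) u = a * poly_eval (c j) u - 2 * z * (a * poly_eval (c (Suc j)) u) + z\<^sup>2 * (a * poly_eval (c i) u)"
            using 3 by (simp add: g_def poly_eval_simps u0 algebra_simps)
          then show ?thesis unfolding cu using 3 by (simp add: hk' algebra_simps)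
        qed
      qed
      then have "coeff h = cscale a (\<lambda>i. poly_eval (g i) u)" by (simp add: cscale_def fun_eq_iff)
      then show ?thesis using P(3) by (simp add: poly_eval_form_scale[OF P(1)])
    qed
    then show ?thesis using P by blast
  qed
qed

text \<open>If the closure of the locus \<open>F \<noteq> 0\<close> missed a point, a form
  \<open>H\<close> vanishing on the closure but not at that point would make \<open>F * H\<close>
  vanish at all points although neither factor is zero.\<close>

lemma generically_form:
  assumes F: "form N e F" "F \<noteq> 0" and P: "\<And>v. v \<in> cvec N \<Longrightarrow> poly_eval F v \<noteq> 0 \<Longrightarrow> P (line v)"
  shows "generically (zariski N) P"
  unfolding generically_def
proof (intro exI[of _ "proj_space N - zero_locus N {F}"] conjI ballI)
  let ?U = "proj_space N - zero_locus N {F}"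
  show "openin (zariski N) ?U"
    using closedin_zero_locus1[OF F(1)] by (metis openin_diff openin_topspace topspace_zariski)
  have UF: "\<exists>v. p = line v \<and> v \<in> cvec N \<and> v \<noteq> 0 \<and> poly_eval F v \<noteq> 0" if p: "p \<in> ?U" for p
  proof -
    obtain v where v: "p = line v" "v \<in> cvec N" "v \<noteq> 0" using p by (auto simp: proj_space_def)
    moreover have "poly_eval F v \<noteq> 0"
    proof
      assume "poly_eval F v = 0"
      then have "\<forall>x\<in>p. poly_eval F x = 0" unfolding v(1) vanish_line[OF F(1)] .
      then show False using p by (auto simp: zero_locus_def)
    qed
    ultimately show ?thesis by blast
  qed
  show "P p" if "p \<in> ?U" for p using UF[OF that] P by blast
  let ?T = "zariski N closure_of ?U"
  have T: "closedin (zariski N) ?T" by simp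
  have UT: "?U \<subseteq> ?T" by (rule closure_of_subset) auto
  show "?T = topspace (zariski N)"
  proof (rule ccontr)
    assume "?T \<noteq> topspace (zariski N)"
    moreover have "?T \<subseteq> proj_space N" using closedin_subset_proj_space[OF T] .
    ultimately obtain p where "p \<in> proj_space N" "p \<notin> ?T" by auto
    then obtain v where v: "v \<in> cvec N" "v \<noteq> 0" "line v \<notin> ?T" by (auto simp: proj_space_def)
    obtain H d where H: "form N d H" "\<forall>x\<in>\<Union>?T. poly_eval H x = 0" "poly_eval H v \<noteq> 0"
      using closed_separate[OF T v] by blast
    have "poly_eval (F * H) x = 0" if x: "x \<in> cvec N" "x \<noteq> 0" for x
    proof (cases "poly_eval F x = 0")
      case False
      then have "line x \<in> ?U" using line_in_proj_space[OF x] line_self[of x] by (auto simp: zero_locus_def)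
      then have "poly_eval H x = 0" using UT H(2) line_self by blast
      then show ?thesis by (simp add: poly_eval_mult)
    qed (simp add: poly_eval_mult)
    moreover have "F * H \<noteq> 0" using F(2) H(3) by auto
    \<comment> \<open>The factor \<open>cX 0\<close> ensures that the point chosen below remains
      nonzero after truncation to \<open>cvec N\<close>.\<close>
    then have "F * H * cX 0 \<noteq> 0" using cX_neq_0 by simp
    then obtain y where y: "poly_eval (F * H * cX 0) y \<noteq> 0" using nonzero_cpoly_nonvanishing by blast
    define x where "x j = (if j \<le> N then y j else 0)" for j
    have "vars_in {..N} (F * H * cX 0)"
      using F(1) H(1) by (intro vars_in_mult) (auto intro: form_vars_in)
    then have "poly_eval (F * H * cX 0) x = poly_eval (F * H * cX 0) y"
      by (rule poly_eval_cong) (auto simp: x_def)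
    then have "poly_eval (F * H) x \<noteq> 0" "x 0 \<noteq> 0" using y by (auto simp: poly_eval_mult)
    moreover have "x \<noteq> 0" using \<open>x 0 \<noteq> 0\<close> by auto
    moreover have "x \<in> cvec N" by (simp add: x_def cvec_def)
    ultimately show False by blast
  qed
qed

text \<open>A hyperplane \<open>a\<close> cuts the affine part of the curve at the roots of the
  polynomial \<open>h\<close> with coefficients \<open>a\<close> applied to the \<open>w k\<close>.
  Nonvanishing of \<open>D\<close> keeps the leading coefficient nonzero, so the point
  \<open>s = 0\<close> is off the hyperplane, and it rules out double roots, so there are exactly
  \<open>q\<close> points.\<close>

lemma rnc_degree:
  assumes wb: "dual_family N q w b" and q1: "q \<ge> 1"
  shows "curve_degree N (rnc w q) q"
proof -
  obtain s P where P: "form q s P" "P \<noteq> 0"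
    "\<And>h :: complex poly. degree h = q \<Longrightarrow> \<not> rsquarefree h \<Longrightarrow> poly_eval P (coeff h) = 0"
    using discriminant_form[OF q1] by blast
  define \<beta> where "\<beta> k = linear_form N (w k)" for k
  define D where "D = \<beta> q * psubst P \<beta>"
  have D: "form N (1 + s * 1) D" unfolding D_def \<beta>_def
    by (intro form_mult form_psubst_form[OF P(1)] form_linear_form)
  have "D \<noteq> 0"
  proof -
    have "cX q * P \<noteq> 0" using P(2) cX_neq_0 by simp
    then obtain x where x: "poly_eval (cX q * P) x \<noteq> 0" using nonzero_cpoly_nonvanishing by blast
    \<comment> \<open>The dual functionals allow the coefficients of \<open>h\<close> to be
      prescribed arbitrarily, so the discriminant does not become zero when pulled back to
      hyperplanes.\<close>
    define a where "a j = (\<Sum>l\<le>q. x l * b l j)" for j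
    have \<beta>a: "poly_eval (\<beta> k) a = x k" if k: "k \<le> q" for k
    proof -
      have "poly_eval (\<beta> k) a = (\<Sum>l\<le>q. x l * (\<Sum>j\<le>N. b l j * w k j))"
        unfolding \<beta>_def poly_eval_linear_form a_def sum_distrib_left by (subst sum.swap) (simp add: mult_ac)
      also have "\<dots> = (\<Sum>l\<le>q. if l = k then x k else 0)"
        by (rule sum.cong) (use wb k in \<open>auto simp: dual_family_def\<close>)
      finally show ?thesis using k by simp
    qed
    have "poly_eval P (\<lambda>k. poly_eval (\<beta> k) a) = poly_eval P x"
      by (rule poly_eval_cong[OF form_vars_in[OF P(1)]]) (use \<beta>a in auto)
    then have "poly_eval D a \<noteq> 0" using x \<beta>a[of q] by (auto simp: D_def poly_eval_simps poly_eval_psubst)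
    then show ?thesis by auto
  qed
  have "finite (rnc w q \<inter> hyperplane N (line a)) \<and> card (rnc w q \<inter> hyperplane N (line a)) = q"
    if a: "a \<in> cvec N" "poly_eval D a \<noteq> 0" for a
  proof -
    define h where "h = (\<Sum>k\<le>q. monom (poly_eval (\<beta> k) a) k)"
    have ch: "coeff h k = (if k \<le> q then poly_eval (\<beta> k) a else 0)" for k
      by (simp add: h_def coeff_sum)
    have \<beta>q: "poly_eval (\<beta> q) a \<noteq> 0" using a(2) by (auto simp: D_def poly_eval_mult)
    have deg: "degree h = q"
    proof (rule antisym)
      show "degree h \<le> q" by (rule degree_le) (simp add: ch)
      show "q \<le> degree h" by (rule le_degree) (simp add: ch \<beta>q del: poly_eval_linear_form)
    qed
    have "poly_eval P (coeff h) = poly_eval P (\<lambda>k. poly_eval (\<beta> k) a)"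
      by (rule poly_eval_cong[OF form_vars_in[OF P(1)]]) (auto simp: ch)
    then have "poly_eval P (coeff h) \<noteq> 0" using a(2) by (auto simp: D_def poly_eval_mult poly_eval_psubst)
    then have sq: "rsquarefree h" using P(3)[OF deg] by blast
    have h0: "h \<noteq> 0" using deg q1 by auto
    have pair: "(\<Sum>j\<le>N. a j * vcurve w q s t j) = (\<Sum>k\<le>q. poly_eval (\<beta> k) a * (s ^ (q - k) * t ^ k))" for s t
      unfolding vcurve_def \<beta>_def poly_eval_linear_form sum_distrib_left sum_distrib_right
      by (subst sum.swap) (simp add: mult_ac)
    have hyp: "line (vcurve w q s t) \<in> hyperplane N (line a) \<longleftrightarrow> (\<Sum>j\<le>N. a j * vcurve w q s t j) = 0"
      if "s \<noteq> 0 \<or> t \<noteq> 0" for s t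
    proof
      assume "line (vcurve w q s t) \<in> hyperplane N (line a)"
      then show "(\<Sum>j\<le>N. a j * vcurve w q s t j) = 0" using line_self by (auto simp: hyperplane_def)
    next
      assume 0: "(\<Sum>j\<le>N. a j * vcurve w q s t j) = 0"
      have "(\<Sum>j\<le>N. u j * v j) = 0" if uv: "u \<in> line a" "v \<in> line (vcurve w q s t)" for u v
      proof -
        obtain c c' where "u = cscale c a" "v = cscale c' (vcurve w q s t)" using uv by (auto simp: line_def)
        then have "(\<Sum>j\<le>N. u j * v j) = c * c' * (\<Sum>j\<le>N. a j * vcurve w q s t j)"
          by (simp add: cscale_def sum_distrib_left mult_ac)
        then show ?thesis using 0 by simp
      qed
      then show "line (vcurve w q s t) \<in> hyperplane N (line a)"
        using line_in_proj_space[OF vcurve_cvec[OF wb] vcurve_nonzero[OF wb that]] by (simp add: hyperplane_def)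
    qed
    have ph: "poly h t = (\<Sum>j\<le>N. a j * vcurve w q 1 t j)" for t
      by (simp add: pair h_def poly_sum poly_monom)
    have "rnc w q \<inter> hyperplane N (line a) = (\<lambda>t. line (vcurve w q 1 t)) ` {t. poly h t = 0}"
    proof
      show "rnc w q \<inter> hyperplane N (line a) \<subseteq> (\<lambda>t. line (vcurve w q 1 t)) ` {t. poly h t = 0}"
      proof
        fix p assume p: "p \<in> rnc w q \<inter> hyperplane N (line a)"
        then obtain s t where st: "p = line (vcurve w q s t)" "s \<noteq> 0 \<or> t \<noteq> 0" by (auto simp: rnc_def)
        have "s \<noteq> 0"
        proof
          assume s: "s = 0"
          have "0 = (\<Sum>k\<le>q. poly_eval (\<beta> k) a * (s ^ (q - k) * t ^ k))"
            using p hyp[OF st(2)] st(1) pair by simp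
          also have "\<dots> = (\<Sum>k\<le>q. if k = q then poly_eval (\<beta> q) a * t ^ q else 0)"
            by (rule sum.cong) (auto simp: s power_0_left)
          finally show False using \<beta>q st(2) s by simp
        qed
        then have "p = line (vcurve w q 1 (t / s))" using line_vcurve_scale[of s w q 1 "t / s"] st(1) by simp
        moreover from this have "poly h (t / s) = 0" using p hyp[of 1 "t / s"] by (simp add: ph)
        ultimately show "p \<in> (\<lambda>t. line (vcurve w q 1 t)) ` {t. poly h t = 0}" by blast
      qed
      show "(\<lambda>t. line (vcurve w q 1 t)) ` {t. poly h t = 0} \<subseteq> rnc w q \<inter> hyperplane N (line a)"
      proof
        fix p assume "p \<in> (\<lambda>t. line (vcurve w q 1 t)) ` {t. poly h t = 0}"
        then obtain t where t: "p = line (vcurve w q 1 t)" "poly h t = 0" by blast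
        have 1: "(1 :: complex) \<noteq> 0 \<or> t \<noteq> 0" by simp
        then have "p \<in> rnc w q" unfolding t(1) rnc_def by blast
        then show "p \<in> rnc w q \<inter> hyperplane N (line a)" using hyp[OF 1] t by (simp add: ph)
      qed
    qed
    moreover have "inj_on (\<lambda>t. line (vcurve w q 1 t)) {t. poly h t = 0}"
      by (rule inj_onI) (rule rnc_affine_points_distinct[OF wb q1])
    ultimately show ?thesis
      using rsquarefree_card_roots[OF sq] deg h0 by (simp add: card_image poly_roots_finite)
  qed
  then show ?thesis unfolding curve_degree_def by (rule generically_form[OF D \<open>D \<noteq> 0\<close>])
qed

theorem rnc_is_rational_normal_curve:
  assumes "dual_family N q w b" "q \<ge> 1"
  shows "rational_normal_curve N q (rnc w q)"
  unfolding rational_normal_curve_def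
  using rnc_variety_structure[OF assms] rnc_dimension[OF assms] rnc_smooth[OF assms]
    rnc_birational[OF assms] rnc_degree[OF assms] rnc_span[OF assms] by blast

section \<open>The extremal weighted Veronese variety and the comparison of the bounds\<close>

section \<open>A variety attaining the bound\<close>

subsection \<open>Monomials of bounded weighted degree\<close>

definition wmonomials :: "nat \<Rightarrow> nat \<Rightarrow> nat \<Rightarrow> (nat \<Rightarrow>\<^sub>0 nat) set" where
  "wmonomials r c q = {e. keys e \<subseteq> {..r} \<and> lookup e 0 + c * (\<Sum>i=1..r. lookup e i) \<le> q}"

text \<open>Here \<open>b\<close> is the remainder of the exponent of \<open>t\<close> modulo
  \<open>c\<close>, and \<open>S\<close> is the total degree once that exponent is divided by
  \<open>c\<close>. Since \<open>q = \<rho> * c + (m - 1)\<close>, the quotient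
  \<open>\<rho>\<close> is attainable exactly for remainders up to \<open>m - 1\<close>.\<close>

lemma weighted_bound_iff:
  fixes c b \<rho> m S q :: nat
  assumes "b < c" "m \<le> c" "\<rho> \<ge> 1" "q + 1 = \<rho> * c + m"
  shows "c * S + b \<le> q \<longleftrightarrow> S \<le> (if b < m then \<rho> else \<rho> - 1)"
proof (cases "b < m")
  case True
  have "c * S + b \<le> q \<longleftrightarrow> S \<le> \<rho>"
  proof
    assume "c * S + b \<le> q"
    then have "S * c < Suc \<rho> * c" using assms True by (simp add: mult.commute)
    then show "S \<le> \<rho>" using mult_less_cancel2[of S c "Suc \<rho>"] by simp
  next
    assume "S \<le> \<rho>"
    then have "c * S \<le> \<rho> * c" using mult_le_mono2[of S \<rho> c] by (simp add: mult.commute)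
    then show "c * S + b \<le> q" using assms(4) True by linarith
  qed
  then show ?thesis using True by simp
next
  case False
  obtain \<rho>' where \<rho>': "\<rho> = Suc \<rho>'" using assms(3) by (cases \<rho>) auto
  have "c * S + b \<le> q \<longleftrightarrow> S \<le> \<rho>'"
  proof
    assume "c * S + b \<le> q"
    then have "S * c < Suc \<rho>' * c" using assms(4) False unfolding \<rho>' by (simp add: mult.commute)
    then show "S \<le> \<rho>'" using mult_less_cancel2[of S c "Suc \<rho>'"] by simp
  next
    assume "S \<le> \<rho>'"
    then have "c * S \<le> \<rho>' * c" using mult_le_mono2[of S \<rho>' c] by (simp add: mult.commute)
    moreover have "q + 1 = \<rho>' * c + c + m" using assms(4) by (simp add: \<rho>')
    moreover have "b + 1 \<le> c" using assms(1) by simp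
    ultimately show "c * S + b \<le> q" using False assms(1) by linarith
  qed
  then show ?thesis using False \<rho>' by simp
qed

text \<open>Division with remainder of the exponent of the first variable by its weight \<open>c\<close>.\<close>

lemma
  fixes c \<rho> m q :: nat
  assumes c: "c \<ge> 1" and m: "m \<le> c" and \<rho>: "\<rho> \<ge> 1" and q: "q + 1 = \<rho> * c + m"
  shows finite_wmonomials: "finite (wmonomials r c q)"
    and card_wmonomials: "card (wmonomials r c q) =
      m * ((r + \<rho> + 1) choose (r + 1)) + (c - m) * ((r + \<rho>) choose (r + 1))"
proof -
  define k where "k b = (if b < m then \<rho> else \<rho> - 1)" for b
  \<comment> \<open>Adding \<open>(c - 1) * lookup e 0 + b\<close> turns the exponent
    \<open>lookup e 0\<close> into \<open>c * lookup e 0 + b\<close>, so the weighted degree becomes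
    \<open>c\<close> times the total degree plus \<open>b\<close>.\<close>
  define f :: "nat \<times> (nat \<Rightarrow>\<^sub>0 nat) \<Rightarrow> (nat \<Rightarrow>\<^sub>0 nat)" where "f = (\<lambda>(b, e). e + Poly_Mapping.single 0 ((c - 1) * lookup e 0 + b))"
  define g where "g e = (lookup e 0 mod c, Poly_Mapping.update 0 (lookup e 0 div c) e)" for e :: "nat \<Rightarrow>\<^sub>0 nat"
  let ?S = "Sigma {..<c} (\<lambda>b. exps (Suc r) (k b))"
  have f0: "lookup (f (b, e)) 0 = c * lookup e 0 + b" for b e
    using c by (cases c) (simp_all add: f_def lookup_add)
  have fi: "lookup (f (b, e)) i = lookup e i" if "i \<noteq> 0" for b e i
    using that by (simp add: f_def lookup_add lookup_single)
  have split: "(\<Sum>i<Suc r. lookup e i) = lookup e 0 + (\<Sum>i=1..r. lookup e i)" for e :: "nat \<Rightarrow>\<^sub>0 nat"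
  proof -
    have "{..<Suc r} = insert 0 {1..r}" by auto
    then show ?thesis by simp
  qed
  have weight: "lookup (f (b, e)) 0 + c * (\<Sum>i=1..r. lookup (f (b, e)) i) = c * (\<Sum>i<Suc r. lookup e i) + b" for b e
  proof -
    have "(\<Sum>i=1..r. lookup (f (b, e)) i) = (\<Sum>i=1..r. lookup e i)" by (rule sum.cong) (auto simp: fi)
    then show ?thesis unfolding split f0 by (simp add: algebra_simps)
  qed
  have keys_f: "keys (f (b, e)) \<subseteq> {..r} \<longleftrightarrow> keys e \<subseteq> {..<Suc r}" for b e
  proof -
    have "i \<in> keys (f (b, e)) \<longleftrightarrow> i \<in> keys e" if "i \<noteq> 0" for i using fi[OF that] by (simp add: in_keys_iff)
    then have "(i \<in> keys (f (b, e)) \<longrightarrow> i \<le> r) \<longleftrightarrow> (i \<in> keys e \<longrightarrow> i \<le> r)" for i by (cases "i = 0") auto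
    then show ?thesis unfolding subset_iff atMost_iff lessThan_iff less_Suc_eq_le by blast
  qed
  have f_mem: "f (b, e) \<in> wmonomials r c q \<longleftrightarrow> e \<in> exps (Suc r) (k b)" if b: "b < c" for b e
    using weighted_bound_iff[OF b m \<rho> q, of "\<Sum>i<Suc r. lookup e i"]
    unfolding wmonomials_def exps_def mem_Collect_eq weight keys_f k_def by blast
  have gf: "g (f (b, e)) = (b, e)" if b: "b < c" for b e
  proof -
    have "lookup (Poly_Mapping.update 0 (lookup (f (b, e)) 0 div c) (f (b, e))) i = lookup e i" for i
      using b fi[of i b e] by (cases "i = 0") (simp_all add: lookup_update f0)
    then show ?thesis using b by (simp add: g_def f0 poly_mapping_eqI)
  qed
  have fg: "f (g e) = e" for e
  proof (rule poly_mapping_eqI)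
    fix i
    show "lookup (f (g e)) i = lookup e i"
    proof (cases "i = 0")
      case True
      then show ?thesis using f0[of "lookup e 0 mod c" "Poly_Mapping.update 0 (lookup e 0 div c) e"]
        by (simp add: g_def lookup_update)
    next
      case False
      then show ?thesis using fi[of i "lookup e 0 mod c" "Poly_Mapping.update 0 (lookup e 0 div c) e"]
        by (simp add: g_def lookup_update)
    qed
  qed
  have bij: "bij_betw f ?S (wmonomials r c q)"
  proof (rule bij_betw_byWitness[of _ g])
    show "\<forall>a\<in>?S. g (f a) = a" using gf by auto
    show "\<forall>e\<in>wmonomials r c q. f (g e) = e" using fg by blast
    show "f ` ?S \<subseteq> wmonomials r c q" using f_mem by auto
    show "g ` wmonomials r c q \<subseteq> ?S"
    proof
      fix a assume "a \<in> g ` wmonomials r c q"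
      then obtain e where e: "e \<in> wmonomials r c q" "a = g e" by blast
      obtain b e' where a: "a = (b, e')" by fastforce
      have b: "b < c" using e(2) a c by (auto simp: g_def)
      have "f (b, e') \<in> wmonomials r c q" using fg[of e] e a by simp
      then show "a \<in> ?S" using f_mem[OF b] a b by simp
    qed
  qed
  have "finite ?S" using finite_exps by (intro finite_SigmaI) auto
  then show "finite (wmonomials r c q)" using bij bij_betw_finite by blast
  have "card (wmonomials r c q) = (\<Sum>b<c. card (exps (Suc r) (k b)))"
    using bij_betw_same_card[OF bij] finite_exps by simp
  also have "\<dots> = (\<Sum>b<m. card (exps (Suc r) (k b))) + (\<Sum>b\<in>{m..<c}. card (exps (Suc r) (k b)))"
  proof -
    have "{..<c} = {..<m} \<union> {m..<c}" using m by auto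
    then show ?thesis by (simp add: sum.union_disjoint ivl_disj_int)
  qed
  also have "\<dots> = m * ((Suc r + \<rho>) choose (Suc r)) + (c - m) * ((Suc r + (\<rho> - 1)) choose (Suc r))"
    by (simp add: k_def card_exps)
  finally show "card (wmonomials r c q) = m * ((r + \<rho> + 1) choose (r + 1)) + (c - m) * ((r + \<rho>) choose (r + 1))"
    using \<rho> by simp
qed

lemma interpolation:
  fixes t y :: "nat \<Rightarrow> complex"
  assumes "inj_on t {..<n}"
  shows "\<exists>p. degree p \<le> n - 1 \<and> (\<forall>i<n. poly p (t i) = y i)"
proof -
  define L where "L i = (\<Prod>k\<in>{..<n} - {i}. [:- t k, 1:])" for i
  define p where "p = (\<Sum>i<n. smult (y i / poly (L i) (t i)) (L i))"
  have L0: "poly (L i) (t k) = 0" if "k < n" "k \<noteq> i" for i k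
    using that by (auto simp: L_def poly_prod prod_zero_iff)
  have L1: "poly (L i) (t i) \<noteq> 0" if "i < n" for i
    using assms that by (auto simp: L_def poly_prod prod_zero_iff inj_on_def)
  have "degree p \<le> n - 1" unfolding p_def
  proof (rule degree_sum_le)
    fix i assume i: "i \<in> {..<n}"
    have "degree (L i) = card ({..<n} - {i})" unfolding L_def by (subst degree_prod_eq_sum_degree) auto
    also have "\<dots> = n - 1" using i by simp
    finally show "degree (smult (y i / poly (L i) (t i)) (L i)) \<le> n - 1"
      using degree_smult_le order_trans by (metis order_refl)
  qed simp
  moreover have "poly p (t i) = y i" if i: "i < n" for i
  proof -
    have "poly p (t i) = (\<Sum>k<n. if k = i then y i else 0)"
      unfolding p_def poly_sum by (rule sum.cong) (use L0[OF i] L1[OF i] in auto)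
    then show ?thesis using i by simp
  qed
  ultimately show ?thesis by blast
qed

text \<open>The closure of the image of affine space under all monomials \<open>t\<^sup>j y\<^sup>e\<close> of weighted degree at most
  \<open>q\<close>, where \<open>t\<close> (the variable with index 0) has weight 1 and each \<open>y\<^sub>i\<close> has weight \<open>c = n - 1\<close>.\<close>

locale weighted_veronese =
  fixes r c q N :: nat and idx :: "nat \<Rightarrow> (nat \<Rightarrow>\<^sub>0 nat)"
  assumes c: "c \<ge> 1" and cq: "c \<le> q" and idx: "bij_betw idx {..N} (wmonomials r c q)"
begin

definition \<Psi> :: "(nat \<Rightarrow> complex) \<Rightarrow> nat \<Rightarrow> complex" where
  "\<Psi> u = (\<lambda>j. if j \<le> N then monom_eval (idx j) u else 0)"

definition X :: "ppoint set" where
  "X = pclosure N (range \<Psi>)"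

definition pos :: "(nat \<Rightarrow>\<^sub>0 nat) \<Rightarrow> nat" where
  "pos = inv_into {..N} idx"

definition coordinate_poly :: "nat \<Rightarrow> nat cpoly" where
  "coordinate_poly j = (if j \<le> N then Poly_Mapping.single (idx j) 1 else 0)"

lemma pos: "e \<in> wmonomials r c q \<Longrightarrow> pos e \<le> N \<and> idx (pos e) = e"
  using bij_betw_inv_into_right[OF idx] bij_betwE[OF bij_betw_inv_into[OF idx]] by (auto simp: pos_def)

lemma idx_mem: "j \<le> N \<Longrightarrow> idx j \<in> wmonomials r c q"
  using bij_betwE[OF idx] by auto

lemma power_mem: "k \<le> q \<Longrightarrow> Poly_Mapping.single 0 k \<in> wmonomials r c q"
  by (auto simp: wmonomials_def lookup_single)

lemma variable_mem:
  assumes "l \<le> r" shows "Poly_Mapping.single l 1 \<in> wmonomials r c q"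
proof (cases "l = 0")
  case True
  then show ?thesis using power_mem[of 1] c cq by simp
next
  case False
  then have "(\<Sum>i=1..r. lookup (Poly_Mapping.single l (1::nat)) i) = (\<Sum>i=1..r. if i = l then 1 else 0)"
    by (intro sum.cong) (auto simp: lookup_single when_def)
  then show ?thesis using False assms cq by (simp add: wmonomials_def lookup_single)
qed

lemma one_mem: "0 \<in> wmonomials r c q"
  using power_mem[of 0] by simp

lemma \<Psi>_pos: "e \<in> wmonomials r c q \<Longrightarrow> \<Psi> u (pos e) = monom_eval e u"
  using pos by (simp add: \<Psi>_def)

lemma \<Psi>_poly: "\<Psi> u j = poly_eval (coordinate_poly j) u"
  by (simp add: \<Psi>_def coordinate_poly_def poly_eval_single)

lemma \<Psi>_cvec: "\<Psi> u \<in> cvec N"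
  by (simp add: \<Psi>_def cvec_def)

lemma \<Psi>_nonzero: "\<Psi> u \<noteq> 0"
proof
  assume "\<Psi> u = 0"
  then show False using \<Psi>_pos[OF one_mem, of u] by simp
qed

lemma coordinate_poly_vars: "vars_in {..r} (coordinate_poly j)"
  using idx_mem[of j] by (auto simp: coordinate_poly_def vars_in_def wmonomials_def)

lemma \<Psi>_cong:
  assumes "\<And>i. i \<le> r \<Longrightarrow> u i = u' i" shows "\<Psi> u = \<Psi> u'"
proof
  show "\<Psi> u j = \<Psi> u' j" for j
    unfolding \<Psi>_poly by (rule poly_eval_cong[OF coordinate_poly_vars]) (use assms in simp)
qed

lemma X_variety: "proj_variety N X"
  unfolding X_def by (rule parametrized_variety[OF _ \<Psi>_poly]) (use \<Psi>_cvec \<Psi>_nonzero in blast)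

lemma \<Psi>_in_X: "line (\<Psi> u) \<in> X"
  unfolding X_def using line_in_pclosure \<Psi>_cvec \<Psi>_nonzero by blast

text \<open>Setting the variables from index \<open>k\<close> on to zero gives closures growing from
  a point \<open>Z 0\<close> to \<open>Z (r + 1)\<close>, told apart by the coordinates of the
  single variables. Longer chains are impossible because the parametrization uses
  \<open>r + 1\<close> variables.\<close>

lemma X_dimension: "has_dimension (zariski N) X (r + 1)"
  unfolding has_dimension_def
proof
  define restr where "restr k u = (\<lambda>i. if i < k then u i else 0)" for k and u :: "nat \<Rightarrow> complex"
  define Z where "Z k = pclosure N (range (\<lambda>u. \<Psi> (restr k u)))" for k
  have Z: "proj_variety N (Z k)" for k unfolding Z_def
  proof (rule parametrized_variety)
    show "\<Psi> (restr k u) \<in> cvec N \<and> \<Psi> (restr k u) \<noteq> 0" for u using \<Psi>_cvec \<Psi>_nonzero by blast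
    show "\<Psi> (restr k u) j = poly_eval (psubst (coordinate_poly j) (\<lambda>i. if i < k then cX i else 0)) u" for u j
      unfolding \<Psi>_poly poly_eval_psubst restr_def by (rule arg_cong[where f = "poly_eval _"]) auto
  qed
  have ZX: "Z k \<subseteq> X" for k unfolding Z_def X_def by (rule pclosure_mono) blast
  have "Z k \<subset> Z (Suc k)" if k: "k < r + 1" for k
  proof (rule psubsetI)
    show "Z k \<subseteq> Z (Suc k)" unfolding Z_def
    proof (rule pclosure_mono, rule image_subsetI)
      fix u
      have "restr k u = restr (Suc k) (restr k u)" by (auto simp: restr_def)
      then show "\<Psi> (restr k u) \<in> range (\<lambda>u. \<Psi> (restr (Suc k) u))" by (rule range_eqI[OF arg_cong])
    qed
    let ?e = "Poly_Mapping.single k (1 :: nat)"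
    have e: "?e \<in> wmonomials r c q" using variable_mem[of k] k by simp
    let ?v = "\<Psi> (restr (Suc k) (\<lambda>_. 1))"
    have "line ?v \<in> Z (Suc k)" unfolding Z_def by (rule line_in_pclosure) (use \<Psi>_cvec \<Psi>_nonzero in auto)
    moreover have "line ?v \<notin> Z k"
    proof
      assume Zk: "line ?v \<in> Z k"
      have "poly_eval (cX (pos ?e)) v = 0" if "v \<in> range (\<lambda>u. \<Psi> (restr k u))" for v
        using that \<Psi>_pos[OF e] by (auto simp: restr_def)
      from pclosure_vanish[OF form_cX this Zk[unfolded Z_def] line_self] pos[OF e]
      have "?v (pos ?e) = 0" by simp
      then show False using \<Psi>_pos[OF e] by (simp add: restr_def)
    qed
    ultimately show "Z k \<noteq> Z (Suc k)" by blast
  qed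
  then show "irreducible_chain (zariski N) X (r + 1)"
    using Z ZX unfolding irreducible_chain_def proj_variety_def by (intro exI[of _ Z]) blast
  have "\<not> irreducible_chain (zariski N) X (Suc (card {..r}))"
    by (rule parametrized_no_long_chain[where g = coordinate_poly and \<Psi> = \<Psi>])
      (auto simp: \<Psi>_poly X_def coordinate_poly_vars)
  then show "\<not> irreducible_chain (zariski N) X (Suc (r + 1))" by simp
qed

text \<open>A hyperplane containing \<open>X\<close> would be a linear relation between distinct
  monomials.\<close>

lemma X_span: "cfun.dim (\<Union>X) = Suc N"
proof -
  define e where "e k = (\<lambda>j. if j = k then 1 else 0 :: complex)" for k :: nat
  have eN: "e ` {..N} \<subseteq> cvec N" by (auto simp: e_def cvec_def)
  have pick: "(\<Sum>j\<le>N. l j * e k j) = l k" if "k \<le> N" for l k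
    using that by (simp add: e_def sum.delta' if_distrib cong: if_cong)
  have dual: "dual_family N N e e" unfolding dual_family_def
    using eN pick by (auto simp: e_def)
  have XN: "\<Union>X \<subseteq> cvec N" using variety_cone_cvec[OF X_variety] by blast
  show ?thesis
  proof (rule dim_dual_family[OF dual])
    show "\<Union>X \<subseteq> cfun.span (e ` {..N})"
    proof (rule cone_subset_span[OF eN XN])
      fix l assume l: "\<And>w. w \<in> e ` {..N} \<Longrightarrow> (\<Sum>j\<le>N. l j * w j) = 0"
      have "l k = 0" if "k \<le> N" for k using l[of "e k"] pick[OF that, of l] that by simp
      then show "\<forall>v\<in>\<Union>X. (\<Sum>j\<le>N. l j * v j) = 0" by simp
    qed
    show "e ` {..N} \<subseteq> cfun.span (\<Union>X)"
    proof (rule cone_subset_span[OF XN eN])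
      fix l assume l: "\<And>w. w \<in> \<Union>X \<Longrightarrow> (\<Sum>j\<le>N. l j * w j) = 0"
      define F where "F = (\<Sum>j\<le>N. Poly_Mapping.single (idx j) (l j))"
      have "poly_eval F u = 0" for u
      proof -
        have "\<Psi> u \<in> \<Union>X" using \<Psi>_in_X line_self by blast
        then have "(\<Sum>j\<le>N. l j * \<Psi> u j) = 0" by (rule l)
        then show ?thesis by (simp add: F_def poly_eval_sum poly_eval_single \<Psi>_def)
      qed
      then have F0: "F = 0" by (rule poly_eval_eq_0_imp_eq_0)
      have "l k = 0" if k: "k \<le> N" for k
      proof -
        have "lookup F (idx k) = (\<Sum>j\<le>N. if j = k then l k else 0)"
          unfolding F_def lookup_sum
          by (rule sum.cong) (use bij_betw_imp_inj_on[OF idx] k in \<open>auto simp: lookup_single when_def inj_on_def\<close>)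
        then show ?thesis using k F0 by simp
      qed
      then show "\<forall>v\<in>e ` {..N}. (\<Sum>j\<le>N. l j * v j) = 0" by simp
    qed
  qed
qed

text \<open>On the chart where the coordinate of the monomial 1 is nonzero, taking the closure adds
  no points: the binomial equations of the parametrization recover every coordinate from those of
  the single variables.\<close>

lemma X_chart:
  assumes v: "v \<in> \<Union>X" "v (pos 0) \<noteq> 0"
  shows "\<exists>u. v = cscale (v (pos 0)) (\<Psi> u) \<and> u 0 = v (pos (Poly_Mapping.single 0 1)) / v (pos 0)"
proof -
  define \<iota> where "\<iota> l = pos (Poly_Mapping.single l 1)" for l
  define u where "u l = v (\<iota> l) / v (pos 0)" for l
  have \<iota>: "\<iota> l \<le> N" "\<Psi> u (\<iota> l) = u l" if "l \<le> r" for l and u :: "nat \<Rightarrow> complex"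
    using pos[OF variable_mem[OF that]] \<Psi>_pos[OF variable_mem[OF that], of u] by (simp_all add: \<iota>_def)
  have "v j = v (pos 0) * monom_eval (idx j) u" if j: "j \<le> N" for j
  proof -
    let ?m = "idx j"
    define s where "s = (\<Sum>a\<in>keys ?m. lookup ?m a)"
    have km: "a \<le> r" if "a \<in> keys ?m" for a using idx_mem[OF j] that by (auto simp: wmonomials_def)
    \<comment> \<open>The factorization of a monomial into its variables, made homogeneous of degree
      \<open>s + 1\<close> by powers of the coordinate belonging to the monomial 1.\<close>
    define F where "F = cX j * cX (pos 0) ^ s - cX (pos 0) * (\<Prod>a\<in>keys ?m. cX (\<iota> a) ^ lookup ?m a)"
    have "form N (1 + s * 1) (cX j * cX (pos 0) ^ s)"
      using j pos[OF one_mem] by (intro form_mult form_power form_cX) auto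
    moreover have "form N (1 + (\<Sum>a\<in>keys ?m. lookup ?m a * 1)) (cX (pos 0) * (\<Prod>a\<in>keys ?m. cX (\<iota> a) ^ lookup ?m a))"
      using km \<iota>(1) pos[OF one_mem] by (intro form_mult form_prod form_power form_cX) auto
    ultimately have F: "form N (1 + s) F" unfolding F_def by (intro form_diff) (simp_all add: s_def)
    have van: "poly_eval F x = 0" if "x \<in> range \<Psi>" for x
    proof -
      obtain u where x: "x = \<Psi> u" using \<open>x \<in> range \<Psi>\<close> by blast
      have "(\<Prod>a\<in>keys ?m. \<Psi> u (\<iota> a) ^ lookup ?m a) = monom_eval ?m u"
        unfolding monom_eval_def by (rule prod.cong) (use \<iota>(2) km in auto)
      then show ?thesis using \<Psi>_pos[OF one_mem, of u] j by (simp add: F_def poly_eval_simps x \<Psi>_def)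
    qed
    obtain p where "p \<in> X" "v \<in> p" using v(1) by blast
    from pclosure_vanish[OF F van this(1)[unfolded X_def] this(2)]
    have *: "v j * v (pos 0) ^ s = v (pos 0) * (\<Prod>a\<in>keys ?m. v (\<iota> a) ^ lookup ?m a)"
      by (simp add: F_def poly_eval_simps)
    have "monom_eval ?m u * v (pos 0) ^ s = (\<Prod>a\<in>keys ?m. v (\<iota> a) ^ lookup ?m a)"
      using v(2) by (simp add: monom_eval_def u_def s_def power_divide power_sum flip: prod.distrib)
    then have "v j * v (pos 0) ^ s = v (pos 0) * monom_eval ?m u * v (pos 0) ^ s"
      using * by (simp add: mult.assoc)
    then show ?thesis using v(2) by simp
  qed
  moreover have "v \<in> cvec N" using variety_cone_cvec[OF X_variety v(1)] .
  ultimately have "v = cscale (v (pos 0)) (\<Psi> u)" by (auto simp: cscale_def \<Psi>_def cvec_def fun_eq_iff)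
  then show ?thesis by (intro exI[of _ u]) (simp add: u_def \<iota>_def)
qed

text \<open>Interpolating polynomials of degree at most \<open>n - 1 = c\<close> match the weight
  \<open>c\<close> of the variables \<open>y\<close>, so a monomial of weighted degree at most
  \<open>q\<close> restricts to a polynomial of degree at most \<open>q\<close> in
  \<open>t\<close>.\<close>

lemma curve_through_points:
  assumes n: "n = c + 1" and u: "inj_on (\<lambda>i. u i 0) {..<n}"
  shows "\<exists>C. rational_normal_curve N q C \<and> C \<subseteq> X \<and> (\<forall>i<n. line (\<Psi> (u i)) \<in> C)"
proof -
  have "\<forall>l. \<exists>p. degree p \<le> n - 1 \<and> (\<forall>i<n. poly p (u i 0) = u i l)"
  proof
    fix l
    show "\<exists>p. degree p \<le> n - 1 \<and> (\<forall>i<n. poly p (u i 0) = u i l)" by (rule interpolation[OF u])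
  qed
  then obtain p' where p': "\<And>l. degree (p' l) \<le> n - 1" "\<And>l i. i < n \<Longrightarrow> poly (p' l) (u i 0) = u i l"
    by metis
  \<comment> \<open>The variable \<open>t\<close> is the parameter itself, so the curve is a graph
    over the \<open>t\<close>-line and passes through the \<open>i\<close>-th point at the parameter
    \<open>u i 0\<close>.\<close>
  define p where "p l = (if l = 0 then [:0, 1:] else p' l)" for l
  define h where "h j = (\<Prod>a\<in>keys (idx j). p a ^ lookup (idx j) a)" for j
  have h: "poly (h j) \<tau> = monom_eval (idx j) (\<lambda>a. poly (p a) \<tau>)" for j \<tau>
    by (simp add: h_def monom_eval_def poly_prod poly_power)
  have h_deg: "degree (h j) \<le> q" if j: "j \<le> N" for j
  proof -
    let ?m = "idx j" and ?w = "\<lambda>l :: nat. if l = 0 then 1 else c"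
    have "degree (h j) \<le> (\<Sum>a\<in>keys ?m. ?w a * lookup ?m a)"
      unfolding h_def by (rule degree_monomial_subst_le) (use p'(1) n in \<open>auto simp: p_def\<close>)
    also have "\<dots> = (\<Sum>a\<in>insert 0 {1..r}. ?w a * lookup ?m a)"
      by (rule sum.mono_neutral_left) (use idx_mem[OF j] in \<open>auto simp: wmonomials_def in_keys_iff\<close>)
    also have "\<dots> = lookup ?m 0 + (\<Sum>a=1..r. ?w a * lookup ?m a)" by simp
    also have "(\<Sum>a=1..r. ?w a * lookup ?m a) = c * (\<Sum>a=1..r. lookup ?m a)"
      unfolding sum_distrib_left by (rule sum.cong) auto
    also have "lookup ?m 0 + c * (\<Sum>a=1..r. lookup ?m a) \<le> q" using idx_mem[OF j] by (simp add: wmonomials_def)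
    finally show ?thesis .
  qed
  define w where "w k = (\<lambda>j. if j \<le> N then coeff (h j) k else 0)" for k
  \<comment> \<open>The powers of \<open>t\<close> up to \<open>q\<close> occur among the
    coordinates and restrict to the powers of the parameter. The corresponding coordinate
    functionals therefore form the dual family, which makes the degree exactly
    \<open>q\<close>.\<close>
  define b where "b l = (\<lambda>j. if j = pos (Poly_Mapping.single 0 l) then 1 else 0 :: complex)" for l
  have wb: "dual_family N q w b" unfolding dual_family_def
  proof (intro conjI allI impI)
    show "w k \<in> cvec N" for k by (simp add: w_def cvec_def)
    fix k l assume "k \<le> q" "l \<le> q"
    let ?i = "pos (Poly_Mapping.single 0 l)"
    have i: "?i \<le> N" "idx ?i = Poly_Mapping.single 0 l" using pos[OF power_mem[OF \<open>l \<le> q\<close>]] by auto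
    have "h ?i = monom 1 l" unfolding h_def i(2)
      by (cases "l = 0") (simp_all add: p_def monom_altdef)
    then have "w k ?i = (if k = l then 1 else 0)" using i(1) by (simp add: w_def)
    moreover have "(\<Sum>j\<le>N. b l j * w k j) = (\<Sum>j\<le>N. if j = ?i then w k ?i else 0)"
      by (rule sum.cong) (auto simp: b_def)
    ultimately show "(\<Sum>j\<le>N. b l j * w k j) = (if k = l then 1 else 0)" using i(1) by simp
  qed
  have curve: "vcurve w q 1 \<tau> = \<Psi> (\<lambda>a. poly (p a) \<tau>)" for \<tau>
  proof
    fix j
    show "vcurve w q 1 \<tau> j = \<Psi> (\<lambda>a. poly (p a) \<tau>) j"
    proof (cases "j \<le> N")
      case True
      then show ?thesis using poly_sum_coeffs[OF h_deg[OF True], of \<tau>]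
        by (simp add: vcurve_def w_def \<Psi>_def h mult.commute)
    qed (simp add: vcurve_def w_def \<Psi>_def)
  qed
  have q1: "q \<ge> 1" using c cq by simp
  have "rnc w q \<subseteq> X"
  proof (rule rnc_subset_closed[OF _ wb])
    show "closedin (zariski N) X" using X_variety by (simp add: proj_variety_def)
    show "line (vcurve w q 1 \<tau>) \<in> X" for \<tau> unfolding curve by (rule \<Psi>_in_X)
  qed
  moreover have "line (\<Psi> (u i)) \<in> rnc w q" if i: "i < n" for i
  proof -
    have "\<Psi> (u i) = vcurve w q 1 (u i 0)"
      unfolding curve by (rule \<Psi>_cong) (use p'(2)[OF i] in \<open>auto simp: p_def\<close>)
    moreover have "(1 :: complex) \<noteq> 0 \<or> u i 0 \<noteq> 0" by simp
    then have "line (vcurve w q 1 (u i 0)) \<in> rnc w q" unfolding rnc_def by blast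
    ultimately show ?thesis by simp
  qed
  ultimately show ?thesis using rnc_is_rational_normal_curve[OF wb q1] by blast
qed

text \<open>In one factor the image of \<open>\<Psi>\<close> is dense in \<open>X\<close> by
  construction. The factors are passed from the image to \<open>X\<close> one at a time while the
  others are frozen.\<close>

lemma multiform_vanishes_on_power:
  assumes F: "multiform N n d F"
    and van: "\<And>u. poly_eval F (\<lambda>(i, j). \<Psi> (u i) j) = 0" and v: "\<And>i. i < n \<Longrightarrow> v i \<in> \<Union>X"
  shows "poly_eval F (\<lambda>(i, j). v i j) = 0"
proof -
  have "poly_eval F (\<lambda>(i, j). v i j) = 0"
    if "k \<le> n" "\<And>i. i < k \<Longrightarrow> v i \<in> \<Union>X" "\<And>i. i \<ge> k \<Longrightarrow> v i \<in> range \<Psi>" for k v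
    using that
  proof (induction k arbitrary: v)
    case 0
    then have "\<forall>i. \<exists>u. v i = \<Psi> u" by blast
    then obtain u where "\<And>i. v i = \<Psi> (u i)" by metis
    then show ?case using van[of u] by simp
  next
    case (Suc k)
    then have kn: "k < n" by simp
    obtain H where H: "form N (d k) H" "\<And>x. poly_eval H x = poly_eval F (\<lambda>(i, j). (v(k := x)) i j)"
      using multiform_partial_eval[OF F kn, of v] by blast
    have "poly_eval H x = 0" if "x \<in> range \<Psi>" for x
      unfolding H(2) by (rule Suc.IH) (use kn Suc.prems that in \<open>auto simp: Suc_le_eq less_Suc_eq\<close>)
    moreover obtain p where "p \<in> X" "v k \<in> p" using Suc.prems(2)[of k] by blast
    ultimately have "poly_eval H (v k) = 0" using pclosure_vanish[OF H(1)] unfolding X_def by blast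
    then show ?case by (simp add: H(2))
  qed
  note vanish = this[of n]
  \<comment> \<open>The induction quantifies over all indices, so those from \<open>n\<close> on
    receive the default \<open>\<Psi> 0\<close>; the variables of \<open>F\<close> do not reach
    them.\<close>
  let ?v = "\<lambda>i. if i < n then v i else \<Psi> 0"
  have "poly_eval F (\<lambda>(i, j). ?v i j) = 0" by (rule vanish) (use v in auto)
  moreover have "vars_in ({..<n} \<times> {..N}) F" using F by (simp add: multiform_def vars_in_def)
  then have "poly_eval F (\<lambda>(i, j). v i j) = poly_eval F (\<lambda>(i, j). ?v i j)"
    by (rule poly_eval_cong) auto
  ultimately show ?thesis by simp
qed

text \<open>Interpolation needs points in the image of \<open>\<Psi>\<close> with distinct values of
  \<open>t\<close>. Both conditions are encoded in one multihomogeneous polynomial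
  \<open>D\<close>.\<close>

lemma X_rnc_through_generic_points:
  assumes n: "n = c + 1"
  shows "rnc_through_generic_points n q N X"
  unfolding rnc_through_generic_points_def generically_def
proof -
  let ?Y = "{..<n} \<rightarrow>\<^sub>E X"
  define i0 where "i0 = pos 0"
  define i1 where "i1 = pos (Poly_Mapping.single 0 1)"
  have i01: "i0 \<le> N" "i1 \<le> N" using pos[OF one_mem] pos[OF variable_mem[of 0]] by (auto simp: i0_def i1_def)
  have \<Psi>01: "\<Psi> u i0 = 1" "\<Psi> u i1 = u 0" for u
    using \<Psi>_pos[OF one_mem, of u] \<Psi>_pos[OF variable_mem[of 0], of u] by (simp_all add: i0_def i1_def)
  let ?I = "{(i, k). i < n \<and> k < i}"
  have finI: "finite ?I" by (rule finite_subset[of _ "{..<n} \<times> {..<n}"]) auto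
  \<comment> \<open>The first product puts every point into the chart of the monomial 1; the second
    makes the ratios of the coordinates \<open>i1\<close> and \<open>i0\<close>, which are the
    values of \<open>t\<close>, pairwise distinct.\<close>
  define D where "D = (\<Prod>i<n. cX (i, i0)) * (\<Prod>(i, k)\<in>?I. cX (i, i1) * cX (k, i0) - cX (k, i1) * cX (i, i0))"
  have "\<exists>d. multiform N n d (cX (i, i0))" if "i \<in> {..<n}" for i
    using multiform_cX[of i n i0 N] that i01 by auto
  moreover have "\<exists>d. multiform N n d (case a of (i, k) \<Rightarrow> cX (i, i1) * cX (k, i0) - cX (k, i1) * cX (i, i0))" if "a \<in> ?I" for a
  proof -
    obtain i k where a: "a = (i, k)" "i < n" "k < n" using \<open>a \<in> ?I\<close> by auto
    have "multiform N n (\<lambda>l. (if l = i then 1 else 0) + (if l = k then 1 else 0)) (cX (i, i1) * cX (k, i0))"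
      using a i01 by (intro multiform_mult multiform_cX) auto
    moreover have "multiform N n (\<lambda>l. (if l = k then 1 else 0) + (if l = i then 1 else 0)) (cX (k, i1) * cX (i, i0))"
      using a i01 by (intro multiform_mult multiform_cX) auto
    then have "multiform N n (\<lambda>l. (if l = i then 1 else 0) + (if l = k then 1 else 0)) (cX (k, i1) * cX (i, i0))"
      by (simp add: add.commute)
    ultimately show ?thesis using multiform_diff a(1) by (simp only: prod.case) blast
  qed
  ultimately obtain d1 d2 where "multiform N n d1 (\<Prod>i<n. cX (i, i0))"
    "multiform N n d2 (\<Prod>a\<in>?I. case a of (i, k) \<Rightarrow> cX (i, i1) * cX (k, i0) - cX (k, i1) * cX (i, i0))"
    using multiform_prod[of "{..<n}" N n] multiform_prod[of ?I N n] by meson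
  from multiform_mult[OF this] have D: "multiform N n (\<lambda>i. d1 i + d2 i) D" by (simp add: D_def)
  have D_eval: "poly_eval D (\<lambda>(i, j). v i j) = (\<Prod>i<n. v i i0) * (\<Prod>(i, k)\<in>?I. v i i1 * v k i0 - v k i1 * v i i0)" for v
    unfolding D_def poly_eval_mult poly_eval_prod
    by (intro arg_cong2[where f = "(*)"] prod.cong) (auto simp: poly_eval_simps)
  have XP: "X \<subseteq> proj_space N" by (rule variety_subset[OF X_variety])
  have YP: "?Y \<subseteq> proj_prod N n" using XP unfolding proj_prod_def by (intro PiE_mono) auto
  let ?T = "subtopology (zariski_prod N n) ?Y"
  define U where "U = (proj_prod N n - multi_zero_locus N n {D}) \<inter> ?Y"
  have topT: "topspace ?T = ?Y" using YP by auto
  have rep: "\<exists>v. \<forall>i<n. x i = line (v i) \<and> v i \<in> \<Union>X \<and> v i \<noteq> 0" if x: "x \<in> ?Y" for x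
  proof -
    have "\<forall>i. \<exists>v. i < n \<longrightarrow> x i = line v \<and> v \<in> \<Union>X \<and> v \<noteq> 0"
    proof
      fix i
      show "\<exists>v. i < n \<longrightarrow> x i = line v \<and> v \<in> \<Union>X \<and> v \<noteq> 0"
      proof (cases "i < n")
        case True
        then have "x i \<in> X" using x by auto
        moreover from this obtain v where "x i = line v" "v \<noteq> 0" using XP by (auto simp: proj_space_def)
        ultimately show ?thesis using line_self[of v] by auto
      qed simp
    qed
    from choice[OF this] show ?thesis by blast
  qed
  have zero_iff: "x \<in> multi_zero_locus N n S \<longleftrightarrow> (\<forall>F\<in>S. poly_eval F (\<lambda>(i, j). v i j) = 0)"
    if x: "x \<in> ?Y" "\<And>i. i < n \<Longrightarrow> x i = line (v i)" and S: "S \<subseteq> {F. \<exists>d. multiform N n d F}" for x v S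
  proof -
    have "(\<forall>v'. (\<forall>i<n. v' i \<in> x i) \<longrightarrow> poly_eval F (\<lambda>(i, j). v' i j) = 0) \<longleftrightarrow> poly_eval F (\<lambda>(i, j). v i j) = 0"
      if "F \<in> S" for F
    proof -
      obtain d where "multiform N n d F" using S \<open>F \<in> S\<close> by blast
      from multi_vanish_line[OF this x(2)] show ?thesis .
    qed
    then show ?thesis using x(1) YP by (auto simp: multi_zero_locus_def)
  qed
  have "openin (zariski_prod N n) (proj_prod N n - multi_zero_locus N n {D})"
  proof -
    have "closedin (zariski_prod N n) (multi_zero_locus N n {D})"
      unfolding closedin_zariski_prod by (rule exI[of _ "{D}"]) (use D in auto)
    then show ?thesis by (metis openin_diff openin_topspace topspace_zariski_prod)
  qed
  then have Uo: "openin ?T U" unfolding U_def by (rule openin_subtopology_Int)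
  \<comment> \<open>Density is checked on parameters: if \<open>F\<close> vanishes on
    \<open>U\<close>, the pullbacks of \<open>F\<close> and \<open>D\<close> to the affine space of
    all parameters have product zero, and that of \<open>D\<close> is nonzero, so that of
    \<open>F\<close> vanishes.\<close>
  have "?T closure_of U = topspace ?T"
  proof
    show "?T closure_of U \<subseteq> topspace ?T" by (rule closure_of_subset_topspace)
    have "closedin ?T (?T closure_of U)" by (rule closedin_closure_of)
    then obtain K where K: "closedin (zariski_prod N n) K" "?T closure_of U = K \<inter> ?Y"
      unfolding closedin_subtopology by blast
    obtain S where S: "S \<subseteq> {F. \<exists>d. multiform N n d F}" "K = multi_zero_locus N n S"
      using K(1) closedin_zariski_prod by blast
    have UK: "U \<subseteq> K" using closure_of_subset[of U ?T] openin_subset[OF Uo] K(2) by blast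
    show "topspace ?T \<subseteq> ?T closure_of U" unfolding topT
    proof
      fix x assume x: "x \<in> ?Y"
      then obtain v where v: "\<And>i. i < n \<Longrightarrow> x i = line (v i) \<and> v i \<in> \<Union>X \<and> v i \<noteq> 0" using rep by blast
      have "poly_eval F (\<lambda>(i, j). v i j) = 0" if F: "F \<in> S" for F
      proof -
        obtain d where d: "multiform N n d F" using S(1) F by blast
        define sub where "sub = (\<lambda>(i :: nat, j). psubst (coordinate_poly j) (\<lambda>l. cX (i, l)))"
        have ev: "poly_eval (psubst H sub) y = poly_eval H (\<lambda>(i, j). \<Psi> (\<lambda>l. y (i, l)) j)" for H y
          unfolding poly_eval_psubst
          by (rule arg_cong[where f = "poly_eval H"]) (auto simp: sub_def poly_eval_psubst \<Psi>_poly)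
        have "poly_eval (psubst F sub) y * poly_eval (psubst D sub) y = 0" for y
        proof (cases "poly_eval (psubst D sub) y = 0")
          case False
          let ?u = "\<lambda>i. \<Psi> (\<lambda>l. y (i, l))" and ?x = "\<lambda>i\<in>{..<n}. line (\<Psi> (\<lambda>l. y (i, l)))"
          have xY: "?x \<in> ?Y" using \<Psi>_in_X by auto
          have "?x \<notin> multi_zero_locus N n {D}"
            using zero_iff[OF xY, of ?u "{D}"] D False by (auto simp: ev)
          then have "?x \<in> U" using xY YP unfolding U_def by blast
          then have "?x \<in> K" using UK by blast
          then have "poly_eval F (\<lambda>(i, j). ?u i j) = 0"
            using zero_iff[OF xY, of ?u S] S F by auto
          then show ?thesis by (simp add: ev)
        qed simp
        from poly_eval_mult_eq_0[OF this]
        have "(\<forall>y. poly_eval (psubst F sub) y = 0) \<or> (\<forall>y. poly_eval (psubst D sub) y = 0)" .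
        \<comment> \<open>The parameter vectors with all entries \<open>i\<close> for the
          \<open>i\<close>-th point have distinct values of \<open>t\<close>.\<close>
        moreover have "poly_eval (psubst D sub) (\<lambda>(i, l). of_nat i) \<noteq> 0"
          unfolding ev D_eval \<Psi>01 using finI by (auto simp: prod_zero_iff)
        ultimately have F0: "poly_eval (psubst F sub) y = 0" for y by blast
        have "poly_eval F (\<lambda>(i, j). \<Psi> (u i) j) = 0" for u
          using F0[of "\<lambda>(i, l). u i l"] by (simp add: ev)
        then show ?thesis by (rule multiform_vanishes_on_power[OF d]) (use v in blast)
      qed
      then have "x \<in> K" using zero_iff[OF x _ S(1), of v] v S(2) by blast
      then show "x \<in> ?T closure_of U" using x K(2) by blast
    qed
  qed
  moreover have "\<exists>C. rational_normal_curve N q C \<and> C \<subseteq> X \<and> (\<forall>i<n. x i \<in> C)" if x: "x \<in> U" for x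
  proof -
    have xY: "x \<in> ?Y" using x by (simp add: U_def)
    then obtain v where v: "\<And>i. i < n \<Longrightarrow> x i = line (v i) \<and> v i \<in> \<Union>X \<and> v i \<noteq> 0" using rep by blast
    have "x \<notin> multi_zero_locus N n {D}" using x by (simp add: U_def)
    then have "poly_eval D (\<lambda>(i, j). v i j) \<noteq> 0" using zero_iff[OF xY, of v "{D}"] v D by auto
    then have v0: "\<And>i. i < n \<Longrightarrow> v i i0 \<noteq> 0"
      and v1: "\<And>i k. i < n \<Longrightarrow> k < i \<Longrightarrow> v i i1 * v k i0 - v k i1 * v i i0 \<noteq> 0"
      unfolding D_eval using finI by (auto simp: prod_zero_iff)
    have "\<forall>i. \<exists>u. i < n \<longrightarrow> v i = cscale (v i i0) (\<Psi> u) \<and> u 0 = v i i1 / v i i0"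
    proof
      fix i
      show "\<exists>u. i < n \<longrightarrow> v i = cscale (v i i0) (\<Psi> u) \<and> u 0 = v i i1 / v i i0"
      proof (cases "i < n")
        case True
        then have "v i \<in> \<Union>X" "v i (pos 0) \<noteq> 0" using v[OF True] v0[OF True] by (simp_all add: i0_def)
        from X_chart[OF this] show ?thesis unfolding i0_def i1_def by (elim exE) (intro exI impI)
      qed simp
    qed
    from choice[OF this] obtain u where
      u: "\<And>i. i < n \<Longrightarrow> v i = cscale (v i i0) (\<Psi> (u i)) \<and> u i 0 = v i i1 / v i i0" by blast
    have xu: "x i = line (\<Psi> (u i))" if "i < n" for i
      using v[OF that] u[OF that] line_cscale[OF v0[OF that]] by metis
    have "u i 0 \<noteq> u k 0" if "i < n" "k < i" for i k
    proof -
      have "k < n" using that by simp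
      then show ?thesis using u[OF that(1)] u[of k] v0[OF that(1)] v0[of k] v1[OF that]
        by (simp add: frac_eq_eq mult.commute)
    qed
    then have "inj_on (\<lambda>i. u i 0) {..<n}" by (intro linorder_inj_onI') (metis lessThan_iff)
    from curve_through_points[where u = u, OF n this] show ?thesis using xu by auto
  qed
  ultimately show "\<exists>U. openin ?T U \<and> ?T closure_of U = topspace ?T \<and>
      (\<forall>x\<in>U. \<exists>C. rational_normal_curve N q C \<and> C \<subseteq> X \<and> (\<forall>i<n. x i \<in> C))"
    using Uo by blast
qed

end

theorem mainTheorem1:
  fixes r n q \<rho> m N :: nat and X :: "ppoint set"
  assumes "r \<ge> 1" and "n \<ge> 2" and "q \<ge> n - 1"
    and "m \<in> {1..n - 1}" and "q = \<rho> * (n - 1) + m - 1"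
    and "(N, X) \<in> class_X (r + 1) n q"
  shows "proj_span_dim X + 1 =
    int (m * ((r + \<rho> + 1) choose (r + 1)) + (n - 1 - m) * ((r + \<rho>) choose (r + 1)))"
proof -
  let ?B = "m * ((r + \<rho> + 1) choose (r + 1)) + (n - 1 - m) * ((r + \<rho>) choose (r + 1))"
  have m: "1 \<le> m" "m \<le> n - 1" using assms(4) by auto
  have q: "q + 1 = \<rho> * (n - 1) + m" using assms(5) m by simp
  have \<rho>: "\<rho> \<ge> 1"
  proof (rule ccontr)
    assume "\<not> \<rho> \<ge> 1"
    then have "q + 1 = m" using q by simp
    then show False using m assms(3) by simp
  qed
  have X: "rnc_variety (r + 1) n q N X"
    and max: "\<And>M Y. rnc_variety (r + 1) n q M Y \<Longrightarrow> proj_span_dim Y \<le> proj_span_dim X"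
    using assms(6) by (auto simp: class_X_def)
  have "cfun.dim (\<Union>X) \<le> ?B"
    using span_upper_bound[OF _ assms(2) m \<rho> q X] by (simp add: add.commute add.left_commute)
  then have "int (cfun.dim (\<Union>X)) \<le> int ?B" by (simp only: of_nat_le_iff)
  \<comment> \<open>Membership in \<open>class_X\<close> includes maximality of the span, so the
    lower bound follows from a single competitor of dimension \<open>r + 1\<close> that satisfies
    the curve condition, in whatever ambient space it lives.\<close>
  moreover have "int ?B - 1 \<le> proj_span_dim X"
  proof -
    have c: "n - 1 \<ge> 1" using assms(2) by simp
    let ?W = "wmonomials r (n - 1) q"
    have finW: "finite ?W" and cardW: "card ?W = ?B"
      using finite_wmonomials[OF c m(2) \<rho> q] card_wmonomials[OF c m(2) \<rho> q] by auto
    \<comment> \<open>The constant monomial makes the number of coordinates positive, so they can be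
      indexed by \<open>{..M}\<close> and the ambient space has dimension
      \<open>?B - 1\<close>.\<close>
    have "0 \<in> ?W" by (simp add: wmonomials_def)
    then have "card ?W > 0" using finW card_gt_0_iff by blast
    then obtain M where M: "card ?W = Suc M" using not0_implies_Suc by blast
    obtain idx where "bij_betw idx {0..<card ?W} ?W" using ex_bij_betw_nat_finite[OF finW] by blast
    moreover have "{0..<card ?W} = {..M}" using M by auto
    ultimately have idx: "bij_betw idx {..M} ?W" by simp
    interpret W: weighted_veronese r "n - 1" q M idx by unfold_locales (use c assms(3) idx in auto)
    have "n = (n - 1) + 1" using assms(2) by simp
    then have "rnc_variety (r + 1) n q M W.X"
      unfolding rnc_variety_def using W.X_variety W.X_dimension W.X_rnc_through_generic_points by blast
    from max[OF this] have "proj_span_dim W.X \<le> proj_span_dim X" .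
    moreover have "cfun.dim (\<Union>W.X) = ?B" using W.X_span M cardW by simp
    ultimately show ?thesis by (simp only: proj_span_dim_def)
  qed
  ultimately show ?thesis unfolding proj_span_dim_def by linarith
qed

end
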